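(* Assume the Exponential-Time Hypothesis (ETH). There exists an absolute constant $c>0$ such that, for every constant $\varepsilon>0$ and every $p=p(k)$ with $(1+\varepsilon)\log k/k\leq p\leq 1/2$, the following holds: with high probability (as $k\to+\infty$) over an Erdős–Rényi random graph $H\sim\mathcal{G}(k,p)$, the problem $\mathrm{Sub}(H)$ admits no $O(n^{c\cdot k/\rho})$-time algorithm on $n$-vertex input graphs, where $\rho=\log(k)/\log(kp)$.
   Context: All graphs are finite, simple, loopless and undirected. $\log$ is the natural logarithm. $\mathcal{G}(k,p)$ is the random graph on vertex set $\{1,\dots,k\}$ in which each pair of distinct vertices is joined by an edge independently with probability $p$. "With high probability" means with probability tending to $1$ as $k\to+\infty$. For a fixed graph $H$, $\mathrm{Sub}(H)$ is the decision problem that takes a graph $G$ as input and asks whether $G$ contains a (not necessarily induced) subgraph isomorphic to $H$; $n$ denotes the number of vertices of the input graph $G$. ETH is the standard hypothesis that there is a constant $\delta>0$ such that 3-SAT on $N$ variables cannot be solved in time $O(2^{\delta N})$. *)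

theory Defs
  imports "HOL-Probability.Probability" "HOL-Library.Landau_Symbols"
begin

section \<open>Model of computation\<close>

text \<open>
  Random access machines with finitely many registers, an unbounded memory, and
  unit-cost addition and (truncated) subtraction, given as structured programs. There is
  no multiplication, so a step lengthens the binary representation of the largest stored
  number by at most one bit. Hence running times agree with those of Turing machines up
  to a polynomial, which only affects the constants in the hypothesis \<open>ETH\<close> below and
  in running times of the form \<open>n powr (c * e)\<close>.
\<close>

datatype com =
    Skip
  | Const nat nat      \<comment> \<open>\<open>R[r] := a\<close>\<close>
  | Plus nat nat nat   \<comment> \<open>\<open>R[r] := R[s] + R[t]\<close>\<close>
  | Minus nat nat nat  \<comment> \<open>\<open>R[r] := R[s] - R[t]\<close>\<close>
  | Load nat nat       \<comment> \<open>\<open>R[r] := M[R[s]]\<close>\<close>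
  | Store nat nat      \<comment> \<open>\<open>M[R[r]] := R[s]\<close>\<close>
  | Seq com com
  | If nat com com     \<comment> \<open>branch on \<open>R[r] \<noteq> 0\<close>\<close>
  | While nat com      \<comment> \<open>loop while \<open>R[r] \<noteq> 0\<close>\<close>

text \<open>A state consists of the register contents and the memory contents.\<close>

type_synonym state = "(nat \<Rightarrow> nat) \<times> (nat \<Rightarrow> nat)"

text \<open>\<open>exec c s t s'\<close>: started in \<open>s\<close>, the program \<open>c\<close> halts in \<open>s'\<close> after exactly \<open>t\<close> steps.\<close>

inductive exec :: "com \<Rightarrow> state \<Rightarrow> nat \<Rightarrow> state \<Rightarrow> bool" where
  Skip: "exec Skip s 1 s"
| Const: "exec (Const r a) (R, M) 1 (R(r := a), M)"
| Plus: "exec (Plus r s t) (R, M) 1 (R(r := R s + R t), M)"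
| Minus: "exec (Minus r s t) (R, M) 1 (R(r := R s - R t), M)"
| Load: "exec (Load r s) (R, M) 1 (R(r := M (R s)), M)"
| Store: "exec (Store r s) (R, M) 1 (R, M(R r := R s))"
| Seq: "exec c1 s t1 s' \<Longrightarrow> exec c2 s' t2 s'' \<Longrightarrow> exec (Seq c1 c2) s (t1 + t2) s''"
| IfTrue: "fst s r \<noteq> 0 \<Longrightarrow> exec c1 s t s' \<Longrightarrow> exec (If r c1 c2) s (Suc t) s'"
| IfFalse: "fst s r = 0 \<Longrightarrow> exec c2 s t s' \<Longrightarrow> exec (If r c1 c2) s (Suc t) s'"
| WhileFalse: "fst s r = 0 \<Longrightarrow> exec (While r c) s 1 s"
| WhileTrue: "fst s r \<noteq> 0 \<Longrightarrow> exec c s t1 s' \<Longrightarrow> exec (While r c) s' t2 s'' \<Longrightarrow>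
    exec (While r c) s (Suc (t1 + t2)) s''"

inductive_cases exec_elims:
  "exec Skip s t s'" "exec (Const r a) s t s'" "exec (Plus r x y) s t s'"
  "exec (Minus r x y) s t s'" "exec (Load r x) s t s'" "exec (Store r x) s t s'"
  "exec (Seq c1 c2) s t s'" "exec (If r c1 c2) s t s'"
inductive_cases exec_WhileE: "exec (While r c) s t s'"

lemma exec_deterministic:
  "exec c s t s' \<Longrightarrow> exec c s u s'' \<Longrightarrow> u = t \<and> s'' = s'"
proof (induction arbitrary: u s'' rule: exec.induct)
  case (Seq c1 s t1 s' c2 t2 s3)
  from Seq.prems obtain u1 q u2
    where u: "exec c1 s u1 q" "exec c2 q u2 s''" "u = u1 + u2"
    by (rule exec_elims)
  from Seq.IH(1)[OF u(1)] have q: "u1 = t1" "q = s'" by simp_all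
  from Seq.IH(2)[OF u(2)[unfolded q]] show ?case by (simp add: u(3) q)
next
  case (WhileTrue s r c t1 s' t2 s3)
  from WhileTrue.prems obtain u1 q u2
    where u: "exec c s u1 q" "exec (While r c) q u2 s''" "u = Suc (u1 + u2)"
    by (rule exec_WhileE) (use WhileTrue.hyps(1) in simp_all)
  from WhileTrue.IH(1)[OF u(1)] have q: "u1 = t1" "q = s'" by simp_all
  from WhileTrue.IH(2)[OF u(2)[unfolded q]] show ?case by (simp add: u(3) q)
next
  case (WhileFalse s r c)
  from WhileFalse.prems show ?case by (rule exec_WhileE) (use WhileFalse.hyps in simp_all)
next
  case (IfTrue s r c1 t s' c2)
  from IfTrue.prems obtain v where v: "exec c1 s v s''" "u = Suc v"
    by (rule exec_elims(8)) (use IfTrue.hyps(1) in simp_all)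
  from IfTrue.IH[OF v(1)] show ?case by (simp add: v(2))
next
  case (IfFalse s r c2 t s' c1)
  from IfFalse.prems obtain v where v: "exec c2 s v s''" "u = Suc v"
    by (rule exec_elims(8)) (use IfFalse.hyps(1) in simp_all)
  from IfFalse.IH[OF v(1)] show ?case by (simp add: v(2))
qed (auto elim: exec_elims)

text \<open>
  The input is stored in the memory cells \<open>0, 1, \<dots>\<close>, its length in register 0; everything
  else is 0. The machine accepts iff register 0 is nonzero on halting.
\<close>

definition initial :: "nat list \<Rightarrow> state" where
  "initial xs = ((\<lambda>_. 0)(0 := length xs), \<lambda>i. if i < length xs then xs ! i else 0)"

definition accepting :: "state \<Rightarrow> bool" where
  "accepting s \<longleftrightarrow> fst s 0 \<noteq> 0"

text \<open>
  Running times are measured in the parameter \<open>param\<close> of an instance (the number of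
  vertices or of variables), not in the length of its encoding.
\<close>

record 'i problem =
  instances :: "'i set"
  yes :: "'i \<Rightarrow> bool"
  encode :: "'i \<Rightarrow> nat list"
  param :: "'i \<Rightarrow> nat"

definition decides_within :: "com \<Rightarrow> 'i problem \<Rightarrow> (nat \<Rightarrow> nat) \<Rightarrow> bool" where
  "decides_within c Q T \<longleftrightarrow>
     (\<forall>x\<in>instances Q. \<exists>t s. exec c (initial (encode Q x)) t s \<and> t \<le> T (param Q x) \<and>
        (accepting s \<longleftrightarrow> yes Q x))"

definition solvable_in_bigo :: "'i problem \<Rightarrow> (nat \<Rightarrow> real) \<Rightarrow> bool" where
  "solvable_in_bigo Q f \<longleftrightarrow>
     (\<exists>c T. decides_within c Q T \<and> (\<lambda>n. real (T n)) \<in> O(f))"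


section \<open>3-SAT and the Exponential-Time Hypothesis\<close>

text \<open>The literal \<open>(x, b)\<close> is satisfied by the assignments giving \<open>x\<close> the value \<open>b\<close>.\<close>

type_synonym literal = "nat \<times> bool"
type_synonym clause = "literal list"
type_synonym cnf = "clause list"

definition satisfiable :: "cnf \<Rightarrow> bool" where
  "satisfiable F \<longleftrightarrow> (\<exists>\<alpha> :: nat \<Rightarrow> bool. \<forall>C\<in>set F. \<exists>(x, b)\<in>set C. \<alpha> x = b)"

definition encode_clause :: "clause \<Rightarrow> nat list" where
  "encode_clause C = length C # map (\<lambda>(x, b). 2 * x + of_bool b) C"

text \<open>
  An instance \<open>(N, F)\<close> has the variables \<open>0, \<dots>, N - 1\<close>. Repeated clauses are excluded: with
  them, the length of the input would not be bounded by any function of \<open>N\<close>, and neither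
  would the running time of any algorithm.
\<close>

definition three_sat :: "(nat \<times> cnf) problem" where
  "three_sat = \<lparr>
     instances = {(N, F). distinct F \<and>
       (\<forall>C\<in>set F. length C \<le> 3 \<and> (\<forall>(x, b)\<in>set C. x < N))},
     yes = (\<lambda>(N, F). satisfiable F),
     encode = (\<lambda>(N, F). N # length F # concat (map encode_clause F)),
     param = fst\<rparr>"

definition ETH :: bool where
  "ETH \<longleftrightarrow> (\<exists>\<delta>>0. \<not> solvable_in_bigo three_sat (\<lambda>N. 2 powr (\<delta> * real N)))"


section \<open>Graphs and the subgraph problem\<close>

type_synonym 'a graph = "'a set \<times> 'a set set"

abbreviation verts :: "'a graph \<Rightarrow> 'a set" where "verts \<equiv> fst"
abbreviation edges :: "'a graph \<Rightarrow> 'a set set" where "edges \<equiv> snd"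

definition pairs :: "'a set \<Rightarrow> 'a set set" where
  "pairs V = {e. e \<subseteq> V \<and> card e = 2}"

definition simple_graph :: "'a graph \<Rightarrow> bool" where
  "simple_graph G \<longleftrightarrow> finite (verts G) \<and> edges G \<subseteq> pairs (verts G)"

definition subgraph :: "'a graph \<Rightarrow> 'a graph \<Rightarrow> bool" where
  "subgraph G' G \<longleftrightarrow> simple_graph G' \<and> verts G' \<subseteq> verts G \<and> edges G' \<subseteq> edges G"

definition isomorphic :: "'a graph \<Rightarrow> 'b graph \<Rightarrow> bool" where
  "isomorphic G H \<longleftrightarrow>
     (\<exists>f. bij_betw f (verts G) (verts H) \<and>
        (\<forall>u\<in>verts G. \<forall>v\<in>verts G. {u, v} \<in> edges G \<longleftrightarrow> {f u, f v} \<in> edges H))"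

text \<open>Input graphs have vertices \<open>0, \<dots>, n - 1\<close> and are given by \<open>n\<close> and their adjacency matrix.\<close>

definition encode_graph :: "nat graph \<Rightarrow> nat list" where
  "encode_graph G = (let n = card (verts G) in
     n # concat (map (\<lambda>i. map (\<lambda>j. of_bool ({i, j} \<in> edges G)) [0..<n]) [0..<n]))"

definition Sub :: "'a graph \<Rightarrow> nat graph problem" where
  "Sub H = \<lparr>
     instances = {G. simple_graph G \<and> (\<exists>n. verts G = {..<n})},
     yes = (\<lambda>G. \<exists>G'. subgraph G' G \<and> isomorphic G' H),
     encode = encode_graph,
     param = (\<lambda>G. card (verts G))\<rparr>"


section \<open>Random graphs\<close>

definition random_graph :: "nat \<Rightarrow> real \<Rightarrow> nat graph pmf" where
  "random_graph k p =
     map_pmf (\<lambda>X. ({1..k}, {e \<in> pairs {1..k}. X e}))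
       (Pi_pmf (pairs {1..k}) False (\<lambda>_. bernoulli_pmf p))"

definition rho :: "nat \<Rightarrow> real \<Rightarrow> real" where
  "rho k p = ln (real k) / ln (real k * p)"

end

theory Submission
 imports Defs "HOL-Real_Asymp.Real_Asymp"
begin

text \<open>
 Suppose that \<open>Sub H\<close> were solvable in time \<open>n powr (c * (k / \<rho>))\<close>. A 3-CNF formula on \<open>N\<close> variables is a
 disjunction of \<open>2 powr (\<epsilon> * N)\<close> formulas in which every variable occurs boundedly often (sparsification).
 The variables of such a formula are divided into \<open>k\<close> groups, every clause is placed at a vertex of
 \<open>H\<close>, and every group is routed from its home vertex to its clauses. The vertices of the host graph over
 a vertex \<open>v\<close> of \<open>H\<close> are the assignments to the variables that are routed through \<open>v\<close> and satisfy the
 clauses at \<open>v\<close>; adjacent copies have to agree. If \<open>H\<close> is a core, a copy of \<open>H\<close> in the host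
 picks one assignment over every vertex of \<open>H\<close>, hence a satisfying assignment. If \<open>O(k * \<rho>)\<close> pairs of a
 group and a target are routed through every vertex, each of which stands for \<open>O(N / k\<^sup>2)\<close> variables, the
 host has \<open>k * 2 powr O(\<rho> * N / k)\<close> vertices, and 3-SAT would be solved in time \<open>2 powr (O(c + \<epsilon>) * N)\<close>.

 In a random graph, balls grow by a factor of order \<open>k * p\<close>, so paths of length \<open>O(\<rho>)\<close> suffice for the routing.
 A graph that is not a core has a retraction that moves some vertices. It does not move few vertices, as
 the neighbours of a moved vertex that are not neighbours of its image are moved as well, and small sets
 span few edges; a union bound excludes the retractions that move many vertices.
\<close>

text \<open>The constant c is chosen before H, so H may influence the cost of the reduction only
  through constant factors. Therefore the reduction is one program that receives the pattern and the
  parameters as data: its polynomial degree m is known first, the sparsification rate \<epsilon> of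
  order \<delta> / m comes second, and the occurrence bound of the sparse formulas, which enters c,
  comes last. Without a core, a copy of H could fold onto a part of H, pick several assignments over
  one vertex and none over another, and so miss clauses. Some targets may be reachable only through
  vertices that are full or have low degree. Hence every group may miss a tenth of the targets, and
  clauses are placed after the routing is known. The union bound over large retractions has two
  regimes. If k p is of order log k, then k^k maps are too many, as the gain is only exp (- const *
  k * k p) with a small constant. There the images of few hubs are guessed, and every other vertex
  costs a factor of at most the maximum degree. For p above k^(-9/10) the crude count is good
  enough.\<close>

datatype val = Num nat | Pr val val

text \<open>A number counts with its value, as if written in unary. So functions that count, such as
  \<open>divmod\<close>, and lists such as \<open>[0..<n]\<close> are polynomial.\<close>

primrec vsz :: "val \<Rightarrow> nat" where
 "vsz (Num n) = Suc n"
| "vsz (Pr a b) = Suc (vsz a + vsz b)"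

class data = fixes enc :: "'a \<Rightarrow> val"

instantiation nat :: data begin
definition "enc (n::nat) = Num n"
instance ..
end

instantiation bool :: data begin
definition "enc (b::bool) = Num (of_bool b)"
instance ..
end

instantiation prod :: (data, data) data begin
definition "enc p = Pr (enc (fst p)) (enc (snd p))"
instance ..
end

instantiation list :: (data) data begin
primrec enc_list :: "'a list \<Rightarrow> val" where
 "enc_list [] = Num 0"
| "enc_list (x # xs) = Pr (enc x) (enc_list xs)"
instance ..
end

definition sz :: "'a::data \<Rightarrow> nat" where "sz x = vsz (enc x)"

lemma sz_simps [simp]:
 "sz (n::nat) = Suc n"
 "sz (b::bool) = Suc (of_bool b)"
 "sz (x, y) = Suc (sz x + sz y)"
 "sz ([] :: 'a::data list) = 1"
 "sz (x # xs) = Suc (sz x + sz xs)"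
 by (simp_all add: sz_def enc_nat_def enc_bool_def enc_prod_def)

lemma sz_pos [simp]: "0 < sz x"
 unfolding sz_def by (cases "enc x") auto

lemma sz_fst: "sz (fst p) < sz p" and sz_snd: "sz (snd p) < sz p"
 by (cases p; simp)+

lemma length_less_sz: "length xs < sz xs"
 by (induction xs) auto

lemma sz_mem: "x \<in> set xs \<Longrightarrow> sz x < sz xs"
 by (induction xs) auto

text \<open>
 Heap cells are pairs of words at the addresses \<open>w\<close> and \<open>w + 3\<close>, all congruent to \<open>2\<close> modulo
 \<open>3\<close>; the two other residue classes are reserved for the memory of a simulated machine. As
 heap addresses are positive, \<open>[]\<close> (the word \<open>0\<close>) is distinguishable from \<open>x # xs\<close>.
\<close>

primrec repr :: "(nat \<Rightarrow> nat) \<Rightarrow> nat \<Rightarrow> val \<Rightarrow> nat \<Rightarrow> bool" where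
 "repr M h (Num n) w \<longleftrightarrow> w = n"
| "repr M h (Pr a b) w \<longleftrightarrow> w mod 3 = 2 \<and> w + 3 < h \<and> repr M h a (M w) \<and> repr M h b (M (w + 3))"

text \<open>
 Registers: 0 accumulator, 1, 2 and 8 scratch, 3 stack pointer (a linked list in the heap),
 4 first free heap address, 5, 6 and 7 the constants 1, 0 and 3.
\<close>

definition wf_regs :: "(nat \<Rightarrow> nat) \<Rightarrow> bool" where
 "wf_regs R \<longleftrightarrow> R 5 = 1 \<and> R 6 = 0 \<and> R 7 = 3 \<and> R 4 mod 3 = 2"

text \<open>Allocated cells are never overwritten and nothing is freed, so a value represented
  before a computation is still represented after it (\<open>ext_repr\<close>). The cells of the
  other residue classes and the registers from 20 on belong to the simulated machine.\<close>

definition ext :: "state \<Rightarrow> state \<Rightarrow> bool" where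
 "ext s s' \<longleftrightarrow> wf_regs (fst s') \<and> fst s' 3 = fst s 3 \<and> fst s 4 \<le> fst s' 4 \<and>
   (\<forall>r\<ge>20. fst s' r = fst s r) \<and> (\<forall>a. a < fst s 4 \<or> a mod 3 \<noteq> 2 \<longrightarrow> snd s' a = snd s a)"

lemma ext_refl: "wf_regs (fst s) \<Longrightarrow> ext s s"
 by (simp add: ext_def)

lemma ext_trans: "ext s s' \<Longrightarrow> ext s' s'' \<Longrightarrow> ext s s''"
 unfolding ext_def by (auto intro: order.trans dest: order_less_le_trans)

lemma repr_mono:
 assumes "repr M h v w" "h \<le> h'" "\<And>a. a < h \<Longrightarrow> a mod 3 = 2 \<Longrightarrow> M' a = M a"
 shows "repr M' h' v w"
 using assms(1)
proof (induction v arbitrary: w)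
 case (Pr a b)
 have "(w + 3) mod 3 = w mod 3" by simp
 with Pr assms(2,3) show ?case by auto
qed simp

lemma ext_repr: "ext s s' \<Longrightarrow> repr (snd s) (fst s 4) v w \<Longrightarrow> repr (snd s') (fst s' 4) v w"
 by (erule repr_mono) (auto simp: ext_def)

section \<open>Programs that compute on represented values\<close>

definition run :: "com \<Rightarrow> val \<Rightarrow> val \<Rightarrow> nat \<Rightarrow> bool" where
 "run c x y t \<longleftrightarrow> (\<forall>s. wf_regs (fst s) \<longrightarrow> repr (snd s) (fst s 4) x (fst s 0) \<longrightarrow>
   (\<exists>u s'. u \<le> t \<and> exec c s u s' \<and> ext s s' \<and> repr (snd s') (fst s' 4) y (fst s' 0)))"

lemma runI:
 assumes "\<And>R M. wf_regs R \<Longrightarrow> repr M (R 4) x (R 0) \<Longrightarrow>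
   \<exists>u R' M'. u \<le> t \<and> exec c (R, M) u (R', M') \<and> ext (R, M) (R', M') \<and> repr M' (R' 4) y (R' 0)"
 shows "run c x y t"
 unfolding run_def using assms by (metis prod.collapse fst_conv snd_conv)

lemma runE:
 assumes "run c x y t" "wf_regs R" "repr M (R 4) x (R 0)"
 obtains u R' M' where "u \<le> t" "exec c (R, M) u (R', M')" "ext (R, M) (R', M')" "repr M' (R' 4) y (R' 0)"
 using assms unfolding run_def by (metis prod.collapse fst_conv snd_conv)

lemma run_mono: "run c x y t \<Longrightarrow> t \<le> t' \<Longrightarrow> run c x y t'"
 unfolding run_def by (meson order_trans)

lemma run_skip: "run Skip x x 1"
 by (rule runI, intro exI conjI, rule order_refl, rule exec.Skip) (auto simp: ext_refl)

lemma run_seq: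
 assumes "run c x y t" "run d y z u"
 shows "run (Seq c d) x z (t + u)"
proof (rule runI)
 fix R M assume "wf_regs R" "repr M (R 4) x (R 0)"
 with assms(1) obtain t' R' M' where 1: "t' \<le> t" "exec c (R, M) t' (R', M')"
  "ext (R, M) (R', M')" "repr M' (R' 4) y (R' 0)" by (rule runE)
 hence "wf_regs R'" by (simp add: ext_def)
 with assms(2) obtain u' R'' M'' where 2: "u' \<le> u" "exec d (R', M') u' (R'', M'')"
  "ext (R', M') (R'', M'')" "repr M'' (R'' 4) z (R'' 0)" using 1 by (elim runE)
 show "\<exists>ua R' M'. ua \<le> t + u \<and> exec (Seq c d) (R, M) ua (R', M') \<and> ext (R, M) (R', M') \<and> repr M' (R' 4) z (R' 0)"
  using exec.Seq[OF 1(2) 2(2)] ext_trans[OF 1(3) 2(3)] add_mono[OF 1(1) 2(1)] 2(4) by blast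
qed

lemma run_const: "run (Const 0 n) x (Num n) 1"
 by (rule runI, intro exI conjI, rule order_refl, rule exec.Const) (auto simp: ext_def wf_regs_def)

lemma run_fst: "run (Load 0 0) (Pr a b) a 1"
 by (rule runI, intro exI conjI, rule order_refl, rule exec.Load) (auto simp: ext_def wf_regs_def)

lemma run_snd: "run (Seq (Plus 0 0 7) (Load 0 0)) (Pr a b) b 2"
 by (rule runI, intro exI conjI, rule order_refl, unfold one_add_one[symmetric], rule exec.Seq,
   rule exec.Plus, rule exec.Load) (auto simp: ext_def wf_regs_def)

definition plus_com :: com where
 "plus_com = Seq (Plus 1 0 7) (Seq (Load 1 1) (Seq (Load 0 0) (Plus 0 0 1)))"
definition minus_com :: com where
 "minus_com = Seq (Plus 1 0 7) (Seq (Load 1 1) (Seq (Load 0 0) (Minus 0 0 1)))"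

lemma run_plus: "run plus_com (Pr (Num a) (Num b)) (Num (a + b)) (1 + (1 + (1 + 1)))"
 unfolding plus_com_def
 by (rule runI, intro exI conjI, rule order_refl, (rule exec.intros)+) (auto simp: ext_def wf_regs_def)

lemma run_minus: "run minus_com (Pr (Num a) (Num b)) (Num (a - b)) (1 + (1 + (1 + 1)))"
 unfolding minus_com_def
 by (rule runI, intro exI conjI, rule order_refl, (rule exec.intros)+) (auto simp: ext_def wf_regs_def)

definition nonzero_com :: com where "nonzero_com = If 0 (Const 0 1) (Const 0 0)"

lemma run_nonzero: "run nonzero_com v (Num (of_bool (v \<noteq> Num 0))) 2"
proof (rule runI)
 fix R M assume R: "wf_regs R" "repr M (R 4) v (R 0)"
 have *: "R 0 = 0 \<longleftrightarrow> v = Num 0" using R(2) by (cases v) (auto split: if_splits)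
 have "exec nonzero_com (R, M) 2 (R(0 := of_bool (R 0 \<noteq> 0)), M)"
  unfolding nonzero_com_def numeral_2_eq_2
  by (cases "R 0 = 0"; simp; intro exec.IfTrue exec.IfFalse) (auto intro: exec.Const[unfolded One_nat_def])
 thus "\<exists>u R' M'. u \<le> 2 \<and> exec nonzero_com (R, M) u (R', M') \<and> ext (R, M) (R', M') \<and>
   repr M' (R' 4) (Num (of_bool (v \<noteq> Num 0))) (R' 0)"
  using R(1) by - (intro exI conjI, rule order_refl, assumption, auto simp: ext_def wf_regs_def *)
qed

definition push_com :: com where
 "push_com = Seq (Store 4 0) (Seq (Plus 1 4 7) (Seq (Store 1 3) (Seq (Plus 3 4 6) (Plus 4 1 7))))"
definition pop_com :: com where
 "pop_com = Seq (Load 2 3) (Seq (Plus 1 3 7) (Load 3 1))"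

lemma exec_push:
 assumes "wf_regs R"
 shows "exec push_com (R, M) 5
  (R(1 := R 4 + 3, 3 := R 4, 4 := R 4 + 6), M(R 4 := R 0, R 4 + 3 := R 3))"
proof -
 have "exec push_com (R, M) (1 + (1 + (1 + (1 + 1))))
  (R(1 := R 4 + R 7, 3 := R 4 + R 6, 4 := R 4 + R 7 + R 7), M(R 4 := R 0, R 4 + R 7 := R 3))"
  unfolding push_com_def
  by (rule exec.Seq, rule exec.Store, rule exec.Seq, rule exec.Plus, rule exec.Seq, rule exec.Store,
    rule exec.Seq, rule exec.Plus, rule back_subst[of "\<lambda>s. exec _ _ _ s"], rule exec.Plus) (auto simp: fun_eq_iff)
 moreover have "R 7 = 3" "R 6 = 0" "R 4 + 3 + 3 = R 4 + 6" "1 + (1 + (1 + (1 + 1))) = (5::nat)"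
  using assms by (auto simp: wf_regs_def)
 ultimately show ?thesis by (simp only: add_0_right)
qed

lemma exec_pop:
 assumes "wf_regs R"
 shows "exec pop_com (R, M) 3 (R(2 := M (R 3), 1 := R 3 + 3, 3 := M (R 3 + 3)), M)"
proof -
 have "exec pop_com (R, M) (1 + (1 + 1))
  (R(2 := M (R 3), 1 := R 3 + R 7, 3 := M (R 3 + R 7)), M)"
  unfolding pop_com_def
  by (rule exec.Seq, rule exec.Load, rule exec.Seq, rule exec.Plus,
   rule back_subst[of "\<lambda>s. exec _ _ _ s"], rule exec.Load) (auto simp: fun_eq_iff)
 moreover have "R 7 = 3" "1 + (1 + 1) = (3::nat)" using assms by (auto simp: wf_regs_def)
 ultimately show ?thesis by (simp only: add_0_right)
qed

text \<open>The argument of \<open>c\<close> is saved on the stack and ends in register 2.\<close>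

definition saving :: "com \<Rightarrow> com" where "saving c = Seq push_com (Seq c pop_com)"

text \<open>The pushed cell lies below the heap pointer at which \<open>c\<close> starts, and
  \<open>ext\<close> makes \<open>c\<close> return with the stack pointer it was given, so
  \<open>pop_com\<close> finds the argument again.\<close>

lemma exec_saving:
 assumes "run c x y t" "wf_regs R" "repr M (R 4) x (R 0)"
 obtains u R' M' where "u \<le> t + 8" "exec (saving c) (R, M) u (R', M')" "ext (R, M) (R', M')"
  "repr M' (R' 4) y (R' 0)" "R' 2 = R 0"
proof -
 let ?R = "R(1 := R 4 + 3, 3 := R 4, 4 := R 4 + 6)" and ?M = "M(R 4 := R 0, R 4 + 3 := R 3)"
 have wf: "wf_regs ?R" using assms(2) unfolding wf_regs_def by (simp add: mod_add_eq[symmetric, of "R 4" 6])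
 have "repr ?M (?R 4) x (?R 0)"
  using assms(3) by simp (erule repr_mono; simp)
 with assms(1) wf obtain u R1 M1 where 1: "u \<le> t" "exec c (?R, ?M) u (R1, M1)" "ext (?R, ?M) (R1, M1)"
  "repr M1 (R1 4) y (R1 0)" by (rule runE)
 have wf1: "wf_regs R1" and R13: "R1 3 = R 4" using 1(3) by (simp_all add: ext_def)
 have M1: "M1 a = ?M a" if "a < R 4 + 6 \<or> a mod 3 \<noteq> 2" for a using 1(3) that unfolding ext_def by auto
 let ?R2 = "R1(2 := M1 (R1 3), 1 := R1 3 + 3, 3 := M1 (R1 3 + 3))"
 have "exec (saving c) (R, M) (5 + (u + 3)) (?R2, M1)"
  unfolding saving_def by (rule exec.Seq[OF exec_push[OF assms(2)] exec.Seq[OF 1(2) exec_pop[OF wf1]]])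
 moreover have "?R2 3 = R 3" "?R2 2 = R 0" using M1 by (auto simp: R13)
 moreover have "ext (R, M) (?R2, M1)"
 proof -
  have "M1 a = M a" if "a < R 4 \<or> a mod 3 \<noteq> 2" for a
  proof -
   have "R 4 mod 3 = 2" "(R 4 + 3) mod 3 = 2" using assms(2) by (auto simp: wf_regs_def)
   hence "a \<noteq> R 4" "a \<noteq> R 4 + 3" using that by auto
   thus ?thesis using M1[of a] that by auto
  qed
  thus ?thesis using 1(3) \<open>?R2 3 = R 3\<close> wf1 unfolding ext_def by (auto simp: wf_regs_def)
 qed
 ultimately show ?thesis using 1(1,4) by (intro that[of "5 + (u + 3)" ?R2 M1]) auto
qed

text \<open>Pairing is the basic way to combine programs. Register 8 keeps the argument for
  \<open>d\<close> while the result of \<open>c\<close> waits on the stack; the last five commands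
  allocate the pair.\<close>

definition fork :: "com \<Rightarrow> com \<Rightarrow> com" where
 "fork c d = Seq (saving c) (Seq (Plus 8 2 6) (Seq push_com (Seq (Plus 0 8 6) (Seq d (Seq pop_com
   (Seq (Store 4 2) (Seq (Plus 1 4 7) (Seq (Store 1 0) (Seq (Plus 0 4 6) (Plus 4 1 7))))))))))"

lemma run_fork:
 assumes "run c x a t" "run d x b u"
 shows "run (fork c d) x (Pr a b) (t + u + 25)"
proof (rule runI)
 fix R M assume R: "wf_regs R" "repr M (R 4) x (R 0)"
 from assms(1) R obtain t1 R1 M1 where 1: "t1 \<le> t + 8" "exec (saving c) (R, M) t1 (R1, M1)"
  "ext (R, M) (R1, M1)" "repr M1 (R1 4) a (R1 0)" "R1 2 = R 0" by (rule exec_saving)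
 have wf1: "wf_regs R1" using 1(3) by (simp add: ext_def)
 have x1: "repr M1 (R1 4) x (R 0)" using ext_repr[OF 1(3)] R(2) by simp
 let ?R2 = "R1(8 := R 0)"
 have e2: "exec (Plus 8 2 6) (R1, M1) 1 (?R2, M1)"
  using exec.Plus[of 8 2 6 R1 M1] wf1 by (simp add: wf_regs_def 1(5))
 have wf2: "wf_regs ?R2" using wf1 by (simp add: wf_regs_def)
 let ?R3 = "?R2(1 := R1 4 + 3, 3 := R1 4, 4 := R1 4 + 6)" and ?M3 = "M1(R1 4 := R1 0, R1 4 + 3 := R1 3)"
 have e3: "exec push_com (?R2, M1) 5 (?R3, ?M3)" using exec_push[OF wf2, of M1] by simp
 let ?R4 = "?R3(0 := R 0)"
 have e4: "exec (Plus 0 8 6) (?R3, ?M3) 1 (?R4, ?M3)"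
  using exec.Plus[of 0 8 6 ?R3 ?M3] wf1 by (simp add: wf_regs_def)
 have wf4: "wf_regs ?R4" using wf1 unfolding wf_regs_def by (simp add: mod_add_eq[symmetric, of "R1 4" 6])
 have "repr ?M3 (?R4 4) x (?R4 0)" using x1 by simp (erule repr_mono; simp)
 with assms(2) wf4 obtain u' R5 M5 where 5: "u' \<le> u" "exec d (?R4, ?M3) u' (R5, M5)"
  "ext (?R4, ?M3) (R5, M5)" "repr M5 (R5 4) b (R5 0)" by (rule runE)
 have wf5: "wf_regs R5" and R53: "R5 3 = R1 4" using 5(3) by (simp_all add: ext_def)
 have M5: "M5 z = ?M3 z" if "z < R1 4 + 6 \<or> z mod 3 \<noteq> 2" for z using 5(3) that unfolding ext_def by auto
 have a5: "repr M5 (R5 4) a (R1 0)"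
 proof (rule repr_mono[OF 1(4)])
  show "R1 4 \<le> R5 4" using 5(3) by (simp add: ext_def)
 qed (simp add: M5)
 let ?R6 = "R5(2 := R1 0, 1 := R1 4 + 3, 3 := R1 3)"
 have "M5 (R1 4) = R1 0" "M5 (R1 4 + 3) = R1 3" using M5 by auto
 hence e6: "exec pop_com (R5, M5) 3 (?R6, M5)" using exec_pop[OF wf5, of M5] by (simp add: R53)
 have R5: "R5 7 = 3" "R5 6 = 0" "R5 4 mod 3 = 2" using wf5 by (auto simp: wf_regs_def)
 let ?R7 = "?R6(1 := R5 4 + 3, 0 := R5 4, 4 := R5 4 + 6)" and ?M7 = "M5(R5 4 := R1 0, R5 4 + 3 := R5 0)"
 have e7: "exec (Store 4 2) (?R6, M5) 1 (?R6, M5(R5 4 := R1 0))" using exec.Store[of 4 2 ?R6 M5] by simp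
 have e8: "exec (Plus 1 4 7) (?R6, M5(R5 4 := R1 0)) 1 (?R6(1 := R5 4 + 3), M5(R5 4 := R1 0))"
  using exec.Plus[of 1 4 7 ?R6] by (simp add: R5)
 have e9: "exec (Store 1 0) (?R6(1 := R5 4 + 3), M5(R5 4 := R1 0)) 1 (?R6(1 := R5 4 + 3), ?M7)"
  using exec.Store[of 1 0 "?R6(1 := R5 4 + 3)" "M5(R5 4 := R1 0)"] by simp
 have e10: "exec (Plus 0 4 6) (?R6(1 := R5 4 + 3), ?M7) 1 (?R6(1 := R5 4 + 3, 0 := R5 4), ?M7)"
  using exec.Plus[of 0 4 6 "?R6(1 := R5 4 + 3)" ?M7] by (simp add: R5)
 have e11: "exec (Plus 4 1 7) (?R6(1 := R5 4 + 3, 0 := R5 4), ?M7) 1 (?R7, ?M7)"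
  using exec.Plus[of 4 1 7 "?R6(1 := R5 4 + 3, 0 := R5 4)" ?M7] by (simp add: R5 add.commute[of "R5 4"])
 have E: "exec (fork c d) (R, M) (t1 + (1 + (5 + (1 + (u' + (3 + (1 + (1 + (1 + (1 + 1)))))))))) (?R7, ?M7)"
  unfolding fork_def
  by (rule exec.Seq[OF 1(2) exec.Seq[OF e2 exec.Seq[OF e3 exec.Seq[OF e4 exec.Seq[OF 5(2) exec.Seq[OF e6
     exec.Seq[OF e7 exec.Seq[OF e8 exec.Seq[OF e9 exec.Seq[OF e10 e11]]]]]]]]]])
 have M15: "M5 z = M1 z" if "z < R1 4 \<or> z mod 3 \<noteq> 2" for z
 proof -
  have "R1 4 mod 3 = 2" "(R1 4 + 3) mod 3 = 2" using wf1 by (auto simp: wf_regs_def)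
  hence "z \<noteq> R1 4" "z \<noteq> R1 4 + 3" using that by auto
  thus ?thesis using M5[of z] that by auto
 qed
 have R15: "R1 4 \<le> R5 4" using 5(3) by (simp add: ext_def)
 have "ext (R1, M1) (?R7, ?M7)"
 proof -
  have "?M7 z = M1 z" if "z < R1 4 \<or> z mod 3 \<noteq> 2" for z
  proof -
   have "(R5 4 + 3) mod 3 = 2" using R5 by simp
   hence "z \<noteq> R5 4" "z \<noteq> R5 4 + 3" using that R15 R5(3) by auto
   thus ?thesis using M15[OF that] by simp
  qed
  moreover have "wf_regs ?R7" using wf5 unfolding wf_regs_def by (simp add: mod_add_eq[symmetric, of "R5 4" 6])
  moreover have "?R7 r = R1 r" if "r \<ge> 20" for r using 5(3) that by (auto simp: ext_def)
  ultimately show ?thesis using R15 unfolding ext_def by (simp del: fun_upd_apply) simp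
 qed
 with 1(3) have "ext (R, M) (?R7, ?M7)" by (rule ext_trans)
 moreover have "repr ?M7 (?R7 4) (Pr a b) (?R7 0)"
  using R5 a5 5(4) by (auto elim!: repr_mono)
 ultimately show "\<exists>ua R' M'. ua \<le> t + u + 25 \<and> exec (fork c d) (R, M) ua (R', M') \<and> ext (R, M) (R', M') \<and>
   repr M' (R' 4) (Pr a b) (R' 0)"
  using E 1(1) 5(1) by (intro exI conjI; (assumption)?) auto
qed

definition test_com :: "com \<Rightarrow> com" where
 "test_com c = Seq (saving c) (Seq (Plus 8 0 6) (Plus 0 2 6))"

lemma exec_test:
 assumes "run c x (Num n) t" "wf_regs R" "repr M (R 4) x (R 0)"
 obtains u R' M' where "u \<le> t + 10" "exec (test_com c) (R, M) u (R', M')" "ext (R, M) (R', M')"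
  "repr M' (R' 4) x (R' 0)" "R' 8 = n"
proof -
 from assms obtain u R1 M1 where 1: "u \<le> t + 8" "exec (saving c) (R, M) u (R1, M1)"
  "ext (R, M) (R1, M1)" "repr M1 (R1 4) (Num n) (R1 0)" "R1 2 = R 0" by (rule exec_saving)
 have wf1: "wf_regs R1" using 1(3) by (simp add: ext_def)
 have x1: "repr M1 (R1 4) x (R 0)" using ext_repr[OF 1(3)] assms(3) by simp
 have e2: "exec (Plus 8 0 6) (R1, M1) 1 (R1(8 := n), M1)"
  using exec.Plus[of 8 0 6 R1 M1] wf1 1(4) by (simp add: wf_regs_def)
 have e3: "exec (Plus 0 2 6) (R1(8 := n), M1) 1 (R1(8 := n, 0 := R 0), M1)"
  using exec.Plus[of 0 2 6 "R1(8 := n)" M1] wf1 1(5) by (simp add: wf_regs_def)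
 have "exec (test_com c) (R, M) (u + (1 + 1)) (R1(8 := n, 0 := R 0), M1)"
  unfolding test_com_def by (rule exec.Seq[OF 1(2) exec.Seq[OF e2 e3]])
 moreover have "ext (R, M) (R1(8 := n, 0 := R 0), M1)"
  using 1(3) by (auto simp: ext_def wf_regs_def)
 ultimately show ?thesis using 1(1) x1 by (intro that[of "u + (1 + 1)" "R1(8 := n, 0 := R 0)" M1]) auto
qed

definition if_com :: "com \<Rightarrow> com \<Rightarrow> com \<Rightarrow> com" where
 "if_com c d e = Seq (test_com c) (If 8 d e)"

lemma run_if:
 assumes "run c x (Num n) t" "n \<noteq> 0 \<Longrightarrow> run d x y u" "n = 0 \<Longrightarrow> run e x y u"
 shows "run (if_com c d e) x y (t + u + 11)"
proof (rule runI)
 fix R M assume R: "wf_regs R" "repr M (R 4) x (R 0)"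
 from assms(1) R obtain t1 R1 M1 where 1: "t1 \<le> t + 10" "exec (test_com c) (R, M) t1 (R1, M1)"
  "ext (R, M) (R1, M1)" "repr M1 (R1 4) x (R1 0)" "R1 8 = n" by (rule exec_test)
 have wf1: "wf_regs R1" using 1(3) by (simp add: ext_def)
 have "run (if n \<noteq> 0 then d else e) x y u" using assms(2,3) by simp
 from runE[OF this wf1 1(4)] obtain t2 R2 M2 where 2: "t2 \<le> u"
  "exec (if n \<noteq> 0 then d else e) (R1, M1) t2 (R2, M2)" "ext (R1, M1) (R2, M2)" "repr M2 (R2 4) y (R2 0)" .
 have "exec (If 8 d e) (R1, M1) (Suc t2) (R2, M2)"
  using 1(5) 2(2) by (cases "n = 0") (auto intro: exec.IfTrue exec.IfFalse)
 from exec.Seq[OF 1(2) this] show "\<exists>ua R' M'. ua \<le> t + u + 11 \<and> exec (if_com c d e) (R, M) ua (R', M') \<and>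
   ext (R, M) (R', M') \<and> repr M' (R' 4) y (R' 0)"
  unfolding if_com_def using 1(1) 2(1,4) ext_trans[OF 1(3) 2(3)]
  by (intro exI conjI; (assumption)?) auto
qed

text \<open>A loop can only test a register. So the condition is evaluated into register 8 before
  the loop and again at the end of every round, and \<open>test_com\<close> restores the value in
  register 0.\<close>

definition while_com :: "com \<Rightarrow> com \<Rightarrow> com" where
 "while_com b c = Seq (test_com b) (While 8 (Seq c (test_com b)))"

lemma run_while:
 assumes "\<And>i. i < m \<Longrightarrow> run b (v i) (Num 1) t" "run b (v m) (Num 0) t"
  and "\<And>i. i < m \<Longrightarrow> run c (v i) (v (Suc i)) t"
 shows "run (while_com b c) (v 0) (v m) ((m + 1) * (2 * t + 12))"
proof (rule runI)
 fix R M assume R: "wf_regs R" "repr M (R 4) (v 0) (R 0)"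
 have b: "run b (v i) (Num (of_bool (i < m))) t" if "i \<le> m" for i
  using that assms(1)[of i] assms(2) by (cases "i = m") auto
 have loop: "\<exists>u R' M'. u \<le> n * (2 * t + 12) + 1 \<and> exec (While 8 (Seq c (test_com b))) (R, M) u (R', M') \<and>
   ext (R, M) (R', M') \<and> repr M' (R' 4) (v m) (R' 0)"
  if "wf_regs R" "repr M (R 4) (v i) (R 0)" "R 8 = of_bool (i < m)" "i + n = m" for n i R M
  using that
 proof (induction n arbitrary: i R M)
  case 0
  hence "exec (While 8 (Seq c (test_com b))) (R, M) 1 (R, M)" by (intro exec.WhileFalse) simp
  with 0 show ?case by (intro exI conjI) (auto simp: ext_refl)
 next
  case (Suc n)
  hence i: "i < m" by simp
  from runE[OF assms(3)[OF i] Suc.prems(1,2)] obtain t1 R1 M1 where 1: "t1 \<le> t"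
   "exec c (R, M) t1 (R1, M1)" "ext (R, M) (R1, M1)" "repr M1 (R1 4) (v (Suc i)) (R1 0)" .
  have wf1: "wf_regs R1" using 1(3) by (simp add: ext_def)
  from i have "Suc i \<le> m" by simp
  from exec_test[OF b[OF this] wf1 1(4)] obtain t2 R2 M2 where 2: "t2 \<le> t + 10"
   "exec (test_com b) (R1, M1) t2 (R2, M2)" "ext (R1, M1) (R2, M2)" "repr M2 (R2 4) (v (Suc i)) (R2 0)"
   "R2 8 = of_bool (Suc i < m)" .
  have wf2: "wf_regs R2" using 2(3) by (simp add: ext_def)
  from Suc.IH[OF wf2 2(4,5)] Suc.prems(4) obtain u R3 M3 where 3: "u \<le> n * (2 * t + 12) + 1"
   "exec (While 8 (Seq c (test_com b))) (R2, M2) u (R3, M3)" "ext (R2, M2) (R3, M3)"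
   "repr M3 (R3 4) (v m) (R3 0)" by auto
  have "exec (While 8 (Seq c (test_com b))) (R, M) (Suc ((t1 + t2) + u)) (R3, M3)"
   by (rule exec.WhileTrue[OF _ exec.Seq[OF 1(2) 2(2)] 3(2)]) (simp add: Suc.prems i)
  thus ?case using 1(1) 2(1) 3(1,4) ext_trans[OF ext_trans[OF 1(3) 2(3)] 3(3)]
   by (intro exI conjI; (assumption)?) auto
 qed
 from exec_test[OF b[of 0] R] obtain t2 R2 M2 where 2: "t2 \<le> t + 10"
   "exec (test_com b) (R, M) t2 (R2, M2)" "ext (R, M) (R2, M2)" "repr M2 (R2 4) (v 0) (R2 0)"
   "R2 8 = of_bool (0 < m)" by auto
 have wf2: "wf_regs R2" using 2(3) by (simp add: ext_def)
 from loop[OF wf2 2(4,5), of m] obtain u R3 M3 where 3: "u \<le> m * (2 * t + 12) + 1"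
   "exec (While 8 (Seq c (test_com b))) (R2, M2) u (R3, M3)" "ext (R2, M2) (R3, M3)"
   "repr M3 (R3 4) (v m) (R3 0)" by auto
 from exec.Seq[OF 2(2) 3(2)] show "\<exists>u R' M'. u \<le> (m + 1) * (2 * t + 12) \<and> exec (while_com b c) (R, M) u (R', M') \<and>
   ext (R, M) (R', M') \<and> repr M' (R' 4) (v m) (R' 0)"
  unfolding while_com_def using 2(1) 3(1,4) ext_trans[OF 2(3) 3(3)]
  by (intro exI conjI; (assumption)?) auto
qed

section \<open>Polynomial bounds and polynomial-time functions\<close>

definition poly_bd :: "'a set \<Rightarrow> ('a \<Rightarrow> nat) \<Rightarrow> ('a \<Rightarrow> nat) \<Rightarrow> bool" where
 "poly_bd D \<mu> t \<longleftrightarrow> (\<exists>d. \<forall>x\<in>D. t x \<le> (\<mu> x + 2) ^ d)"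

lemma poly_bdI: "(\<And>x. x \<in> D \<Longrightarrow> t x \<le> (\<mu> x + 2) ^ d) \<Longrightarrow> poly_bd D \<mu> t"
 by (auto simp: poly_bd_def)

lemma poly_bd_mono: "poly_bd D \<mu> t \<Longrightarrow> (\<And>x. x \<in> D \<Longrightarrow> s x \<le> t x) \<Longrightarrow> poly_bd D \<mu> s"
 unfolding poly_bd_def by (meson order.trans)

text \<open>The summand 2 in \<open>poly_bd\<close> serves this purpose: the base of the power is at
  least 2, even where the measure vanishes.\<close>

lemma poly_bd_const: "poly_bd D \<mu> (\<lambda>_. n)"
proof (rule poly_bdI)
 fix x have "n \<le> 2 ^ n" by (simp add: less_imp_le)
 also have "\<dots> \<le> (\<mu> x + 2) ^ n" by (simp add: power_mono)
 finally show "n \<le> (\<mu> x + 2) ^ n" .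
qed

lemma poly_bd_measure: "poly_bd D \<mu> \<mu>"
 by (rule poly_bdI[where d = 1]) simp

lemma poly_bd_mult:
 assumes "poly_bd D \<mu> s" "poly_bd D \<mu> t"
 shows "poly_bd D \<mu> (\<lambda>x. s x * t x)"
proof -
 from assms obtain d e where "\<And>x. x \<in> D \<Longrightarrow> s x \<le> (\<mu> x + 2) ^ d" "\<And>x. x \<in> D \<Longrightarrow> t x \<le> (\<mu> x + 2) ^ e"
  unfolding poly_bd_def by blast
 thus ?thesis by (intro poly_bdI[where d = "d + e"]) (simp add: power_add mult_mono)
qed

lemma poly_bd_add:
 assumes "poly_bd D \<mu> s" "poly_bd D \<mu> t"
 shows "poly_bd D \<mu> (\<lambda>x. s x + t x)"
proof -
 have "poly_bd D \<mu> (\<lambda>x. (s x + 1) * (t x + 1))" if "poly_bd D \<mu> (\<lambda>x. s x + 1)" "poly_bd D \<mu> (\<lambda>x. t x + 1)"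
  using that by (rule poly_bd_mult)
 moreover have "poly_bd D \<mu> (\<lambda>x. u x + 1)" if "poly_bd D \<mu> u" for u
 proof -
  from that have "poly_bd D \<mu> (\<lambda>x. u x * 1)" by simp
  from that obtain d where d: "\<And>x. x \<in> D \<Longrightarrow> u x \<le> (\<mu> x + 2) ^ d" unfolding poly_bd_def by blast
  have "u x + 1 \<le> (\<mu> x + 2) ^ Suc d" if "x \<in> D" for x
  proof -
   have "u x + 1 \<le> 2 * (\<mu> x + 2) ^ d" using d[OF that] one_le_power[of "\<mu> x + 2" d] by linarith
   also have "\<dots> \<le> (\<mu> x + 2) ^ Suc d" by simp
   finally show ?thesis .
  qed
  thus ?thesis by (rule poly_bdI)
 qed
 ultimately have "poly_bd D \<mu> (\<lambda>x. (s x + 1) * (t x + 1))" using assms by blast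
 thus ?thesis by (rule poly_bd_mono) simp
qed

lemma poly_bd_power: "poly_bd D \<mu> s \<Longrightarrow> poly_bd D \<mu> (\<lambda>x. s x ^ n)"
 by (induction n) (auto intro: poly_bd_mult poly_bd_const)

lemma poly_bd_comp:
 assumes "poly_bd E \<nu> t" "\<And>x. x \<in> D \<Longrightarrow> g x \<in> E" "poly_bd D \<mu> (\<lambda>x. \<nu> (g x))"
 shows "poly_bd D \<mu> (\<lambda>x. t (g x))"
proof -
 from assms(1) obtain d where "\<And>x. x \<in> E \<Longrightarrow> t x \<le> (\<nu> x + 2) ^ d" unfolding poly_bd_def by blast
 hence "t (g x) \<le> (\<nu> (g x) + 2) ^ d" if "x \<in> D" for x using assms(2)[OF that] by blast
 with poly_bd_power[OF poly_bd_add[OF assms(3) poly_bd_const]] show ?thesis by (rule poly_bd_mono)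
qed

lemmas poly_bd_intros = poly_bd_const poly_bd_measure poly_bd_add poly_bd_mult poly_bd_power

text \<open>The measure \<open>\<mu>\<close> may be larger than the size of the argument. The
  reduction enumerates exponentially many assignments, so its time is polynomial only in a measure
  that counts these. The domain \<open>D\<close> lets the branches of a conditional be treated only
  where they are executed.\<close>

definition pcomp :: "'a::data set \<Rightarrow> ('a \<Rightarrow> nat) \<Rightarrow> ('a \<Rightarrow> 'b::data) \<Rightarrow> bool" where
 "pcomp D \<mu> f \<longleftrightarrow> poly_bd D \<mu> (\<lambda>x. sz (f x)) \<and>
   (\<exists>c t. poly_bd D \<mu> t \<and> (\<forall>x\<in>D. run c (enc x) (enc (f x)) (t x)))"

lemma pcompI:
 "poly_bd D \<mu> (\<lambda>x. sz (f x)) \<Longrightarrow> poly_bd D \<mu> t \<Longrightarrow> (\<And>x. x \<in> D \<Longrightarrow> run c (enc x) (enc (f x)) (t x)) \<Longrightarrow> pcomp D \<mu> f"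
 by (auto simp: pcomp_def)

lemma pcomp_size: "pcomp D \<mu> f \<Longrightarrow> poly_bd D \<mu> (\<lambda>x. sz (f x))"
 by (simp add: pcomp_def)

lemma pcomp_cong: "pcomp D \<mu> f \<Longrightarrow> (\<And>x. x \<in> D \<Longrightarrow> f x = g x) \<Longrightarrow> pcomp D \<mu> g"
 unfolding pcomp_def poly_bd_def by simp

lemma pcomp_subset: "pcomp D \<mu> f \<Longrightarrow> E \<subseteq> D \<Longrightarrow> pcomp E \<mu> f"
 unfolding pcomp_def poly_bd_def by (meson subset_iff)

lemma pcomp_id: "poly_bd D \<mu> sz \<Longrightarrow> pcomp D \<mu> (\<lambda>x. x)"
 by (rule pcompI[where c = Skip and t = "\<lambda>_. 1"]) (auto intro: run_skip[unfolded One_nat_def] poly_bd_const)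

lemma pcomp_comp:
 assumes "pcomp E \<nu> g" "pcomp D \<mu> f" "\<And>x. x \<in> D \<Longrightarrow> f x \<in> E" "poly_bd D \<mu> (\<lambda>x. \<nu> (f x))"
 shows "pcomp D \<mu> (\<lambda>x. g (f x))"
proof -
 from assms(1) obtain c t where c: "poly_bd E \<nu> (\<lambda>x. sz (g x))" "poly_bd E \<nu> t"
  "\<And>x. x \<in> E \<Longrightarrow> run c (enc x) (enc (g x)) (t x)" unfolding pcomp_def by blast
 from assms(2) obtain d u where d: "poly_bd D \<mu> u" "\<And>x. x \<in> D \<Longrightarrow> run d (enc x) (enc (f x)) (u x)"
  unfolding pcomp_def by blast
 show ?thesis
 proof (rule pcompI)
  show "poly_bd D \<mu> (\<lambda>x. sz (g (f x)))" by (rule poly_bd_comp[OF c(1)]) (use assms in auto)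
  show "poly_bd D \<mu> (\<lambda>x. u x + t (f x))"
   by (rule poly_bd_add[OF d(1) poly_bd_comp[OF c(2)]]) (use assms in auto)
  show "run (Seq d c) (enc x) (enc (g (f x))) (u x + t (f x))" if "x \<in> D" for x
   using run_seq[OF d(2)[OF that] c(3)[OF assms(3)[OF that]]] .
 qed
qed

abbreviation pc :: "('a::data \<Rightarrow> 'b::data) \<Rightarrow> bool" where "pc \<equiv> pcomp UNIV sz"

lemma pcomp_app: "pc g \<Longrightarrow> pcomp D \<mu> f \<Longrightarrow> pcomp D \<mu> (\<lambda>x. g (f x))"
 by (rule pcomp_comp) (auto dest: pcomp_size)

lemma pcomp_Pair:
 assumes "pcomp D \<mu> f" "pcomp D \<mu> g"
 shows "pcomp D \<mu> (\<lambda>x. (f x, g x))"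
proof -
 from assms(1) obtain c t where c: "poly_bd D \<mu> (\<lambda>x. sz (f x))" "poly_bd D \<mu> t"
  "\<And>x. x \<in> D \<Longrightarrow> run c (enc x) (enc (f x)) (t x)" unfolding pcomp_def by blast
 from assms(2) obtain d u where d: "poly_bd D \<mu> (\<lambda>x. sz (g x))" "poly_bd D \<mu> u"
  "\<And>x. x \<in> D \<Longrightarrow> run d (enc x) (enc (g x)) (u x)" unfolding pcomp_def by blast
 show ?thesis
 proof (rule pcompI)
  show "poly_bd D \<mu> (\<lambda>x. sz (f x, g x))"
   using poly_bd_add[OF poly_bd_add[OF c(1) d(1)] poly_bd_const[of _ _ 1]] by simp
  show "poly_bd D \<mu> (\<lambda>x. t x + u x + 25)" by (intro poly_bd_intros c d)
  show "run (fork c d) (enc x) (enc (f x, g x)) (t x + u x + 25)" if "x \<in> D" for x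
   using run_fork[OF c(3)[OF that] d(3)[OF that]] by (simp add: enc_prod_def)
 qed
qed

text \<open>A nonempty list has the same encoding as the pair of its head and its tail. The same
  identity gives \<open>pcomp_hd_tl\<close>.\<close>

lemma pcomp_Cons:
 assumes "pcomp D \<mu> f" "pcomp D \<mu> g"
 shows "pcomp D \<mu> (\<lambda>x. f x # g x)"
proof -
 have "pcomp D \<mu> (\<lambda>x. (f x, g x))" using assms by (rule pcomp_Pair)
 thus ?thesis unfolding pcomp_def by (simp add: enc_prod_def sz_def)
qed

lemma pc_fst': "pc fst"
proof (rule pcompI)
 show "poly_bd UNIV sz (\<lambda>p :: 'a \<times> 'b. sz (fst p))"
  by (rule poly_bd_mono[OF poly_bd_measure]) (simp add: sz_fst less_imp_le)
 show "run (Load 0 0) (enc p) (enc (fst p)) 1" for p :: "'a \<times> 'b"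
  unfolding enc_prod_def by (rule run_fst)
qed (rule poly_bd_const)

lemma pc_snd': "pc snd"
proof (rule pcompI)
 show "poly_bd UNIV sz (\<lambda>p :: 'a \<times> 'b. sz (snd p))"
  by (rule poly_bd_mono[OF poly_bd_measure]) (simp add: sz_snd less_imp_le)
 show "run (Seq (Plus 0 0 7) (Load 0 0)) (enc p) (enc (snd p)) 2" for p :: "'a \<times> 'b"
  unfolding enc_prod_def by (rule run_snd)
qed (rule poly_bd_const)

lemmas pcomp_fst = pcomp_app[OF pc_fst']
lemmas pcomp_snd = pcomp_app[OF pc_snd']

text \<open>Allows a program to contain the pattern graph, its paths and the parameters as
  constants.\<close>

lemma run_constant: "\<exists>c t. \<forall>x. run c x v t"
proof (induction v)
 case (Num n)
 thus ?case using run_const by blast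
next
 case (Pr v w)
 then obtain c t d u where "\<And>x. run c x v t" "\<And>x. run d x w u" by blast
 thus ?case using run_fork[of c _ v t d w u] by blast
qed

lemma pcomp_const: "pcomp D \<mu> (\<lambda>_. a)"
proof -
 obtain c t where "run c x (enc a) t" for x using run_constant by blast
 thus ?thesis by (intro pcompI[where c = c and t = "\<lambda>_. t"] poly_bd_const)
qed

lemma pcomp_plus:
 assumes "pcomp D \<mu> f" "pcomp D \<mu> g"
 shows "pcomp D \<mu> (\<lambda>x. f x + g x :: nat)"
proof -
 have "pc (\<lambda>p. fst p + snd p :: nat)"
 proof (rule pcompI)
  show "poly_bd UNIV sz (\<lambda>p :: nat \<times> nat. sz (fst p + snd p))"
   by (rule poly_bd_mono[OF poly_bd_measure]) auto
  show "run plus_com (enc p) (enc (fst p + snd p)) 4" for p :: "nat \<times> nat"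
   using run_plus[of "fst p" "snd p"] unfolding enc_prod_def enc_nat_def by (simp add: eval_nat_numeral)
 qed (rule poly_bd_const)
 from pcomp_app[OF this pcomp_Pair[OF assms]] show ?thesis by simp
qed

lemma pcomp_minus:
 assumes "pcomp D \<mu> f" "pcomp D \<mu> g"
 shows "pcomp D \<mu> (\<lambda>x. f x - g x :: nat)"
proof -
 have "pc (\<lambda>p. fst p - snd p :: nat)"
 proof (rule pcompI)
  show "poly_bd UNIV sz (\<lambda>p :: nat \<times> nat. sz (fst p - snd p))"
   by (rule poly_bd_mono[OF poly_bd_measure]) auto
  show "run minus_com (enc p) (enc (fst p - snd p)) 4" for p :: "nat \<times> nat"
   using run_minus[of "fst p" "snd p"] unfolding enc_prod_def enc_nat_def by (simp add: eval_nat_numeral)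
 qed (rule poly_bd_const)
 from pcomp_app[OF this pcomp_Pair[OF assms]] show ?thesis by simp
qed

lemma pcomp_if_nat:
 assumes "pcomp D \<mu> b" "pcomp {x\<in>D. b x \<noteq> 0} \<mu> f" "pcomp {x\<in>D. b x = 0} \<mu> g"
 shows "pcomp D \<mu> (\<lambda>x. if b x \<noteq> (0::nat) then f x else g x)"
proof -
 from assms(1) obtain a s where a: "poly_bd D \<mu> s" "\<And>x. x \<in> D \<Longrightarrow> run a (enc x) (enc (b x)) (s x)"
  unfolding pcomp_def by blast
 from assms(2) obtain c t where c: "poly_bd {x\<in>D. b x \<noteq> 0} \<mu> (\<lambda>x. sz (f x))" "poly_bd {x\<in>D. b x \<noteq> 0} \<mu> t"
  "\<And>x. x \<in> {x\<in>D. b x \<noteq> 0} \<Longrightarrow> run c (enc x) (enc (f x)) (t x)" unfolding pcomp_def by blast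
 from assms(3) obtain d u where d: "poly_bd {x\<in>D. b x = 0} \<mu> (\<lambda>x. sz (g x))" "poly_bd {x\<in>D. b x = 0} \<mu> u"
  "\<And>x. x \<in> {x\<in>D. b x = 0} \<Longrightarrow> run d (enc x) (enc (g x)) (u x)" unfolding pcomp_def by blast
 have split: "poly_bd D \<mu> (\<lambda>x. if b x \<noteq> 0 then p x else q x)"
  if "poly_bd {x\<in>D. b x \<noteq> 0} \<mu> p" "poly_bd {x\<in>D. b x = 0} \<mu> q" for p q
 proof -
  from that obtain i j where "\<And>x. x \<in> D \<Longrightarrow> b x \<noteq> 0 \<Longrightarrow> p x \<le> (\<mu> x + 2) ^ i"
   "\<And>x. x \<in> D \<Longrightarrow> b x = 0 \<Longrightarrow> q x \<le> (\<mu> x + 2) ^ j" unfolding poly_bd_def by auto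
  hence "(if b x \<noteq> 0 then p x else q x) \<le> (\<mu> x + 2) ^ i + (\<mu> x + 2) ^ j" if "x \<in> D" for x
   using that by (auto intro: trans_le_add1 trans_le_add2)
  moreover have "poly_bd D \<mu> (\<lambda>x. (\<mu> x + 2) ^ i + (\<mu> x + 2) ^ j)" by (intro poly_bd_intros)
  ultimately show ?thesis by (metis (no_types, lifting) poly_bd_mono)
 qed
 show ?thesis
 proof (rule pcompI)
  show "poly_bd D \<mu> (\<lambda>x. sz (if b x \<noteq> 0 then f x else g x))"
   using split[OF c(1) d(1)] by (simp add: if_distrib)
  show "poly_bd D \<mu> (\<lambda>x. s x + (if b x \<noteq> 0 then t x else u x) + 11)"
   using split[OF c(2) d(2)] a(1) by (intro poly_bd_intros)
  show "run (if_com a c d) (enc x) (enc (if b x \<noteq> 0 then f x else g x))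
    (s x + (if b x \<noteq> 0 then t x else u x) + 11)" if "x \<in> D" for x
   by (rule run_if) (use a(2) c(3) d(3) that in \<open>auto simp: enc_nat_def\<close>)
 qed
qed

lemma pcomp_of_bool: "pcomp D \<mu> b \<Longrightarrow> pcomp D \<mu> (\<lambda>x. of_bool (b x) :: nat)"
 unfolding pcomp_def by (simp add: enc_bool_def enc_nat_def)

lemma pcomp_If:
 assumes "pcomp D \<mu> b" "pcomp {x\<in>D. b x} \<mu> f" "pcomp {x\<in>D. \<not> b x} \<mu> g"
 shows "pcomp D \<mu> (\<lambda>x. if b x then f x else g x)"
 using pcomp_if_nat[OF pcomp_of_bool[OF assms(1)], of f g] assms(2,3) by simp

lemma pcomp_nonzero: "pcomp D \<mu> f \<Longrightarrow> pcomp D \<mu> (\<lambda>x. f x \<noteq> (0::nat))"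
 using pcomp_if_nat[of D \<mu> f "\<lambda>_. True" "\<lambda>_. False"]
 by (simp add: pcomp_const if_bool_eq_disj)

lemma pcomp_Not: "pcomp D \<mu> b \<Longrightarrow> pcomp D \<mu> (\<lambda>x. \<not> b x)"
 using pcomp_If[of D \<mu> b "\<lambda>_. False" "\<lambda>_. True"] by (simp add: pcomp_const if_bool_eq_disj)

lemma pcomp_conj: "pcomp D \<mu> a \<Longrightarrow> pcomp D \<mu> b \<Longrightarrow> pcomp D \<mu> (\<lambda>x. a x \<and> b x)"
 by (rule pcomp_cong[OF pcomp_If[of D \<mu> a b "\<lambda>_. False"]]) (auto intro: pcomp_const elim: pcomp_subset)
lemma pcomp_disj: "pcomp D \<mu> a \<Longrightarrow> pcomp D \<mu> b \<Longrightarrow> pcomp D \<mu> (\<lambda>x. a x \<or> b x)"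
 by (rule pcomp_cong[OF pcomp_If[of D \<mu> a "\<lambda>_. True" b]]) (auto intro: pcomp_const elim: pcomp_subset)
lemma pcomp_less: "pcomp D \<mu> f \<Longrightarrow> pcomp D \<mu> g \<Longrightarrow> pcomp D \<mu> (\<lambda>x. f x < (g x :: nat))"
 using pcomp_nonzero[OF pcomp_minus[of D \<mu> g f]] by (simp add: not_le)

lemma pcomp_le: "pcomp D \<mu> f \<Longrightarrow> pcomp D \<mu> g \<Longrightarrow> pcomp D \<mu> (\<lambda>x. f x \<le> (g x :: nat))"
 using pcomp_Not[OF pcomp_less[of D \<mu> g f]] by (simp add: not_less)

lemma pcomp_eq: "pcomp D \<mu> f \<Longrightarrow> pcomp D \<mu> g \<Longrightarrow> pcomp D \<mu> (\<lambda>x. f x = (g x :: nat))"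
 using pcomp_conj[OF pcomp_le[of D \<mu> f g] pcomp_le[of D \<mu> g f]] by (simp add: eq_iff)

lemma pcomp_Nil_test:
 assumes "pcomp D \<mu> f"
 shows "pcomp D \<mu> (\<lambda>x. f x \<noteq> [])"
proof -
 have "pc (\<lambda>xs :: 'b list. xs \<noteq> [])"
 proof (rule pcompI)
  show "run nonzero_com (enc xs) (enc (xs \<noteq> [])) 2" for xs :: "'b list"
   using run_nonzero[of "enc xs"] by (cases xs) (simp_all add: enc_bool_def)
  show "poly_bd UNIV sz (\<lambda>xs :: 'b list. sz (xs \<noteq> []))"
   by (rule poly_bd_mono[OF poly_bd_const[of _ _ 2]]) auto
 qed (rule poly_bd_const)
 from pcomp_app[OF this assms] show ?thesis .
qed

lemma pcomp_hd_tl: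
 assumes "pcomp D \<mu> f" "\<And>x. x \<in> D \<Longrightarrow> f x \<noteq> []"
 shows "pcomp D \<mu> (\<lambda>x. hd (f x))" "pcomp D \<mu> (\<lambda>x. tl (f x))"
proof -
 have "pcomp D \<mu> (\<lambda>x. (hd (f x), tl (f x)))"
 proof -
  have "enc (hd (f x), tl (f x)) = enc (f x)" if "x \<in> D" for x
   using assms(2)[OF that] by (cases "f x") (auto simp: enc_prod_def)
  thus ?thesis using assms(1) unfolding pcomp_def sz_def poly_bd_def by simp
 qed
 from pcomp_fst[OF this] pcomp_snd[OF this]
 show "pcomp D \<mu> (\<lambda>x. hd (f x))" "pcomp D \<mu> (\<lambda>x. tl (f x))" by simp_all
qed

lemma pcomp_case_list:
 assumes "pcomp D \<mu> (\<lambda>x. x)" "pcomp D \<mu> xs" "pcomp {x\<in>D. xs x = []} \<mu> f"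
  and "pcomp E \<nu> (\<lambda>z. g (fst z) (fst (snd z)) (snd (snd z)))"
  and "\<And>x y ys. x \<in> D \<Longrightarrow> xs x = y # ys \<Longrightarrow> (x, y, ys) \<in> E"
  and "poly_bd {x\<in>D. xs x \<noteq> []} \<mu> (\<lambda>x. \<nu> (x, hd (xs x), tl (xs x)))"
 shows "pcomp D \<mu> (\<lambda>x. case xs x of [] \<Rightarrow> f x | y # ys \<Rightarrow> g x y ys)"
proof -
 let ?D = "{x\<in>D. xs x \<noteq> []}"
 have *: "pcomp ?D \<mu> (\<lambda>x. x)" "pcomp ?D \<mu> xs" using assms(1,2) by (auto elim: pcomp_subset)
 have "pcomp ?D \<mu> (\<lambda>x. (x, hd (xs x), tl (xs x)))"
  by (intro pcomp_Pair pcomp_hd_tl * ) auto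
 from pcomp_comp[OF assms(4) this _ assms(6)]
 have 1: "pcomp ?D \<mu> (\<lambda>x. g x (hd (xs x)) (tl (xs x)))" using assms(5) by fastforce
 have "pcomp D \<mu> (\<lambda>x. if xs x \<noteq> [] then g x (hd (xs x)) (tl (xs x)) else f x)"
  by (rule pcomp_If[OF pcomp_Nil_test[OF assms(2)] 1]) (use assms(3) in simp)
 thus ?thesis by (rule pcomp_cong) (auto split: list.split)
qed

text \<open>The loop state is a triple of environment, accumulator and remaining list. The loops of
  the reduction are folds of this kind, except for the one in \<open>pc_upt\<close>.\<close>

definition fold_com :: "com \<Rightarrow> com" where
 "fold_com c = (let f = Load 0 0; s = Seq (Plus 0 0 7) (Load 0 0) in
   Seq (while_com (Seq s (Seq s nonzero_com))
    (fork f (fork (Seq (fork f (fork (Seq s f) (Seq s (Seq s f)))) c) (Seq s (Seq s s))))) (Seq s f))"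

lemma run_foldl:
 assumes "\<And>i. i < length ys \<Longrightarrow>
  run c (enc (x, foldl F a (take i ys), ys ! i)) (enc (foldl F a (take (Suc i) ys))) t"
 shows "run (fold_com c) (enc (x, a, ys)) (enc (foldl F a ys)) ((length ys + 1) * (2 * t + 400))"
proof -
 let ?f = "Load 0 0" and ?s = "Seq (Plus 0 0 7) (Load 0 0)"
 let ?v = "\<lambda>i. enc (x, foldl F a (take i ys), drop i ys)"
 let ?b = "Seq ?s (Seq ?s nonzero_com)"
  and ?c = "fork ?f (fork (Seq (fork ?f (fork (Seq ?s ?f) (Seq ?s (Seq ?s ?f)))) c) (Seq ?s (Seq ?s ?s)))"
 have b: "run ?b (?v i) (Num (of_bool (i < length ys))) (t + 180)" if "i \<le> length ys" for i
 proof -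
  have "run ?b (?v i) (Num (of_bool (enc (drop i ys) \<noteq> Num 0))) (2 + (2 + 2))"
   unfolding enc_prod_def by (simp only: fst_conv snd_conv) (rule run_seq[OF run_snd run_seq[OF run_snd run_nonzero]])
  moreover have "enc (drop i ys) \<noteq> Num 0 \<longleftrightarrow> i < length ys"
  proof -
   have "enc (drop i ys) = Num 0 \<longleftrightarrow> drop i ys = []" by (cases "drop i ys") auto
   thus ?thesis by (simp add: not_le)
  qed
  ultimately show ?thesis by (auto elim!: run_mono)
 qed
 have c: "run ?c (?v i) (?v (Suc i)) (t + 180)" if "i < length ys" for i
 proof -
  have d: "drop i ys = ys ! i # drop (Suc i) ys" using that by (simp add: Cons_nth_drop_Suc)
  have "run ?c (?v i) (?v (Suc i)) (1 + (1 + (2 + 1 + (2 + (2 + 1)) + 25) + 25 + t + (2 + (2 + 2)) + 25) + 25)"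
   unfolding d enc_prod_def
   by (simp only: fst_conv snd_conv enc_list.simps, rule run_fork[OF run_fst run_fork[OF run_seq[OF
     run_fork[OF run_fst run_fork[OF run_seq[OF run_snd run_fst] run_seq[OF run_snd run_seq[OF run_snd run_fst]]]]
     assms[OF that, unfolded enc_prod_def fst_conv snd_conv]] run_seq[OF run_snd run_seq[OF run_snd run_snd]]]])
  thus ?thesis by (rule run_mono) simp
 qed
 have "run (while_com ?b ?c) (?v 0) (?v (length ys)) ((length ys + 1) * (2 * (t + 180) + 12))"
 proof (rule run_while)
  show "run ?b (?v i) (Num 1) (t + 180)" if "i < length ys" for i
   using b[of i] that by simp
  show "run ?b (?v (length ys)) (Num 0) (t + 180)"
   using b[of "length ys"] by simp
 qed (rule c)
 moreover have "run (Seq ?s ?f) (?v (length ys)) (enc (foldl F a ys)) (2 + 1)"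
  unfolding enc_prod_def by (simp only: fst_conv snd_conv take_all order_refl) (rule run_seq[OF run_snd run_fst])
 ultimately have "run (fold_com c) (?v 0) (enc (foldl F a ys)) ((length ys + 1) * (2 * (t + 180) + 12) + (2 + 1))"
  unfolding fold_com_def Let_def by (rule run_seq)
 thus ?thesis by simp (erule run_mono, simp add: algebra_simps)
qed

text \<open>Iterating a polynomial step need not be polynomial, since the accumulator could double
  in every round. Hence the measure of every intermediate state has to be bounded in advance, with
  one exponent \<open>d\<close> for all rounds.\<close>

lemma pcomp_foldl:
 assumes F: "pcomp E \<nu> (\<lambda>z. F (fst z) (fst (snd z)) (snd (snd z)))"
  and id: "pcomp D \<mu> (\<lambda>x. x)" and a: "pcomp D \<mu> a" and ys: "pcomp D \<mu> ys"
  and E: "\<And>x j. x \<in> D \<Longrightarrow> j < length (ys x) \<Longrightarrow> (x, foldl (F x) (a x) (take j (ys x)), ys x ! j) \<in> E"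
  and \<nu>: "\<And>x j. x \<in> D \<Longrightarrow> j < length (ys x) \<Longrightarrow> \<nu> (x, foldl (F x) (a x) (take j (ys x)), ys x ! j) \<le> (\<mu> x + 2) ^ d"
  and sz: "poly_bd D \<mu> (\<lambda>x. sz (foldl (F x) (a x) (ys x)))"
 shows "pcomp D \<mu> (\<lambda>x. foldl (F x) (a x) (ys x))"
proof -
 from F obtain c t where c: "poly_bd E \<nu> t"
  "\<And>z. z \<in> E \<Longrightarrow> run c (enc z) (enc (F (fst z) (fst (snd z)) (snd (snd z)))) (t z)" unfolding pcomp_def by blast
 from c(1) obtain e where e: "\<And>z. z \<in> E \<Longrightarrow> t z \<le> (\<nu> z + 2) ^ e" unfolding poly_bd_def by blast
 let ?t = "\<lambda>x. ((\<mu> x + 2) ^ d + 2) ^ e"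
 have "pcomp D \<mu> (\<lambda>x. (x, a x, ys x))" by (intro pcomp_Pair id a ys)
 then obtain i u where i: "poly_bd D \<mu> u" "\<And>x. x \<in> D \<Longrightarrow> run i (enc x) (enc (x, a x, ys x)) (u x)"
  unfolding pcomp_def by blast
 show ?thesis
 proof (rule pcompI[OF sz])
  show "poly_bd D \<mu> (\<lambda>x. u x + (sz (ys x) + 1) * (2 * ?t x + 400))"
   by (intro poly_bd_intros i pcomp_size[OF ys])
  fix x assume x: "x \<in> D"
  have "run (fold_com c) (enc (x, a x, ys x)) (enc (foldl (F x) (a x) (ys x))) ((length (ys x) + 1) * (2 * ?t x + 400))"
  proof (rule run_foldl)
   fix j assume j: "j < length (ys x)"
   let ?z = "(x, foldl (F x) (a x) (take j (ys x)), ys x ! j)"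
   have "t ?z \<le> (\<nu> ?z + 2) ^ e" by (rule e[OF E[OF x j]])
   also have "\<dots> \<le> ?t x" using \<nu>[OF x j] by (intro power_mono) auto
   finally have "run c (enc ?z) (enc (F x (foldl (F x) (a x) (take j (ys x))) (ys x ! j))) (?t x)"
    using c(2)[OF E[OF x j]] by (auto elim: run_mono)
   thus "run c (enc ?z) (enc (foldl (F x) (a x) (take (Suc j) (ys x)))) (?t x)"
    using j by (simp add: take_Suc_conv_app_nth)
  qed
  from run_seq[OF i(2)[OF x] this]
  show "run (Seq i (fold_com c)) (enc x) (enc (foldl (F x) (a x) (ys x))) (u x + (sz (ys x) + 1) * (2 * ?t x + 400))"
   by (rule run_mono) (simp add: less_imp_le[OF length_less_sz])
 qed
qed

section \<open>List operations in polynomial time\<close>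

lemma pc_id: "pc (\<lambda>x. x)"
 by (rule pcomp_id) (rule poly_bd_measure)

lemma pcomp_app2:
 "pc (\<lambda>z. g (fst z) (snd z)) \<Longrightarrow> pcomp D \<mu> a \<Longrightarrow> pcomp D \<mu> b \<Longrightarrow> pcomp D \<mu> (\<lambda>x. g (a x) (b x))"
 using pcomp_app[of "\<lambda>z. g (fst z) (snd z)", OF _ pcomp_Pair[of D \<mu> a b]] by simp

lemma pcomp_app3:
 "pc (\<lambda>z. g (fst z) (fst (snd z)) (snd (snd z))) \<Longrightarrow> pcomp D \<mu> a \<Longrightarrow> pcomp D \<mu> b \<Longrightarrow> pcomp D \<mu> c \<Longrightarrow>
  pcomp D \<mu> (\<lambda>x. g (a x) (b x) (c x))"
 using pcomp_app2[of "\<lambda>x y. g x (fst y) (snd y)", OF _ _ pcomp_Pair[of D \<mu> b c]] by simp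

lemma pcomp_app4:
 "pc (\<lambda>z. g (fst z) (fst (snd z)) (fst (snd (snd z))) (snd (snd (snd z)))) \<Longrightarrow>
  pcomp D \<mu> a \<Longrightarrow> pcomp D \<mu> b \<Longrightarrow> pcomp D \<mu> c \<Longrightarrow> pcomp D \<mu> d \<Longrightarrow>
  pcomp D \<mu> (\<lambda>x. g (a x) (b x) (c x) (d x))"
 using pcomp_app3[of "\<lambda>x y z. g x y (fst z) (snd z)", OF _ _ _ pcomp_Pair[of D \<mu> c d]] by simp

lemma sz_append: "Suc (sz (xs @ ys)) = sz xs + sz ys"
 by (induction xs) auto

lemma sz_rev: "sz (rev xs) = sz xs"
proof (induction xs)
 case (Cons x xs)
 thus ?case using sz_append[of "rev xs" "[x]"] by simp
qed simp

lemma sz_take: "sz (take j xs) \<le> sz xs"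
 using sz_append[of "take j xs" "drop j xs"] sz_pos[of "drop j xs"] by (simp del: sz_pos)

lemma sz_filter: "sz (filter P xs) \<le> sz xs"
 by (induction xs) auto

lemma sz_le_length: "(\<And>y. y \<in> set ys \<Longrightarrow> sz y \<le> B) \<Longrightarrow> sz ys \<le> Suc (length ys * Suc B)"
proof (induction ys)
 case (Cons y ys)
 have "sz y + sz ys \<le> B + Suc (length ys * Suc B)"
  by (intro add_mono Cons.IH Cons.prems) (simp_all add: Cons.prems)
 thus ?case by simp
qed simp

lemma pcomp_foldl':
 assumes F: "pc (\<lambda>z. F (fst z) (fst (snd z)) (snd (snd z)))"
  and id: "pcomp D \<mu> (\<lambda>x. x)" and a: "pcomp D \<mu> a" and ys: "pcomp D \<mu> ys"
  and B: "\<And>x j. x \<in> D \<Longrightarrow> sz (foldl (F x) (a x) (take j (ys x))) \<le> B x" "poly_bd D \<mu> B"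
 shows "pcomp D \<mu> (\<lambda>x. foldl (F x) (a x) (ys x))"
proof -
 have "poly_bd D \<mu> (\<lambda>x. Suc (Suc (sz x + (B x + sz (ys x)))))"
  using poly_bd_add[OF poly_bd_add[OF pcomp_size[OF id] poly_bd_add[OF B(2) pcomp_size[OF ys]]] poly_bd_const[of _ _ 2]]
  by simp
 then obtain d where d: "\<And>x. x \<in> D \<Longrightarrow> Suc (Suc (sz x + (B x + sz (ys x)))) \<le> (\<mu> x + 2) ^ d"
  unfolding poly_bd_def by blast
 show ?thesis
 proof (rule pcomp_foldl[where d = d, OF F id a ys])
  show "poly_bd D \<mu> (\<lambda>x. sz (foldl (F x) (a x) (ys x)))"
   by (rule poly_bd_mono[OF B(2)]) (metis B(1) order_refl take_all)
  fix x j assume x: "x \<in> D" and j: "j < length (ys x)"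
  have "sz (ys x ! j) < sz (ys x)" using j by (intro sz_mem nth_mem)
  hence "sz (x, foldl (F x) (a x) (take j (ys x)), ys x ! j) \<le> Suc (Suc (sz x + (B x + sz (ys x))))"
   using B(1)[OF x, of j] by simp
  also note d[OF x]
  finally show "sz (x, foldl (F x) (a x) (take j (ys x)), ys x ! j) \<le> (\<mu> x + 2) ^ d" .
 qed simp
qed

lemma pc_foldl:
 assumes "pc (\<lambda>z. F (fst z) (fst (snd z)) (snd (snd z)))" "pc a" "pc ys"
  and "\<And>x j. sz (foldl (F x) (a x) (take j (ys x))) \<le> B x" "poly_bd UNIV sz B"
 shows "pc (\<lambda>x. foldl (F x) (a x) (ys x))"
 by (rule pcomp_foldl'[OF assms(1) pc_id assms(2,3,4,5)])

lemmas pc_basic = pc_id pcomp_fst pcomp_snd pcomp_Pair pcomp_Cons pcomp_plus pcomp_minus pcomp_of_bool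
 pcomp_Not pcomp_conj pcomp_disj pcomp_less pcomp_le pcomp_eq

lemma pc_If: "pc b \<Longrightarrow> pc f \<Longrightarrow> pc g \<Longrightarrow> pc (\<lambda>x. if b x then f x else g x)"
 by (rule pcomp_If) (auto elim: pcomp_subset)

lemma pc_imp: "pc a \<Longrightarrow> pc b \<Longrightarrow> pc (\<lambda>x. a x \<longrightarrow> b x)"
 by (rule pcomp_cong[OF pcomp_disj[OF pcomp_Not]]) auto

lemma pc_rev:
 assumes "pcomp D \<mu> ys"
 shows "pcomp D \<mu> (\<lambda>x. rev (ys x))"
proof -
 have "foldl (\<lambda>a y. y # a) [] ys = rev ys" for ys :: "'b list"
  by (induction ys rule: rev_induct) auto
 moreover have "pc (\<lambda>ys :: 'b list. foldl (\<lambda>a y. y # a) [] ys)"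
 proof (rule pc_foldl)
  show "sz (foldl (\<lambda>a y. y # a) [] (take j ys)) \<le> sz ys" for j and ys :: "'b list"
   by (simp add: calculation sz_rev sz_take)
 qed (intro pc_basic pcomp_const poly_bd_measure)+
 ultimately have "pc (rev :: 'b list \<Rightarrow> _)" by simp
 thus ?thesis using assms by (rule pcomp_app)
qed

lemma pcomp_map:
 assumes f: "pcomp E \<nu> (\<lambda>z. f (fst z) (snd z))"
  and id: "pcomp D \<mu> (\<lambda>x. x)" and ys: "pcomp D \<mu> ys"
  and E: "\<And>x y. x \<in> D \<Longrightarrow> y \<in> set (ys x) \<Longrightarrow> (x, y) \<in> E"
  and \<nu>: "\<And>x y. x \<in> D \<Longrightarrow> y \<in> set (ys x) \<Longrightarrow> \<nu> (x, y) \<le> N x" "poly_bd D \<mu> N"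
 shows "pcomp D \<mu> (\<lambda>x. map (f x) (ys x))"
proof -
 from pcomp_size[OF f] obtain e where e: "\<And>z. z \<in> E \<Longrightarrow> sz (f (fst z) (snd z)) \<le> (\<nu> z + 2) ^ e"
  unfolding poly_bd_def by blast
 let ?F = "\<lambda>x a y. f x y # a"
 have fold: "foldl (?F x) [] zs = rev (map (f x) zs)" for x zs
  by (induction zs rule: rev_induct) auto
 define B where "B x = Suc (sz (ys x) * Suc ((N x + 2) ^ e))" for x
 have B: "poly_bd D \<mu> B"
 proof -
  have "poly_bd D \<mu> (\<lambda>x. 1 + sz (ys x) * (1 + (N x + 2) ^ e))"
   by (intro poly_bd_intros \<nu>(2) pcomp_size[OF ys])
  thus ?thesis unfolding B_def by simp
 qed
 have le: "sz (foldl (?F x) [] (take j (ys x))) \<le> B x" if x: "x \<in> D" for x j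
 proof -
  have 1: "sz (f x y) \<le> (N x + 2) ^ e" if "y \<in> set (ys x)" for y
  proof -
   have "sz (f x y) \<le> (\<nu> (x, y) + 2) ^ e" using e[OF E[OF x that]] by simp
   also have "\<dots> \<le> (N x + 2) ^ e" using \<nu>(1)[OF x that] by (intro power_mono) auto
   finally show ?thesis .
  qed
  have "sz (foldl (?F x) [] (take j (ys x))) = sz (take j (map (f x) (ys x)))"
   by (simp add: fold sz_rev take_map)
  also have "\<dots> \<le> sz (map (f x) (ys x))" by (rule sz_take)
  also have "\<dots> \<le> Suc (length (map (f x) (ys x)) * Suc ((N x + 2) ^ e))"
   by (rule sz_le_length) (use 1 in auto)
  also have "\<dots> \<le> B x" unfolding B_def using less_imp_le[OF length_less_sz[of "ys x"]]
   by (simp only: length_map Suc_le_mono) (rule mult_right_mono, auto)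
  finally show ?thesis .
 qed
 \<comment> \<open>The step of the fold also carries the accumulator, which \<open>\<nu>\<close>
   does not count.\<close>
 let ?\<nu> = "\<lambda>z. \<nu> (fst z, snd (snd z)) + sz z" and ?E = "{z. (fst z, snd (snd z)) \<in> E}"
 have sz: "poly_bd ?E ?\<nu> sz" by (rule poly_bd_mono[OF poly_bd_measure]) simp
 have "pcomp ?E ?\<nu> (\<lambda>z. f (fst (fst z, snd (snd z))) (snd (fst z, snd (snd z))))"
  by (rule pcomp_comp[OF f])
   (auto intro!: pcomp_Pair pcomp_fst pcomp_snd pcomp_id sz poly_bd_mono[OF poly_bd_measure])
 hence F: "pcomp ?E ?\<nu> (\<lambda>z. ?F (fst z) (fst (snd z)) (snd (snd z)))"
  by (intro pcomp_Cons pcomp_fst pcomp_snd pcomp_id sz) simp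
 have "poly_bd D \<mu> (\<lambda>x. Suc (Suc (N x + (sz x + (B x + sz (ys x))))))"
  using poly_bd_add[OF poly_bd_add[OF \<nu>(2) poly_bd_add[OF pcomp_size[OF id] poly_bd_add[OF B pcomp_size[OF ys]]]]
    poly_bd_const[of _ _ 2]]
  by simp
 then obtain d where d: "\<And>x. x \<in> D \<Longrightarrow> Suc (Suc (N x + (sz x + (B x + sz (ys x))))) \<le> (\<mu> x + 2) ^ d"
  unfolding poly_bd_def by blast
 have "pcomp D \<mu> (\<lambda>x. foldl (?F x) [] (ys x))"
 proof (rule pcomp_foldl[where d = d, OF F id pcomp_const ys])
  show "poly_bd D \<mu> (\<lambda>x. sz (foldl (?F x) [] (ys x)))"
   by (rule poly_bd_mono[OF B]) (metis le order_refl take_all)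
  fix x j assume x: "x \<in> D" and j: "j < length (ys x)"
  thus "(x, foldl (?F x) [] (take j (ys x)), ys x ! j) \<in> ?E" using E by simp
  have "sz (ys x ! j) < sz (ys x)" "\<nu> (x, ys x ! j) \<le> N x" using j x \<nu>(1) by (auto intro: sz_mem)
  hence "?\<nu> (x, foldl (?F x) [] (take j (ys x)), ys x ! j) \<le> Suc (Suc (N x + (sz x + (B x + sz (ys x)))))"
   using le[OF x, of j] by simp
  also note d[OF x]
  finally show "?\<nu> (x, foldl (?F x) [] (take j (ys x)), ys x ! j) \<le> (\<mu> x + 2) ^ d" .
 qed
 from pc_rev[OF this] show ?thesis by (simp add: fold)
qed

lemma pc_map:
 assumes "pc (\<lambda>z. f (fst z) (snd z))" "pc ys"
 shows "pc (\<lambda>x. map (f x) (ys x))"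
proof (rule pcomp_map[OF assms(1) pc_id assms(2)])
 show "sz (x, y) \<le> Suc (sz x + sz (ys x))" if "y \<in> set (ys x)" for x y
  using sz_mem[OF that] by simp
 show "poly_bd UNIV sz (\<lambda>x. Suc (sz x + sz (ys x)))"
  using poly_bd_add[OF poly_bd_add[OF poly_bd_measure pcomp_size[OF assms(2)]] poly_bd_const[of _ _ 1]] by simp
qed simp

lemma pc_filter:
 assumes "pc (\<lambda>z. P (fst z) (snd z))" "pc ys"
 shows "pc (\<lambda>x. filter (P x) (ys x))"
proof -
 have fold: "foldl (\<lambda>a y. if P x y then y # a else a) [] zs = rev (filter (P x) zs)" for x zs
  by (induction zs rule: rev_induct) auto
 have "pc (\<lambda>z. P (fst (fst z, snd (snd z))) (snd (fst z, snd (snd z))))"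
  by (rule pcomp_app[OF assms(1)]) (intro pc_basic)
 hence P: "pc (\<lambda>z. P (fst z) (snd (snd z)))" by simp
 have "pc (\<lambda>x. foldl (\<lambda>a y. if P x y then y # a else a) [] (ys x))"
 proof (rule pc_foldl)
  show "sz (foldl (\<lambda>a y. if P x y then y # a else a) [] (take j (ys x))) \<le> sz (ys x)" for x j
   unfolding fold sz_rev using sz_filter[of "P x" "take j (ys x)"] sz_take[of j "ys x"] by linarith
  show "pc (\<lambda>z. if P (fst z) (snd (snd z)) then snd (snd z) # fst (snd z) else fst (snd z))"
   by (intro pc_If P pc_basic)
 qed (intro assms pcomp_const pcomp_size)+
 from pc_rev[OF this] show ?thesis by (simp add: fold)
qed

lemma pc_Bex:
 assumes "pc (\<lambda>z. P (fst z) (snd z))" "pc ys"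
 shows "pc (\<lambda>x. \<exists>y\<in>set (ys x). P x y)"
proof -
 have fold: "foldl (\<lambda>b y. b \<or> P x y) False zs \<longleftrightarrow> (\<exists>y\<in>set zs. P x y)" for x zs
  by (induction zs rule: rev_induct) auto
 have "pc (\<lambda>z. P (fst (fst z, snd (snd z))) (snd (fst z, snd (snd z))))"
  by (rule pcomp_app[OF assms(1)]) (intro pc_basic)
 hence P: "pc (\<lambda>z. P (fst z) (snd (snd z)))" by simp
 have "pc (\<lambda>x. foldl (\<lambda>b y. b \<or> P x y) False (ys x))"
 proof (rule pc_foldl)
  show "sz (foldl (\<lambda>b y. b \<or> P x y) False (take j (ys x))) \<le> 2" for x j by simp
  show "pc (\<lambda>z. fst (snd z) \<or> P (fst z) (snd (snd z)))"
   by (intro P pc_basic)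
 qed (intro assms pcomp_const poly_bd_const)+
 thus ?thesis by (simp add: fold)
qed

lemma pc_Ball:
 assumes "pc (\<lambda>z. P (fst z) (snd z))" "pc ys"
 shows "pc (\<lambda>x. \<forall>y\<in>set (ys x). P x y)"
 using pcomp_Not[OF pc_Bex[OF pcomp_Not[OF assms(1)] assms(2)]] by simp

lemma pc_mem: "pc a \<Longrightarrow> pc ys \<Longrightarrow> pc (\<lambda>x. (a x :: nat) \<in> set (ys x))"
 using pc_Bex[of "\<lambda>x y. a x = y" ys] pcomp_eq[OF pcomp_app[OF _ pc_fst'] pc_snd', of a] by simp

lemma pc_append:
 assumes "pcomp D \<mu> f" "pcomp D \<mu> g"
 shows "pcomp D \<mu> (\<lambda>x. f x @ g x)"
proof -
 have fold: "foldl (\<lambda>a y. y # a) zs ys = rev ys @ zs" for ys zs :: "'b list"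
  by (induction ys rule: rev_induct) auto
 have "pc (\<lambda>z :: 'b list \<times> 'b list. foldl (\<lambda>a y. y # a) (snd z) (rev (fst z)))"
 proof (rule pc_foldl)
  show "sz (foldl (\<lambda>a y. y # a) (snd z) (take j (rev (fst z)))) \<le> sz z" for z :: "'b list \<times> 'b list" and j
   using sz_append[of "rev (take j (rev (fst z)))" "snd z"] sz_take[of j "rev (fst z)"]
   by (cases z) (simp add: fold sz_rev)
 qed (intro pc_rev pc_basic poly_bd_measure)+
 hence "pc (\<lambda>z :: 'b list \<times> 'b list. fst z @ snd z)" by (simp add: fold)
 thus ?thesis using assms by (rule pcomp_app2)
qed

lemma pc_concat:
 assumes "pcomp D \<mu> f"
 shows "pcomp D \<mu> (\<lambda>x. concat (f x))"
proof -
 have fold: "foldl (@) [] yss = concat yss" for yss :: "'b list list"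
  by (induction yss rule: rev_induct) auto
 have sz: "sz (concat yss) \<le> sz yss" for yss :: "'b list list"
 proof (induction yss)
  case (Cons ys yss)
  thus ?case using sz_append[of ys "concat yss"] by simp
 qed simp
 have "pc (\<lambda>yss :: 'b list list. foldl (@) [] yss)"
 proof (rule pc_foldl)
  show "sz (foldl (@) [] (take j yss)) \<le> sz yss" for yss :: "'b list list" and j
   unfolding fold using sz[of "take j yss"] sz_take[of j yss] by linarith
 qed (intro pc_append pc_basic pcomp_const poly_bd_measure)+
 hence "pc (concat :: 'b list list \<Rightarrow> _)" by (simp add: fold)
 thus ?thesis using assms by (rule pcomp_app)
qed

lemma pc_length:
 assumes "pcomp D \<mu> f"
 shows "pcomp D \<mu> (\<lambda>x. length (f x))"
proof -
 have fold: "foldl (\<lambda>a y. a + 1) 0 ys = length ys" for ys :: "'b list"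
  by (induction ys rule: rev_induct) auto
 have fold': "foldl (\<lambda>a y. a + 1) 0 = (length :: 'b list \<Rightarrow> nat)" using fold by (rule ext)
 have "pc (\<lambda>ys :: 'b list. foldl (\<lambda>a y. a + 1) (0::nat) ys)"
 proof (rule pc_foldl)
  show "sz (foldl (\<lambda>a y. a + 1) (0::nat) (take j ys)) \<le> sz ys" for ys :: "'b list" and j
   unfolding fold using length_less_sz[of ys] by simp
 qed (intro pc_basic pcomp_const poly_bd_measure)+
 hence "pc (length :: 'b list \<Rightarrow> _)" unfolding fold' .
 thus ?thesis using assms by (rule pcomp_app)
qed

text \<open>A fold needs a list to run along, so this first list comes from a loop. Counting down
  makes consing produce the increasing order.\<close>

lemma pc_upt:
 assumes "pcomp D \<mu> f"
 shows "pcomp D \<mu> (\<lambda>x. [0..<f x])"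
proof -
 have "pc (\<lambda>z :: nat \<times> nat list. (fst z - 1, (fst z - 1) # snd z))"
  by (intro pc_basic pcomp_const)
 then obtain c t where c: "poly_bd UNIV sz t" "\<And>z :: nat \<times> nat list. run c (enc z) (enc (fst z - 1, (fst z - 1) # snd z)) (t z)"
  unfolding pcomp_def by blast
 have "pc (\<lambda>z :: nat \<times> nat list. fst z \<noteq> 0)"
  by (intro pc_basic pcomp_nonzero)
 then obtain b s where b: "poly_bd UNIV sz s" "\<And>z :: nat \<times> nat list. run b (enc z) (enc (fst z \<noteq> 0)) (s z)"
  unfolding pcomp_def by blast
 have szu: "sz ([m..<n]) \<le> Suc (n * Suc n)" for m n
 proof -
  have "sz ([m..<n]) \<le> Suc (length [m..<n] * Suc n)" by (rule sz_le_length) auto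
  also have "\<dots> \<le> Suc (n * Suc n)" by (simp only: Suc_le_mono length_upt) (rule mult_right_mono, auto)
  finally show ?thesis .
 qed
 have "poly_bd UNIV sz (\<lambda>z. t z + s z)" using c(1) b(1) by (rule poly_bd_add)
 then obtain e where e: "\<And>z. t z + s z \<le> (sz z + 2) ^ e" unfolding poly_bd_def by blast
 define T where "T n = (Suc (Suc n + Suc (n * Suc n)) + 2) ^ e" for n
 have T: "poly_bd UNIV sz T"
 proof -
  have "poly_bd UNIV sz (\<lambda>n::nat. (1 + (sz n + (1 + (sz n * (1 + sz n)))) + 2) ^ e)"
   by (intro poly_bd_intros)
  thus ?thesis by (rule poly_bd_mono) (auto simp: T_def intro!: power_mono add_mono mult_mono)
 qed
 have "pc (\<lambda>n::nat. (n, [] :: nat list))" by (intro pc_basic pcomp_const)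
 then obtain i u where i: "poly_bd UNIV sz u" "\<And>n :: nat. run i (enc n) (enc (n, [] :: nat list)) (u n)"
  unfolding pcomp_def by blast
 have "pc (\<lambda>n::nat. [0..<n])"
 proof (rule pcompI)
  have "poly_bd UNIV sz (\<lambda>n::nat. 1 + (sz n * (1 + sz n)))" by (intro poly_bd_intros)
  thus "poly_bd UNIV sz (\<lambda>n::nat. sz [0..<n])"
   by (rule poly_bd_mono) (use szu in \<open>auto intro!: order.trans[OF szu] mult_mono\<close>)
  show "poly_bd UNIV sz (\<lambda>n::nat. u n + (sz n + 1) * (2 * T n + 12) + 2)"
   by (intro poly_bd_intros i T)
  fix n
  let ?v = "\<lambda>i. (n - i, [n - i..<n])"
  have ts: "t (?v i) \<le> T n" "s (?v i) \<le> T n" if "i \<le> n" for i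
  proof -
   have "t (?v i) + s (?v i) \<le> (sz (?v i) + 2) ^ e" by (rule e)
   also have "\<dots> \<le> T n" unfolding T_def
    by (intro power_mono add_mono) (use szu[of "n - i" n] in auto)
   finally show "t (?v i) \<le> T n" "s (?v i) \<le> T n" by auto
  qed
  have "run (while_com b c) (enc (?v 0)) (enc (?v n)) ((n + 1) * (2 * T n + 12))"
  proof (rule run_while)
   show "run b (enc (?v i)) (Num 1) (T n)" if "i < n" for i
    using b(2)[of "?v i"] ts[of i] that by (auto simp: enc_bool_def elim: run_mono)
   show "run b (enc (?v n)) (Num 0) (T n)"
    using b(2)[of "?v n"] ts[of n] by (auto simp: enc_bool_def elim: run_mono)
   show "run c (enc (?v i)) (enc (?v (Suc i))) (T n)" if "i < n" for i
   proof -
    have "[n - Suc i..<n] = (n - Suc i) # [n - i..<n]"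
     using that by (subst upt_conv_Cons) (auto simp: Suc_diff_Suc)
    thus ?thesis using c(2)[of "?v i"] ts(1)[of i] that by (auto elim: run_mono)
   qed
  qed
  from run_seq[OF i(2) run_seq[OF this[simplified], of "Seq (Plus 0 0 7) (Load 0 0)" "enc [0..<n]" 2]]
  show "run (Seq i (Seq (while_com b c) (Seq (Plus 0 0 7) (Load 0 0)))) (enc n) (enc [0..<n])
    (u n + (sz n + 1) * (2 * T n + 12) + 2)"
   by (auto simp: enc_prod_def run_snd elim!: run_mono)
 qed
 thus ?thesis using assms by (rule pcomp_app)
qed

lemma pc_case_list:
 assumes "pc xs" "pc f" "pc (\<lambda>z. g (fst z) (fst (snd z)) (snd (snd z)))"
 shows "pc (\<lambda>x. case xs x of [] \<Rightarrow> f x | y # ys \<Rightarrow> g x y ys)"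
proof (rule pcomp_case_list[OF pc_id assms(1) _ assms(3)])
 show "pcomp {x \<in> UNIV. xs x = []} sz f" using assms(2) by (rule pcomp_subset) simp
 have "poly_bd {x \<in> UNIV. xs x \<noteq> []} sz (\<lambda>x. 1 + sz x + sz (xs x))"
  using pcomp_size[OF pcomp_subset[OF assms(1)], of "{x \<in> UNIV. xs x \<noteq> []}"] by (intro poly_bd_intros) auto
 thus "poly_bd {x \<in> UNIV. xs x \<noteq> []} sz (\<lambda>x. sz (x, hd (xs x), tl (xs x)))"
  by (rule poly_bd_mono) (auto simp: neq_Nil_conv)
qed simp

lemma pc_Let: "pc f \<Longrightarrow> pc (\<lambda>z. g (fst z) (snd z)) \<Longrightarrow> pc (\<lambda>x. let y = f x in g x y)"
 unfolding Let_def by (rule pcomp_app2[OF _ pc_id])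

lemmas pc_intros = pc_basic pc_If pc_imp pc_rev pc_map pc_filter pc_mem pc_Bex pc_Ball pc_append pc_concat pc_length
 pc_upt pc_case_list pc_Let pcomp_const

section \<open>The reduction as a functional program\<close>

text \<open>Literals are coded as in the input: \<open>2 * x\<close> and \<open>2 * x + 1\<close> are the two literals of \<open>x\<close>.\<close>

definition add_clause :: "nat list \<Rightarrow> nat list list \<Rightarrow> nat list list" where
 "add_clause C \<Phi> = (if \<exists>D\<in>set \<Phi>. \<forall>l\<in>set D. l \<in> set C then \<Phi>
   else C # filter (\<lambda>D. \<not> (\<forall>l\<in>set C. l \<in> set D)) \<Phi>)"

definition add_clauses :: "nat list list \<Rightarrow> nat list list \<Rightarrow> nat list list" where
 "add_clauses Cs \<Phi> = foldl (\<lambda>\<Phi> C. add_clause C \<Phi>) \<Phi> Cs"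

definition flower :: "nat \<Rightarrow> nat list \<Rightarrow> nat list list \<Rightarrow> nat list list" where
 "flower c h \<Phi> = filter (\<lambda>C. length C = c \<and> (\<forall>l\<in>set h. l \<in> set C)) \<Phi>"

text \<open>A candidate \<open>(c, h, t)\<close> stands for the clauses of size \<open>c\<close>
  that contain the heart \<open>h\<close>, and for the number \<open>t\<close> of them from which
  branching pays. The order matters: \<open>branch\<close> takes the first large flower, so a single
  literal is split off ternary clauses only when no binary degree and no pair of literals has
  reached \<open>d\<close>.\<close>

definition candidates :: "nat \<Rightarrow> nat \<Rightarrow> nat list list \<Rightarrow> (nat \<times> nat list \<times> nat) list" where
 "candidates d e \<Phi> = map (\<lambda>l. (2, [l], d)) (concat \<Phi>) @
   concat (map (\<lambda>l. map (\<lambda>m. (3, [l, m], d)) (filter (\<lambda>m. m \<noteq> l) (concat \<Phi>))) (concat \<Phi>)) @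
   map (\<lambda>l. (3, [l], e)) (concat \<Phi>)"

definition branch :: "nat \<Rightarrow> nat \<Rightarrow> nat list list \<Rightarrow> nat list list list" where
 "branch d e \<Phi> = (case filter (\<lambda>c. snd (snd c) \<le> length (flower (fst c) (fst (snd c)) \<Phi>)) (candidates d e \<Phi>) of
   [] \<Rightarrow> [\<Phi>]
  | c # cs \<Rightarrow> [add_clause (fst (snd c)) \<Phi>,
    add_clauses (map (\<lambda>C. filter (\<lambda>l. l \<notin> set (fst (snd c))) C) (flower (fst c) (fst (snd c)) \<Phi>)) \<Phi>])"

text \<open>The list \<open>rs\<close> serves as a clock. The recursion tree is explored level by
  level; \<open>branch\<close> returns a finished formula unchanged, so additional rounds do no
  harm.\<close>

definition leaves :: "nat \<Rightarrow> nat \<Rightarrow> nat list \<Rightarrow> nat list list list \<Rightarrow> nat list list list" where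
 "leaves d e rs \<Psi> = foldl (\<lambda>\<Psi> _. concat (map (branch d e) \<Psi>)) \<Psi> rs"

text \<open>The state holds the number of literals still to be read, the current clause and the
  finished clauses. At 0 the next number is a length, and an empty clause is finished at
  once.\<close>

definition parse_step :: "nat \<times> nat list \<times> nat list list \<Rightarrow> nat \<Rightarrow> nat \<times> nat list \<times> nat list list" where
 "parse_step s x = (if fst s = 0 then (x, [], if x = 0 then [] # snd (snd s) else snd (snd s))
   else if fst s = 1 then (0, [], (x # fst (snd s)) # snd (snd s))
   else (fst s - 1, x # fst (snd s), snd (snd s)))"

definition parse :: "nat list \<Rightarrow> nat list list" where
 "parse xs = snd (snd (foldl parse_step (0, [], []) xs))"

definition dedup :: "nat list \<Rightarrow> nat list" where
 "dedup xs = foldl (\<lambda>a x. if x \<in> set a then a else x # a) [] xs"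

definition head :: "nat list \<Rightarrow> nat" where "head xs = (case xs of [] \<Rightarrow> 0 | x # ys \<Rightarrow> x)"
definition tail :: "nat list \<Rightarrow> nat list" where "tail xs = (case xs of [] \<Rightarrow> [] | x # ys \<Rightarrow> ys)"

definition initial_cnf :: "nat list \<Rightarrow> nat list list" where
 "initial_cnf xs = add_clauses (map dedup (parse (tail (tail xs)))) []"

text \<open>Counts up to \<open>x\<close>, as addition and subtraction are the only arithmetic of
  the machine.\<close>

definition divmod :: "nat \<Rightarrow> nat \<Rightarrow> nat \<times> nat" where
 "divmod x q = foldl (\<lambda>p _. if snd p + 1 = q then (fst p + 1, 0) else (fst p, snd p + 1)) (0, 0) [0..<x]"

definition half :: "nat \<Rightarrow> nat" where "half l = fst (divmod l 2)"
definition grp :: "nat \<Rightarrow> nat \<Rightarrow> nat" where "grp q l = snd (divmod (half l) q)"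

definition times :: "nat \<Rightarrow> nat \<Rightarrow> nat" where "times m n = foldl (\<lambda>s _. s + m) 0 [0..<n]"

text \<open>
 The pattern graph and a system of paths in it: the vertices, the edges (in both directions), the
 triples \<open>(g, w, v)\<close> such that \<open>v\<close> is on the path from the home of group \<open>g\<close> to \<open>w\<close>,
 and the number of groups. The variable \<open>x\<close> belongs to the group \<open>x mod q\<close>.
\<close>

type_synonym pattern = "(nat list \<times> (nat \<times> nat) list) \<times> (nat \<times> nat \<times> nat) list \<times> nat"

definition has_path :: "pattern \<Rightarrow> nat \<Rightarrow> nat \<Rightarrow> bool" where
 "has_path P g w \<longleftrightarrow> (\<exists>z\<in>set (fst (snd P)). fst z = g \<and> fst (snd z) = w)"

definition on_path :: "pattern \<Rightarrow> nat \<Rightarrow> nat \<Rightarrow> nat \<Rightarrow> bool" where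
 "on_path P g w v \<longleftrightarrow> (\<exists>z\<in>set (fst (snd P)). fst z = g \<and> fst (snd z) = w \<and> snd (snd z) = v)"

definition cnt :: "nat \<Rightarrow> (nat list \<times> nat) list \<Rightarrow> nat \<Rightarrow> nat \<Rightarrow> nat" where
 "cnt q asg g w = length (filter (\<lambda>a. snd a = w \<and> (\<exists>l\<in>set (fst a). grp q l = g)) asg)"

definition place_ok :: "pattern \<Rightarrow> nat \<Rightarrow> (nat list \<times> nat) list \<times> nat list \<Rightarrow> nat \<Rightarrow> bool" where
 "place_ok P cap s w \<longleftrightarrow> (\<forall>l\<in>set (snd s). has_path P (grp (snd (snd P)) l) w \<and>
   cnt (snd (snd P)) (fst s) (grp (snd (snd P)) l) w < cap)"

definition place :: "pattern \<Rightarrow> nat \<Rightarrow> (nat list \<times> nat) list \<times> nat list \<Rightarrow> nat" where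
 "place P cap s = head (filter (place_ok P cap s) (fst (fst P)))"

definition assign :: "pattern \<Rightarrow> nat \<Rightarrow> nat list list \<Rightarrow> (nat list \<times> nat) list" where
 "assign P cap \<Phi> = foldl (\<lambda>asg C. (C, place P cap (asg, C)) # asg) [] \<Phi>"

text \<open>A variable travels only to the places of its own clauses. Carrying whole groups of about
  N / k variables along every path would make the bags larger by a factor of order k.\<close>

definition bag :: "pattern \<Rightarrow> nat \<Rightarrow> (nat list \<times> nat) list \<Rightarrow> nat \<Rightarrow> nat list" where
 "bag P N asg v = filter (\<lambda>x. \<exists>a\<in>set asg. \<exists>l\<in>set (fst a).
   half l = x \<and> on_path P (grp (snd (snd P)) l) (snd a) v) [0..<N]"

text \<open>An assignment is the list of its true literals. So \<open>valid\<close> is a membership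
  test, and two assignments are consistent if they contain no complementary literals.\<close>

definition assignments :: "nat list \<Rightarrow> nat list list" where
 "assignments S = foldl (\<lambda>A x. map (\<lambda>\<alpha>. (x + x) # \<alpha>) A @ map (\<lambda>\<alpha>. (x + x + 1) # \<alpha>) A) [[]] S"

definition valid :: "(nat list \<times> nat) list \<Rightarrow> nat \<Rightarrow> nat list \<Rightarrow> bool" where
 "valid asg v \<alpha> \<longleftrightarrow> (\<forall>a\<in>set asg. snd a = v \<longrightarrow> (\<exists>l\<in>set (fst a). l \<in> set \<alpha>))"

definition options :: "pattern \<Rightarrow> nat \<Rightarrow> (nat list \<times> nat) list \<Rightarrow> nat \<Rightarrow> (nat \<times> nat list) list" where
 "options P N asg v = map (\<lambda>\<alpha>. (v, \<alpha>)) (filter (valid asg v) (assignments (bag P N asg v)))"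

definition positions :: "pattern \<Rightarrow> nat \<Rightarrow> (nat list \<times> nat) list \<Rightarrow> (nat \<times> nat list) list" where
 "positions P N asg = concat (map (options P N asg) (fst (fst P)))"

definition adj :: "(nat \<times> nat) list \<Rightarrow> nat \<times> nat list \<Rightarrow> nat \<times> nat list \<Rightarrow> bool" where
 "adj E y z \<longleftrightarrow> (\<exists>e\<in>set E. fst e = fst y \<and> snd e = fst z) \<and>
   (\<forall>l\<in>set (snd y). \<forall>m\<in>set (snd z). half l = half m \<longrightarrow> l = m)"

definition matrix :: "(nat \<times> nat) list \<Rightarrow> (nat \<times> nat list) list \<Rightarrow> nat list" where
 "matrix E L = length L # concat (map (\<lambda>y. map (\<lambda>z. of_bool (adj E y z)) L) L)"

definition host :: "pattern \<Rightarrow> nat \<Rightarrow> nat \<Rightarrow> nat list list \<Rightarrow> nat list" where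
 "host P N cap \<Phi> = matrix (snd (fst P)) (positions P N (assign P cap \<Phi>))"

text \<open>The parameters of the sparsification, the number of rounds per variable, and two numbers that give the capacity.\<close>

type_synonym params = "(nat \<times> nat) \<times> nat \<times> nat \<times> nat"

text \<open>The potential starts at no more than \<open>12 * d * N\<close> and drops by at least 1
  in every branching. So with \<open>r = 12 * d\<close>, one round more than this leaves nothing to
  branch on.\<close>

definition rounds :: "nat \<Rightarrow> nat \<Rightarrow> nat list" where
 "rounds r N = [0..<times r N + 1]"

text \<open>A multiple of N / k^2, rounded up: a group of about N / k variables meets O(N / k)
  clauses, which are spread over k vertices. The divisor in the parameters will be k * k.\<close>

definition capacity :: "params \<Rightarrow> nat \<Rightarrow> nat" where
 "capacity p N = times (fst (snd (snd p))) (fst (divmod N (snd (snd (snd p)))) + 1)"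

definition input_leaves :: "params \<Rightarrow> nat list \<Rightarrow> nat list list list" where
 "input_leaves p xs = leaves (fst (fst p)) (snd (fst p)) (rounds (fst (snd p)) (head xs)) [initial_cnf xs]"

definition reduction :: "pattern \<Rightarrow> params \<Rightarrow> nat list \<Rightarrow> nat list list" where
 "reduction P p xs = map (host P (head xs) (capacity p (head xs))) (input_leaves p xs)"

subsection \<open>Its complexity\<close>

named_theorems pcs

lemma pc_add_clause [pcs]: "pcomp D \<mu> a \<Longrightarrow> pcomp D \<mu> b \<Longrightarrow> pcomp D \<mu> (\<lambda>x. add_clause (a x) (b x))"
 by (rule pcomp_app2) (unfold add_clause_def, intro pc_intros)

lemma sz_add_clause: "sz (add_clause C \<Phi>) \<le> Suc (sz C + sz \<Phi>)"
 unfolding add_clause_def using sz_filter[of _ \<Phi>] by auto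

lemma sz_foldl_add:
 assumes "\<And>a x. sz (F a x) \<le> Suc (sz a + sz x)"
 shows "sz (foldl F a (take j xs)) \<le> sz a + sz xs"
proof -
 have "sz (foldl F a xs) + 1 \<le> sz a + sz xs" for xs
 proof (induction xs arbitrary: a)
  case (Cons x xs)
  show ?case using Cons[of "F a x"] assms[of a x] by simp
 qed simp
 from this[of "take j xs"] show ?thesis using sz_take[of j xs] by linarith
qed

lemma pc_add_clauses [pcs]:
 assumes "pcomp D \<mu> a" "pcomp D \<mu> b" shows "pcomp D \<mu> (\<lambda>x. add_clauses (a x) (b x))"
proof (rule pcomp_app2[OF _ assms], unfold add_clauses_def, rule pc_foldl)
 show "sz (foldl (\<lambda>\<Phi> C. add_clause C \<Phi>) (snd z) (take j (fst z))) \<le> sz z" for z j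
 proof -
  have "sz (foldl (\<lambda>\<Phi> C. add_clause C \<Phi>) (snd z) (take j (fst z))) \<le> sz (snd z) + sz (fst z)"
   by (rule sz_foldl_add) (metis sz_add_clause add.commute)
  also have "\<dots> \<le> sz z" by (cases z) simp
  finally show ?thesis .
 qed
qed (intro pc_intros pcs poly_bd_measure)+

lemma pc_flower [pcs]: "pcomp D \<mu> a \<Longrightarrow> pcomp D \<mu> b \<Longrightarrow> pcomp D \<mu> c \<Longrightarrow> pcomp D \<mu> (\<lambda>x. flower (a x) (b x) (c x))"
 by (rule pcomp_app3) (unfold flower_def, intro pc_intros)

lemma pc_candidates [pcs]:
 "pcomp D \<mu> a \<Longrightarrow> pcomp D \<mu> b \<Longrightarrow> pcomp D \<mu> c \<Longrightarrow> pcomp D \<mu> (\<lambda>x. candidates (a x) (b x) (c x))"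
 by (rule pcomp_app3) (unfold candidates_def, intro pc_intros)

lemma pc_branch [pcs]:
 "pcomp D \<mu> a \<Longrightarrow> pcomp D \<mu> b \<Longrightarrow> pcomp D \<mu> c \<Longrightarrow> pcomp D \<mu> (\<lambda>x. branch (a x) (b x) (c x))"
 by (rule pcomp_app3) (unfold branch_def, intro pc_intros pcs)

lemma pc_parse [pcs]:
 assumes "pcomp D \<mu> a" shows "pcomp D \<mu> (\<lambda>x. parse (a x))"
proof (rule pcomp_app[OF _ assms])
 define m where "m s = fst s + 2 * sz (fst (snd s)) + sz (snd (snd s))" for s :: "nat \<times> nat list \<times> nat list list"
 have *: "m (parse_step s x) \<le> m s + (3 * Suc x + 3)" for s x
  unfolding parse_step_def m_def by (cases s) auto
 have "m (foldl parse_step s xs) \<le> m s + 3 * sz xs" for s xs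
 proof (induction xs arbitrary: s)
  case (Cons x xs)
  from Cons[of "parse_step s x"] *[of s x] show ?case by simp
 qed simp
 note fold = this
 have **: "sz (foldl parse_step (0, [], []) (take j xs)) \<le> 6 + 3 * sz xs" for j xs
 proof -
  have "sz s \<le> 3 + m s" for s by (cases s) (auto simp: m_def)
  from this[of "foldl parse_step (0, [], []) (take j xs)"] fold[of "(0, [], [])" "take j xs"] sz_take[of j xs]
  show ?thesis by (simp add: m_def)
 qed
 have "pc (\<lambda>xs. foldl parse_step (0, [], []) xs)"
  by (rule pc_foldl[where B = "\<lambda>xs. 6 + 3 * sz xs"], unfold parse_step_def,
    (intro pc_intros poly_bd_intros)+, fold parse_step_def, rule **, intro poly_bd_intros)
 thus "pc parse" unfolding parse_def[abs_def] by (intro pcomp_snd)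
qed

lemma pc_dedup [pcs]:
 assumes "pcomp D \<mu> a" shows "pcomp D \<mu> (\<lambda>x. dedup (a x))"
proof (rule pcomp_app[OF _ assms], unfold dedup_def[abs_def], rule pc_foldl)
 show "sz (foldl (\<lambda>a x. if x \<in> set a then a else x # a) [] (take j xs)) \<le> 1 + sz xs" for xs :: "nat list" and j
  using sz_foldl_add[of "\<lambda>a x. if x \<in> set a then a else x # a" "[]" j xs] by simp
qed (intro pc_intros poly_bd_intros)+

lemma pc_head [pcs]: "pcomp D \<mu> a \<Longrightarrow> pcomp D \<mu> (\<lambda>x. head (a x))"
 by (rule pcomp_app) (unfold head_def[abs_def], intro pc_intros)

lemma pc_tail [pcs]: "pcomp D \<mu> a \<Longrightarrow> pcomp D \<mu> (\<lambda>x. tail (a x))"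
 by (rule pcomp_app) (unfold tail_def[abs_def], intro pc_intros)

lemma pc_initial_cnf [pcs]: "pcomp D \<mu> a \<Longrightarrow> pcomp D \<mu> (\<lambda>x. initial_cnf (a x))"
 by (rule pcomp_app) (unfold initial_cnf_def[abs_def], intro pc_intros pcs)

lemma pc_divmod [pcs]:
 assumes "pcomp D \<mu> a" "pcomp D \<mu> b" shows "pcomp D \<mu> (\<lambda>x. divmod (a x) (b x))"
proof (rule pcomp_app2[OF _ assms], unfold divmod_def, rule pc_foldl)
 let ?F = "\<lambda>z (p :: nat \<times> nat) _. if snd p + 1 = snd z then (fst p + 1, 0) else (fst p, snd p + 1)"
 have *: "fst (foldl (?F z) p xs) + snd (foldl (?F z) p xs) \<le> fst p + snd p + length xs"
  for z :: "nat \<times> nat" and p and xs :: "nat list"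
 proof (induction xs arbitrary: p)
  case (Cons x xs)
  show ?case using Cons[of "?F z p x"] by auto
 qed simp
 have "sz q = fst q + snd q + 3" for q :: "nat \<times> nat" by (cases q) auto
 thus "sz (foldl (?F z) (0, 0) (take j [0..<fst z])) \<le> sz z + 3" for z j
  using *[of z "(0, 0)" "take j [0..<fst z]"] by (simp add: min_le_iff_disj le_SucI)
 show "poly_bd UNIV sz (\<lambda>z :: nat \<times> nat. sz z + 3)" by (intro poly_bd_intros)
qed (intro pc_intros)+

lemma pc_half [pcs]: "pcomp D \<mu> a \<Longrightarrow> pcomp D \<mu> (\<lambda>x. half (a x))"
 unfolding half_def by (intro pc_intros pcs)

lemma pc_grp [pcs]: "pcomp D \<mu> a \<Longrightarrow> pcomp D \<mu> b \<Longrightarrow> pcomp D \<mu> (\<lambda>x. grp (a x) (b x))"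
 unfolding grp_def by (intro pc_intros pcs)

lemma times_eq: "times m n = m * n"
 unfolding times_def by (induction n) auto

lemma pc_times [pcs]:
 assumes "pcomp D \<mu> a" "pcomp D \<mu> b" shows "pcomp D \<mu> (\<lambda>x. times (a x) (b x))"
proof (rule pcomp_app2[OF _ assms], unfold times_def, rule pc_foldl)
 have *: "foldl (\<lambda>s _. s + m) a xs = a + m * length xs" for m a :: nat and xs :: "nat list"
  by (induction xs arbitrary: a) auto
 show "sz (foldl (\<lambda>s _. s + fst z) 0 (take j [0..<snd z])) \<le> sz z * sz z + 1" for z :: "nat \<times> nat" and j
 proof -
  have "fst z * length (take j [0..<snd z]) \<le> sz z * sz z"
   by (intro mult_mono) (cases z; simp)+
  thus ?thesis unfolding * by simp
 qed
 show "poly_bd UNIV sz (\<lambda>z :: nat \<times> nat. sz z * sz z + 1)" by (intro poly_bd_intros)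
qed (intro pc_intros)+

lemma pc_has_path [pcs]: "pcomp D \<mu> a \<Longrightarrow> pcomp D \<mu> b \<Longrightarrow> pcomp D \<mu> c \<Longrightarrow> pcomp D \<mu> (\<lambda>x. has_path (a x) (b x) (c x))"
 by (rule pcomp_app3) (unfold has_path_def, intro pc_intros)

lemma pc_on_path [pcs]: "pcomp D \<mu> a \<Longrightarrow> pcomp D \<mu> b \<Longrightarrow> pcomp D \<mu> c \<Longrightarrow> pcomp D \<mu> d \<Longrightarrow>
  pcomp D \<mu> (\<lambda>x. on_path (a x) (b x) (c x) (d x))"
 by (rule pcomp_app4) (unfold on_path_def, intro pc_intros)

lemma pc_cnt [pcs]: "pcomp D \<mu> a \<Longrightarrow> pcomp D \<mu> b \<Longrightarrow> pcomp D \<mu> c \<Longrightarrow> pcomp D \<mu> d \<Longrightarrow>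
  pcomp D \<mu> (\<lambda>x. cnt (a x) (b x) (c x) (d x))"
 by (rule pcomp_app4) (unfold cnt_def, intro pc_intros pcs)

lemma pc_place_ok [pcs]: "pcomp D \<mu> a \<Longrightarrow> pcomp D \<mu> b \<Longrightarrow> pcomp D \<mu> c \<Longrightarrow> pcomp D \<mu> d \<Longrightarrow>
  pcomp D \<mu> (\<lambda>x. place_ok (a x) (b x) (c x) (d x))"
 by (rule pcomp_app4) (unfold place_ok_def, intro pc_intros pcs)

lemma pc_place [pcs]: "pcomp D \<mu> a \<Longrightarrow> pcomp D \<mu> b \<Longrightarrow> pcomp D \<mu> c \<Longrightarrow> pcomp D \<mu> (\<lambda>x. place (a x) (b x) (c x))"
 by (rule pcomp_app3) (unfold place_def, intro pc_intros pcs)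

lemma place_le: "place P cap s \<le> sz P"
proof -
 have "head xs \<le> sz xs" for xs by (cases xs) (auto simp: head_def)
 from this[of "filter (place_ok P cap s) (fst (fst P))"] sz_filter[of "place_ok P cap s" "fst (fst P)"]
  sz_fst[of P] sz_fst[of "fst P"]
 show ?thesis unfolding place_def by linarith
qed

lemma pc_assign [pcs]:
 assumes "pcomp D \<mu> a" "pcomp D \<mu> b" "pcomp D \<mu> c"
 shows "pcomp D \<mu> (\<lambda>x. assign (a x) (b x) (c x))"
proof (rule pcomp_app3[OF _ assms], unfold assign_def, rule pc_foldl)
 let ?F = "\<lambda>P cap asg C. (C, place P cap (asg, C)) # asg"
 have *: "sz (foldl (?F P cap) asg xs) \<le> sz asg + (sz P + 3) * sz xs" for P cap asg xs
 proof (induction xs arbitrary: asg)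
  case (Cons C xs)
  have "sz C + 3 + sz P \<le> (sz P + 3) * Suc (sz C)" by simp
  thus ?case using Cons[of "?F P cap asg C"] place_le[of P cap "(asg, C)"]
   by (simp add: algebra_simps)
 qed simp
 show "sz (foldl (?F (fst z) (fst (snd z))) [] (take j (snd (snd z)))) \<le> 1 + (sz z + 3) * sz z"
  for z :: "pattern \<times> nat \<times> nat list list" and j
 proof -
  have "sz (foldl (?F (fst z) (fst (snd z))) [] (take j (snd (snd z)))) \<le>
    1 + (sz (fst z) + 3) * sz (take j (snd (snd z)))" using *[of "fst z" "fst (snd z)" "[]"] by simp
  also have "\<dots> \<le> 1 + (sz z + 3) * sz z"
   using sz_take[of j "snd (snd z)"] sz_fst[of z] sz_snd[of z] sz_snd[of "snd z"]
   by (intro add_left_mono mult_mono) linarith+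
  finally show ?thesis .
 qed
 show "poly_bd UNIV sz (\<lambda>z :: pattern \<times> nat \<times> nat list list. 1 + (sz z + 3) * sz z)" by (intro poly_bd_intros)
qed (intro pc_intros pcs)+

lemma pc_bag [pcs]: "pcomp D \<mu> a \<Longrightarrow> pcomp D \<mu> b \<Longrightarrow> pcomp D \<mu> c \<Longrightarrow> pcomp D \<mu> d \<Longrightarrow>
  pcomp D \<mu> (\<lambda>x. bag (a x) (b x) (c x) (d x))"
 by (rule pcomp_app4) (unfold bag_def, intro pc_intros pcs)

lemma pc_filter_valid: "pcomp D \<mu> a \<Longrightarrow> pcomp D \<mu> b \<Longrightarrow> pcomp D \<mu> c \<Longrightarrow>
  pcomp D \<mu> (\<lambda>x. map (\<lambda>\<alpha>. (b x, \<alpha>)) (filter (valid (a x) (b x)) (c x)))"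
 by (rule pcomp_app3[where g = "\<lambda>a b c. map (\<lambda>\<alpha>. (b, \<alpha>)) (filter (valid a b) c)"])
   (unfold valid_def, intro pc_intros pcs)

lemma pc_matrix [pcs]: "pcomp D \<mu> a \<Longrightarrow> pcomp D \<mu> b \<Longrightarrow> pcomp D \<mu> (\<lambda>x. matrix (a x) (b x))"
 by (rule pcomp_app2) (unfold matrix_def adj_def, intro pc_intros pcs)

lemma pc_rounds [pcs]: "pcomp D \<mu> a \<Longrightarrow> pcomp D \<mu> b \<Longrightarrow> pcomp D \<mu> (\<lambda>x. rounds (a x) (b x))"
 by (rule pcomp_app2) (unfold rounds_def, intro pc_intros pcs)

lemma pc_capacity [pcs]: "pcomp D \<mu> a \<Longrightarrow> pcomp D \<mu> b \<Longrightarrow> pcomp D \<mu> (\<lambda>x. capacity (a x) (b x))"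
 by (rule pcomp_app2) (unfold capacity_def, intro pc_intros pcs)

lemma sz_assignments:
 fixes S :: "nat list"
 shows "sz (foldl (\<lambda>A x. map (\<lambda>\<alpha>. (x + x) # \<alpha>) A @ map (\<lambda>\<alpha>. (x + x + 1) # \<alpha>) A) [[]] (take j S))
  \<le> Suc (2 ^ length S * Suc (3 * sz S))"
proof -
 have *: "length (assignments S) = 2 ^ length S \<and> (\<forall>\<alpha>\<in>set (assignments S). sz \<alpha> + 2 \<le> 3 * sz S)"
  for S :: "nat list"
 proof (induction S rule: rev_induct)
  case (snoc x S)
  have "Suc (sz (S @ [x])) = sz S + (x + 3)" using sz_append[of S "[x]"] by simp
  with snoc show ?case by (auto simp: assignments_def; fastforce)
 qed (auto simp: assignments_def)
 have "sz (assignments (take j S)) \<le> Suc (length (assignments (take j S)) * Suc (3 * sz S))"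
 proof (rule sz_le_length)
  fix \<alpha> assume "\<alpha> \<in> set (assignments (take j S))"
  thus "sz \<alpha> \<le> 3 * sz S" using *[of "take j S"] sz_take[of j S] by fastforce
 qed
 also have "\<dots> \<le> Suc (2 ^ length S * Suc (3 * sz S))"
  using * by (simp only: Suc_le_mono) (intro mult_right_mono, auto intro: power_increasing)
 finally show ?thesis by (simp add: assignments_def)
qed

lemma pc_assignments: "pcomp UNIV (\<lambda>S. sz S + 2 ^ length S) assignments"
 unfolding assignments_def[abs_def]
proof (rule pcomp_foldl')
 let ?\<mu> = "\<lambda>S :: nat list. sz S + 2 ^ length S"
 show id: "pcomp UNIV ?\<mu> (\<lambda>S. S)" "pcomp UNIV ?\<mu> (\<lambda>S. S)"
  by (rule pcomp_id, rule poly_bd_mono[OF poly_bd_measure], simp)+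
 have "poly_bd UNIV ?\<mu> (\<lambda>S. 1 + (?\<mu> S * (1 + 3 * ?\<mu> S)))" by (intro poly_bd_intros)
 thus "poly_bd UNIV ?\<mu> (\<lambda>S. Suc (2 ^ length S * Suc (3 * sz S)))"
 proof (rule poly_bd_mono)
  show "Suc (2 ^ length S * Suc (3 * sz S)) \<le> 1 + (?\<mu> S * (1 + 3 * ?\<mu> S))" for S
   using mult_mono[of "2 ^ length S" "?\<mu> S" "Suc (3 * sz S)" "1 + 3 * ?\<mu> S"] by simp
 qed
qed (rule sz_assignments | intro pc_intros)+

text \<open>Counts the candidates for host vertices before validity is checked; their enumeration
  takes time polynomial in this number.\<close>

definition cost :: "pattern \<Rightarrow> nat \<Rightarrow> (nat list \<times> nat) list \<Rightarrow> nat" where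
 "cost P N asg = (\<Sum>v\<leftarrow>fst (fst P). 2 ^ length (bag P N asg v))"

lemma pc_positions: "pcomp UNIV (\<lambda>z. sz z + cost (fst z) (fst (snd z)) (snd (snd z)))
  (\<lambda>z. positions (fst z) (fst (snd z)) (snd (snd z)))" (is "pcomp UNIV ?\<mu> _")
proof -
 let ?\<nu> = "\<lambda>y. sz y + 2 ^ length (bag (fst (fst y)) (fst (snd (fst y))) (snd (snd (fst y))) (snd y))"
 have sz: "poly_bd UNIV ?\<nu> sz" by (rule poly_bd_mono[OF poly_bd_measure]) simp
 have sz': "poly_bd UNIV ?\<mu> sz" by (rule poly_bd_mono[OF poly_bd_measure]) simp
 have bag: "pcomp UNIV ?\<nu> (\<lambda>y. bag (fst (fst y)) (fst (snd (fst y))) (snd (snd (fst y))) (snd y))"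
  by (intro pcs pc_intros(2,3) pcomp_id sz)
 have "pcomp UNIV ?\<nu> (\<lambda>y. assignments (bag (fst (fst y)) (fst (snd (fst y))) (snd (snd (fst y))) (snd y)))"
  by (rule pcomp_comp[OF pc_assignments bag UNIV_I])
   (intro poly_bd_add pcomp_size[OF bag], rule poly_bd_mono[OF poly_bd_measure], simp)
 hence "pcomp UNIV ?\<nu> (\<lambda>y. options (fst (fst y)) (fst (snd (fst y))) (snd (snd (fst y))) (snd y))"
  unfolding options_def by (intro pc_filter_valid pc_intros(2,3) pcomp_id sz)
 hence "pcomp UNIV ?\<mu> (\<lambda>z. map (options (fst z) (fst (snd z)) (snd (snd z))) (fst (fst (fst z))))"
 proof (rule pcomp_map)
  show "?\<nu> (z, v) \<le> 2 * ?\<mu> z + 1" if "v \<in> set (fst (fst (fst z)))" for z v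
  proof -
   have "sz v < sz z" using sz_mem[OF that] sz_fst[of z] sz_fst[of "fst z"] sz_fst[of "fst (fst z)"] by linarith
   moreover have "2 ^ length (bag (fst z) (fst (snd z)) (snd (snd z)) v) \<le> cost (fst z) (fst (snd z)) (snd (snd z))"
    unfolding cost_def using that by (intro member_le_sum_list) auto
   ultimately show ?thesis by simp
  qed
  show "poly_bd UNIV ?\<mu> (\<lambda>z. 2 * ?\<mu> z + 1)" by (intro poly_bd_intros)
  show "pcomp UNIV ?\<mu> (\<lambda>x. x)" "pcomp UNIV ?\<mu> (\<lambda>x. fst (fst (fst x)))"
   by (intro pc_intros(2,3) pcomp_id sz')+
 qed simp
 thus ?thesis unfolding positions_def by (rule pc_concat)
qed

text \<open>Everything that may become exponentially large: the list of formulas after each round,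
  which is the accumulator of the fold in \<open>leaves\<close>, and the assignments enumerated for
  the host of each final formula.\<close>

definition input_measure :: "pattern \<times> params \<times> nat list \<Rightarrow> nat" where
 "input_measure = (\<lambda>(P, p, xs). sz (P, p, xs) +
   (\<Sum>j\<le>length (rounds (fst (snd p)) (head xs)).
    sz (leaves (fst (fst p)) (snd (fst p)) (take j (rounds (fst (snd p)) (head xs))) [initial_cnf xs])) +
   (\<Sum>\<Phi>\<leftarrow>input_leaves p xs. cost P (head xs) (assign P (capacity p (head xs)) \<Phi>)))"

text \<open>The source of the exponent m in \<open>solver_reduction\<close>. As the pattern and the
  parameters are arguments here, it is the same for all graphs H.\<close>

theorem pc_reduction: "pcomp UNIV input_measure (\<lambda>z. reduction (fst z) (fst (snd z)) (snd (snd z)))"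
proof -
 let ?\<mu> = input_measure
 have "sz z \<le> ?\<mu> z" for z unfolding input_measure_def by (cases z) simp
 hence sz: "poly_bd UNIV ?\<mu> sz" by (rule poly_bd_mono[OF poly_bd_measure])
 note id = pcomp_id[OF sz]
 let ?\<Psi> = "\<lambda>z j. leaves (fst (fst (fst (snd z)))) (snd (fst (fst (snd z))))
   (take j (rounds (fst (snd (fst (snd z)))) (head (snd (snd z))))) [initial_cnf (snd (snd z))]"
 have leaves: "pcomp UNIV ?\<mu> (\<lambda>z. input_leaves (fst (snd z)) (snd (snd z)))"
  unfolding input_leaves_def leaves_def
 proof (rule pcomp_foldl'[where B = "\<lambda>z. \<Sum>j\<le>length (rounds (fst (snd (fst (snd z)))) (head (snd (snd z)))). sz (?\<Psi> z j)"])
  fix z :: "pattern \<times> params \<times> nat list" and j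
  let ?n = "length (rounds (fst (snd (fst (snd z)))) (head (snd (snd z))))"
  have "sz (?\<Psi> z j) = sz (?\<Psi> z (min j ?n))" by (cases "j \<le> ?n") (auto simp: min_def)
  also have "\<dots> \<le> (\<Sum>j\<le>?n. sz (?\<Psi> z j))" by (intro member_le_sum) auto
  finally show "sz (foldl (\<lambda>\<Psi> _. concat (map (branch (fst (fst (fst (snd z)))) (snd (fst (fst (snd z))))) \<Psi>))
    [initial_cnf (snd (snd z))] (take j (rounds (fst (snd (fst (snd z)))) (head (snd (snd z)))))) \<le> \<dots>"
   unfolding leaves_def .
 next
  show "poly_bd UNIV ?\<mu> (\<lambda>z. \<Sum>j\<le>length (rounds (fst (snd (fst (snd z)))) (head (snd (snd z)))). sz (?\<Psi> z j))"
   by (rule poly_bd_mono[OF poly_bd_measure]) (auto simp: input_measure_def)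
 qed (intro pc_intros(2,3,5) pcs id pc_intros)+
 let ?\<nu> = "\<lambda>y. sz y + cost (fst (fst y)) (head (snd (snd (fst y))))
  (assign (fst (fst y)) (capacity (fst (snd (fst y))) (head (snd (snd (fst y))))) (snd y))"
 have sz': "poly_bd UNIV ?\<nu> sz" by (rule poly_bd_mono[OF poly_bd_measure]) simp
 note id' = pcomp_id[OF sz']
 have tri: "pcomp UNIV ?\<nu> (\<lambda>y. (fst (fst y), head (snd (snd (fst y))),
   assign (fst (fst y)) (capacity (fst (snd (fst y))) (head (snd (snd (fst y))))) (snd y)))"
  by (intro pcs pc_intros(2-4) id')
 have cost: "poly_bd UNIV ?\<nu> (\<lambda>y. cost (fst (fst y)) (head (snd (snd (fst y))))
  (assign (fst (fst y)) (capacity (fst (snd (fst y))) (head (snd (snd (fst y))))) (snd y)))"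
  by (rule poly_bd_mono[OF poly_bd_measure]) simp
 have "pcomp UNIV ?\<nu> (\<lambda>y. positions (fst (fst y)) (head (snd (snd (fst y))))
   (assign (fst (fst y)) (capacity (fst (snd (fst y))) (head (snd (snd (fst y))))) (snd y)))"
  using pcomp_comp[OF pc_positions tri UNIV_I] poly_bd_add[OF pcomp_size[OF tri] cost] by simp
 hence "pcomp UNIV ?\<nu> (\<lambda>y. host (fst (fst y)) (head (snd (snd (fst y))))
    (capacity (fst (snd (fst y))) (head (snd (snd (fst y))))) (snd y))"
  unfolding host_def by (intro pcs pc_intros(2,3) id')
 thus ?thesis unfolding reduction_def
 proof (rule pcomp_map[OF _ id leaves UNIV_I])
  have "poly_bd UNIV ?\<mu> (\<lambda>z. sz z + sz (input_leaves (fst (snd z)) (snd (snd z))) + ?\<mu> z + 1)"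
   by (intro poly_bd_intros pcomp_size[OF id] pcomp_size[OF leaves])
  thus "poly_bd UNIV ?\<mu> \<dots>" .
  fix z :: "pattern \<times> params \<times> nat list" and \<Phi>
  assume mem: "\<Phi> \<in> set (input_leaves (fst (snd z)) (snd (snd z)))"
  have "cost (fst z) (head (snd (snd z))) (assign (fst z) (capacity (fst (snd z)) (head (snd (snd z)))) \<Phi>) \<le> ?\<mu> z"
  proof -
   obtain P p xs where z: "z = (P, p, xs)" by (cases z)
   have "cost P (head xs) (assign P (capacity p (head xs)) \<Phi>) \<le>
     (\<Sum>\<Phi>\<leftarrow>input_leaves p xs. cost P (head xs) (assign P (capacity p (head xs)) \<Phi>))"
    using mem by (intro member_le_sum_list) (auto simp: z)
   thus ?thesis by (simp add: z input_measure_def del: sz_simps)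
  qed
  thus "?\<nu> (z, \<Phi>) \<le> sz z + sz (input_leaves (fst (snd z)) (snd (snd z))) + ?\<mu> z + 1"
   using sz_mem[OF mem] sz_simps(3)[of z \<Phi>] by (simp del: sz_simps)
 qed
qed

section \<open>Calling a machine on every element of a list\<close>

text \<open>
 The register \<open>r\<close> and the memory cell \<open>a\<close> of the simulated machine are the register \<open>r + 20\<close> and
 the memory cell \<open>3 * a\<close>; the latter counts as \<open>0\<close> unless \<open>3 * a + 1\<close> holds the number of the
 current call (register 11), so that no memory has to be cleared between the calls.
\<close>

primrec translate :: "com \<Rightarrow> com" where
 "translate Skip = Skip"
| "translate (Const r a) = Const (r + 20) a"
| "translate (Plus r s t) = Plus (r + 20) (s + 20) (t + 20)"
| "translate (Minus r s t) = Minus (r + 20) (s + 20) (t + 20)"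
| "translate (Load r s) = Seq (Plus 1 (s + 20) (s + 20)) (Seq (Plus 1 1 (s + 20)) (Seq (Plus 2 1 5) (Seq (Load 2 2)
   (Seq (Minus 8 11 2) (If 8 (Const (r + 20) 0) (Load (r + 20) 1))))))"
| "translate (Store r s) = Seq (Plus 1 (r + 20) (r + 20)) (Seq (Plus 1 1 (r + 20)) (Seq (Store 1 (s + 20))
   (Seq (Plus 2 1 5) (Store 2 11))))"
| "translate (Seq c d) = Seq (translate c) (translate d)"
| "translate (If r c d) = If (r + 20) (translate c) (translate d)"
| "translate (While r c) = While (r + 20) (translate c)"

text \<open>Marks never exceed the current call number \<open>k\<close>. So the truncated difference
  of \<open>k\<close> and the mark, which the translated \<open>Load\<close> computes, vanishes
  exactly for the cells written during this call.\<close>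

definition sim :: "nat \<Rightarrow> state \<Rightarrow> state \<Rightarrow> bool" where
 "sim k s z \<longleftrightarrow> (\<forall>r. fst z (r + 20) = fst s r) \<and> fst z 5 = 1 \<and> fst z 6 = 0 \<and> fst z 7 = 3 \<and> fst z 11 = k \<and>
   (\<forall>a. snd s a = (if snd z (3 * a + 1) = k then snd z (3 * a) else 0)) \<and> (\<forall>a. snd z (3 * a + 1) \<le> k)"

definition frame :: "state \<Rightarrow> state \<Rightarrow> bool" where
 "frame z z' \<longleftrightarrow> fst z' 10 = fst z 10 \<and> fst z' 12 = fst z 12 \<and> (\<forall>a. a mod 3 = 2 \<longrightarrow> snd z' a = snd z a)"

lemma frame_refl: "frame z z" by (simp add: frame_def)

lemma frame_trans: "frame z z' \<Longrightarrow> frame z' z'' \<Longrightarrow> frame z z''" by (simp add: frame_def)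

lemma sim_upd: "sim k (R, M) (R', M') \<Longrightarrow> sim k (R(r := x), M) (R'(r + 20 := x), M')"
 unfolding sim_def by auto

lemma sim_load:
 assumes "sim k (R, M) (R', M')"
 shows "\<exists>u z'. u \<le> 7 \<and> exec (translate (Load r s)) (R', M') u z' \<and> sim k (R(r := M (R s)), M) z' \<and> frame (R', M') z'"
proof -
 define a where "a = R s"
 have R': "R' (s + 20) = a" "R' 5 = 1" "R' 11 = k" "a + a + a = 3 * a" using assms by (auto simp: sim_def a_def)
 have cell: "M a = (if M' (3 * a + 1) = k then M' (3 * a) else 0)" "M' (3 * a + 1) \<le> k"
  using assms by (auto simp: sim_def)
 let ?R = "R'(1 := 3 * a, 2 := M' (3 * a + 1), 8 := k - M' (3 * a + 1))"
 have 1: "exec (Plus 1 (s + 20) (s + 20)) (R', M') 1 (R'(1 := a + a), M')"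
  using exec.Plus[of 1 "s + 20" "s + 20" R' M'] by (simp add: R')
 have 2: "exec (Plus 1 1 (s + 20)) (R'(1 := a + a), M') 1 (R'(1 := 3 * a), M')"
  using exec.Plus[of 1 1 "s + 20" "R'(1 := a + a)" M'] by (simp add: R')
 have 3: "exec (Plus 2 1 5) (R'(1 := 3 * a), M') 1 (R'(1 := 3 * a, 2 := 3 * a + 1), M')"
  using exec.Plus[of 2 1 5 "R'(1 := 3 * a)" M'] by (simp add: R')
 have 4: "exec (Load 2 2) (R'(1 := 3 * a, 2 := 3 * a + 1), M') 1 (R'(1 := 3 * a, 2 := M' (3 * a + 1)), M')"
  using exec.Load[of 2 2 "R'(1 := 3 * a, 2 := 3 * a + 1)" M'] by simp
 have 5: "exec (Minus 8 11 2) (R'(1 := 3 * a, 2 := M' (3 * a + 1)), M') 1 (?R, M')"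
  using exec.Minus[of 8 11 2 "R'(1 := 3 * a, 2 := M' (3 * a + 1))" M'] by (simp add: R')
 have 6: "exec (If 8 (Const (r + 20) 0) (Load (r + 20) 1)) (?R, M') (Suc 1) (?R(r + 20 := M a), M')"
 proof (cases "M' (3 * a + 1) = k")
  case True
  thus ?thesis using exec.Load[of "r + 20" 1 ?R M'] cell by (intro exec.IfFalse) auto
 next
  case False
  thus ?thesis using exec.Const[of "r + 20" 0 ?R M'] cell by (intro exec.IfTrue) auto
 qed
 have "sim k (R, M) (?R, M')" using assms by (auto simp: sim_def)
 from sim_upd[OF this] have "sim k (R(r := M (R s)), M) (?R(r + 20 := M a), M')" by (simp add: a_def)
 moreover have "frame (R', M') (?R(r + 20 := M a), M')" by (simp add: frame_def)
 moreover note exec.Seq[OF 1 exec.Seq[OF 2 exec.Seq[OF 3 exec.Seq[OF 4 exec.Seq[OF 5 6]]]]]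
 ultimately show ?thesis by (intro exI conjI) (auto simp del: fun_upd_apply)
qed

lemma sim_store:
 assumes "sim k (R, M) (R', M')"
 shows "\<exists>u z'. u \<le> 5 \<and> exec (translate (Store r s)) (R', M') u z' \<and> sim k (R, M(R r := R s)) z' \<and> frame (R', M') z'"
proof -
 define a where "a = R r"
 have R': "R' (r + 20) = a" "R' (s + 20) = R s" "R' 5 = 1" "R' 11 = k" "a + a + a = 3 * a"
  using assms by (auto simp: sim_def a_def)
 let ?R = "R'(1 := 3 * a, 2 := 3 * a + 1)"
 let ?M = "M'(3 * a := R s, 3 * a + 1 := k)"
 have 1: "exec (Plus 1 (r + 20) (r + 20)) (R', M') 1 (R'(1 := a + a), M')"
  using exec.Plus[of 1 "r + 20" "r + 20" R' M'] by (simp add: R')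
 have 2: "exec (Plus 1 1 (r + 20)) (R'(1 := a + a), M') 1 (R'(1 := 3 * a), M')"
  using exec.Plus[of 1 1 "r + 20" "R'(1 := a + a)" M'] by (simp add: R')
 have 3: "exec (Store 1 (s + 20)) (R'(1 := 3 * a), M') 1 (R'(1 := 3 * a), M'(3 * a := R s))"
  using exec.Store[of 1 "s + 20" "R'(1 := 3 * a)" M'] by (simp add: R')
 have 4: "exec (Plus 2 1 5) (R'(1 := 3 * a), M'(3 * a := R s)) 1 (?R, M'(3 * a := R s))"
  using exec.Plus[of 2 1 5 "R'(1 := 3 * a)" "M'(3 * a := R s)"] by (simp add: R')
 have 5: "exec (Store 2 11) (?R, M'(3 * a := R s)) 1 (?R, ?M)"
  using exec.Store[of 2 11 ?R "M'(3 * a := R s)"] by (simp add: R')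
 have "3 * b \<noteq> 3 * a + 1" "3 * b + 1 \<noteq> 3 * a" for b by presburger+
 hence "sim k (R, M(R r := R s)) (?R, ?M)"
  using assms by (auto simp: sim_def a_def)
 moreover have "frame (R', M') (?R, ?M)"
 proof -
  have "c \<noteq> 3 * a" "c \<noteq> 3 * a + 1" if "c mod 3 = 2" for c using that by presburger+
  thus ?thesis by (auto simp: frame_def)
 qed
 moreover note exec.Seq[OF 1 exec.Seq[OF 2 exec.Seq[OF 3 exec.Seq[OF 4 5]]]]
 ultimately show ?thesis by (intro exI conjI) (auto simp del: fun_upd_apply)
qed

text \<open>The factor 7 is the running time of the translated \<open>Load\<close>, the longest
  translation of a single step.\<close>

lemma simulation:
 "exec c s t s' \<Longrightarrow> sim k s z \<Longrightarrow>
   \<exists>u z'. u \<le> 7 * t \<and> exec (translate c) z u z' \<and> sim k s' z' \<and> frame z z'"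
proof (induction arbitrary: z rule: exec.induct)
 case (Skip s)
 thus ?case using exec.Skip[of z] frame_refl[of z] by (intro exI[of _ 1] exI[of _ z]) auto
next
 case (Const r a R M)
 obtain R' M' where z: "z = (R', M')" by (cases z)
 show ?case using exec.Const[of "r + 20" a R' M'] sim_upd[of k R M R' M' r] Const
  by (intro exI[of _ 1] exI) (auto simp: z frame_def)
next
 case (Plus r s t R M)
 obtain R' M' where z: "z = (R', M')" by (cases z)
 have "R' (s + 20) = R s" "R' (t + 20) = R t" using Plus by (auto simp: z sim_def)
 thus ?case using exec.Plus[of "r + 20" "s + 20" "t + 20" R' M'] sim_upd[of k R M R' M' r] Plus
  by (intro exI[of _ 1] exI) (auto simp: z frame_def)
next
 case (Minus r s t R M)
 obtain R' M' where z: "z = (R', M')" by (cases z)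
 have "R' (s + 20) = R s" "R' (t + 20) = R t" using Minus by (auto simp: z sim_def)
 thus ?case using exec.Minus[of "r + 20" "s + 20" "t + 20" R' M'] sim_upd[of k R M R' M' r] Minus
  by (intro exI[of _ 1] exI) (auto simp: z frame_def)
next
 case (Load r s R M)
 thus ?case using sim_load[of k R M "fst z" "snd z" r s] by auto
next
 case (Store r s R M)
 then obtain u z' where "u \<le> 5" "exec (translate (com.Store r s)) z u z'" "sim k (R, M(R r := R s)) z'" "frame z z'"
  using sim_store[of k R M "fst z" "snd z" r s] by auto
 thus ?case by (intro exI[of _ u] exI[of _ z']) auto
next
 case (Seq c1 s t1 s' c2 t2 s'')
 from Seq.IH(1)[OF Seq.prems] obtain u1 z1 where 1: "u1 \<le> 7 * t1" "exec (translate c1) z u1 z1" "sim k s' z1" "frame z z1"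
  by blast
 from Seq.IH(2)[OF 1(3)] obtain u2 z2 where 2: "u2 \<le> 7 * t2" "exec (translate c2) z1 u2 z2" "sim k s'' z2" "frame z1 z2"
  by blast
 show ?case using exec.Seq[OF 1(2) 2(2)] 1(1) 2(1,3) frame_trans[OF 1(4) 2(4)]
  by (intro exI[of _ "u1 + u2"] exI[of _ z2]) auto
next
 case (IfTrue s r c1 t s' c2)
 then obtain u z' where 1: "u \<le> 7 * t" "exec (translate c1) z u z'" "sim k s' z'" "frame z z'" by blast
 have "fst z (r + 20) \<noteq> 0" using IfTrue by (simp add: sim_def)
 from exec.IfTrue[OF this 1(2)] 1 show ?case by (intro exI[of _ "Suc u"] exI[of _ z']) auto
next
 case (IfFalse s r c2 t s' c1)
 then obtain u z' where 1: "u \<le> 7 * t" "exec (translate c2) z u z'" "sim k s' z'" "frame z z'" by blast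
 have "fst z (r + 20) = 0" using IfFalse by (simp add: sim_def)
 from exec.IfFalse[OF this 1(2)] 1 show ?case by (intro exI[of _ "Suc u"] exI[of _ z']) auto
next
 case (WhileFalse s r c)
 hence "fst z (r + 20) = 0" by (simp add: sim_def)
 from exec.WhileFalse[OF this] WhileFalse show ?case
  by (intro exI[of _ 1] exI[of _ z]) (auto simp: frame_refl)
next
 case (WhileTrue s r c t1 s' t2 s'')
 from WhileTrue.IH(1)[OF WhileTrue.prems] obtain u1 z1
  where 1: "u1 \<le> 7 * t1" "exec (translate c) z u1 z1" "sim k s' z1" "frame z z1" by blast
 from WhileTrue.IH(2)[OF 1(3)] obtain u2 z2
  where 2: "u2 \<le> 7 * t2" "exec (translate (While r c)) z1 u2 z2" "sim k s'' z2" "frame z1 z2" by blast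
 have "fst z (r + 20) \<noteq> 0" using WhileTrue by (simp add: sim_def)
 from exec.WhileTrue[OF this 1(2) 2(2)[unfolded translate.simps]]
 show ?case using 1(1) 2(1,3) frame_trans[OF 1(4) 2(4)]
  by (intro exI[of _ "Suc (u1 + u2)"] exI[of _ z2]) auto
qed

text \<open>Registers from this number on are never written by the program, so a new call has to
  reset only finitely many of them.\<close>

primrec reg_bound :: "com \<Rightarrow> nat" where
 "reg_bound Skip = 0"
| "reg_bound (Const r a) = Suc r"
| "reg_bound (Plus r s t) = Suc r"
| "reg_bound (Minus r s t) = Suc r"
| "reg_bound (Load r s) = Suc r"
| "reg_bound (Store r s) = 0"
| "reg_bound (Seq c d) = max (reg_bound c) (reg_bound d)"
| "reg_bound (If r c d) = max (reg_bound c) (reg_bound d)"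
| "reg_bound (While r c) = reg_bound c"

lemma exec_reg_bound: "exec c s t s' \<Longrightarrow> reg_bound c \<le> r \<Longrightarrow> fst s' r = fst s r"
 by (induction rule: exec.induct) auto

text \<open>Starts at 21, the simulated register 1: register 20 is the simulated register 0 and
  already holds the length of the copied input.\<close>

primrec clear_regs :: "nat \<Rightarrow> com" where
 "clear_regs 0 = Skip"
| "clear_regs (Suc n) = Seq (clear_regs n) (Const (n + 21) 0)"

lemma exec_clear_regs: "exec (clear_regs n) (R, M) (Suc n) ((\<lambda>r. if 21 \<le> r \<and> r < 21 + n then 0 else R r), M)"
proof (induction n)
 case 0
 have "(\<lambda>r. if 21 \<le> r \<and> r < 21 + 0 then 0 else R r) = R" by auto
 thus ?case using exec.Skip by simp
next
 case (Suc n)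
 let ?R = "\<lambda>r. if 21 \<le> r \<and> r < 21 + n then 0 else R r"
 have "?R(n + 21 := 0) = (\<lambda>r. if 21 \<le> r \<and> r < 21 + Suc n then 0 else R r)" by (auto simp: fun_eq_iff)
 thus ?case using exec.Seq[OF Suc exec.Const[of "n + 21" 0 ?R M]] by simp
qed

definition copy_body :: com where
 "copy_body = Seq (Load 1 13) (Seq (Store 14 1) (Seq (Plus 2 14 5) (Seq (Store 2 11)
   (Seq (Plus 14 14 7) (Seq (Plus 20 20 5) (Seq (Plus 1 13 7) (Load 13 1)))))))"

lemma exec_copy_body:
 assumes "R 5 = 1" "R 7 = 3" "R 13 mod 3 = 2" "R 14 = 3 * i"
 shows "exec copy_body (R, M) 8 (R(2 := 3 * i + 1, 14 := 3 * (i + 1), 20 := R 20 + 1, 1 := R 13 + 3, 13 := M (R 13 + 3)),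
   M(3 * i := M (R 13), 3 * i + 1 := R 11))"
proof -
 let ?M = "M(3 * i := M (R 13), 3 * i + 1 := R 11)"
 let ?R1 = "R(1 := M (R 13))"
 let ?R2 = "?R1(2 := 3 * i + 1)"
 let ?R3 = "?R2(14 := 3 * (i + 1))"
 let ?R4 = "?R3(20 := R 20 + 1)"
 let ?R5 = "?R4(1 := R 13 + 3)"
 have 1: "exec (Load 1 13) (R, M) 1 (?R1, M)" by (rule exec.Load)
 have 2: "exec (Store 14 1) (?R1, M) 1 (?R1, M(3 * i := M (R 13)))"
  using exec.Store[of 14 1 ?R1 M] by (simp add: assms)
 have 3: "exec (Plus 2 14 5) (?R1, M(3 * i := M (R 13))) 1 (?R2, M(3 * i := M (R 13)))"
  using exec.Plus[of 2 14 5 ?R1 "M(3 * i := M (R 13))"] by (simp add: assms)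
 have 4: "exec (Store 2 11) (?R2, M(3 * i := M (R 13))) 1 (?R2, ?M)"
  using exec.Store[of 2 11 ?R2 "M(3 * i := M (R 13))"] by (simp add: assms)
 have 5: "exec (Plus 14 14 7) (?R2, ?M) 1 (?R3, ?M)"
  using exec.Plus[of 14 14 7 ?R2 ?M] by (simp add: assms add.commute)
 have 6: "exec (Plus 20 20 5) (?R3, ?M) 1 (?R4, ?M)"
  using exec.Plus[of 20 20 5 ?R3 ?M] by (simp add: assms)
 have 7: "exec (Plus 1 13 7) (?R4, ?M) 1 (?R5, ?M)"
  using exec.Plus[of 1 13 7 ?R4 ?M] by (simp add: assms)
 have "R 13 + 3 \<noteq> 3 * i" "R 13 + 3 \<noteq> 3 * i + 1" using assms(3) by presburger+
 hence 8: "exec (Load 13 1) (?R5, ?M) 1 (?R5(13 := M (R 13 + 3)), ?M)"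
  using exec.Load[of 13 1 ?R5 ?M] by simp
 have "exec copy_body (R, M) (1 + (1 + (1 + (1 + (1 + (1 + (1 + 1))))))) (?R5(13 := M (R 13 + 3)), ?M)"
  unfolding copy_body_def
  by (rule exec.Seq[OF 1 exec.Seq[OF 2 exec.Seq[OF 3 exec.Seq[OF 4 exec.Seq[OF 5 exec.Seq[OF 6 exec.Seq[OF 7 8]]]]]]])
 moreover have "?R5(13 := M (R 13 + 3)) = R(2 := 3 * i + 1, 14 := 3 * (i + 1), 20 := R 20 + 1, 1 := R 13 + 3, 13 := M (R 13 + 3))"
  by (auto simp: fun_eq_iff)
 moreover have "1 + (1 + (1 + (1 + (1 + (1 + (1 + 1)))))) = (8::nat)" by simp
 ultimately show ?thesis by (simp only:)
qed

definition copied :: "nat list \<Rightarrow> nat \<Rightarrow> state \<Rightarrow> state \<Rightarrow> bool" where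
 "copied ys i z z' \<longleftrightarrow> fst z' 20 = fst z 20 + length ys \<and>
   (\<forall>r. r \<notin> {1, 2, 13, 14, 20} \<longrightarrow> fst z' r = fst z r) \<and>
   (\<forall>j<length ys. snd z' (3 * (i + j)) = ys ! j \<and> snd z' (3 * (i + j) + 1) = fst z 11) \<and>
   (\<forall>a. a mod 3 = 2 \<or> a div 3 < i \<or> i + length ys \<le> a div 3 \<longrightarrow> snd z' a = snd z a)"

lemma exec_copy:
 assumes "repr M h (enc ys) (R 13)" "R 5 = 1" "R 7 = 3" "R 14 = 3 * i"
 shows "\<exists>z'. exec (While 13 copy_body) (R, M) (9 * length ys + 1) z' \<and> copied ys i (R, M) z'"
 using assms
proof (induction ys arbitrary: R M i)
 case Nil
 hence "R 13 = 0" by simp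
 thus ?case using exec.WhileFalse[of "(R, M)" 13 copy_body] by (intro exI[of _ "(R, M)"]) (auto simp: copied_def)
next
 case (Cons y ys)
 from Cons.prems have p: "R 13 mod 3 = 2" "R 13 + 3 < h" "M (R 13) = y" "repr M h (enc ys) (M (R 13 + 3))"
  by (auto simp: enc_nat_def)
 let ?R = "R(2 := 3 * i + 1, 14 := 3 * (i + 1), 20 := R 20 + 1, 1 := R 13 + 3, 13 := M (R 13 + 3))"
 let ?M = "M(3 * i := M (R 13), 3 * i + 1 := R 11)"
 have 1: "exec copy_body (R, M) 8 (?R, ?M)" using exec_copy_body[OF Cons.prems(2,3) p(1) Cons.prems(4)] .
 have "repr ?M h (enc ys) (?R 13)" using p(4) by simp (erule repr_mono; auto)
 moreover have "?R 5 = 1" "?R 7 = 3" "?R 14 = 3 * (i + 1)" using Cons.prems by simp_all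
 ultimately obtain z' where 2: "exec (While 13 copy_body) (?R, ?M) (9 * length ys + 1) z'"
  and C: "copied ys (i + 1) (?R, ?M) z'" using Cons.IH[where R = ?R and M = ?M and i = "i + 1"] by blast
 have "R 13 \<noteq> 0" using p(1) by presburger
 hence "exec (While 13 copy_body) (R, M) (Suc (8 + (9 * length ys + 1))) z'"
  by (intro exec.WhileTrue[OF _ 1 2]) simp
 moreover have "snd z' (3 * (i + j)) = (y # ys) ! j \<and> snd z' (3 * (i + j) + 1) = R 11" if "j < length (y # ys)" for j
 proof (cases j)
  case 0
  have "snd z' (3 * i) = ?M (3 * i)" "snd z' (3 * i + 1) = ?M (3 * i + 1)" using C unfolding copied_def by auto
  thus ?thesis using 0 p by simp
 next
  case (Suc j')
  thus ?thesis using C that unfolding copied_def by (auto dest!: spec[of _ j'] simp: algebra_simps)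
 qed
 moreover have "snd z' a = M a" if "a mod 3 = 2 \<or> a div 3 < i \<or> i + length (y # ys) \<le> a div 3" for a
 proof -
  have "snd z' a = ?M a" using C that unfolding copied_def by auto
  moreover have "a \<noteq> 3 * i" "a \<noteq> 3 * i + 1" using that by auto
  ultimately show ?thesis by simp
 qed
 moreover have "fst z' 20 = R 20 + length (y # ys)" "\<forall>r. r \<notin> {1, 2, 13, 14, 20} \<longrightarrow> fst z' r = R r"
  using C unfolding copied_def by auto
 ultimately show ?case by (intro exI[of _ z']) (auto simp: copied_def)
qed

text \<open>Register 10 holds the list of the remaining inputs, 11 the call number and 12 the
  disjunction of the answers. Raising the call number first makes all marks of earlier calls
  stale.\<close>

definition call_body :: "com \<Rightarrow> com" where
 "call_body c = Seq (Plus 11 11 5) (Seq (Load 13 10) (Seq (Plus 1 10 7) (Seq (Load 10 1) (Seq (Const 14 0) (Seq (Const 20 0)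
   (Seq (While 13 copy_body) (Seq (clear_regs (reg_bound c)) (Seq (translate c) (If 20 (Const 12 1) Skip)))))))))"

definition call_inv :: "com \<Rightarrow> nat list list \<Rightarrow> (nat \<Rightarrow> nat) \<times> (nat \<Rightarrow> nat) \<Rightarrow> bool" where
 "call_inv c gs z \<longleftrightarrow> fst z 5 = 1 \<and> fst z 6 = 0 \<and> fst z 7 = 3 \<and> (\<exists>h. repr (snd z) h (enc gs) (fst z 10)) \<and>
   (\<forall>r\<ge>21 + reg_bound c. fst z r = 0) \<and> (\<forall>a. snd z (3 * a + 1) \<le> fst z 11)"

lemma exec_call_body:
 assumes inv: "call_inv c (g # gs) z" and c: "exec c (initial g) t s"
 shows "\<exists>u z'. u \<le> 9 * length g + 7 * t + reg_bound c + 20 \<and> exec (call_body c) z u z' \<and> call_inv c gs z' \<and>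
   fst z' 12 = (if accepting s then 1 else fst z 12)"
proof -
 obtain R M where z: "z = (R, M)" by (cases z)
 from inv obtain h where I: "R 5 = 1" "R 6 = 0" "R 7 = 3" "repr M h (enc (g # gs)) (R 10)"
  "\<And>r. r \<ge> 21 + reg_bound c \<Longrightarrow> R r = 0" "\<And>a. M (3 * a + 1) \<le> R 11"
  by (auto simp: call_inv_def z)
 define p where "p = R 10"
 have p: "repr M h (enc g) (M p)" "repr M h (enc gs) (M (p + 3))" using I(4) by (auto simp: p_def)
 define k where "k = R 11 + 1"
 let ?R1 = "R(11 := k)" let ?R2 = "?R1(13 := M p)" let ?R3 = "?R2(1 := p + 3)"
 let ?R4 = "?R3(10 := M (p + 3))" let ?R5 = "?R4(14 := 0)" let ?R6 = "?R5(20 := 0)"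
 have 1: "exec (Plus 11 11 5) (R, M) 1 (?R1, M)" using exec.Plus[of 11 11 5 R M] by (simp add: I k_def)
 have 2: "exec (Load 13 10) (?R1, M) 1 (?R2, M)" using exec.Load[of 13 10 ?R1 M] by (simp add: p_def)
 have 3: "exec (Plus 1 10 7) (?R2, M) 1 (?R3, M)" using exec.Plus[of 1 10 7 ?R2 M] by (simp add: p_def I)
 have 4: "exec (Load 10 1) (?R3, M) 1 (?R4, M)" using exec.Load[of 10 1 ?R3 M] by simp
 have 5: "exec (Const 14 0) (?R4, M) 1 (?R5, M)" by (rule exec.Const)
 have 6: "exec (Const 20 0) (?R5, M) 1 (?R6, M)" by (rule exec.Const)
 have "repr M h (enc g) (?R6 13)" using p(1) by simp
 moreover have "?R6 5 = 1" "?R6 7 = 3" "?R6 14 = 3 * 0" using I by simp_all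
 ultimately obtain z7 where
  7: "exec (While 13 copy_body) (?R6, M) (9 * length g + 1) z7" and C: "copied g 0 (?R6, M) z7"
  using exec_copy[where R = ?R6 and i = 0] by blast
 obtain R7 M7 where z7: "z7 = (R7, M7)" by (cases z7)
 have R7: "R7 20 = length g" "\<And>r. r \<notin> {1, 2, 13, 14, 20} \<Longrightarrow> R7 r = ?R6 r" and
  M7: "\<And>j. j < length g \<Longrightarrow> M7 (3 * j) = g ! j \<and> M7 (3 * j + 1) = k"
   "\<And>a. a mod 3 = 2 \<or> length g \<le> a div 3 \<Longrightarrow> M7 a = M a"
  using C unfolding copied_def z7 by auto
 let ?R8 = "\<lambda>r. if 21 \<le> r \<and> r < 21 + reg_bound c then 0 else R7 r"
 have 8: "exec (clear_regs (reg_bound c)) (R7, M7) (Suc (reg_bound c)) (?R8, M7)" by (rule exec_clear_regs)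
 have "sim k (initial g) (?R8, M7)"
 proof -
  have "?R8 (r + 20) = ((\<lambda>_. 0)(0 := length g)) r" for r
   using R7 I(5)[of "r + 20"] by (cases "r = 0") auto
  moreover have "(if a < length g then g ! a else 0) = (if M7 (3 * a + 1) = k then M7 (3 * a) else 0)"
   "M7 (3 * a + 1) \<le> k" for a
  proof -
   have "M7 (3 * a + 1) < k" if "a \<ge> length g" using M7(2)[of "3 * a + 1"] that I(6)[of a] by (simp add: k_def)
   thus "(if a < length g then g ! a else 0) = (if M7 (3 * a + 1) = k then M7 (3 * a) else 0)"
   "M7 (3 * a + 1) \<le> k" using M7(1)[of a] by (cases "a < length g"; simp)+
  qed
  ultimately show ?thesis unfolding sim_def initial_def using R7(2) I by simp
 qed
 from simulation[OF c this] obtain u z9 where 9: "u \<le> 7 * t" "exec (translate c) (?R8, M7) u z9" "sim k s z9"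
  "frame (?R8, M7) z9" by blast
 obtain R9 M9 where z9: "z9 = (R9, M9)" by (cases z9)
 define R10 where "R10 = (if accepting s then R9(12 := 1) else R9)"
 have R9: "R9 20 = fst s 0" "R9 5 = 1" "R9 6 = 0" "R9 7 = 3" "R9 11 = k" "\<And>a. M9 (3 * a + 1) \<le> k"
  using 9(3) by (auto simp: sim_def z9 dest: spec[of _ 0])
 have F: "R9 10 = M (p + 3)" "R9 12 = R 12" "\<And>a. a mod 3 = 2 \<Longrightarrow> M9 a = M a"
  using 9(4) R7(2) M7(2) by (auto simp: frame_def z9)
 have 10: "exec (If 20 (Const 12 1) Skip) (R9, M9) (Suc 1) (R10, M9)"
 proof (cases "accepting s")
  case True
  thus ?thesis using R9(1) unfolding R10_def by (auto intro!: exec.IfTrue exec.Const[unfolded One_nat_def] simp: accepting_def)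
 next
  case False
  thus ?thesis using R9(1) unfolding R10_def by (auto intro!: exec.IfFalse exec.Skip[unfolded One_nat_def] simp: accepting_def)
 qed
 have E: "exec (call_body c) z (1 + (1 + (1 + (1 + (1 + (1 + ((9 * length g + 1) + (Suc (reg_bound c) + (u + Suc 1))))))))) (R10, M9)"
  unfolding call_body_def z
  by (rule exec.Seq[OF 1 exec.Seq[OF 2 exec.Seq[OF 3 exec.Seq[OF 4 exec.Seq[OF 5 exec.Seq[OF 6 exec.Seq[OF 7[unfolded z7]
    exec.Seq[OF 8 exec.Seq[OF 9(2)[unfolded z9] 10]]]]]]]]])
 have "repr M9 h (enc gs) (M (p + 3))" using p(2) by (rule repr_mono) (auto simp: F)
 moreover have "R9 r = 0" if "r \<ge> 21 + reg_bound c" for r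
 proof -
  have "R9 ((r - 20) + 20) = fst s (r - 20)" using 9(3) unfolding sim_def z9 by simp
  hence "R9 r = fst s (r - 20)" using that by simp
  also have "\<dots> = fst (initial g) (r - 20)" using exec_reg_bound[OF c, of "r - 20"] that by simp
  also have "\<dots> = 0" using that by (simp add: initial_def)
  finally show ?thesis .
 qed
 ultimately have "call_inv c gs (R10, M9)"
  unfolding call_inv_def R10_def using R9 F(1) by auto
 thus ?thesis using E 9(1) F(2)
  by (intro exI[of _ "1 + (1 + (1 + (1 + (1 + (1 + ((9 * length g + 1) + (Suc (reg_bound c) + (u + Suc 1))))))))"]
     exI[of _ "(R10, M9)"]) (auto simp: R10_def z)
qed

lemma exec_calls:
 assumes "call_inv c gs z" "\<And>g. g \<in> set gs \<Longrightarrow> exec c (initial g) (t g) (s g)"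
 shows "\<exists>u z'. u \<le> (\<Sum>g\<leftarrow>gs. 9 * length g + 7 * t g + reg_bound c + 21) + 1 \<and> exec (While 10 (call_body c)) z u z' \<and>
   (fst z' 12 \<noteq> 0 \<longleftrightarrow> fst z 12 \<noteq> 0 \<or> (\<exists>g\<in>set gs. accepting (s g))) \<and> fst z' 6 = 0"
 using assms
proof (induction gs arbitrary: z)
 case Nil
 hence "fst z 10 = 0" "fst z 6 = 0" by (auto simp: call_inv_def)
 thus ?case using exec.WhileFalse[of z 10 "call_body c"] by (intro exI[of _ 1] exI[of _ z]) auto
next
 case (Cons g gs)
 from exec_call_body[OF Cons.prems(1) Cons.prems(2)[of g]] obtain u z1 where
  1: "u \<le> 9 * length g + 7 * t g + reg_bound c + 20" "exec (call_body c) z u z1" "call_inv c gs z1" and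
  z1: "fst z1 12 = (if accepting (s g) then 1 else fst z 12)"
  by auto
 have "exec c (initial g) (t g) (s g)" if "g \<in> set gs" for g using Cons.prems(2) that by simp
 from Cons.IH[OF 1(3) this] obtain u' z2 where
  2: "u' \<le> (\<Sum>g\<leftarrow>gs. 9 * length g + 7 * t g + reg_bound c + 21) + 1" "exec (While 10 (call_body c)) z1 u' z2"
   "fst z2 12 \<noteq> 0 \<longleftrightarrow> fst z1 12 \<noteq> 0 \<or> (\<exists>g\<in>set gs. accepting (s g))" "fst z2 6 = 0" by blast
 have "fst z 10 \<noteq> 0" using Cons.prems(1) by (auto simp: call_inv_def)
 from exec.WhileTrue[OF this 1(2) 2(2)] show ?case
  using 1(1) 2 z1 by (intro exI[of _ "Suc (u + u')"] exI[of _ z2]) auto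
qed

text \<open>The input occupies consecutive cells of all residue classes. It is consumed from the
  last cell, so that consing restores its order, and every cell is reset to 0, since the cells with
  residue 0 and 1 later become simulated memory and marks.\<close>

definition read_body :: com where
 "read_body = Seq (Minus 9 9 5) (Seq (Load 1 9) (Seq (Store 9 6) (Seq (Store 4 1) (Seq (Plus 1 4 7)
   (Seq (Store 1 0) (Seq (Plus 0 4 6) (Plus 4 1 7)))))))"

text \<open>The quantifier over \<open>M\<close> expresses that the list built so far lies at
  addresses from \<open>3 * length xs + 2\<close> on, so that erasing input cells does not affect
  it.\<close>

definition read_inv :: "nat list \<Rightarrow> nat \<Rightarrow> (nat \<Rightarrow> nat) \<times> (nat \<Rightarrow> nat) \<Rightarrow> bool" where
 "read_inv xs i z \<longleftrightarrow> wf_regs (fst z) \<and> fst z 9 = i \<and> 3 * length xs + 2 \<le> fst z 4 \<and>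
   (\<forall>M. (\<forall>a\<ge>3 * length xs + 2. M a = snd z a) \<longrightarrow> repr M (fst z 4) (enc (drop i xs)) (fst z 0)) \<and> (\<forall>j<i. snd z j = xs ! j) \<and>
   (\<forall>a\<ge>i. a < 3 * length xs + 2 \<or> a mod 3 \<noteq> 2 \<longrightarrow> snd z a = 0) \<and> (\<forall>r\<ge>20. fst z r = 0)"

lemma exec_read_body:
 assumes "read_inv xs (Suc i) z" "Suc i \<le> length xs"
 shows "\<exists>z'. exec read_body z 8 z' \<and> read_inv xs i z'"
proof -
 obtain R M where z: "z = (R, M)" by (cases z)
 from assms(1) have I: "R 5 = 1" "R 6 = 0" "R 7 = 3" "R 4 mod 3 = 2" "R 9 = Suc i" "3 * length xs + 2 \<le> R 4"
  "\<And>M'. \<forall>a\<ge>3 * length xs + 2. M' a = M a \<Longrightarrow> repr M' (R 4) (enc (drop (Suc i) xs)) (R 0)" "\<And>j. j < Suc i \<Longrightarrow> M j = xs ! j"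
  "\<And>a. a \<ge> Suc i \<Longrightarrow> a < 3 * length xs + 2 \<or> a mod 3 \<noteq> 2 \<Longrightarrow> M a = 0" "\<And>r. r \<ge> 20 \<Longrightarrow> R r = 0"
  unfolding read_inv_def z by (auto simp: wf_regs_def)
 define h where "h = R 4"
 let ?R1 = "R(9 := i)" let ?R2 = "?R1(1 := xs ! i)"
 let ?M1 = "M(i := 0)" let ?M2 = "?M1(h := xs ! i)"
 let ?R3 = "?R2(1 := h + 3)" let ?M3 = "?M2(h + 3 := R 0)" let ?R4 = "?R3(0 := h)" let ?R5 = "?R4(4 := h + 3 + 3)"
 have 1: "exec (Minus 9 9 5) (R, M) 1 (?R1, M)" using exec.Minus[of 9 9 5 R M] by (simp add: I)
 have 2: "exec (Load 1 9) (?R1, M) 1 (?R2, M)" using exec.Load[of 1 9 ?R1 M] by (simp add: I(8))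
 have 3: "exec (Store 9 6) (?R2, M) 1 (?R2, ?M1)" using exec.Store[of 9 6 ?R2 M] by (simp add: I)
 have 4: "exec (Store 4 1) (?R2, ?M1) 1 (?R2, ?M2)" using exec.Store[of 4 1 ?R2 ?M1] by (simp add: h_def)
 have 5: "exec (Plus 1 4 7) (?R2, ?M2) 1 (?R3, ?M2)" using exec.Plus[of 1 4 7 ?R2 ?M2] by (simp add: h_def I)
 have 6: "exec (Store 1 0) (?R3, ?M2) 1 (?R3, ?M3)" using exec.Store[of 1 0 ?R3 ?M2] by (simp add: h_def)
 have 7: "exec (Plus 0 4 6) (?R3, ?M3) 1 (?R4, ?M3)" using exec.Plus[of 0 4 6 ?R3 ?M3] by (simp add: h_def I)
 have 8: "exec (Plus 4 1 7) (?R4, ?M3) 1 (?R5, ?M3)" using exec.Plus[of 4 1 7 ?R4 ?M3] by (simp add: h_def I)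
 have "exec read_body z (1 + (1 + (1 + (1 + (1 + (1 + (1 + 1))))))) (?R5, ?M3)"
  unfolding read_body_def z
  by (rule exec.Seq[OF 1 exec.Seq[OF 2 exec.Seq[OF 3 exec.Seq[OF 4 exec.Seq[OF 5 exec.Seq[OF 6 exec.Seq[OF 7 8]]]]]]])
 moreover have "1 + (1 + (1 + (1 + (1 + (1 + (1 + 1)))))) = (8::nat)" by simp
 ultimately have E: "exec read_body z 8 (?R5, ?M3)" by (simp only:)
 have ih: "i < h" "i < h + 3" using I(6) assms(2) by (auto simp: h_def)
 have h3: "h mod 3 = 2" using I(4) by (simp add: h_def)
 have d: "drop i xs = xs ! i # drop (Suc i) xs" using assms(2) by (simp add: Cons_nth_drop_Suc)
 have "read_inv xs i (?R5, ?M3)"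
  unfolding read_inv_def fst_conv snd_conv
 proof (intro conjI allI impI)
  have "(h + 3 + 3) mod 3 = 2" using h3 by presburger
  thus "wf_regs ?R5" using I by (simp add: wf_regs_def)
  show "?R5 9 = i" "3 * length xs + 2 \<le> ?R5 4" using I(6) by (simp_all add: h_def)
  show "?R5 r = 0" if "r \<ge> 20" for r using I(10) that by simp
  show "?M3 j = xs ! j" if "j < i" for j using that ih I(8) by simp
  show "?M3 a = 0" if "a \<ge> i" "a < 3 * length xs + 2 \<or> a mod 3 \<noteq> 2" for a
  proof -
   have "(h + 3) mod 3 = 2" using h3 by simp
   hence "a \<noteq> h" "a \<noteq> h + 3" using that(2) I(6) h3 by (auto simp: h_def)
   thus ?thesis using that I(9)[of a] by (cases "a = i") auto
  qed
  fix N assume N: "\<forall>a\<ge>3 * length xs + 2. N a = ?M3 a"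
  have Nh: "N h = xs ! i" "N (h + 3) = R 0" using N I(6) by (auto simp: h_def)
  have "repr (N(h := M h, h + 3 := M (h + 3))) (R 4) (enc (drop (Suc i) xs)) (R 0)"
   by (rule I(7)) (use N ih assms(2) in auto)
  hence "repr N (h + 3 + 3) (enc (drop (Suc i) xs)) (R 0)"
   by (rule repr_mono) (auto simp: h_def)
  thus "repr N (?R5 4) (enc (drop i xs)) (?R5 0)"
   using Nh h3 by (simp add: d enc_nat_def)
 qed
 with E show ?thesis by blast
qed

definition read_com :: com where
 "read_com = Seq (Const 5 1) (Seq (Const 7 3) (Seq (Plus 9 0 6) (Seq (Plus 4 0 0) (Seq (Plus 4 4 0) (Seq (Const 8 2)
   (Seq (Plus 4 4 8) (Seq (Const 0 0) (While 9 read_body))))))))"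

lemma exec_read:
 "\<exists>u R M. u \<le> 9 * length xs + 9 \<and> exec read_com (initial xs) u (R, M) \<and> wf_regs R \<and> repr M (R 4) (enc xs) (R 0) \<and>
   (\<forall>a. a mod 3 \<noteq> 2 \<longrightarrow> M a = 0) \<and> (\<forall>r\<ge>20. R r = 0)"
proof -
 let ?n = "length xs"
 define R0 :: "nat \<Rightarrow> nat" where "R0 = (\<lambda>_. 0)(0 := ?n)"
 define M where "M = (\<lambda>i. if i < ?n then xs ! i else 0)"
 let ?R1 = "R0(5 := 1)" let ?R2 = "?R1(7 := 3)" let ?R3 = "?R2(9 := ?n)" let ?R4 = "?R3(4 := ?n + ?n)"
 let ?R5 = "?R4(4 := 3 * ?n)" let ?R6 = "?R5(8 := 2)" let ?R7 = "?R6(4 := 3 * ?n + 2)" let ?R8 = "?R7(0 := 0)"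
 have n3: "?n + ?n + ?n = 3 * ?n" by simp
 have 1: "exec (Const 5 1) (R0, M) 1 (?R1, M)" by (rule exec.Const)
 have 2: "exec (Const 7 3) (?R1, M) 1 (?R2, M)" by (rule exec.Const)
 have 3: "exec (Plus 9 0 6) (?R2, M) 1 (?R3, M)" using exec.Plus[of 9 0 6 ?R2 M] by (simp add: R0_def)
 have 4: "exec (Plus 4 0 0) (?R3, M) 1 (?R4, M)" using exec.Plus[of 4 0 0 ?R3 M] by (simp add: R0_def)
 have 5: "exec (Plus 4 4 0) (?R4, M) 1 (?R5, M)" using exec.Plus[of 4 4 0 ?R4 M] by (simp add: R0_def n3)
 have 6: "exec (Const 8 2) (?R5, M) 1 (?R6, M)" by (rule exec.Const)
 have 7: "exec (Plus 4 4 8) (?R6, M) 1 (?R7, M)" using exec.Plus[of 4 4 8 ?R6 M] by (simp add: R0_def)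
 have 8: "exec (Const 0 0) (?R7, M) 1 (?R8, M)" by (rule exec.Const)
 have loop: "\<exists>z'. exec (While 9 read_body) z (9 * i + 1) z' \<and> read_inv xs 0 z'"
  if "read_inv xs i z" "i \<le> ?n" for i z
  using that
 proof (induction i arbitrary: z)
  case 0
  hence "fst z 9 = 0" by (simp add: read_inv_def)
  from exec.WhileFalse[OF this, of read_body] 0 show ?case by (intro exI[of _ z]) simp
 next
  case (Suc i)
  from exec_read_body[OF Suc.prems] obtain z1 where z1: "exec read_body z 8 z1" "read_inv xs i z1" by blast
  from Suc.IH[OF z1(2)] Suc.prems(2) obtain z2 where z2: "exec (While 9 read_body) z1 (9 * i + 1) z2" "read_inv xs 0 z2"
   by auto
  have "fst z 9 \<noteq> 0" using Suc.prems(1) by (simp add: read_inv_def)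
  from exec.WhileTrue[OF this z1(1) z2(1)] z2(2) show ?case by (intro exI[of _ z2]) (simp add: algebra_simps)
 qed
 have "read_inv xs ?n (?R8, M)"
 proof -
  have "(3 * ?n + 2) mod 3 = 2" by presburger
  thus ?thesis unfolding read_inv_def by (auto simp: R0_def M_def wf_regs_def simp del: add_2_eq_Suc')
 qed
 from loop[OF this] obtain R9 M9 where 9: "exec (While 9 read_body) (?R8, M) (9 * ?n + 1) (R9, M9)" "read_inv xs 0 (R9, M9)"
  by auto
 have "exec read_com (R0, M) (1 + (1 + (1 + (1 + (1 + (1 + (1 + (1 + (9 * ?n + 1))))))))) (R9, M9)"
  unfolding read_com_def
  by (rule exec.Seq[OF 1 exec.Seq[OF 2 exec.Seq[OF 3 exec.Seq[OF 4 exec.Seq[OF 5 exec.Seq[OF 6 exec.Seq[OF 7 exec.Seq[OF 8 9(1)]]]]]]]])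
 moreover have "(R0, M) = initial xs" by (simp add: R0_def M_def initial_def)
 ultimately show ?thesis using 9(2)
  by (intro exI[of _ "1 + (1 + (1 + (1 + (1 + (1 + (1 + (1 + (9 * ?n + 1))))))))"] exI[of _ R9] exI[of _ M9])
   (auto simp: read_inv_def)
qed

definition calls_com :: "com \<Rightarrow> com \<Rightarrow> com" where
 "calls_com d c = Seq read_com (Seq d (Seq (Plus 10 0 6) (Seq (Const 11 0) (Seq (Const 12 0)
   (Seq (While 10 (call_body c)) (Plus 0 12 6))))))"

text \<open>A disjunctive Turing reduction on the machine: \<open>d\<close> lists the queries,
  \<open>c\<close> answers them one after the other, and one positive answer suffices. Each call
  costs its own time and the copying of its input, up to constants.\<close>

theorem exec_calls_com:
 assumes d: "run d (enc xs) (enc gs) T" and c: "\<And>g. g \<in> set gs \<Longrightarrow> exec c (initial g) (t g) (s g)"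
 shows "\<exists>u z. u \<le> 9 * length xs + T + (\<Sum>g\<leftarrow>gs. 9 * length g + 7 * t g + reg_bound c + 21) + 14 \<and>
   exec (calls_com d c) (initial xs) u z \<and> (accepting z \<longleftrightarrow> (\<exists>g\<in>set gs. accepting (s g)))"
proof -
 from exec_read obtain u R M where 1: "u \<le> 9 * length xs + 9" "exec read_com (initial xs) u (R, M)" "wf_regs R"
  "repr M (R 4) (enc xs) (R 0)" "\<forall>a. a mod 3 \<noteq> 2 \<longrightarrow> M a = 0" "\<forall>r\<ge>20. R r = 0" by blast
 from runE[OF d 1(3,4)] obtain v R1 M1 where 2: "v \<le> T" "exec d (R, M) v (R1, M1)" "ext (R, M) (R1, M1)"
  "repr M1 (R1 4) (enc gs) (R1 0)" .
 have R1: "R1 5 = 1" "R1 6 = 0" "R1 7 = 3" "\<And>r. r \<ge> 20 \<Longrightarrow> R1 r = 0" "\<And>a. a mod 3 \<noteq> 2 \<Longrightarrow> M1 a = 0"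
  using 2(3) 1(5,6) by (auto simp: ext_def wf_regs_def)
 let ?R2 = "R1(10 := R1 0)" let ?R3 = "?R2(11 := 0)" let ?R4 = "?R3(12 := 0)"
 have 3: "exec (Plus 10 0 6) (R1, M1) 1 (?R2, M1)" using exec.Plus[of 10 0 6 R1 M1] by (simp add: R1)
 have 4: "exec (Const 11 0) (?R2, M1) 1 (?R3, M1)" by (rule exec.Const)
 have 5: "exec (Const 12 0) (?R3, M1) 1 (?R4, M1)" by (rule exec.Const)
 have "(3 * a + 1) mod 3 \<noteq> 2" for a :: nat by presburger
 hence "call_inv c gs (?R4, M1)" using R1 2(4) unfolding call_inv_def by auto
 from exec_calls[OF this c] obtain w R5 M5 where
  6: "w \<le> (\<Sum>g\<leftarrow>gs. 9 * length g + 7 * t g + reg_bound c + 21) + 1" "exec (While 10 (call_body c)) (?R4, M1) w (R5, M5)"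
   "R5 12 \<noteq> 0 \<longleftrightarrow> (\<exists>g\<in>set gs. accepting (s g))" "R5 6 = 0" by auto
 have 7: "exec (Plus 0 12 6) (R5, M5) 1 (R5(0 := R5 12), M5)" using exec.Plus[of 0 12 6 R5 M5] by (simp add: 6)
 have "exec (calls_com d c) (initial xs) (u + (v + (1 + (1 + (1 + (w + 1)))))) (R5(0 := R5 12), M5)"
  unfolding calls_com_def
  by (rule exec.Seq[OF 1(2) exec.Seq[OF 2(2) exec.Seq[OF 3 exec.Seq[OF 4 exec.Seq[OF 5 exec.Seq[OF 6(2) 7]]]]]])
 thus ?thesis using 1(1) 2(1) 6(1,3)
  by (intro exI[of _ "u + (v + (1 + (1 + (1 + (w + 1)))))"] exI[of _ "(R5(0 := R5 12), M5)"]) (auto simp: accepting_def)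
qed

section \<open>Sparsification\<close>

definition lit_true :: "(nat \<Rightarrow> bool) \<Rightarrow> nat \<Rightarrow> bool" where "lit_true \<alpha> l \<longleftrightarrow> \<alpha> (l div 2) = odd l"

definition sat :: "(nat \<Rightarrow> bool) \<Rightarrow> nat list list \<Rightarrow> bool" where
 "sat \<alpha> \<Phi> \<longleftrightarrow> (\<forall>C\<in>set \<Phi>. \<exists>l\<in>set C. lit_true \<alpha> l)"

lemma sat_add_clause: "sat \<alpha> (add_clause C \<Phi>) \<longleftrightarrow> sat \<alpha> \<Phi> \<and> (\<exists>l\<in>set C. lit_true \<alpha> l)"
 unfolding sat_def add_clause_def by (auto; blast)

lemma sat_add_clauses: "sat \<alpha> (add_clauses Cs \<Phi>) \<longleftrightarrow> sat \<alpha> \<Phi> \<and> sat \<alpha> Cs"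
 unfolding add_clauses_def
proof (induction Cs arbitrary: \<Phi>)
 case (Cons C Cs)
 have "sat \<alpha> (C # Cs) \<longleftrightarrow> (\<exists>l\<in>set C. lit_true \<alpha> l) \<and> sat \<alpha> Cs" by (simp add: sat_def)
 thus ?case using Cons by (auto simp: sat_add_clause)
qed (simp add: sat_def)

text \<open>An assignment that satisfies no literal of the heart has to satisfy every clause of the
  flower through its petal.\<close>

lemma sat_branch: "(\<exists>\<Psi>\<in>set (branch d e \<Phi>). sat \<alpha> \<Psi>) \<longleftrightarrow> sat \<alpha> \<Phi>"
proof (cases "filter (\<lambda>c. snd (snd c) \<le> length (flower (fst c) (fst (snd c)) \<Phi>)) (candidates d e \<Phi>)")
 case Nil
 thus ?thesis unfolding branch_def by simp
next
 case (Cons c cs)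
 define h where "h = fst (snd c)"
 define P where "P = map (\<lambda>C. filter (\<lambda>l. l \<notin> set h) C) (flower (fst c) h \<Phi>)"
 have B: "branch d e \<Phi> = [add_clause h \<Phi>, add_clauses P \<Phi>]"
  unfolding branch_def Cons by (simp add: h_def P_def)
 have "(\<exists>l\<in>set h. lit_true \<alpha> l) \<or> sat \<alpha> P" if "sat \<alpha> \<Phi>"
  using that by (fastforce simp: sat_def P_def flower_def)
 thus ?thesis unfolding B by (auto simp: sat_add_clause sat_add_clauses)
qed

lemma sat_leaves: "(\<exists>\<Psi>\<in>set (leaves d e rs \<Psi>s). sat \<alpha> \<Psi>) \<longleftrightarrow> (\<exists>\<Psi>\<in>set \<Psi>s. sat \<alpha> \<Psi>)"
 unfolding leaves_def
proof (induction rs arbitrary: \<Psi>s)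
 case (Cons r rs)
 have "(\<exists>\<Psi>\<in>set (concat (map (branch d e) \<Psi>s)). sat \<alpha> \<Psi>) \<longleftrightarrow> (\<exists>\<Phi>\<in>set \<Psi>s. \<exists>\<Psi>\<in>set (branch d e \<Phi>). sat \<alpha> \<Psi>)"
  by auto
 thus ?case using Cons sat_branch by simp
qed simp

definition good_clause :: "nat \<Rightarrow> nat list \<Rightarrow> bool" where
 "good_clause N C \<longleftrightarrow> distinct C \<and> length C \<le> 3 \<and> set C \<subseteq> {..<2 * N}"

text \<open>An antichain under inclusion. Comparing positions of the list instead of its elements
  also excludes two clauses with the same literals in different order, and in particular
  repetitions.\<close>

definition reduced :: "nat \<Rightarrow> nat list list \<Rightarrow> bool" where
 "reduced N \<Phi> \<longleftrightarrow> (\<forall>C\<in>set \<Phi>. good_clause N C) \<and> sorted_wrt (\<lambda>C D. \<not> set C \<subseteq> set D \<and> \<not> set D \<subseteq> set C) \<Phi>"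

lemma reduced_antichain: "reduced N \<Phi> \<Longrightarrow> C \<in> set \<Phi> \<Longrightarrow> D \<in> set \<Phi> \<Longrightarrow> set C \<subseteq> set D \<Longrightarrow> C = D"
 unfolding reduced_def sorted_wrt_iff_nth_less in_set_conv_nth by (metis nat_neq_iff)

lemma reduced_distinct: "reduced N \<Phi> \<Longrightarrow> distinct \<Phi>"
 unfolding reduced_def sorted_wrt_iff_nth_less distinct_conv_nth by (metis nat_neq_iff order_refl)

lemma reduced_add_clause: "reduced N \<Phi> \<Longrightarrow> good_clause N C \<Longrightarrow> reduced N (add_clause C \<Phi>)"
 unfolding reduced_def add_clause_def by (auto simp: sorted_wrt_filter)

lemma reduced_add_clauses: "reduced N \<Phi> \<Longrightarrow> (\<And>C. C \<in> set Cs \<Longrightarrow> good_clause N C) \<Longrightarrow> reduced N (add_clauses Cs \<Phi>)"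
 unfolding add_clauses_def by (induction Cs arbitrary: \<Phi>) (auto intro!: reduced_add_clause)

definition unsubsumed :: "nat list \<Rightarrow> nat list list \<Rightarrow> bool" where
 "unsubsumed C \<Phi> \<longleftrightarrow> (\<forall>D\<in>set \<Phi>. \<not> set D \<subseteq> set C)"

lemma add_unsubsumed:
 "unsubsumed C \<Phi> \<Longrightarrow> add_clause C \<Phi> = C # filter (\<lambda>D. \<not> set C \<subseteq> set D) \<Phi>"
 unfolding unsubsumed_def add_clause_def by (auto simp: subset_eq)

lemma unsubsumed_add: "unsubsumed C \<Phi> \<Longrightarrow> unsubsumed C' \<Phi> \<Longrightarrow> \<not> set C' \<subseteq> set C \<Longrightarrow> unsubsumed C (add_clause C' \<Phi>)"
 by (simp add: add_unsubsumed) (simp add: unsubsumed_def)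

text \<open>Applied to hearts and petals, which are proper parts of clauses of an antichain.\<close>

lemma unsubsumed_subset:
 assumes "reduced N \<Phi>" "C \<in> set \<Phi>" "set h \<subset> set C"
 shows "unsubsumed h \<Phi>"
 unfolding unsubsumed_def
proof (intro ballI notI)
 fix D assume "D \<in> set \<Phi>" "set D \<subseteq> set h"
 hence "D = C" using reduced_antichain[OF assms(1) _ assms(2)] assms(3) by blast
 thus False using \<open>set D \<subseteq> set h\<close> assms(3) by blast
qed

definition units :: "nat list list \<Rightarrow> nat" where "units \<Phi> = length (filter (\<lambda>C. length C = 1) \<Phi>)"
definition binaries :: "nat list list \<Rightarrow> nat" where "binaries \<Phi> = length (filter (\<lambda>C. length C = 2) \<Phi>)"
definition degree2 :: "nat list list \<Rightarrow> nat \<Rightarrow> nat" where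
 "degree2 \<Phi> l = length (filter (\<lambda>C. length C = 2 \<and> l \<in> set C) \<Phi>)"

text \<open>
 Every round either adds a unit clause, which costs at most \<open>2 * d\<close> binary clauses, or adds binary
 clauses. While some literal lies in more than \<open>2 * d\<close> binary clauses, binary clauses do not count.
\<close>

definition potential :: "nat \<Rightarrow> nat \<Rightarrow> nat list list \<Rightarrow> real" where
 "potential N d \<Phi> = 4 * d * (2 * N - real (units \<Phi>)) + 4 * N * d -
   (if \<forall>l. degree2 \<Phi> l \<le> 2 * d then real (binaries \<Phi>) else 0)"

lemma card_le_set: assumes "distinct xs" "inj_on f (set xs)" "f ` set xs \<subseteq> A" "finite A"
 shows "length xs \<le> card A"
 using card_mono[OF assms(4,3)] by (simp add: card_image[OF assms(2)] distinct_card[OF assms(1)])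

lemma units_le: assumes "reduced N \<Phi>" shows "units \<Phi> \<le> 2 * N"
proof -
 let ?F = "filter (\<lambda>C. length C = 1) \<Phi>"
 have "length ?F \<le> card {..<2 * N}"
 proof (rule card_le_set[where f = hd])
  show "distinct ?F" using reduced_distinct[OF assms] by simp
  show "inj_on hd (set ?F)" by (auto simp: inj_on_def length_Suc_conv)
  show "hd ` set ?F \<subseteq> {..<2 * N}" using assms unfolding reduced_def good_clause_def
   by (force simp: length_Suc_conv)
 qed simp
 thus ?thesis by (simp add: units_def)
qed

lemma binaries_le: assumes "reduced N \<Phi>" "\<And>l. degree2 \<Phi> l \<le> m" shows "binaries \<Phi> \<le> 2 * N * m"
proof -
 let ?F = "filter (\<lambda>C. length C = 2) \<Phi>"
 have "set ?F \<subseteq> (\<Union>l<2 * N. set (filter (\<lambda>C. length C = 2 \<and> l \<in> set C) \<Phi>))"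
  using assms(1) unfolding reduced_def good_clause_def
  by (auto simp: length_Suc_conv numeral_2_eq_2; force)
 hence "card (set ?F) \<le> card (\<Union>l<2 * N. set (filter (\<lambda>C. length C = 2 \<and> l \<in> set C) \<Phi>))"
  by (intro card_mono) auto
 also have "\<dots> \<le> (\<Sum>l<2 * N. card (set (filter (\<lambda>C. length C = 2 \<and> l \<in> set C) \<Phi>)))"
  by (intro card_UN_le) auto
 also have "\<dots> \<le> (\<Sum>l<2 * N. m)"
  by (intro sum_mono order.trans[OF card_length]) (use assms(2) in \<open>simp add: degree2_def\<close>)
 finally show ?thesis using distinct_card[of ?F] reduced_distinct[OF assms(1)] by (simp add: binaries_def)
qed

lemma potential_eq: "potential N d \<Phi> = 4 * real d * (2 * real N - real (units \<Phi>)) + 4 * real N * real d -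
   (if \<forall>l. degree2 \<Phi> l \<le> 2 * d then real (binaries \<Phi>) else 0)"
 by (simp add: potential_def)

text \<open>There are at most \<open>2 * N\<close> unit clauses, and degrees of at most
  \<open>2 * d\<close> leave room for at most \<open>2 * N * (2 * d)\<close> binary clauses; the
  summand \<open>4 * N * d\<close> pays for the latter.\<close>

lemma potential_nonneg: assumes "reduced N \<Phi>" shows "0 \<le> potential N d \<Phi>"
proof -
 have "4 * real d * (2 * real N - real (units \<Phi>)) \<ge> 0" using units_le[OF assms] by simp
 moreover have "(if \<forall>l. degree2 \<Phi> l \<le> 2 * d then real (binaries \<Phi>) else 0) \<le> 4 * real N * real d"
 proof (cases "\<forall>l. degree2 \<Phi> l \<le> 2 * d")
  case True
  hence "binaries \<Phi> \<le> 2 * N * (2 * d)" using binaries_le[OF assms] by blast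
  hence "real (binaries \<Phi>) \<le> real (2 * N * (2 * d))" by (simp only: of_nat_le_iff)
  thus ?thesis using True by simp
 qed auto
 ultimately show ?thesis unfolding potential_eq by linarith
qed

lemma potential_le: "potential N d \<Phi> \<le> 12 * d * N"
proof -
 have "4 * real d * (2 * real N - real (units \<Phi>)) \<le> 4 * real d * (2 * real N)" by (intro mult_left_mono) auto
 thus ?thesis unfolding potential_eq by (auto simp: algebra_simps)
qed

lemma length_filter_mono: "(\<And>x. P x \<Longrightarrow> Q x) \<Longrightarrow> length (filter P xs) \<le> length (filter Q xs)"
 by (induction xs) auto

lemma length_filter_le_add: "length (filter P xs) \<le> length (filter Q (filter P xs)) + length (filter (\<lambda>x. P x \<and> \<not> Q x) xs)"
 by (induction xs) auto

text \<open>The unit clause brings \<open>4 * d\<close> and deletes the binary clauses through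
  \<open>m\<close>. If binary clauses count, there are at most \<open>2 * d\<close> of these. If the
  degrees become small only now, the newly counted binary clauses lower the potential
  further.\<close>

lemma potential_add_unit:
 assumes "reduced N \<Phi>" "unsubsumed [m] \<Phi>"
 shows "potential N d (add_clause [m] \<Phi>) \<le> potential N d \<Phi> - 2 * d"
  and "\<forall>l. degree2 \<Phi> l \<le> 2 * d \<Longrightarrow> \<forall>l. degree2 (add_clause [m] \<Phi>) l \<le> 2 * d"
proof -
 note eq = add_unsubsumed[OF assms(2)]
 have deg: "degree2 (add_clause [m] \<Phi>) l \<le> degree2 \<Phi> l" for l
  unfolding eq degree2_def by (auto simp: filter_filter intro!: length_filter_mono)
 thus inv: "\<forall>l. degree2 \<Phi> l \<le> 2 * d \<Longrightarrow> \<forall>l. degree2 (add_clause [m] \<Phi>) l \<le> 2 * d"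
  by (meson order.trans)
 have "filter (\<lambda>C. length C = 1) (filter (\<lambda>D. \<not> set [m] \<subseteq> set D) \<Phi>) = filter (\<lambda>C. length C = 1) \<Phi>"
  using assms(2) by (auto simp: unsubsumed_def filter_filter length_Suc_conv intro!: filter_cong)
 hence u: "units (add_clause [m] \<Phi>) = Suc (units \<Phi>)" unfolding eq units_def by simp
 have t: "binaries \<Phi> \<le> binaries (add_clause [m] \<Phi>) + degree2 \<Phi> m"
  using length_filter_le_add[of "\<lambda>C. length C = 2" \<Phi> "\<lambda>D. \<not> set [m] \<subseteq> set D"]
  unfolding eq binaries_def degree2_def by (simp add: filter_filter conj_commute)
 have t': "real (binaries \<Phi>) \<le> binaries (add_clause [m] \<Phi>) + 2 * d" if "\<forall>l. degree2 \<Phi> l \<le> 2 * d"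
  using t that[rule_format, of m] by linarith
 show "potential N d (add_clause [m] \<Phi>) \<le> potential N d \<Phi> - 2 * d"
  unfolding potential_def u using inv t' by (auto simp: algebra_simps)
qed

lemma potential_add_units:
 assumes "reduced N \<Phi>" "distinct ms" "\<And>m. m \<in> set ms \<Longrightarrow> unsubsumed [m] \<Phi>" "set ms \<subseteq> {..<2 * N}"
 shows "potential N d (add_clauses (map (\<lambda>m. [m]) ms) \<Phi>) \<le> potential N d \<Phi> - 2 * d * length ms"
 using assms
proof (induction ms arbitrary: \<Phi>)
 case (Cons m ms)
 have "reduced N (add_clause [m] \<Phi>)" using Cons.prems by (intro reduced_add_clause) (auto simp: good_clause_def)
 moreover have "unsubsumed [k] (add_clause [m] \<Phi>)" if "k \<in> set ms" for k
  using Cons.prems that by (intro unsubsumed_add) auto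
 ultimately have "potential N d (add_clauses (map (\<lambda>m. [m]) ms) (add_clause [m] \<Phi>)) \<le>
   potential N d (add_clause [m] \<Phi>) - 2 * d * length ms" using Cons.prems by (intro Cons.IH) auto
 also have "potential N d (add_clause [m] \<Phi>) \<le> potential N d \<Phi> - 2 * d"
  using Cons.prems by (intro potential_add_unit) auto
 finally show ?case by (simp add: add_clauses_def algebra_simps)
qed (simp add: add_clauses_def)

text \<open>A binary clause that is not absorbed itself can absorb only longer clauses.\<close>

lemma add_binary:
 assumes "reduced N \<Phi>" "unsubsumed C \<Phi>" "length C = 2" "distinct C"
 shows "units (add_clause C \<Phi>) = units \<Phi>" "binaries (add_clause C \<Phi>) = Suc (binaries \<Phi>)"
  "degree2 (add_clause C \<Phi>) l = degree2 \<Phi> l + of_bool (l \<in> set C)"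
proof -
 note eq = add_unsubsumed[OF assms(2)]
 have *: "\<not> set C \<subseteq> set D" if "D \<in> set \<Phi>" "length D \<le> 2" for D
 proof
  assume "set C \<subseteq> set D"
  moreover have "card (set D) \<le> card (set C)"
   using card_length[of D] that(2) distinct_card[OF assms(4)] assms(3) by simp
  ultimately have "set D = set C" by (metis List.finite_set card_seteq)
  thus False using assms(2) that(1) by (auto simp: unsubsumed_def)
 qed
 have "filter (\<lambda>C. length C = 1) (filter (\<lambda>D. \<not> set C \<subseteq> set D) \<Phi>) = filter (\<lambda>C. length C = 1) \<Phi>"
  unfolding filter_filter using * by (intro filter_cong) auto
 thus "units (add_clause C \<Phi>) = units \<Phi>" unfolding eq units_def using assms(3) by simp
 have "filter (\<lambda>C. length C = 2) (filter (\<lambda>D. \<not> set C \<subseteq> set D) \<Phi>) = filter (\<lambda>C. length C = 2) \<Phi>"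
  unfolding filter_filter using * by (intro filter_cong) auto
 thus "binaries (add_clause C \<Phi>) = Suc (binaries \<Phi>)" unfolding eq binaries_def using assms(3) by simp
 have "filter (\<lambda>C. length C = 2 \<and> l \<in> set C) (filter (\<lambda>D. \<not> set C \<subseteq> set D) \<Phi>) =
   filter (\<lambda>C. length C = 2 \<and> l \<in> set C) \<Phi>"
  unfolding filter_filter using * by (intro filter_cong) auto
 thus "degree2 (add_clause C \<Phi>) l = degree2 \<Phi> l + of_bool (l \<in> set C)"
  unfolding eq degree2_def using assms(3) by simp
qed

lemma add_binaries:
 assumes "reduced N \<Phi>" "\<And>C. C \<in> set Cs \<Longrightarrow> unsubsumed C \<Phi> \<and> length C = 2 \<and> good_clause N C"
  and "sorted_wrt (\<lambda>C D. set C \<noteq> set D) Cs"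
 shows "units (add_clauses Cs \<Phi>) = units \<Phi>" "binaries (add_clauses Cs \<Phi>) = binaries \<Phi> + length Cs"
  "degree2 (add_clauses Cs \<Phi>) l = degree2 \<Phi> l + length (filter (\<lambda>C. l \<in> set C) Cs)"
proof -
 have "units (add_clauses Cs \<Phi>) = units \<Phi> \<and> binaries (add_clauses Cs \<Phi>) = binaries \<Phi> + length Cs \<and>
  degree2 (add_clauses Cs \<Phi>) l = degree2 \<Phi> l + length (filter (\<lambda>C. l \<in> set C) Cs)"
  using assms
 proof (induction Cs arbitrary: \<Phi>)
  case (Cons C Cs)
  have C: "unsubsumed C \<Phi>" "length C = 2" "good_clause N C" "distinct C"
   using Cons.prems(2)[of C] by (auto simp: good_clause_def)
  have "unsubsumed D (add_clause C \<Phi>)" if D: "D \<in> set Cs" for D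
  proof (rule unsubsumed_add)
   show "unsubsumed D \<Phi>" using Cons.prems(2) D by simp
   have "card (set C) = 2" "card (set D) = 2" using Cons.prems(2)[of D] C D by (auto simp: distinct_card good_clause_def)
   thus "\<not> set C \<subseteq> set D" using Cons.prems(3) D by (auto dest: card_seteq[rotated])
  qed (rule C)
  thus ?case
   using Cons.IH[of "add_clause C \<Phi>"] add_binary[OF Cons.prems(1) C(1,2,4)] reduced_add_clause[OF Cons.prems(1) C(3)] Cons.prems
   by (simp add: add_clauses_def)
 qed (simp add: add_clauses_def)
 thus "units (add_clauses Cs \<Phi>) = units \<Phi>" "binaries (add_clauses Cs \<Phi>) = binaries \<Phi> + length Cs"
  "degree2 (add_clauses Cs \<Phi>) l = degree2 \<Phi> l + length (filter (\<lambda>C. l \<in> set C) Cs)" by auto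
qed

definition is_leaf :: "nat \<Rightarrow> nat \<Rightarrow> nat list list \<Rightarrow> bool" where
 "is_leaf d e \<Phi> \<longleftrightarrow> (\<forall>c\<in>set (candidates d e \<Phi>). length (flower (fst c) (fst (snd c)) \<Phi>) < snd (snd c))"

lemma branch_leaf: "is_leaf d e \<Phi> \<Longrightarrow> branch d e \<Phi> = [\<Phi>]"
proof -
 assume "is_leaf d e \<Phi>"
 hence "filter (\<lambda>c. snd (snd c) \<le> length (flower (fst c) (fst (snd c)) \<Phi>)) (candidates d e \<Phi>) = []"
  unfolding is_leaf_def filter_empty_conv by (auto simp: not_le)
 thus ?thesis unfolding branch_def by simp
qed

text \<open>Petals differ because their clauses do, and they are not absorbed because they are
  proper parts of clauses. The last claim turns degrees among the petals into sizes of flowers with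
  a larger heart, which the order of the candidates keeps small.\<close>

lemma flower_petals:
 assumes "reduced N \<Phi>" "h \<noteq> []" "distinct h" "length h < c"
 defines "Ps \<equiv> map (\<lambda>C. filter (\<lambda>l. l \<notin> set h) C) (flower c h \<Phi>)"
 shows "P \<in> set Ps \<Longrightarrow> unsubsumed P \<Phi> \<and> length P = c - length h \<and> good_clause N P"
  and "sorted_wrt (\<lambda>C D. set C \<noteq> set D) Ps"
  and "flower c h \<Phi> \<noteq> [] \<Longrightarrow> unsubsumed h \<Phi> \<and> (length h \<le> 3 \<longrightarrow> good_clause N h)"
  and "l \<notin> set h \<Longrightarrow> length (filter (\<lambda>P. l \<in> set P) Ps) = length (flower c (l # h) \<Phi>)"
proof -
 have F: "C \<in> set \<Phi>" "length C = c" "set h \<subseteq> set C" "good_clause N C" if "C \<in> set (flower c h \<Phi>)" for C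
  using that assms(1) by (auto simp: flower_def reduced_def)
 have sub: "set h \<subset> set C" if C: "C \<in> set (flower c h \<Phi>)" for C
 proof -
  have "card (set h) < card (set C)" using F(2,4)[OF C] assms(3,4) by (simp add: good_clause_def distinct_card)
  thus ?thesis using F(3)[OF C] by auto
 qed
 show "unsubsumed h \<Phi> \<and> (length h \<le> 3 \<longrightarrow> good_clause N h)" if ne: "flower c h \<Phi> \<noteq> []"
 proof -
  obtain C where C: "C \<in> set (flower c h \<Phi>)" using ne by (meson list.set_sel(1))
  show ?thesis using unsubsumed_subset[OF assms(1) F(1)[OF C]] sub[OF C] F(4)[OF C] C assms(3)
   by (auto simp: good_clause_def)
 qed
 show "unsubsumed P \<Phi> \<and> length P = c - length h \<and> good_clause N P" if "P \<in> set Ps"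
 proof -
  from that obtain C where C: "C \<in> set (flower c h \<Phi>)" "P = filter (\<lambda>l. l \<notin> set h) C" by (auto simp: Ps_def)
  have P: "set P = set C - set h" "distinct P" using C(2) F(4)[OF C(1)] by (auto simp: good_clause_def)
  hence "length P = card (set C) - card (set h)"
   using F(3)[OF C(1)] by (simp add: card_Diff_subset distinct_card[symmetric])
  hence "length P = c - length h" using F(2,4)[OF C(1)] assms(3) by (simp add: good_clause_def distinct_card)
  moreover have "set P \<subset> set C" using P F(3)[OF C(1)] assms(2) by (cases h) auto
  hence "unsubsumed P \<Phi>" using unsubsumed_subset[OF assms(1) F(1)[OF C(1)]] by blast
  moreover have "good_clause N P" using P F(4)[OF C(1)] F(2)[OF C(1)] calculation(1) by (auto simp: good_clause_def)
  ultimately show ?thesis by simp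
 qed
 have "sorted_wrt (\<lambda>C D. \<not> set C \<subseteq> set D \<and> \<not> set D \<subseteq> set C) (flower c h \<Phi>)"
  using assms(1) by (simp add: reduced_def flower_def sorted_wrt_filter)
 thus "sorted_wrt (\<lambda>C D. set C \<noteq> set D) Ps"
  unfolding Ps_def sorted_wrt_map
 proof (rule sorted_wrt_mono_rel[rotated])
  fix C D assume "C \<in> set (flower c h \<Phi>)" "D \<in> set (flower c h \<Phi>)" "\<not> set C \<subseteq> set D \<and> \<not> set D \<subseteq> set C"
  thus "set (filter (\<lambda>l. l \<notin> set h) C) \<noteq> set (filter (\<lambda>l. l \<notin> set h) D)"
   using F(3) by auto
 qed
 show "length (filter (\<lambda>P. l \<in> set P) Ps) = length (flower c (l # h) \<Phi>)" if "l \<notin> set h"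
 proof -
  have "filter (\<lambda>C. l \<in> set C) (flower c h \<Phi>) = flower c (l # h) \<Phi>"
   unfolding flower_def filter_filter by (intro filter_cong) auto
  thus ?thesis using that unfolding Ps_def filter_map o_def by simp
 qed
qed

lemma degree2_flower: "degree2 \<Phi> l = length (flower 2 [l] \<Phi>)"
 by (simp add: degree2_def flower_def)

text \<open>Used to read off the priority among the three kinds of candidates.\<close>

lemma filter_append_Cons:
 assumes "filter P (xs @ ys @ zs) = c # cs"
 shows "(c \<in> set xs \<or> (\<forall>x\<in>set xs. \<not> P x) \<and> c \<in> set ys \<or> (\<forall>x\<in>set xs \<union> set ys. \<not> P x) \<and> c \<in> set zs) \<and> P c"
proof -
 have mem: "z \<in> set zs \<and> P z" if "filter P zs = z # us" for z zs us
 proof -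
  have "z \<in> set (filter P zs)" unfolding that by simp
  thus ?thesis by simp
 qed
 consider "filter P xs \<noteq> []" | "filter P xs = []" "filter P ys \<noteq> []" | "filter P xs = []" "filter P ys = []" by blast
 thus ?thesis
 proof cases
  case 1
  hence "filter P xs = c # tl (filter P xs)" using assms by (cases "filter P xs") simp_all
  from mem[OF this] show ?thesis by simp
 next
  case 2
  hence "filter P ys = c # tl (filter P ys)" using assms by (cases "filter P ys") simp_all
  from mem[OF this] 2(1) show ?thesis by (simp add: filter_empty_conv)
 next
  case 3
  hence "filter P zs = c # cs" using assms by simp
  from mem[OF this] 3 show ?thesis by (auto simp: filter_empty_conv)
 qed
qed

text \<open>The pairs list the drops for the heart and for the petals. A literal in \<open>d\<close>
  binary clauses: one unit or \<open>d\<close> units. Two literals in \<open>d\<close> ternary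
  clauses: one binary clause or \<open>d\<close> units. A literal in \<open>e\<close> ternary
  clauses: one unit or \<open>e\<close> binary clauses. Binary clauses are added only when all
  degrees are below \<open>d\<close>; the degrees then stay within \<open>2 * d\<close>, and the new
  clauses count.\<close>

lemma branch_step:
 assumes red: "reduced N \<Phi>" and de: "0 < d" "0 < e" and nl: "\<not> is_leaf d e \<Phi>"
 obtains A B x y where "branch d e \<Phi> = [A, B]" "reduced N A" "reduced N B"
  "potential N d A \<le> potential N d \<Phi> - x" "potential N d B \<le> potential N d \<Phi> - y"
  "(x, y) \<in> {(2 * real d, 2 * real d * d), (1, 2 * real d * d), (2 * real d, real e)}"
proof -
 let ?P = "\<lambda>c. snd (snd c) \<le> length (flower (fst c) (fst (snd c)) \<Phi>)"
 from nl have "filter ?P (candidates d e \<Phi>) \<noteq> []" by (auto simp: is_leaf_def filter_empty_conv not_less)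
 then obtain c cs where c: "filter ?P (candidates d e \<Phi>) = c # cs" by (cases "filter ?P (candidates d e \<Phi>)") auto
 obtain n h t where cc: "c = (n, h, t)" by (cases c)
 define Ps where "Ps = map (\<lambda>C. filter (\<lambda>l. l \<notin> set h) C) (flower n h \<Phi>)"
 have B: "branch d e \<Phi> = [add_clause h \<Phi>, add_clauses Ps \<Phi>]"
  unfolding branch_def c by (simp add: cc Ps_def)
 let ?A = "map (\<lambda>l. (2, [l], d)) (concat \<Phi>)" and ?C = "map (\<lambda>l. (3, [l], e)) (concat \<Phi>)"
 let ?B = "concat (map (\<lambda>l. map (\<lambda>m. (3, [l, m], d)) (filter (\<lambda>m. m \<noteq> l) (concat \<Phi>))) (concat \<Phi>))"
 have "filter ?P (?A @ ?B @ ?C) = c # cs" using c unfolding candidates_def .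
 note cands = filter_append_Cons[of ?P ?A ?B ?C c cs, OF this]
 have t: "t \<le> length (flower n h \<Phi>)" using cands by (simp add: cc)
 have kinds: "(\<exists>l. n = 2 \<and> h = [l] \<and> t = d) \<or> (\<exists>l m. l \<noteq> m \<and> n = 3 \<and> h = [l, m] \<and> t = d \<and> (\<forall>l. degree2 \<Phi> l < d)) \<or>
   (\<exists>l. n = 3 \<and> h = [l] \<and> t = e \<and> (\<forall>l. degree2 \<Phi> l < d) \<and> (\<forall>l m. l \<noteq> m \<longrightarrow> length (flower 3 [l, m] \<Phi>) < d))"
 proof -
  have 1: "\<forall>l. degree2 \<Phi> l < d" if "\<forall>x\<in>set (map (\<lambda>l. (2, [l], d)) (concat \<Phi>)). \<not> ?P x"
  proof
   fix l show "degree2 \<Phi> l < d"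
   proof (cases "l \<in> set (concat \<Phi>)")
    case True
    thus ?thesis using that by (auto simp: degree2_flower not_le)
   next
    case False
    hence "flower 2 [l] \<Phi> = []" by (auto simp: flower_def filter_empty_conv)
    thus ?thesis using de by (simp add: degree2_flower)
   qed
  qed
  have 2: "\<forall>l m. l \<noteq> m \<longrightarrow> length (flower 3 [l, m] \<Phi>) < d"
   if "\<forall>x\<in>set (concat (map (\<lambda>l. map (\<lambda>m. (3, [l, m], d)) (filter (\<lambda>m. m \<noteq> l) (concat \<Phi>))) (concat \<Phi>))). \<not> ?P x"
  proof (intro allI impI)
   fix l m :: nat assume lm: "l \<noteq> m"
   show "length (flower 3 [l, m] \<Phi>) < d"
   proof (cases "l \<in> set (concat \<Phi>) \<and> m \<in> set (concat \<Phi>)")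
    case True
    hence "(3, [l, m], d) \<in> set (concat (map (\<lambda>l. map (\<lambda>m. (3, [l, m], d)) (filter (\<lambda>m. m \<noteq> l) (concat \<Phi>))) (concat \<Phi>)))"
     using lm by fastforce
    from that[rule_format, OF this] show ?thesis by simp
   next
    case False
    hence "flower 3 [l, m] \<Phi> = []" by (auto simp: flower_def filter_empty_conv)
    thus ?thesis using de by simp
   qed
  qed
  from cands consider "c \<in> set ?A" | "\<forall>x\<in>set ?A. \<not> ?P x" "c \<in> set ?B"
   | "\<forall>x\<in>set ?A. \<not> ?P x" "\<forall>x\<in>set ?B. \<not> ?P x" "c \<in> set ?C" by blast
  thus ?thesis
  proof cases
   case c1: 1
   thus ?thesis unfolding cc by auto
  next
   case c2: 2
   hence "\<exists>l m. l \<noteq> m \<and> n = 3 \<and> h = [l, m] \<and> t = d" unfolding cc by auto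
   thus ?thesis using 1[OF c2(1)] by blast
  next
   case c3: 3
   hence "\<exists>l. n = 3 \<and> h = [l] \<and> t = e" unfolding cc by auto
   thus ?thesis using 1[OF c3(1)] 2[OF c3(2)] by blast
  qed
 qed
 have ne: "flower n h \<Phi> \<noteq> []" using t kinds de by auto
 have lenPs: "length Ps = length (flower n h \<Phi>)" by (simp add: Ps_def)
 have hn: "h \<noteq> []" "distinct h" "length h < n" using kinds by auto
 note FP = flower_petals[OF red hn, folded Ps_def]
 have hgood: "unsubsumed h \<Phi>" "good_clause N h" using FP(3)[OF ne] kinds by auto
 have R: "reduced N (add_clause h \<Phi>)" "reduced N (add_clauses Ps \<Phi>)"
  using red hgood FP(1) by (auto intro: reduced_add_clause reduced_add_clauses)
 have units_case: "potential N d (add_clauses Ps \<Phi>) \<le> potential N d \<Phi> - 2 * real d * d"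
  if "n - length h = 1" "t = d"
 proof -
  define ms where "ms = map hd Ps"
  have 1: "C = [hd C]" if "C \<in> set Ps" for C using FP(1)[OF that] \<open>n - length h = 1\<close> by (auto simp: length_Suc_conv)
  have Ps: "Ps = map (\<lambda>m. [m]) ms" unfolding ms_def map_map o_def using 1 by (simp add: map_idI)
  have "distinct ms" using FP(2) unfolding Ps sorted_wrt_map by (induction ms) auto
  hence "potential N d (add_clauses Ps \<Phi>) \<le> potential N d \<Phi> - 2 * d * length ms"
   unfolding Ps by (rule potential_add_units[OF red]) (use FP(1) in \<open>fastforce simp: Ps good_clause_def\<close>)+
  moreover have "2 * real d * d \<le> 2 * d * length ms" using t lenPs \<open>t = d\<close>
   by (simp add: ms_def mult_left_mono)
  ultimately show ?thesis by linarith
 qed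
 from kinds consider l where "n = 2" "h = [l]" "t = d"
  | l m where "l \<noteq> m" "n = 3" "h = [l, m]" "t = d" "\<forall>l. degree2 \<Phi> l < d"
  | l where "n = 3" "h = [l]" "t = e" "\<forall>l. degree2 \<Phi> l < d" "\<forall>l m. l \<noteq> m \<longrightarrow> length (flower 3 [l, m] \<Phi>) < d"
  by blast
 thus thesis
 proof cases
  case 1
  show thesis
   by (rule that[OF B R _ units_case, of "2 * real d"])
    (use 1 potential_add_unit(1)[OF red, of l d] hgood in auto)
 next
  case 2
  have "degree2 \<Phi> l \<le> 2 * d" for l using 2(5)[rule_format, of l] by simp
  hence small: "\<forall>l. degree2 \<Phi> l \<le> 2 * d" by blast
  have "length h = 2" "distinct h" using 2 by auto
  note ab = add_binary[OF red hgood(1) this]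
  have "degree2 (add_clause h \<Phi>) l \<le> 2 * d" for l
   using ab(3)[of l] 2(5)[rule_format, of l] by simp
  hence "potential N d (add_clause h \<Phi>) \<le> potential N d \<Phi> - 1"
   unfolding potential_def using small ab 2 by simp
  thus thesis by (rule that[OF B R _ units_case]) (use 2 in auto)
 next
  case 3
  have "degree2 \<Phi> l \<le> 2 * d" for l using 3(4)[rule_format, of l] by simp
  hence small: "\<forall>l. degree2 \<Phi> l \<le> 2 * d" by blast
  have P: "unsubsumed C \<Phi> \<and> length C = 2 \<and> good_clause N C" if "C \<in> set Ps" for C
   using FP(1)[OF that] 3 by simp
  note ab = add_binaries[OF red P FP(2)]
  have "degree2 (add_clauses Ps \<Phi>) m \<le> 2 * d" for m
  proof -
   have "length (filter (\<lambda>C. m \<in> set C) Ps) < d"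
   proof (cases "m = l")
    case True
    hence "filter (\<lambda>C. m \<in> set C) Ps = []" using 3(2) by (auto simp: filter_empty_conv Ps_def)
    thus ?thesis using de by simp
   next
    case False
    thus ?thesis using FP(4)[of m] 3 by auto
   qed
   thus ?thesis using ab(3)[of m] 3(4)[rule_format, of m] by simp
  qed
  hence PB: "potential N d (add_clauses Ps \<Phi>) \<le> potential N d \<Phi> - e"
   unfolding potential_def using small ab(1,2) t lenPs 3(3) by simp
  have "potential N d (add_clause h \<Phi>) \<le> potential N d \<Phi> - 2 * real d"
   using 3 potential_add_unit(1)[OF red, of l d] hgood by auto
  thus thesis by (rule that[OF B R _ PB]) simp
 qed
qed

text \<open>The three inequalities say that the weight \<open>2 powr (r * potential)\<close> of a
  formula is at least the total weight of its two successors. Every weight is at least 1, so the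
  initial weight bounds the number of leaves. Each branching also lowers the potential by at least
  1, which bounds the depth.\<close>

theorem leaves_invariant:
 assumes red: "reduced N \<Phi>" and de: "0 < d" "0 < e" and r: "0 \<le> r"
  and 1: "2 powr (- r * (2 * d)) + 2 powr (- r * (2 * d * d)) \<le> 1"
  and 2: "2 powr (- r) + 2 powr (- r * (2 * d * d)) \<le> 1"
  and 3: "2 powr (- r * (2 * d)) + 2 powr (- r * e) \<le> 1"
 shows "\<Psi> \<in> set (leaves d e rs [\<Phi>]) \<Longrightarrow> reduced N \<Psi>"
  and "real (length (leaves d e rs [\<Phi>])) \<le> 2 powr (r * real (12 * d * N))"
  and "12 * d * N < length rs \<Longrightarrow> \<Psi> \<in> set (leaves d e rs [\<Phi>]) \<Longrightarrow> is_leaf d e \<Psi>"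
proof -
 let ?p = "potential N d"
 let ?w = "\<lambda>\<Psi>. 2 powr (r * ?p \<Psi>)"
 have step: "(\<forall>\<Psi>'\<in>set (branch d e \<Psi>). reduced N \<Psi>' \<and> (is_leaf d e \<Psi>' \<or> ?p \<Psi>' \<le> ?p \<Psi> - 1)) \<and>
   (\<Sum>\<Psi>'\<leftarrow>branch d e \<Psi>. ?w \<Psi>') \<le> ?w \<Psi>" if \<Psi>: "reduced N \<Psi>" for \<Psi>
 proof (cases "is_leaf d e \<Psi>")
  case True
  thus ?thesis using branch_leaf[OF True] \<Psi> by simp
 next
  case False
  from branch_step[OF \<Psi> de this] obtain A B x y where AB: "branch d e \<Psi> = [A, B]" "reduced N A" "reduced N B"
   "?p A \<le> ?p \<Psi> - x" "?p B \<le> ?p \<Psi> - y"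
   "(x, y) \<in> {(2 * real d, 2 * real d * d), (1, 2 * real d * d), (2 * real d, real e)}" .
  have "1 \<le> 2 * real d" "1 \<le> real e" "1 \<le> real d" using de by auto
  moreover have "1 * 1 \<le> 2 * real d * d" using de by (intro mult_mono) auto
  ultimately have xy: "1 \<le> x" "1 \<le> y" using AB(6) by auto
  have "2 powr (- r * x) + 2 powr (- r * y) \<le> 1" using AB(6) 1 2 3 by auto
  hence "?w \<Psi> * (2 powr (- r * x) + 2 powr (- r * y)) \<le> ?w \<Psi> * 1" by (intro mult_left_mono) auto
  moreover have "?w A \<le> ?w \<Psi> * 2 powr (- r * x)" "?w B \<le> ?w \<Psi> * 2 powr (- r * y)"
   using mult_left_mono[OF AB(4) r] mult_left_mono[OF AB(5) r] by (simp_all add: powr_add[symmetric] algebra_simps)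
  ultimately have "?w A + ?w B \<le> ?w \<Psi>" by (simp add: algebra_simps)
  thus ?thesis using AB xy by auto
 qed
 have "(\<forall>\<Psi>\<in>set (leaves d e rs [\<Phi>]). reduced N \<Psi> \<and> (is_leaf d e \<Psi> \<or> ?p \<Psi> \<le> ?p \<Phi> - length rs)) \<and>
   (\<Sum>\<Psi>\<leftarrow>leaves d e rs [\<Phi>]. ?w \<Psi>) \<le> ?w \<Phi>"
 proof (induction rs rule: rev_induct)
  case Nil
  thus ?case using red by (simp add: leaves_def)
 next
  case (snoc s rs)
  let ?L = "leaves d e rs [\<Phi>]"
  have L: "leaves d e (rs @ [s]) [\<Phi>] = concat (map (branch d e) ?L)" by (simp add: leaves_def)
  have "reduced N \<Psi>' \<and> (is_leaf d e \<Psi>' \<or> ?p \<Psi>' \<le> ?p \<Phi> - length (rs @ [s]))"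
   if "\<Psi> \<in> set ?L" "\<Psi>' \<in> set (branch d e \<Psi>)" for \<Psi> \<Psi>'
  proof (cases "is_leaf d e \<Psi>")
   case True
   thus ?thesis using that snoc branch_leaf[OF True] by auto
  next
   case False
   hence "?p \<Psi> \<le> ?p \<Phi> - length rs" "reduced N \<Psi>" using snoc that(1) by auto
   thus ?thesis using step[of \<Psi>] that(2) by fastforce
  qed
  moreover have "(\<Sum>\<Psi>'\<leftarrow>concat (map (branch d e) ?L). ?w \<Psi>') \<le> (\<Sum>\<Psi>\<leftarrow>?L. ?w \<Psi>)"
  proof -
   have "(\<Sum>\<Psi>'\<leftarrow>concat (map (branch d e) L). ?w \<Psi>') \<le> (\<Sum>\<Psi>\<leftarrow>L. ?w \<Psi>)"
    if "\<forall>\<Psi>\<in>set L. (\<Sum>\<Psi>'\<leftarrow>branch d e \<Psi>. ?w \<Psi>') \<le> ?w \<Psi>" for L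
    using that by (induction L) (auto intro: add_mono)
   thus ?thesis using snoc step by blast
  qed
  ultimately show ?case using snoc unfolding L by fastforce
 qed
 note inv = this
 show "\<Psi> \<in> set (leaves d e rs [\<Phi>]) \<Longrightarrow> reduced N \<Psi>" using inv by blast
 have "1 \<le> ?w \<Psi>" if "\<Psi> \<in> set (leaves d e rs [\<Phi>])" for \<Psi>
  using potential_nonneg[of N \<Psi> d] inv that r by (auto intro!: ge_one_powr_ge_zero)
 hence "(\<Sum>\<Psi>\<leftarrow>leaves d e rs [\<Phi>]. 1) \<le> (\<Sum>\<Psi>\<leftarrow>leaves d e rs [\<Phi>]. ?w \<Psi>)"
  by (intro sum_list_mono) auto
 also have "\<dots> \<le> ?w \<Phi>" using inv by blast
 also have "\<dots> \<le> 2 powr (r * real (12 * d * N))" using mult_left_mono[OF potential_le[of N d \<Phi>] r] by simp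
 finally show "real (length (leaves d e rs [\<Phi>])) \<le> 2 powr (r * real (12 * d * N))" by (simp add: sum_list_triv)
 show "is_leaf d e \<Psi>" if "12 * d * N < length rs" "\<Psi> \<in> set (leaves d e rs [\<Phi>])"
 proof (rule ccontr)
  assume "\<not> is_leaf d e \<Psi>"
  hence "?p \<Psi> \<le> ?p \<Phi> - length rs" "reduced N \<Psi>" using inv that(2) by auto
  moreover have "12 * real d * N < length rs" using that(1) by (metis of_nat_less_iff of_nat_mult of_nat_numeral)
  ultimately show False using potential_nonneg[of N \<Psi> d] potential_le[of N d \<Phi>] by simp
 qed
qed

text \<open>A literal is in at most one unit clause, in fewer than \<open>d\<close> binary and fewer
  than \<open>e\<close> ternary clauses, and a variable has two literals.\<close>

lemma leaf_occurrences:
 assumes "reduced N \<Phi>" "is_leaf d e \<Phi>" "0 < d" "0 < e"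
 shows "length (filter (\<lambda>C. \<exists>l\<in>set C. l div 2 = x) \<Phi>) \<le> 2 * (d + e + 1)"
proof -
 have lit: "length (filter (\<lambda>C. l \<in> set C) \<Phi>) \<le> d + e + 1" for l
 proof (cases "l \<in> set (concat \<Phi>)")
  case True
  hence "length (flower 2 [l] \<Phi>) < d" "length (flower 3 [l] \<Phi>) < e"
   using assms(2) by (auto simp: is_leaf_def candidates_def ball_Un)
  moreover have "length (flower 1 [l] \<Phi>) \<le> 1"
  proof -
   have "length (flower 1 [l] \<Phi>) \<le> card {[l]}"
    by (rule card_le_set[where f = id])
     (use reduced_distinct[OF assms(1)] in \<open>auto simp: flower_def length_Suc_conv\<close>)
   thus ?thesis by simp
  qed
  moreover have "length (filter (\<lambda>C. l \<in> set C) \<Psi>) \<le> length (flower 1 [l] \<Psi>) + length (flower 2 [l] \<Psi>) + length (flower 3 [l] \<Psi>)"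
   if "\<forall>C\<in>set \<Psi>. length C \<le> 3" for \<Psi>
   using that
  proof (induction \<Psi>)
   case (Cons C \<Psi>)
   have "length C \<in> {1, 2, 3}" if "l \<in> set C"
    using Cons.prems that by (cases C) (auto simp: le_Suc_eq numeral_eq_Suc)
   thus ?case using Cons by (auto simp: flower_def)
  qed (simp add: flower_def)
  moreover have "\<forall>C\<in>set \<Phi>. length C \<le> 3" using assms(1) by (auto simp: reduced_def good_clause_def)
  ultimately show ?thesis by fastforce
 next
  case False
  hence "filter (\<lambda>C. l \<in> set C) \<Phi> = []" by (auto simp: filter_empty_conv)
  thus ?thesis by simp
 qed
 have "length (filter (\<lambda>C. \<exists>l\<in>set C. l div 2 = x) \<Psi>) \<le>
   length (filter (\<lambda>C. 2 * x \<in> set C) \<Psi>) + length (filter (\<lambda>C. 2 * x + 1 \<in> set C) \<Psi>)" for \<Psi>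
 proof (induction \<Psi>)
  case (Cons C \<Psi>)
  have "2 * x \<in> set C \<or> 2 * x + 1 \<in> set C" if "l \<in> set C" "l div 2 = x" for l
  proof -
   have "l = 2 * x \<or> l = 2 * x + 1" using that(2) by presburger
   thus ?thesis using that(1) by auto
  qed
  thus ?case using Cons by auto
 qed simp
 from this[of \<Phi>] lit[of "2 * x"] lit[of "2 * x + 1"] show ?thesis by simp
qed

text \<open>The rate \<open>r\<close> is \<epsilon> / (12 d). For large d the gap 1 - 2 powr (- r)
  is of order \<epsilon> / d, while 2 powr (- \<epsilon> d / 6) is exponentially small. The number
  \<open>e\<close> is chosen last, for the third inequality.\<close>

lemma sparsification_constants:
 assumes "\<epsilon> > (0::real)"
 obtains d e :: nat and r :: real where "0 < d" "0 < e" "0 \<le> r" "r * (12 * d) = \<epsilon>"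
  "2 powr (- r * (2 * d)) + 2 powr (- r * (2 * d * d)) \<le> 1"
  "2 powr (- r) + 2 powr (- r * (2 * d * d)) \<le> 1"
  "2 powr (- r * (2 * d)) + 2 powr (- r * e) \<le> 1"
proof -
 have "\<forall>\<^sub>F d in at_top. 2 powr (- (\<epsilon> / (12 * d))) + 2 powr (- (\<epsilon> * d / 6)) \<le> 1"
  using assms by real_asymp
 hence "\<forall>\<^sub>F d in sequentially. 2 powr (- (\<epsilon> / (12 * real d))) + 2 powr (- (\<epsilon> * real d / 6)) \<le> 1"
  by (rule eventually_compose_filterlim[OF _ filterlim_real_sequentially])
 then obtain d :: nat where d: "d > 0" "2 powr (- (\<epsilon> / (12 * real d))) + 2 powr (- (\<epsilon> * real d / 6)) \<le> 1"
  using eventually_conj[OF eventually_gt_at_top[of 0]] eventually_sequentially by (metis (mono_tags, lifting) order_refl)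
 define r where "r = \<epsilon> / (12 * d)"
 have r: "r > 0" "r * (2 * d) = \<epsilon> / 6" "r * (2 * d * d) = \<epsilon> * d / 6" using assms d(1) by (auto simp: r_def)
 have "2 powr (- (\<epsilon> / 6)) < (2::real) powr 0" using assms by (intro powr_less_mono) auto
 hence "2 powr (- (\<epsilon> / 6)) < (1::real)" by simp
 hence "\<forall>\<^sub>F e in at_top. 2 powr (- (\<epsilon> / 6)) + 2 powr (- r * e) \<le> 1"
  using r(1) by real_asymp
 hence "\<forall>\<^sub>F e in sequentially. 2 powr (- (\<epsilon> / 6)) + 2 powr (- r * real e) \<le> 1"
  by (rule eventually_compose_filterlim[OF _ filterlim_real_sequentially])
 then obtain e :: nat where e: "e > 0" "2 powr (- (\<epsilon> / 6)) + 2 powr (- r * real e) \<le> 1"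
  using eventually_conj[OF eventually_gt_at_top[of 0]] eventually_sequentially by (metis (mono_tags, lifting) order_refl)
 show thesis
 proof (rule that)
  have eqs: "- r * real (2 * d) = - (\<epsilon> / 6)" "- r * real (2 * d * d) = - (\<epsilon> * real d / 6)"
   and eq: "- r = - (\<epsilon> / (12 * real d))" using d(1) by (auto simp: r_def)
  have "\<epsilon> / (12 * real d) \<le> \<epsilon> / 6" using assms d(1) by (intro divide_left_mono) auto
  hence "2 powr (- (\<epsilon> / 6)) \<le> (2::real) powr (- (\<epsilon> / (12 * real d)))" by simp
  thus "2 powr (- r * real (2 * d)) + 2 powr (- r * real (2 * d * d)) \<le> 1"
   unfolding eqs using d(2) by linarith
  show "2 powr (- r) + 2 powr (- r * real (2 * d * d)) \<le> 1" using d(2) unfolding eqs unfolding eq .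
  show "2 powr (- r * real (2 * d)) + 2 powr (- r * e) \<le> 1" using e(2) unfolding eqs(1) .
  show "r * (12 * d) = \<epsilon>" using d(1) by (simp add: r_def)
 qed (use d e r in auto)
qed

section \<open>The host graph of a sparse formula\<close>

lemma divmod_eq: "0 < q \<Longrightarrow> divmod x q = (x div q, x mod q)"
proof -
 assume q: "0 < q"
 have "foldl (\<lambda>p _. if snd p + 1 = q then (fst p + 1, 0) else (fst p, snd p + 1)) (0, 0) [0..<x] = (x div q, x mod q)"
  using q by (induction x) (auto simp: div_Suc mod_Suc)
 thus ?thesis by (simp add: divmod_def)
qed

lemma half_eq: "half l = l div 2" by (simp add: half_def divmod_eq)

lemma grp_eq: "0 < q \<Longrightarrow> grp q l = l div 2 mod q" by (simp add: grp_def half_eq divmod_eq)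

definition adjacent :: "nat graph \<Rightarrow> (nat \<times> nat) set" where
 "adjacent H = {(u, v). {u, v} \<in> edges H}"

abbreviation linked :: "nat graph \<Rightarrow> nat set \<Rightarrow> (nat \<times> nat) set" where
 "linked H P \<equiv> (adjacent H \<inter> P \<times> P)\<^sup>*"

text \<open>
 \<open>T\<close> contains the triples \<open>(g, w, v)\<close> such that \<open>v\<close> is on the path from the home of the
 group \<open>g\<close> to \<open>w\<close>. Only its connectedness matters, not that it is a path.
\<close>

definition routing :: "nat graph \<Rightarrow> nat \<Rightarrow> nat \<Rightarrow> (nat \<times> nat \<times> nat) set \<Rightarrow> bool" where
 "routing H q load T \<longleftrightarrow> 0 < q \<and> T \<subseteq> {..<q} \<times> verts H \<times> verts H \<and>
   (\<forall>g<q. 10 * card {w\<in>verts H. \<forall>v. (g, w, v) \<notin> T} \<le> card (verts H)) \<and>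
   (\<exists>home. \<forall>g w v. (g, w, v) \<in> T \<longrightarrow> (g, w, w) \<in> T \<and>
    (home g, v) \<in> linked H {v. (g, w, v) \<in> T}) \<and>
   (\<forall>v. card {(g, w). (g, w, v) \<in> T} \<le> load)"

text \<open>For finite graphs this is the usual notion of a core: every endomorphism is an
  automorphism.\<close>

definition core :: "nat graph \<Rightarrow> bool" where
 "core H \<longleftrightarrow> (\<forall>f. f ` verts H \<subseteq> verts H \<longrightarrow> (\<forall>u v. {u, v} \<in> edges H \<longrightarrow> {f u, f v} \<in> edges H) \<longrightarrow> inj_on f (verts H))"

definition pattern_of :: "nat graph \<Rightarrow> nat \<Rightarrow> (nat \<times> nat \<times> nat) set \<Rightarrow> pattern \<Rightarrow> bool" where
 "pattern_of H q T P \<longleftrightarrow> distinct (fst (fst P)) \<and> set (fst (fst P)) = verts H \<and> set (snd (fst P)) = adjacent H \<and>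
   set (fst (snd P)) = T \<and> snd (snd P) = q"

lemma pattern_exists:
 assumes "simple_graph H" "routing H q load T"
 obtains P where "pattern_of H q T P"
proof -
 have V: "finite (verts H)" using assms(1) by (simp add: simple_graph_def)
 have "adjacent H \<subseteq> verts H \<times> verts H" using assms(1) by (force simp: adjacent_def simple_graph_def pairs_def)
 hence "finite (adjacent H)" using V finite_subset by blast
 moreover have "finite T" using assms(2) V unfolding routing_def by (meson finite_SigmaI finite_lessThan finite_subset)
 ultimately obtain E tab where "set E = adjacent H" "set tab = T" using finite_list by meson
 moreover obtain vs where "set vs = verts H" "distinct vs" using finite_distinct_list[OF V] by blast
 ultimately show thesis by (intro that[of "((vs, E), tab, q)"]) (simp add: pattern_of_def)
qed

lemma has_path_iff: "pattern_of H q T P \<Longrightarrow> has_path P g w \<longleftrightarrow> (\<exists>v. (g, w, v) \<in> T)"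
 unfolding has_path_def pattern_of_def Bex_def split_paired_Ex by auto

lemma on_path_iff: "pattern_of H q T P \<Longrightarrow> on_path P g w v \<longleftrightarrow> (g, w, v) \<in> T"
 unfolding on_path_def pattern_of_def Bex_def split_paired_Ex by auto

lemma head_filter: "\<exists>x\<in>set xs. Q x \<Longrightarrow> head (filter Q xs) \<in> set xs \<and> Q (head (filter Q xs))"
proof -
 assume "\<exists>x\<in>set xs. Q x"
 hence "filter Q xs \<noteq> []" by (auto simp: filter_empty_conv)
 hence "head (filter Q xs) \<in> set (filter Q xs)" by (cases "filter Q xs") (auto simp: head_def simp del: set_filter)
 thus ?thesis by simp
qed

lemma sum_filter_length: "finite W \<Longrightarrow> (\<Sum>w\<in>W. length (filter (\<lambda>a. f a = w \<and> R a) as)) \<le> length (filter R as)"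
proof (induction as)
 case (Cons a as)
 have "(\<Sum>w\<in>W. length (filter (\<lambda>b. f b = w \<and> R b) (a # as))) =
   (\<Sum>w\<in>W. (if f a = w \<and> R a then 1 else 0) + length (filter (\<lambda>b. f b = w \<and> R b) as))"
  by (intro sum.cong) auto
 also have "\<dots> = (\<Sum>w\<in>W. if f a = w \<and> R a then 1 else 0) + (\<Sum>w\<in>W. length (filter (\<lambda>b. f b = w \<and> R b) as))"
  by (rule sum.distrib)
 also have "(\<Sum>w\<in>W. if f a = w \<and> R a then 1 else 0) \<le> (if R a then 1 else (0::nat))"
  using Cons.prems by (auto simp: sum.delta')
 finally show ?case using Cons by auto
qed simp

text \<open>
 For each group, at most a tenth of the vertices is unreachable and at most a tenth is full. A
 clause touches at most three groups, so a place for it always exists.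
\<close>

lemma place_exists:
 assumes T: "routing H q load T" and P: "pattern_of H q T P" and H: "simple_graph H" "verts H \<noteq> {}"
  and B: "\<And>g. g < q \<Longrightarrow> length (filter (\<lambda>a. \<exists>l\<in>set (fst a). grp q l = g) asg) \<le> B"
  and cap: "10 * B \<le> card (verts H) * cap" "0 < cap" and C: "length C \<le> 3"
 shows "place P cap (asg, C) \<in> verts H \<and> place_ok P cap (asg, C) (place P cap (asg, C))"
proof -
 let ?V = "verts H" and ?k = "card (verts H)"
 have V: "finite ?V" using H by (simp add: simple_graph_def)
 have q: "0 < q" and qP: "snd (snd P) = q" using T P by (auto simp: routing_def pattern_of_def)
 define bad where "bad l = {w\<in>?V. \<not> (has_path P (grp q l) w \<and> cnt q asg (grp q l) w < cap)}" for l
 have bad: "10 * card (bad l) \<le> 2 * ?k" for l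
 proof -
  let ?g = "grp q l"
  have g: "?g < q" using q by (simp add: grp_eq)
  let ?X = "{w\<in>?V. \<forall>v. (?g, w, v) \<notin> T}" and ?Y = "{w\<in>?V. cap \<le> cnt q asg ?g w}"
  have "bad l \<subseteq> ?X \<union> ?Y" unfolding bad_def by (auto simp: has_path_iff[OF P])
  hence "card (bad l) \<le> card (?X \<union> ?Y)" using V by (intro card_mono) auto
  also have "\<dots> \<le> card ?X + card ?Y" by (rule card_Un_le)
  finally have "card (bad l) \<le> card ?X + card ?Y" .
  moreover have "10 * card ?X \<le> ?k" using T g by (simp add: routing_def)
  moreover have "10 * card ?Y \<le> ?k"
  proof -
   have "card ?Y * cap \<le> (\<Sum>w\<in>?Y. cnt q asg ?g w)" using sum_mono[of ?Y "\<lambda>_. cap" "cnt q asg ?g"] by simp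
   also have "\<dots> \<le> (\<Sum>w\<in>?V. cnt q asg ?g w)" using V by (intro sum_mono2) auto
   also have "\<dots> \<le> B" unfolding cnt_def using sum_filter_length[OF V] B[OF g] le_trans by blast
   finally have "10 * card ?Y * cap \<le> ?k * cap" using cap(1) by linarith
   thus ?thesis using cap(2) by simp
  qed
  ultimately show ?thesis by linarith
 qed
 have "card (\<Union>l\<in>set C. bad l) < ?k"
 proof -
  have "10 * card (\<Union>l\<in>set C. bad l) \<le> 10 * (\<Sum>l\<in>set C. card (bad l))" by (intro mult_left_mono card_UN_le) auto
  also have "\<dots> = (\<Sum>l\<in>set C. 10 * card (bad l))" by (rule sum_distrib_left)
  also have "\<dots> \<le> (\<Sum>l\<in>set C. 2 * ?k)" by (intro sum_mono bad)
  also have "\<dots> \<le> 3 * (2 * ?k)" using card_length[of C] C by (simp only: sum_constant) (intro mult_right_mono, auto)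
  finally have "10 * card (\<Union>l\<in>set C. bad l) \<le> 3 * (2 * ?k)" .
  moreover have "0 < ?k" using H V by (simp add: card_gt_0_iff)
  ultimately show ?thesis by linarith
 qed
 moreover have "(\<Union>l\<in>set C. bad l) \<subseteq> ?V" by (auto simp: bad_def)
 ultimately obtain w where w: "w \<in> ?V" "w \<notin> (\<Union>l\<in>set C. bad l)" by (metis less_irrefl subsetI subset_antisym)
 hence "place_ok P cap (asg, C) w" unfolding place_ok_def bad_def qP by auto
 moreover have "set (fst (fst P)) = ?V" using P by (simp add: pattern_of_def)
 ultimately show ?thesis unfolding place_def using head_filter[of "fst (fst P)" "place_ok P cap (asg, C)"] w(1) by auto
qed

definition occurrences :: "nat list list \<Rightarrow> nat \<Rightarrow> nat" where
 "occurrences \<Phi> x = length (filter (\<lambda>C. \<exists>l\<in>set C. l div 2 = x) \<Phi>)"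

lemma group_occurrences:
 assumes "\<And>C. C \<in> set \<Phi> \<Longrightarrow> good_clause N C" "0 < q" "\<And>x. occurrences \<Phi> x \<le> D"
 shows "length (filter (\<lambda>C. \<exists>l\<in>set C. grp q l = g) \<Phi>) \<le> D * (N div q + 1)"
proof -
 let ?X = "{x\<in>{..<N}. x mod q = g}"
 have "length (filter (\<lambda>C. \<exists>l\<in>set C. grp q l = g) \<Phi>) \<le> (\<Sum>x\<in>?X. occurrences \<Phi> x)"
  using assms(1) unfolding occurrences_def
 proof (induction \<Phi>)
  case (Cons C \<Phi>)
  have "(if \<exists>l\<in>set C. grp q l = g then 1 else 0) \<le> (\<Sum>x\<in>?X. if \<exists>l\<in>set C. l div 2 = x then 1 else (0::nat))"
  proof (cases "\<exists>l\<in>set C. grp q l = g")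
   case True
   then obtain l where l: "l \<in> set C" "grp q l = g" by blast
   hence "l div 2 \<in> ?X" using Cons.prems[of C] assms(2) by (auto simp: good_clause_def grp_eq)
   hence "(if \<exists>l'\<in>set C. l' div 2 = l div 2 then 1 else 0) \<le> (\<Sum>x\<in>?X. if \<exists>l\<in>set C. l div 2 = x then 1 else (0::nat))"
    by (intro member_le_sum) auto
   moreover have "\<exists>l'\<in>set C. l' div 2 = l div 2" using l(1) by blast
   ultimately show ?thesis using True by (simp only: if_True)
  qed simp
  moreover have "(\<Sum>x\<in>?X. length (filter (\<lambda>C. \<exists>l\<in>set C. l div 2 = x) (C # \<Phi>))) =
    (\<Sum>x\<in>?X. (if \<exists>l\<in>set C. l div 2 = x then 1 else 0) + length (filter (\<lambda>C. \<exists>l\<in>set C. l div 2 = x) \<Phi>))"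
   by (intro sum.cong) auto
  moreover have "length (filter (\<lambda>C. \<exists>l\<in>set C. grp q l = g) (C # \<Phi>)) =
    (if \<exists>l\<in>set C. grp q l = g then 1 else 0) + length (filter (\<lambda>C. \<exists>l\<in>set C. grp q l = g) \<Phi>)" by simp
  moreover have "length (filter (\<lambda>C. \<exists>l\<in>set C. grp q l = g) \<Phi>) \<le>
    (\<Sum>x\<in>?X. length (filter (\<lambda>C. \<exists>l\<in>set C. l div 2 = x) \<Phi>))"
   by (rule Cons.IH) (simp add: Cons.prems)
  ultimately show ?case unfolding sum.distrib by linarith
 qed simp
 also have "\<dots> \<le> (\<Sum>x\<in>?X. D)" by (intro sum_mono assms(3))
 also have "\<dots> = D * card ?X" by simp
 also have "card ?X \<le> card {..N div q}"
 proof (rule card_inj_on_le)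
  show "inj_on (\<lambda>x. x div q) ?X" by (rule inj_onI) (metis (mono_tags, lifting) div_mult_mod_eq mem_Collect_eq)
  show "(\<lambda>x. x div q) ` ?X \<subseteq> {..N div q}" by (auto intro: div_le_mono)
 qed simp
 finally show ?thesis by simp
qed

text \<open>The clauses placed so far are a part of \<Phi>, so its occurrence bounds apply at every
  step of the greedy placement, and \<open>place_exists\<close> always provides a vertex. The
  induction is from the right because \<open>assign\<close> is a left fold.\<close>

lemma assign_invariant:
 assumes T: "routing H q load T" and P: "pattern_of H q T P" and H: "simple_graph H" "verts H \<noteq> {}"
  and \<Phi>: "\<And>C. C \<in> set \<Phi> \<Longrightarrow> good_clause N C" "\<And>x. occurrences \<Phi> x \<le> D"
  and cap: "10 * (D * (N div q + 1)) \<le> card (verts H) * cap" "0 < cap"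
 shows "fst ` set (assign P cap \<Phi>) = set \<Phi>"
  and "a \<in> set (assign P cap \<Phi>) \<Longrightarrow> snd a \<in> verts H \<and> (\<forall>l\<in>set (fst a). (grp q l, snd a, snd a) \<in> T)"
  and "cnt q (assign P cap \<Phi>) g w \<le> cap"
proof -
 have q: "0 < q" and qP: "snd (snd P) = q" using T P by (auto simp: routing_def pattern_of_def)
 have "map fst (assign P cap \<Psi>) = rev \<Psi> \<and>
   (\<forall>a\<in>set (assign P cap \<Psi>). snd a \<in> verts H \<and> (\<forall>l\<in>set (fst a). (grp q l, snd a, snd a) \<in> T)) \<and>
   (\<forall>g w. cnt q (assign P cap \<Psi>) g w \<le> cap)"
  if "(\<forall>C\<in>set \<Psi>. good_clause N C) \<and> (\<forall>x. occurrences \<Psi> x \<le> D)" for \<Psi>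
  using that
 proof (induction \<Psi> rule: rev_induct)
  case Nil
  thus ?case by (simp add: assign_def cnt_def)
 next
  case (snoc C \<Psi>)
  have good: "\<forall>C\<in>set \<Psi>. good_clause N C" using snoc.prems by simp
  have "occurrences \<Psi> x \<le> occurrences (\<Psi> @ [C]) x" for x by (simp add: occurrences_def)
  hence occ: "\<forall>x. occurrences \<Psi> x \<le> D" using snoc.prems le_trans by blast
  let ?asg = "assign P cap \<Psi>" let ?w = "place P cap (?asg, C)"
  have A: "assign P cap (\<Psi> @ [C]) = (C, ?w) # ?asg" by (simp add: assign_def)
  have IH: "map fst ?asg = rev \<Psi>" "\<forall>a\<in>set ?asg. snd a \<in> verts H \<and> (\<forall>l\<in>set (fst a). (grp q l, snd a, snd a) \<in> T)"
   "\<forall>g w. cnt q ?asg g w \<le> cap" using snoc.IH good occ by auto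
  have "length (filter (\<lambda>a. \<exists>l\<in>set (fst a). grp q l = g) ?asg) \<le> D * (N div q + 1)" for g
  proof -
   have "length (filter (\<lambda>a. \<exists>l\<in>set (fst a). grp q l = g) ?asg) = length (filter (\<lambda>C. \<exists>l\<in>set C. grp q l = g) (map fst ?asg))"
    by (simp add: filter_map o_def)
   also have "\<dots> = length (filter (\<lambda>C. \<exists>l\<in>set C. grp q l = g) \<Psi>)" by (simp add: IH(1) rev_filter[symmetric])
   also have "\<dots> \<le> D * (N div q + 1)" using good occ q by (intro group_occurrences) auto
   finally show ?thesis .
  qed
  hence w: "?w \<in> verts H" "place_ok P cap (?asg, C) ?w"
   using place_exists[OF T P H _ cap, of ?asg C] snoc.prems by (auto simp: good_clause_def)
  have "(grp q l, ?w, ?w) \<in> T" if "l \<in> set C" for l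
   using w(2) that T unfolding place_ok_def routing_def qP by (auto simp: has_path_iff[OF P]; blast)
  moreover have "cnt q (assign P cap (\<Psi> @ [C])) g v \<le> cap" for g v
  proof (cases "v = ?w \<and> (\<exists>l\<in>set C. grp q l = g)")
   case True
   hence "cnt q ?asg g v < cap" using w(2) unfolding place_ok_def qP by auto
   thus ?thesis unfolding A using True by (simp add: cnt_def)
  next
   case False
   hence "cnt q (assign P cap (\<Psi> @ [C])) g v = cnt q ?asg g v" unfolding A by (auto simp: cnt_def)
   thus ?thesis using IH(3) by simp
  qed
  ultimately show ?case using IH w(1) unfolding A by auto
 qed
 from this[of \<Phi>] \<Phi> have *: "map fst (assign P cap \<Phi>) = rev \<Phi>"
  "\<forall>a\<in>set (assign P cap \<Phi>). snd a \<in> verts H \<and> (\<forall>l\<in>set (fst a). (grp q l, snd a, snd a) \<in> T)"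
  "\<forall>g w. cnt q (assign P cap \<Phi>) g w \<le> cap" by auto
 show "fst ` set (assign P cap \<Phi>) = set \<Phi>" using arg_cong[OF *(1), of set] by simp
 show "a \<in> set (assign P cap \<Phi>) \<Longrightarrow> snd a \<in> verts H \<and> (\<forall>l\<in>set (fst a). (grp q l, snd a, snd a) \<in> T)"
  "cnt q (assign P cap \<Phi>) g w \<le> cap" using *(2,3) by auto
qed

text \<open>At most \<open>load\<close> pairs of a group and a target pass through \<open>v\<close>,
  at most \<open>cap\<close> clauses at one target involve one group, and each of them brings at
  most three variables.\<close>

lemma bag_length:
 assumes T: "routing H q load T" and P: "pattern_of H q T P"
  and asg: "\<And>a. a \<in> set asg \<Longrightarrow> length (fst a) \<le> 3" "\<And>g w. cnt q asg g w \<le> cap" and fin: "finite (verts H)"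
 shows "length (bag P N asg v) \<le> load * (3 * cap)"
proof -
 have qP: "snd (snd P) = q" using P by (simp add: pattern_of_def)
 let ?I = "{(g, w). (g, w, v) \<in> T}"
 let ?F = "\<lambda>g w. filter (\<lambda>a. snd a = w \<and> (\<exists>l\<in>set (fst a). grp q l = g)) asg"
 have "?I \<subseteq> {..<q} \<times> verts H" using T by (auto simp: routing_def)
 hence I: "finite ?I" using fin finite_subset by blast
 have "set (bag P N asg v) \<subseteq> (\<Union>(g, w)\<in>?I. \<Union>a\<in>set (?F g w). half ` set (fst a))"
  unfolding bag_def qP by (fastforce simp: on_path_iff[OF P])
 hence "card (set (bag P N asg v)) \<le> card (\<Union>(g, w)\<in>?I. \<Union>a\<in>set (?F g w). half ` set (fst a))"
  using I by (intro card_mono) auto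
 also have "\<dots> \<le> (\<Sum>(g, w)\<in>?I. card (\<Union>a\<in>set (?F g w). half ` set (fst a)))"
  using card_UN_le[OF I, of "\<lambda>(g, w). \<Union>a\<in>set (?F g w). half ` set (fst a)"] by (simp add: case_prod_unfold)
 also have "\<dots> \<le> (\<Sum>(g, w)\<in>?I. 3 * cap)"
 proof (rule sum_mono, clarify)
  fix g w
  have "card (\<Union>a\<in>set (?F g w). half ` set (fst a)) \<le> (\<Sum>a\<in>set (?F g w). card (half ` set (fst a)))"
   by (intro card_UN_le) simp
  also have "\<dots> \<le> (\<Sum>a\<in>set (?F g w). 3)"
   by (intro sum_mono) (meson asg(1) card_image_le card_length List.finite_set le_trans filter_is_subset subsetD)
  also have "\<dots> \<le> 3 * cap" using card_length[of "?F g w"] asg(2)[of g w] by (simp add: cnt_def)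
  finally show "card (\<Union>a\<in>set (?F g w). half ` set (fst a)) \<le> 3 * cap" .
 qed
 also have "\<dots> = card ?I * (3 * cap)" by (simp add: case_prod_unfold)
 also have "\<dots> \<le> load * (3 * cap)" using T by (intro mult_right_mono) (auto simp: routing_def)
 finally show ?thesis using distinct_card[of "bag P N asg v"] by (simp add: bag_def)
qed

lemma assignments_snoc:
 "assignments (S @ [x]) = map (\<lambda>\<alpha>. (x + x) # \<alpha>) (assignments S) @ map (\<lambda>\<alpha>. (x + x + 1) # \<alpha>) (assignments S)"
 by (simp add: assignments_def)

lemma assignments_iff:
 "distinct S \<Longrightarrow> \<beta> \<in> set (assignments S) \<longleftrightarrow> (\<exists>b. \<beta> = rev (map (\<lambda>x. 2 * x + of_bool (b x)) S))"
proof (induction S arbitrary: \<beta> rule: rev_induct)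
 case Nil
 thus ?case by (simp add: assignments_def)
next
 case (snoc x S)
 have "\<beta> \<in> set (assignments (S @ [x])) \<longleftrightarrow> (\<exists>c b. \<beta> = (2 * x + of_bool c) # rev (map (\<lambda>x. 2 * x + of_bool (b x)) S))"
 proof -
  have "\<beta> \<in> set (assignments (S @ [x])) \<longleftrightarrow> (\<exists>\<gamma>\<in>set (assignments S). \<beta> = (2 * x) # \<gamma> \<or> \<beta> = (2 * x + 1) # \<gamma>)"
   unfolding assignments_snoc by (auto simp: mult_2)
  also have "\<dots> \<longleftrightarrow> (\<exists>\<gamma>. (\<exists>b. \<gamma> = rev (map (\<lambda>x. 2 * x + of_bool (b x)) S)) \<and> (\<beta> = (2 * x) # \<gamma> \<or> \<beta> = (2 * x + 1) # \<gamma>))"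
   using snoc by (simp add: Bex_def)
  also have "\<dots> \<longleftrightarrow> (\<exists>c b. \<beta> = (2 * x + of_bool c) # rev (map (\<lambda>x. 2 * x + of_bool (b x)) S))"
   unfolding ex_bool_eq by auto
  finally show ?thesis .
 qed
 also have "\<dots> \<longleftrightarrow> (\<exists>b. \<beta> = rev (map (\<lambda>x. 2 * x + of_bool (b x)) (S @ [x])))"
 proof
  assume "\<exists>c b. \<beta> = (2 * x + of_bool c) # rev (map (\<lambda>x. 2 * x + of_bool (b x)) S)"
  then obtain c b where "\<beta> = (2 * x + of_bool c) # rev (map (\<lambda>x. 2 * x + of_bool (b x)) S)" by blast
  moreover have "map (\<lambda>y. 2 * y + of_bool (b y)) S = map (\<lambda>y. 2 * y + of_bool ((b(x := c)) y)) S"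
   using snoc.prems by (intro map_cong) auto
  ultimately show "\<exists>b. \<beta> = rev (map (\<lambda>x. 2 * x + of_bool (b x)) (S @ [x]))" by (intro exI[of _ "b(x := c)"]) simp
 next
  assume "\<exists>b. \<beta> = rev (map (\<lambda>x. 2 * x + of_bool (b x)) (S @ [x]))"
  then obtain b where "\<beta> = rev (map (\<lambda>x. 2 * x + of_bool (b x)) (S @ [x]))" by blast
  thus "\<exists>c b. \<beta> = (2 * x + of_bool c) # rev (map (\<lambda>x. 2 * x + of_bool (b x)) S)"
   by (intro exI[of _ "b x"] exI[of _ b]) simp
 qed
 finally show ?case .
qed

lemma length_assignments: "length (assignments S) = 2 ^ length S"
proof (induction S rule: rev_induct)
 case (snoc x S)
 thus ?case by (simp add: assignments_snoc)
qed (simp add: assignments_def)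

section \<open>The host graph and the correctness of the reduction\<close>

definition host_graph :: "pattern \<Rightarrow> nat \<Rightarrow> nat \<Rightarrow> nat list list \<Rightarrow> nat graph" where
 "host_graph P N cap \<Phi> = (let L = positions P N (assign P cap \<Phi>) in
   ({..<length L}, {{i, j} | i j. i < length L \<and> j < length L \<and> adj (snd (fst P)) (L ! i) (L ! j)}))"

context
 fixes H q load T P N D cap \<Phi>
 assumes H: "simple_graph H" "verts H \<noteq> {}" and T: "routing H q load T" and P: "pattern_of H q T P"
  and \<Phi>: "\<And>C. C \<in> set \<Phi> \<Longrightarrow> good_clause N C" "\<And>x. occurrences \<Phi> x \<le> D"
  and cap: "10 * (D * (N div q + 1)) \<le> card (verts H) * cap" "0 < cap"
begin

abbreviation "asg \<equiv> assign P cap \<Phi>"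
abbreviation "L \<equiv> positions P N asg"

lemma bag_le: "length (bag P N asg v) \<le> load * (3 * cap)"
proof (rule bag_length[OF T P])
 show "length (fst a) \<le> 3" if "a \<in> set asg" for a
  using assign_invariant(1)[OF T P H \<Phi> cap] \<Phi>(1) that by (force simp: good_clause_def)
 show "cnt q asg g w \<le> cap" for g w by (rule assign_invariant(3)[OF T P H \<Phi> cap])
qed (use H in \<open>simp add: simple_graph_def\<close>)

lemma cost_le: "cost P N asg \<le> card (verts H) * 2 ^ (load * (3 * cap))"
proof -
 have "cost P N asg \<le> (\<Sum>v\<leftarrow>fst (fst P). 2 ^ (load * (3 * cap)))"
  unfolding cost_def by (intro sum_list_mono power_increasing bag_le) auto
 also have "\<dots> = length (fst (fst P)) * 2 ^ (load * (3 * cap))" by (simp add: sum_list_triv)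
 also have "length (fst (fst P)) = card (verts H)" using P by (metis distinct_card pattern_of_def)
 finally show ?thesis .
qed

lemma length_positions_le: "length L \<le> cost P N asg"
proof -
 have "length (options P N asg v) \<le> 2 ^ length (bag P N asg v)" for v
  unfolding options_def by (simp add: length_assignments[symmetric])
 thus ?thesis unfolding positions_def cost_def length_concat map_map o_def by (intro sum_list_mono)
qed

lemma distinct_bag: "distinct (bag P N asg v)" by (simp add: bag_def)

lemma positions_iff:
 "(v, \<beta>) \<in> set L \<longleftrightarrow> v \<in> verts H \<and> valid asg v \<beta> \<and> (\<exists>b. \<beta> = rev (map (\<lambda>x. 2 * x + of_bool (b x)) (bag P N asg v)))"
proof -
 have "set (fst (fst P)) = verts H" using P by (simp add: pattern_of_def)
 thus ?thesis unfolding positions_def options_def using assignments_iff[OF distinct_bag] by auto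
qed

lemma adj_iff: "adj (snd (fst P)) y z \<longleftrightarrow> {fst y, fst z} \<in> edges H \<and> (\<forall>l\<in>set (snd y). \<forall>m\<in>set (snd z). l div 2 = m div 2 \<longrightarrow> l = m)"
proof -
 have "set (snd (fst P)) = adjacent H" using P by (simp add: pattern_of_def)
 thus ?thesis unfolding adj_def half_eq by (auto simp: adjacent_def; blast)
qed

lemma adj_sym: "adj (snd (fst P)) y z \<longleftrightarrow> adj (snd (fst P)) z y"
 unfolding adj_iff by (auto simp: insert_commute; metis)

lemma edge_neq: "{u, v} \<in> edges H \<Longrightarrow> u \<noteq> v \<and> u \<in> verts H \<and> v \<in> verts H"
 using H(1) by (fastforce simp: simple_graph_def pairs_def card_insert_if split: if_splits)

lemma host_edge_iff: "i < length L \<Longrightarrow> j < length L \<Longrightarrow> {i, j} \<in> edges (host_graph P N cap \<Phi>) \<longleftrightarrow> adj (snd (fst P)) (L ! i) (L ! j)"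
 unfolding host_graph_def Let_def using adj_sym[of "L ! i" "L ! j"] by (auto simp: doubleton_eq_iff)

lemma host_verts: "verts (host_graph P N cap \<Phi>) = {..<length L}"
 by (simp add: host_graph_def Let_def)

lemma host_edges: "edges (host_graph P N cap \<Phi>) =
  {{i, j} | i j. i < length L \<and> j < length L \<and> adj (snd (fst P)) (L ! i) (L ! j)}"
 by (simp add: host_graph_def Let_def)

lemma host_simple: "simple_graph (host_graph P N cap \<Phi>)"
proof -
 have "card {i, j} = 2" if "adj (snd (fst P)) (L ! i) (L ! j)" for i j
  using that edge_neq[of "fst (L ! i)" "fst (L ! j)"] by (cases "i = j") (auto simp: adj_iff)
 thus ?thesis by (auto simp: simple_graph_def host_verts host_edges pairs_def)
qed

lemma host_eq: "host P N cap \<Phi> = encode_graph (host_graph P N cap \<Phi>)"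
proof -
 have V: "card (verts (host_graph P N cap \<Phi>)) = length L" by (simp add: host_verts)
 have L: "map (\<lambda>i. f (L ! i)) [0..<length L] = map f L" for f :: "_ \<Rightarrow> 'b"
  using arg_cong[OF map_nth[of L], of "map f"] by (simp add: o_def)
 let ?a = "\<lambda>y z. of_bool (adj (snd (fst P)) y z) :: nat"
 have "map (\<lambda>j. ?a y (L ! j)) [0..<length L] = map (?a y) L" for y by (rule L)
 hence "map (\<lambda>i. map (\<lambda>j. ?a (L ! i) (L ! j)) [0..<length L]) [0..<length L] =
   map (\<lambda>i. map (?a (L ! i)) L) [0..<length L]" by simp
 also have "\<dots> = map (\<lambda>y. map (?a y) L) L" by (rule L)
 finally have "matrix (snd (fst P)) L = length L # concat (map (\<lambda>i. map (\<lambda>j. ?a (L ! i) (L ! j)) [0..<length L]) [0..<length L])"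
  unfolding matrix_def by simp
 also have "\<dots> = encode_graph (host_graph P N cap \<Phi>)"
  unfolding encode_graph_def Let_def V using host_edge_iff
  by (intro arg_cong2[of _ _ _ _ Cons] arg_cong[of _ _ concat] map_cong refl) auto
 finally show ?thesis unfolding host_def .
qed

lemma literal_mem:
 assumes "\<beta> = rev (map (\<lambda>x. 2 * x + of_bool (b x)) (bag P N asg v))"
 shows "l \<in> set \<beta> \<longleftrightarrow> l div 2 \<in> set (bag P N asg v) \<and> b (l div 2) = odd l"
proof -
 have "l = 2 * x + of_bool (b x) \<longleftrightarrow> l div 2 = x \<and> b x = odd l" for x
  by (cases "b x") (auto elim!: oddE)
 thus ?thesis unfolding assms by (auto simp: image_iff)
qed

lemma bag_iff: "x \<in> set (bag P N asg v) \<longleftrightarrow> (\<exists>C w. (C, w) \<in> set asg \<and> (\<exists>l\<in>set C. l div 2 = x \<and> (grp q l, w, v) \<in> T))"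
proof -
 have "x < N" if "(C, w) \<in> set asg" "l \<in> set C" "l div 2 = x" for C w l
 proof -
  have "C \<in> set \<Phi>" using assign_invariant(1)[OF T P H \<Phi> cap] that(1) by force
  thus ?thesis using \<Phi>(1)[of C] that by (auto simp: good_clause_def)
 qed
 moreover have "snd (snd P) = q" using P by (simp add: pattern_of_def)
 ultimately show ?thesis unfolding bag_def half_eq by (auto simp: on_path_iff[OF P]; force)
qed

lemma own_bag: "(C, w) \<in> set asg \<Longrightarrow> l \<in> set C \<Longrightarrow> w \<in> verts H \<and> l div 2 \<in> set (bag P N asg w)"
 using assign_invariant(2)[OF T P H \<Phi> cap, of "(C, w)"] unfolding bag_iff by auto

lemma asg_clause: "(C, w) \<in> set asg \<Longrightarrow> C \<in> set \<Phi>" "C \<in> set \<Phi> \<Longrightarrow> \<exists>w. (C, w) \<in> set asg"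
 using assign_invariant(1)[OF T P H \<Phi> cap] by force+

text \<open>The vertex chosen over \<open>v\<close> is the restriction of the satisfying assignment
  to the bag of \<open>v\<close>. Restrictions of one assignment agree, and they satisfy the local
  clauses because all variables of a clause are in the bag of its place.\<close>

lemma host_complete:
 assumes "sat \<alpha> \<Phi>"
 shows "yes (Sub H) (host_graph P N cap \<Phi>)"
proof -
 define \<beta> where "\<beta> v = rev (map (\<lambda>x. 2 * x + of_bool (\<alpha> x)) (bag P N asg v))" for v
 note mem = literal_mem[OF \<beta>_def]
 have "\<exists>i<length L. L ! i = (v, \<beta> v)" if v: "v \<in> verts H" for v
 proof -
  have "valid asg v (\<beta> v)" unfolding valid_def
  proof (intro ballI impI)
   fix a assume a: "a \<in> set asg" "snd a = v"
   obtain C where C: "a = (C, v)" using a(2) by (cases a) auto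
   then obtain l where l: "l \<in> set C" "lit_true \<alpha> l" using assms asg_clause(1)[of C v] a(1) by (auto simp: sat_def)
   hence "l \<in> set (\<beta> v)" using own_bag[of C v l] a(1) C by (simp add: mem lit_true_def)
   thus "\<exists>l\<in>set (fst a). l \<in> set (\<beta> v)" using l C by auto
  qed
  hence "(v, \<beta> v) \<in> set L" using v by (auto simp: positions_iff \<beta>_def)
  thus ?thesis by (simp add: in_set_conv_nth)
 qed
 then obtain pos where pos: "\<And>v. v \<in> verts H \<Longrightarrow> pos v < length L \<and> L ! pos v = (v, \<beta> v)" by metis
 have inj: "inj_on pos (verts H)" by (rule inj_onI) (metis fst_conv pos)
 have edge: "{pos u, pos v} \<in> edges (host_graph P N cap \<Phi>)" if "{u, v} \<in> edges H" for u v
 proof -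
  have uv: "u \<in> verts H" "v \<in> verts H" using edge_neq[OF that] by auto
  have "l = m" if "l \<in> set (\<beta> u)" "m \<in> set (\<beta> v)" "l div 2 = m div 2" for l m
  proof -
   have "odd l = odd m" using that mem by auto
   with that(3) show ?thesis by presburger
  qed
  thus ?thesis using pos uv that by (auto simp: host_edge_iff adj_iff)
 qed
 let ?G = "(pos ` verts H, (`) pos ` edges H)"
 have pairs: "\<exists>u v. e = {u, v}" if "e \<in> edges H" for e
  using that H(1) by (auto simp: simple_graph_def pairs_def card_2_iff dest!: subsetD)
 have "subgraph ?G (host_graph P N cap \<Phi>)"
 proof -
  have "e \<in> pairs (pos ` verts H)" if e: "e \<in> (`) pos ` edges H" for e
  proof -
   from e obtain e' where e': "e' \<in> edges H" "e = pos ` e'" by blast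
   obtain u v where "e' = {u, v}" using pairs[OF e'(1)] by blast
   hence uv: "{u, v} \<in> edges H" "e = {pos u, pos v}" using e' by auto
   hence "pos u \<noteq> pos v" using edge_neq[OF uv(1)] inj by (auto dest: inj_onD)
   thus ?thesis using uv edge_neq[OF uv(1)] by (auto simp: pairs_def)
  qed
  moreover have "(`) pos ` edges H \<subseteq> edges (host_graph P N cap \<Phi>)" using edge pairs by fastforce
  moreover have "pos ` verts H \<subseteq> verts (host_graph P N cap \<Phi>)" using pos by (auto simp: host_verts)
  ultimately show ?thesis using H(1) by (auto simp: subgraph_def simple_graph_def)
 qed
 moreover have "isomorphic ?G H"
 proof -
  let ?f = "inv_into (verts H) pos"
  have "bij_betw ?f (pos ` verts H) (verts H)" by (rule bij_betw_inv_into) (simp add: inj bij_betw_def)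
  moreover have "{pos u, pos v} \<in> (`) pos ` edges H \<longleftrightarrow> {u, v} \<in> edges H" if "u \<in> verts H" "v \<in> verts H" for u v
  proof
   assume "{pos u, pos v} \<in> (`) pos ` edges H"
   then obtain e where e: "e \<in> edges H" "pos ` e = pos ` {u, v}" by auto
   hence "e = {u, v}" using inj_on_image_eq_iff[OF inj, of e "{u, v}"] that H(1)
    by (auto simp: simple_graph_def pairs_def)
   thus "{u, v} \<in> edges H" using e by simp
  qed (force intro: image_eqI[of _ _ "{u, v}"])
  ultimately show ?thesis unfolding isomorphic_def using inj by (intro exI[of _ ?f]) auto
 qed
 ultimately show ?thesis unfolding Sub_def by auto
qed

text \<open>Projecting a copy of H to the vertices of H gives an endomorphism, which is an
  automorphism as H is a core. So exactly one assignment is picked over every vertex, and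
  assignments over adjacent vertices agree. A variable takes its value at the home of its group, and
  the connectedness of the path carries this value unchanged to every clause that contains the
  variable.\<close>

lemma host_sound:
 assumes core: "core H" and yes: "yes (Sub H) (host_graph P N cap \<Phi>)"
 shows "\<exists>\<alpha>. sat \<alpha> \<Phi>"
proof -
 let ?G = "host_graph P N cap \<Phi>"
 from yes obtain G f where G: "subgraph G ?G" and f: "bij_betw f (verts G) (verts H)"
  "\<And>u v. u \<in> verts G \<Longrightarrow> v \<in> verts G \<Longrightarrow> {u, v} \<in> edges G \<longleftrightarrow> {f u, f v} \<in> edges H"
  unfolding Sub_def isomorphic_def by auto
 define g where "g = inv_into (verts G) f"
 have g: "g v \<in> verts G" "f (g v) = v" if "v \<in> verts H" for v
  using f(1) that unfolding g_def by (auto simp: bij_betw_def inv_into_into f_inv_into_f)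
 have gL: "g v < length L" if "v \<in> verts H" for v
  using g(1)[OF that] G by (auto simp: subgraph_def host_verts)
 define \<phi> where "\<phi> v = fst (L ! g v)" for v
 have adj: "adj (snd (fst P)) (L ! g u) (L ! g v)" if "{u, v} \<in> edges H" for u v
 proof -
  have uv: "u \<in> verts H" "v \<in> verts H" using edge_neq[OF that] by auto
  hence "{g u, g v} \<in> edges G" using f(2)[of "g u" "g v"] g that by simp
  hence "{g u, g v} \<in> edges ?G" using G by (auto simp: subgraph_def)
  thus ?thesis using host_edge_iff gL uv by simp
 qed
 have hom: "{\<phi> u, \<phi> v} \<in> edges H" if "{u, v} \<in> edges H" for u v
  using adj[OF that] by (simp add: adj_iff \<phi>_def)
 have LV: "fst y \<in> verts H \<and> valid asg (fst y) (snd y) \<and>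
   (\<exists>b. snd y = rev (map (\<lambda>x. 2 * x + of_bool (b x)) (bag P N asg (fst y))))" if "y \<in> set L" for y
  using positions_iff[of "fst y" "snd y"] that by simp
 have \<phi>V: "\<phi> ` verts H \<subseteq> verts H" using LV[OF nth_mem[OF gL]] unfolding \<phi>_def by blast
 have V: "finite (verts H)" using H by (simp add: simple_graph_def)
 have inj: "inj_on \<phi> (verts H)" using core \<phi>V hom unfolding core_def by blast
 have bij: "bij_betw \<phi> (verts H) (verts H)" using inj \<phi>V V by (simp add: bij_betw_def endo_inj_surj)
 define \<psi> where "\<psi> = inv_into (verts H) \<phi>"
 have \<psi>: "\<psi> v \<in> verts H" "\<phi> (\<psi> v) = v" if "v \<in> verts H" for v
  using bij that unfolding \<psi>_def by (auto simp: bij_betw_def inv_into_into f_inv_into_f)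
 \<comment> \<open>An injective endomorphism permutes the finite set of edges, so its inverse
   preserves edges as well.\<close>
 have hom': "{\<psi> u, \<psi> v} \<in> edges H" if "{u, v} \<in> edges H" for u v
 proof -
  have sub: "e \<subseteq> verts H" if "e \<in> edges H" for e using that H(1) by (auto simp: simple_graph_def pairs_def)
  have "inj_on ((`) \<phi>) (edges H)" by (rule inj_onI) (metis inj inj_on_image_eq_iff sub)
  moreover have "(`) \<phi> ` edges H \<subseteq> edges H"
  proof
   fix e assume "e \<in> (`) \<phi> ` edges H"
   then obtain u v where "{u, v} \<in> edges H" "e = \<phi> ` {u, v}"
    using H(1) by (fastforce simp: simple_graph_def pairs_def card_2_iff dest!: subsetD)
   thus "e \<in> edges H" using hom by simp
  qed
  moreover have "finite (edges H)" using V sub by (meson PowI finite_Pow_iff finite_subset subsetI)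
  ultimately have "(`) \<phi> ` edges H = edges H" by (simp add: endo_inj_surj)
  with that obtain e where e: "e \<in> edges H" "{u, v} = \<phi> ` e" by blast
  have uv: "u \<in> verts H" "v \<in> verts H" using edge_neq[OF that] by auto
  hence "\<phi> ` {\<psi> u, \<psi> v} = \<phi> ` e" using e \<psi> by simp
  hence "{\<psi> u, \<psi> v} = e" using inj_on_image_eq_iff[OF inj, of "{\<psi> u, \<psi> v}" e] \<psi> uv sub[OF e(1)] by simp
  thus ?thesis using e by simp
 qed
 \<comment> \<open>The vertex of the copy that lies over \<open>v\<close>, found by undoing the
   automorphism \<phi>.\<close>
 define y where "y v = L ! g (\<psi> v)" for v
 have y: "y v \<in> set L" "fst (y v) = v" if "v \<in> verts H" for v
  using \<psi>[OF that] gL[of "\<psi> v"] unfolding y_def \<phi>_def by auto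
 have "\<exists>b. snd (y v) = rev (map (\<lambda>x. 2 * x + of_bool (b x)) (bag P N asg v))" if "v \<in> verts H" for v
  using LV[OF y(1)[OF that]] y(2)[OF that] by simp
 then obtain b where b: "\<And>v. v \<in> verts H \<Longrightarrow> snd (y v) = rev (map (\<lambda>x. 2 * x + of_bool (b v x)) (bag P N asg v))" by metis
 have agree: "b u x = b v x" if "{u, v} \<in> edges H" "x \<in> set (bag P N asg u)" "x \<in> set (bag P N asg v)" for u v x
 proof -
  have uv: "u \<in> verts H" "v \<in> verts H" using edge_neq[OF that(1)] by auto
  have "adj (snd (fst P)) (y u) (y v)" unfolding y_def using adj[OF hom'[OF that(1)]] .
  moreover have "2 * x + of_bool (b u x) \<in> set (snd (y u))" "2 * x + of_bool (b v x) \<in> set (snd (y v))"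
   using b uv that by auto
  ultimately have "2 * x + of_bool (b u x) = 2 * x + (of_bool (b v x) :: nat)" unfolding adj_iff by fastforce
  thus ?thesis by (simp add: of_bool_eq_iff)
 qed
 from T obtain home where home: "\<And>g w v. (g, w, v) \<in> T \<Longrightarrow>
   (home g, v) \<in> linked H {v. (g, w, v) \<in> T}" unfolding routing_def by blast
 define \<alpha> where "\<alpha> x = b (home (x mod q)) x" for x
 have "\<exists>l\<in>set C. lit_true \<alpha> l" if C: "C \<in> set \<Phi>" for C
 proof -
  obtain w where w: "(C, w) \<in> set asg" using asg_clause(2)[OF C] by blast
  have wV: "w \<in> verts H" using assign_invariant(2)[OF T P H \<Phi> cap w] by simp
  have "valid asg w (snd (y w))" using LV[OF y(1)[OF wV]] y(2)[OF wV] by simp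
  then obtain l where l: "l \<in> set C" "l \<in> set (snd (y w))" using w by (force simp: valid_def)
  let ?x = "l div 2" and ?g = "grp q l"
  have bw: "b w ?x = odd l" using l(2) literal_mem[OF b[OF wV]] by simp
  have g: "?g = ?x mod q" using T by (simp add: grp_eq routing_def)
  have gw: "(?g, w, w) \<in> T" using assign_invariant(2)[OF T P H \<Phi> cap w] l(1) by simp
  have "b (home ?g) ?x = b v ?x"
   if "(home ?g, v) \<in> linked H {v. (?g, w, v) \<in> T}" for v
   using that
  proof (induction rule: rtrancl_induct)
   case (step u v)
   hence "?x \<in> set (bag P N asg u)" "?x \<in> set (bag P N asg v)" using w l(1) by (auto simp: bag_iff)
   thus ?case using step agree[of u v ?x] by (auto simp: adjacent_def)
  qed simp
  from this[OF home[OF gw]] have "lit_true \<alpha> l" using bw by (simp add: lit_true_def \<alpha>_def g)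
  thus ?thesis using l(1) by blast
 qed
 thus ?thesis by (auto simp: sat_def)
qed

end

section \<open>Product Bernoulli measures\<close>

abbreviation (input) Prob :: "'a pmf \<Rightarrow> 'a set \<Rightarrow> real" where
 "Prob M A \<equiv> measure_pmf.prob M A"

abbreviation bern :: "'e set \<Rightarrow> real \<Rightarrow> ('e \<Rightarrow> bool) pmf" where
 "bern A p \<equiv> Pi_pmf A False (\<lambda>_. bernoulli_pmf p)"

lemma prob_bern_all:
 assumes "finite A" "S \<subseteq> A" "0 \<le> p" "p \<le> 1"
 shows "Prob (bern A p) {X. \<forall>e\<in>S. X e} = p ^ card S"
  and "Prob (bern A p) {X. \<forall>e\<in>S. \<not> X e} = (1 - p) ^ card S"
proof -
 have *: "Prob (bern A p) {X. \<forall>e\<in>S. X e = b} = pmf (bernoulli_pmf p) b ^ card S" for b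
 proof -
  have eq: "{X. \<forall>e\<in>S. X e = b} = Pi A (\<lambda>e. if e \<in> S then {b} else UNIV)"
   using assms(2) by (auto simp: Pi_iff split: if_splits)
  have "Prob (bern A p) {X. \<forall>e\<in>S. X e = b} =
    (\<Prod>e\<in>A. Prob (bernoulli_pmf p) (if e \<in> S then {b} else UNIV))"
   unfolding eq by (rule measure_Pi_pmf_Pi[OF assms(1)])
  also have "\<dots> = (\<Prod>e\<in>S. Prob (bernoulli_pmf p) {b})"
   using assms(1,2) by (intro prod.mono_neutral_cong_right) auto
  finally show ?thesis by (simp add: measure_pmf_single)
 qed
 show "Prob (bern A p) {X. \<forall>e\<in>S. X e} = p ^ card S"
  using *[of True] assms(3,4) by simp
 show "Prob (bern A p) {X. \<forall>e\<in>S. \<not> X e} = (1 - p) ^ card S"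
  using *[of False] assms(3,4) by simp
qed

lemma prob_mono: "(\<And>x. P x \<Longrightarrow> Q x) \<Longrightarrow> Prob M {x. P x} \<le> Prob M {x. Q x}"
 by (intro measure_pmf.finite_measure_mono) auto

lemma prob_union_bound:
 assumes "finite I" "\<And>i. i \<in> I \<Longrightarrow> Prob M {x. Q i x} \<le> c i"
 shows "Prob M {x. \<exists>i\<in>I. Q i x} \<le> (\<Sum>i\<in>I. c i)"
proof -
 have "Prob M {x. \<exists>i\<in>I. Q i x} = Prob M (\<Union>i\<in>I. {x. Q i x})"
  by (intro arg_cong[of _ _ "Prob M"]) auto
 also have "\<dots> \<le> (\<Sum>i\<in>I. Prob M {x. Q i x})"
  using assms(1) by (intro measure_pmf.finite_measure_subadditive_finite) auto
 also have "\<dots> \<le> (\<Sum>i\<in>I. c i)" by (intro sum_mono assms(2))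
 finally show ?thesis .
qed

lemma prob_union_bound_card:
 assumes "finite I" "\<And>i. i \<in> I \<Longrightarrow> Prob M {x. Q i x} \<le> c" "real (card I) \<le> m" "0 \<le> c"
 shows "Prob M {x. \<exists>i\<in>I. Q i x} \<le> m * c"
proof -
 have "Prob M {x. \<exists>i\<in>I. Q i x} \<le> card I * c" using prob_union_bound[OF assms(1,2)] by simp
 also have "\<dots> \<le> m * c" using assms(3,4) by (rule mult_right_mono)
 finally show ?thesis .
qed

lemma prob_disj: "Prob M {x. P x \<or> Q x} \<le> Prob M {x. P x} + Prob M {x. Q x}"
 using measure_Un_le[of "{x. P x}" "measure_pmf M" "{x. Q x}"] by (simp add: Collect_disj_eq)

text \<open>Markov's inequality for exp (- l * count). The flag \<open>b\<close> selects whether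
  edges or missing edges are counted.\<close>

lemma prob_few:
 fixes p l s :: real
 assumes "finite A" "S \<subseteq> A" "0 \<le> p" "p \<le> 1" "0 \<le> l"
 shows "Prob (bern A p) {X. real (card {e\<in>S. X e = b}) \<le> s} \<le>
  exp (l * s - card S * (if b then p else 1 - p) * (1 - exp (- l)))"
proof -
 let ?M = "bern A p" and ?z = "exp (- l)" and ?q = "if b then p else 1 - p"
 have fS: "finite S" using assms(1,2) finite_subset by blast
 have fin: "finite (set_pmf ?M)"
  using assms(1) set_Pi_pmf_subset[OF assms(1), of False "\<lambda>_. bernoulli_pmf p"] finite_PiE_dflt[of A "\<lambda>_. UNIV" False]
  by (rule_tac finite_subset[of _ "PiE_dflt A False (\<lambda>_. UNIV)"]) (auto simp: PiE_dflt_def)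
 let ?f = "\<lambda>e v. if e \<in> S \<and> v = b then ?z else 1"
 have f: "(\<Prod>e\<in>A. ?f e (X e)) = exp (- l * card {e\<in>S. X e = b})" for X
 proof -
  have "(\<Prod>e\<in>A. ?f e (X e)) = (\<Prod>e\<in>{e\<in>S. X e = b}. ?z)"
   using assms(1,2) by (intro prod.mono_neutral_cong_right) auto
  also have "\<dots> = ?z ^ card {e\<in>S. X e = b}" by simp
  finally show ?thesis by (simp add: exp_of_nat_mult[symmetric] mult.commute)
 qed
 have "Prob ?M {X. real (card {e\<in>S. X e = b}) \<le> s} =
   measure_pmf.expectation ?M (indicator {X. real (card {e\<in>S. X e = b}) \<le> s})" by simp
 also have "\<dots> \<le> measure_pmf.expectation ?M (\<lambda>X. exp (l * s) * (\<Prod>e\<in>A. ?f e (X e)))"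
 proof (rule integral_mono)
  show "indicator {X. real (card {e\<in>S. X e = b}) \<le> s} X \<le> exp (l * s) * (\<Prod>e\<in>A. ?f e (X e))" for X
   unfolding f exp_add[symmetric] using mult_left_mono[of "real (card {e\<in>S. X e = b})" s l] assms(5)
   by (auto simp: indicator_def)
 qed (intro integrable_measure_pmf_finite fin)+
 also have "\<dots> = exp (l * s) * measure_pmf.expectation ?M (\<lambda>X. \<Prod>e\<in>A. ?f e (X e))" by simp
 also have "measure_pmf.expectation ?M (\<lambda>X. \<Prod>e\<in>A. ?f e (X e)) = (\<Prod>e\<in>A. measure_pmf.expectation (bernoulli_pmf p) (?f e))"
  by (intro expectation_prod_Pi_pmf assms(1)) (auto intro: integrable_measure_pmf_finite)
 also have "\<dots> = (\<Prod>e\<in>S. 1 - ?q * (1 - ?z))"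
 proof (rule prod.mono_neutral_cong_right[OF assms(1,2)])
  show "measure_pmf.expectation (bernoulli_pmf p) (?f e) = 1 - ?q * (1 - ?z)" if "e \<in> S" for e
   using that assms(3,4) by (simp add: algebra_simps)
 qed (use assms in auto)
 also have "\<dots> \<le> (\<Prod>e\<in>S. exp (- (?q * (1 - ?z))))"
 proof (rule prod_mono)
  fix e
  have "?q * (1 - ?z) \<le> 1 * 1" using assms by (intro mult_mono) auto
  moreover have "1 + - (?q * (1 - ?z)) \<le> exp (- (?q * (1 - ?z)))" by (rule exp_ge_add_one_self)
  ultimately show "0 \<le> 1 - ?q * (1 - ?z) \<and> 1 - ?q * (1 - ?z) \<le> exp (- (?q * (1 - ?z)))" by simp
 qed
 also have "\<dots> = exp (- (card S * ?q * (1 - ?z)))" by (simp add: exp_of_nat_mult[symmetric] mult.assoc)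
 finally show ?thesis by (simp add: exp_add[symmetric] diff_conv_add_uminus del: add_uminus_conv_diff)
qed

lemma prob_many:
 assumes "finite A" "S \<subseteq> A" "0 \<le> p" "p \<le> 1"
 shows "Prob (bern A p) {X. m \<le> card {e\<in>S. X e}} \<le> real (card S choose m) * p ^ m"
proof -
 let ?I = "{S'. S' \<subseteq> S \<and> card S' = m}"
 have fS: "finite S" using assms(1,2) finite_subset by blast
 have "Prob (bern A p) {X. m \<le> card {e\<in>S. X e}} \<le> Prob (bern A p) {X. \<exists>S'\<in>?I. \<forall>e\<in>S'. X e}"
 proof (rule prob_mono)
  fix X assume "m \<le> card {e\<in>S. X e}"
  then obtain S' where "S' \<subseteq> {e\<in>S. X e}" "card S' = m" by (meson obtain_subset_with_card_n)
  thus "\<exists>S'\<in>?I. \<forall>e\<in>S'. X e" by blast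
 qed
 also have "\<dots> \<le> real (card S choose m) * p ^ m"
 proof (rule prob_union_bound_card)
  show "Prob (bern A p) {X. \<forall>e\<in>S'. X e} \<le> p ^ m" if "S' \<in> ?I" for S'
   using prob_bern_all(1)[OF assms(1) _ assms(3,4), of S'] that assms(2) by auto
  show "real (card ?I) \<le> real (card S choose m)" using n_subsets[OF fS, of m] by simp
 qed (use fS assms in auto)
 finally show ?thesis .
qed

text \<open>The form in which edges are revealed in two stages: the outcome \<open>f\<close> on
  \<open>A\<close> is fixed, and everything determined by it is a constant while the coordinates in
  \<open>B\<close> remain independent.\<close>

lemma prob_Pi_union_le:
 assumes "finite A" "finite B" "A \<inter> B = {}"
  and c: "\<And>f. f \<in> set_pmf (Pi_pmf A d P) \<Longrightarrow> Prob (Pi_pmf B d P) {g. Q (\<lambda>x. if x \<in> A then f x else g x)} \<le> c"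
 shows "Prob (Pi_pmf (A \<union> B) d P) {h. Q h} \<le> c"
proof -
 let ?S = "{(f, g). Q (\<lambda>x. if x \<in> A then f x else g x)}"
 let ?M = "Pi_pmf A d P" and ?N = "Pi_pmf B d P"
 have c0: "0 \<le> c" using c set_pmf_not_empty[of ?M] by (meson all_not_in_conv measure_nonneg order.trans)
 have "Prob (Pi_pmf (A \<union> B) d P) {h. Q h} = Prob (pair_pmf ?M ?N) ?S"
  unfolding Pi_pmf_union[OF assms(1-3)] measure_map_pmf by (intro arg_cong[of _ _ "Prob _"]) auto
 also have "ennreal \<dots> = (\<integral>\<^sup>+ z. indicator ?S z \<partial>pair_pmf ?M ?N)"
  by (simp add: measure_pmf.emeasure_eq_measure)
 also have "\<dots> = (\<integral>\<^sup>+ f. \<integral>\<^sup>+ g. indicator ?S (f, g) \<partial>?N \<partial>?M)" by (rule nn_integral_pair_pmf')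
 also have "\<dots> \<le> (\<integral>\<^sup>+ f. ennreal c \<partial>?M)"
 proof (rule nn_integral_mono_AE, rule AE_pmfI)
  fix f assume f: "f \<in> set_pmf ?M"
  have "(\<integral>\<^sup>+ g. indicator ?S (f, g) \<partial>?N) = (\<integral>\<^sup>+ g. indicator {g. Q (\<lambda>x. if x \<in> A then f x else g x)} g \<partial>?N)"
   by (intro nn_integral_cong) (simp add: indicator_def)
  also have "\<dots> = ennreal (Prob ?N {g. Q (\<lambda>x. if x \<in> A then f x else g x)})"
   by (simp add: measure_pmf.emeasure_eq_measure)
  also have "\<dots> \<le> ennreal c" using c[OF f] by (rule ennreal_leI)
  finally show "(\<integral>\<^sup>+ g. indicator ?S (f, g) \<partial>?N) \<le> ennreal c" .
 qed
 also have "\<dots> = ennreal c" by simp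
 finally show ?thesis using c0 by simp
qed

text \<open>The quotient m^m / m! is one term of the series of exp m.\<close>

lemma choose_le_exp: "0 < m \<Longrightarrow> real (n choose m) \<le> (exp 1 * n / m) ^ m"
proof -
 assume m: "0 < m"
 have "real m ^ m / fact m \<le> exp (real m)"
 proof -
  have "(\<lambda>n. real m ^ n /\<^sub>R fact n) sums exp (real m)" by (rule exp_converges)
  from sum_le_suminf[OF sums_summable[OF this], of "{m}"] sums_unique[OF this]
  show ?thesis by (simp add: divide_inverse mult.commute)
 qed
 hence f: "real m ^ m \<le> exp 1 ^ m * fact m" by (simp add: field_simps exp_of_nat_mult[symmetric])
 have "real (n choose m) * fact m \<le> real n ^ m"
  using binomial_fact_pow[of n m] by (metis (mono_tags) of_nat_fact of_nat_le_iff of_nat_mult of_nat_power)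
 hence "real (n choose m) * fact m * real m ^ m \<le> real n ^ m * (exp 1 ^ m * fact m)"
  using f by (intro mult_mono) auto
 hence "(real (n choose m) * real m ^ m) * fact m \<le> (exp 1 ^ m * real n ^ m) * fact m"
  by (simp only: mult_ac)
 hence "real (n choose m) * real m ^ m \<le> exp 1 ^ m * real n ^ m"
  by (rule mult_right_le_imp_le) simp
 thus ?thesis using m by (simp add: power_mult_distrib power_divide pos_le_divide_eq)
qed

section \<open>Random graphs\<close>

lemma finite_pairs [simp]: "finite V \<Longrightarrow> finite (pairs V)"
 unfolding pairs_def by (rule finite_subset[of _ "Pow V"]) auto

lemma pairs_mono: "V \<subseteq> W \<Longrightarrow> pairs V \<subseteq> pairs W"
 by (auto simp: pairs_def)

lemma doubleton_pairs: "{u, v} \<in> pairs V \<longleftrightarrow> u \<in> V \<and> v \<in> V \<and> u \<noteq> v"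
 by (auto simp: pairs_def card_insert_if)

lemma prob_random_graph:
 "Prob (random_graph k p) {H. Q H} =
  Prob (bern (pairs {1..k}) p) {X. Q ({1..k}, {e\<in>pairs {1..k}. X e})}"
 unfolding random_graph_def by (simp add: vimage_def)

lemma random_graph_support:
 "H \<in> set_pmf (random_graph k p) \<Longrightarrow> simple_graph H \<and> verts H = {1..k}"
 unfolding random_graph_def by (auto simp: simple_graph_def)

text \<open>Uniform in p: for each k, all p of the range are covered at once. So the range may be
  split by a condition on both k and p (\<open>whp_cases\<close>), and a sequence p(k) may change
  between the two regimes arbitrarily often.\<close>

definition whp :: "(nat \<Rightarrow> real \<Rightarrow> bool) \<Rightarrow> (nat \<Rightarrow> real \<Rightarrow> nat graph \<Rightarrow> bool) \<Rightarrow> bool" where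
 "whp Rg Q \<longleftrightarrow> (\<forall>\<delta>>0. \<forall>\<^sub>F k in sequentially. \<forall>p. Rg k p \<longrightarrow> Prob (random_graph k p) {H. \<not> Q k p H} \<le> \<delta>)"

lemma whpI:
 assumes "\<forall>\<^sub>F k in sequentially. \<forall>p. Rg k p \<longrightarrow> Prob (random_graph k p) {H. \<not> Q k p H} \<le> f k" "f \<longlonglongrightarrow> 0"
 shows "whp Rg Q"
 unfolding whp_def
proof (intro allI impI)
 fix \<delta> :: real assume "\<delta> > 0"
 with assms(2) have "\<forall>\<^sub>F k in sequentially. f k < \<delta>" by (simp add: order_tendstoD(2))
 with assms(1) show "\<forall>\<^sub>F k in sequentially. \<forall>p. Rg k p \<longrightarrow> Prob (random_graph k p) {H. \<not> Q k p H} \<le> \<delta>"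
  by eventually_elim (use order.trans less_imp_le in blast)
qed

lemma whpI_eventually:
 assumes "\<forall>\<^sub>F k in sequentially. E k" "f \<longlonglongrightarrow> 0"
  and "\<And>k p. E k \<Longrightarrow> Rg k p \<Longrightarrow> Prob (random_graph k p) {H. \<not> Q k p H} \<le> f k"
 shows "whp Rg Q"
 by (rule whpI[OF _ assms(2)]) (use assms(1) in eventually_elim, use assms(3) in blast)

lemma whp_conj:
 assumes "whp Rg Q" "whp Rg Q'"
 shows "whp Rg (\<lambda>k p H. Q k p H \<and> Q' k p H)"
 unfolding whp_def
proof (intro allI impI)
 fix \<delta> :: real assume "\<delta> > 0"
 hence "\<forall>\<^sub>F k in sequentially. \<forall>p. Rg k p \<longrightarrow> Prob (random_graph k p) {H. \<not> Q k p H} \<le> \<delta> / 2"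
  "\<forall>\<^sub>F k in sequentially. \<forall>p. Rg k p \<longrightarrow> Prob (random_graph k p) {H. \<not> Q' k p H} \<le> \<delta> / 2"
  using assms[unfolded whp_def, rule_format, of "\<delta> / 2"] by simp_all
 thus "\<forall>\<^sub>F k in sequentially. \<forall>p. Rg k p \<longrightarrow>
   Prob (random_graph k p) {H. \<not> (Q k p H \<and> Q' k p H)} \<le> \<delta>"
 proof eventually_elim
  case (elim k)
  show ?case
  proof (intro allI impI)
   fix p assume "Rg k p"
   thus "Prob (random_graph k p) {H. \<not> (Q k p H \<and> Q' k p H)} \<le> \<delta>"
    using elim[rule_format, of p] prob_disj[of "random_graph k p" "\<lambda>H. \<not> Q k p H" "\<lambda>H. \<not> Q' k p H"]
    unfolding de_Morgan_conj by linarith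
  qed
 qed
qed

lemma whp_mono:
 assumes "whp Rg Q"
  and "\<forall>\<^sub>F k in sequentially. \<forall>p H. Rg k p \<longrightarrow> simple_graph H \<longrightarrow> verts H = {1..k} \<longrightarrow> Q k p H \<longrightarrow> Q' k p H"
 shows "whp Rg Q'"
 unfolding whp_def
proof (intro allI impI)
 fix \<delta> :: real assume "\<delta> > 0"
 hence "\<forall>\<^sub>F k in sequentially. \<forall>p. Rg k p \<longrightarrow> Prob (random_graph k p) {H. \<not> Q k p H} \<le> \<delta>"
  using assms(1) unfolding whp_def by blast
 with assms(2) show "\<forall>\<^sub>F k in sequentially. \<forall>p. Rg k p \<longrightarrow> Prob (random_graph k p) {H. \<not> Q' k p H} \<le> \<delta>"
 proof eventually_elim
  case (elim k)
  show ?case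
  proof (intro allI impI)
   fix p assume p: "Rg k p"
   have "Prob (random_graph k p) {H. \<not> Q' k p H} \<le> Prob (random_graph k p) {H. \<not> Q k p H}"
   proof (rule measure_pmf.finite_measure_mono_AE)
    show "AE H in random_graph k p. H \<in> {H. \<not> Q' k p H} \<longrightarrow> H \<in> {H. \<not> Q k p H}"
     by (rule AE_pmfI) (use random_graph_support elim(1) p in blast)
   qed simp
   thus "Prob (random_graph k p) {H. \<not> Q' k p H} \<le> \<delta>" using elim(2) p by fastforce
  qed
 qed
qed

lemma whp_range: "whp Rg Q \<Longrightarrow> (\<And>k p. Rg' k p \<Longrightarrow> Rg k p) \<Longrightarrow> whp Rg' Q"
 unfolding whp_def by (fast elim: eventually_mono)

lemma whp_cases:
 assumes "whp (\<lambda>k p. Rg k p \<and> C k p) Q" "whp (\<lambda>k p. Rg k p \<and> \<not> C k p) Q"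
 shows "whp Rg Q"
 unfolding whp_def
proof (intro allI impI)
 fix \<delta> :: real assume "\<delta> > 0"
 with assms show "\<forall>\<^sub>F k in sequentially. \<forall>p. Rg k p \<longrightarrow> Prob (random_graph k p) {H. \<not> Q k p H} \<le> \<delta>"
  unfolding whp_def by (fastforce elim: eventually_elim2)
qed

section \<open>Edge counts of large pairs and of small sets\<close>

definition edges_between :: "nat graph \<Rightarrow> nat set \<Rightarrow> nat set \<Rightarrow> nat set set" where
 "edges_between H Y W = {e\<in>edges H. \<exists>y\<in>Y. \<exists>w\<in>W. e = {y, w}}"

definition dense_pairs :: "real \<Rightarrow> nat \<Rightarrow> real \<Rightarrow> nat graph \<Rightarrow> bool" where
 "dense_pairs \<eta> k p H \<longleftrightarrow> (\<forall>Y W. Y \<subseteq> {1..k} \<longrightarrow> W \<subseteq> {1..k} \<longrightarrow> Y \<inter> W = {} \<longrightarrow>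
   \<eta> * real k \<le> real (card Y) \<longrightarrow> \<eta> * real k \<le> real (card W) \<longrightarrow>
   real (card Y) * real (card W) * p / 2 < real (card (edges_between H Y W)))"

text \<open>Applied in two shapes: with A = B to the vertices moved by a retraction, and with a ball
  A and the next larger ball B to the growth of balls.\<close>

definition sparse_sets :: "real \<Rightarrow> real \<Rightarrow> nat \<Rightarrow> real \<Rightarrow> nat graph \<Rightarrow> bool" where
 "sparse_sets \<tau> \<theta> k p H \<longleftrightarrow> (\<forall>A B. A \<subseteq> B \<longrightarrow> B \<subseteq> {1..k} \<longrightarrow> A \<noteq> {} \<longrightarrow> real (card B) \<le> \<theta> * real k \<longrightarrow>
   real (card B) \<le> real (card A) * \<tau> * (real k * p) / 4 \<longrightarrow>
   real (card {e\<in>edges H. e \<subseteq> B \<and> e \<inter> A \<noteq> {}}) < \<tau> * (real k * p) * real (card A))"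

definition log_range :: "nat \<Rightarrow> real \<Rightarrow> bool" where
 "log_range k p \<longleftrightarrow> ln (real k) \<le> real k * p \<and> 0 < p \<and> p \<le> 1 / 2"

lemma card_doubletons:
 assumes "finite Y" "finite W" "Y \<inter> W = {}"
 shows "card {{y, w} | y w. y \<in> Y \<and> w \<in> W} = card Y * card W"
proof -
 have "{{y, w} | y w. y \<in> Y \<and> w \<in> W} = (\<lambda>(y, w). {y, w}) ` (Y \<times> W)" by auto
 moreover have "inj_on (\<lambda>(y, w). {y, w}) (Y \<times> W)"
  using assms(3) by (auto simp: inj_on_def doubleton_eq_iff)
 ultimately show ?thesis using card_image[of "\<lambda>(y, w). {y, w}" "Y \<times> W"] by (simp add: card_cartesian_product)
qed

lemma doubletons_subset: "Y \<subseteq> V \<Longrightarrow> W \<subseteq> V \<Longrightarrow> Y \<inter> W = {} \<Longrightarrow> {{y, w} | y w. y \<in> Y \<and> w \<in> W} \<subseteq> pairs V"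
 by (auto simp: doubleton_pairs)

lemma exp_minus_one_le: "exp (- 1 :: real) \<le> 2 / 5"
proof -
 have "1 + 1 + 1 / 2 \<le> exp (1 :: real)" using exp_lower_Taylor_quadratic[of 1] by simp
 thus ?thesis by (simp add: exp_minus field_simps)
qed

text \<open>A pair fails with probability at most exp (- \<eta>^2 k^2 p / 10). As k p is at least ln
  k, the exponent contains k ln k and beats the 4^k pairs.\<close>

lemma dense_pairs_whp:
 assumes "0 < \<eta>"
 shows "whp log_range (dense_pairs \<eta>)"
proof (rule whpI)
 let ?f = "\<lambda>k::nat. 2 ^ k * (2 ^ k * exp (- (\<eta> * \<eta> * k * ln k / 10)))"
 have "((\<lambda>x::real. 2 powr x * (2 powr x * exp (- (\<eta> * \<eta> * x * ln x / 10)))) \<longlongrightarrow> 0) at_top"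
  using assms by real_asymp
 from filterlim_compose[OF this filterlim_real_sequentially]
 show "?f \<longlonglongrightarrow> 0" by (simp add: powr_realpow)
 show "\<forall>\<^sub>F k in sequentially. \<forall>p. log_range k p \<longrightarrow>
  Prob (random_graph k p) {H. \<not> dense_pairs \<eta> k p H} \<le> ?f k"
 proof (intro always_eventually allI impI)
  fix k p assume p: "log_range k p"
  let ?V = "{1..k}" let ?M = "bern (pairs ?V) p"
  let ?S = "\<lambda>Y W. {{y, w} | y w. y \<in> Y \<and> w \<in> W}"
  let ?I = "\<lambda>Y. {W. W \<subseteq> ?V \<and> Y \<inter> W = {} \<and> \<eta> * real k \<le> real (card Y) \<and> \<eta> * real k \<le> real (card W)}"
  have p01: "0 \<le> p" "p \<le> 1" using p by (auto simp: log_range_def)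
  have "Prob (random_graph k p) {H. \<not> dense_pairs \<eta> k p H} \<le>
    Prob ?M {X. \<exists>Y\<in>Pow ?V. \<exists>W\<in>?I Y. real (card {e\<in>?S Y W. X e = True}) \<le> real (card (?S Y W)) * p / 2}"
   unfolding prob_random_graph
  proof (rule prob_mono)
   fix X assume "\<not> dense_pairs \<eta> k p (?V, {e \<in> pairs ?V. X e})"
   then obtain Y W where YW: "Y \<subseteq> ?V" "W \<subseteq> ?V" "Y \<inter> W = {}" "\<eta> * real k \<le> real (card Y)" "\<eta> * real k \<le> real (card W)"
    "real (card (edges_between (?V, {e \<in> pairs ?V. X e}) Y W)) \<le> real (card Y) * real (card W) * p / 2"
    unfolding dense_pairs_def by (auto simp: not_less)
   have "edges_between (?V, {e \<in> pairs ?V. X e}) Y W = {e\<in>?S Y W. X e = True}"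
   proof -
    have "?S Y W \<subseteq> pairs ?V" using YW(1-3) by (rule doubletons_subset)
    thus ?thesis unfolding edges_between_def by auto
   qed
   moreover have "card (?S Y W) = card Y * card W"
    using YW(1-3) by (intro card_doubletons) (auto dest: finite_subset)
   ultimately show "\<exists>Y\<in>Pow ?V. \<exists>W\<in>?I Y. real (card {e\<in>?S Y W. X e = True}) \<le> real (card (?S Y W)) * p / 2"
    using YW by (intro bexI[of _ Y] bexI[of _ W]) auto
  qed
  also have "\<dots> \<le> 2 ^ k * (2 ^ k * exp (- (\<eta> * \<eta> * k * ln k / 10)))"
  proof (rule prob_union_bound_card, simp)
   fix Y assume Y: "Y \<in> Pow ?V"
   show "Prob ?M {X. \<exists>W\<in>?I Y. real (card {e\<in>?S Y W. X e = True}) \<le> real (card (?S Y W)) * p / 2} \<le>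
     2 ^ k * exp (- (\<eta> * \<eta> * k * ln k / 10))"
   proof (rule prob_union_bound_card)
    show "finite (?I Y)" by simp
    have "card (?I Y) \<le> card (Pow ?V)" by (intro card_mono) auto
    thus "real (card (?I Y)) \<le> 2 ^ k" by (simp add: card_Pow)
    fix W assume W: "W \<in> ?I Y"
    let ?s = "card (?S Y W)"
    have s: "?s = card Y * card W" using Y W by (intro card_doubletons) (auto dest: finite_subset)
    have "?S Y W \<subseteq> pairs ?V" using Y W by (intro doubletons_subset) auto
    hence "Prob ?M {X. real (card {e\<in>?S Y W. X e = True}) \<le> real ?s * p / 2} \<le>
      exp (1 * (real ?s * p / 2) - real ?s * (if True then p else 1 - p) * (1 - exp (- 1)))"
     using p01 prob_few[of "pairs ?V" "?S Y W" p 1 True "real ?s * p / 2"] by simp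
    also have "\<dots> \<le> exp (- (\<eta> * \<eta> * k * ln k / 10))"
    proof (subst exp_le_cancel_iff)
     have "\<eta> * real k * (\<eta> * real k) \<le> real (card Y) * real (card W)" using W assms by (intro mult_mono) auto
     hence "\<eta> * k * (\<eta> * k) * p \<le> real ?s * p" unfolding s using p01 by (intro mult_right_mono) auto
     moreover have "\<eta> * \<eta> * k * ln k \<le> \<eta> * \<eta> * k * (k * p)"
      using p assms by (intro mult_left_mono) (auto simp: log_range_def)
     ultimately have 1: "\<eta> * \<eta> * k * ln k \<le> real ?s * p" by (simp add: algebra_simps)
     \<comment> \<open>For l = 1 the factor 1 - exp (-1) is at least 3/5, which exceeds the half in
       \<open>dense_pairs\<close> by 1/10.\<close>
     have "real ?s * p * (3 / 5) \<le> real ?s * p * (1 - exp (- 1))"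
      using exp_minus_one_le p01 by (intro mult_left_mono) auto
     thus "1 * (real ?s * p / 2) - real ?s * (if True then p else 1 - p) * (1 - exp (- 1)) \<le> - (\<eta> * \<eta> * k * ln k / 10)"
      using 1 by simp
    qed
    finally show "Prob ?M {X. real (card {e\<in>?S Y W. X e = True}) \<le> real ?s * p / 2} \<le> exp (- (\<eta> * \<eta> * k * ln k / 10))" .
   qed simp
  qed (simp_all add: card_Pow)
  finally show "Prob (random_graph k p) {H. \<not> dense_pairs \<eta> k p H} \<le> ?f k" .
 qed
qed

lemma choose_le_exp':
 fixes n N m :: nat and x y l :: real
 assumes "0 < m" "n \<le> N" "0 \<le> x" "exp 1 * N * x / m \<le> (y::real)" "y \<le> 1" "0 \<le> y" "l \<le> m"
 shows "real (n choose m) * x ^ m \<le> y powr l"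
proof -
 have "real (n choose m) * x ^ m \<le> (exp 1 * n / m) ^ m * x ^ m"
  using choose_le_exp[OF assms(1), of n] assms(3) by (intro mult_right_mono) auto
 also have "\<dots> = (exp 1 * n * x / m) ^ m" by (simp add: power_mult_distrib[symmetric])
 also have "\<dots> \<le> y ^ m"
 proof (rule power_mono)
  have "exp 1 * n * x / m \<le> exp 1 * N * x / m"
   using assms by (intro divide_right_mono mult_right_mono mult_left_mono) auto
  thus "exp 1 * n * x / m \<le> y" using assms(4) by linarith
 qed (use assms in auto)
 also have "\<dots> \<le> y powr l"
 proof (cases "y = 0")
  case False
  hence "y ^ m = y powr m" using assms(6) by (simp add: powr_realpow)
  also have "\<dots> \<le> y powr l" using assms False by (intro powr_mono') auto
  finally show ?thesis .
 qed (use assms in \<open>simp add: zero_power\<close>)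
 finally show ?thesis .
qed

text \<open>For card B = b there are at most (2 e k / b)^b choices of B and A. The size condition
  makes the required number of edges at least 4 b, so that each choice fails with probability at
  most (e b / (\<tau> k))^(4 b). The product is (2 e^5 (b / k)^3 / \<tau>^4)^b, and the bound on
  \<theta> reduces it to (b / k)^(2 b).\<close>

lemma sparse_sets_whp:
 assumes "0 < \<tau>" "\<tau> \<le> 1" "\<theta> \<le> 1 / 4" "\<theta> \<le> \<tau> ^ 4 / (2 * exp 5)"
 shows "whp log_range (sparse_sets \<tau> \<theta>)"
proof (rule whpI)
 let ?f = "\<lambda>k::nat. 32 / (real k * real k)"
 show "?f \<longlonglongrightarrow> 0" by real_asymp
 show "\<forall>\<^sub>F k in sequentially. \<forall>p. log_range k p \<longrightarrow>
  Prob (random_graph k p) {H. \<not> sparse_sets \<tau> \<theta> k p H} \<le> ?f k"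
 proof (rule eventually_mono[OF eventually_gt_at_top[of 1]], intro allI impI)
  fix k :: nat and p assume k: "1 < k" and p: "log_range k p"
  let ?V = "{1..k}" let ?M = "bern (pairs ?V) p" let ?d = "real k * p"
  let ?S = "\<lambda>A B. {e\<in>pairs B. e \<inter> A \<noteq> {}}"
  have p01: "0 \<le> p" "p \<le> 1" "0 < p" using p by (auto simp: log_range_def)
  have d: "0 < ?d" using k p01 by simp
  let ?bad = "\<lambda>A B X. real (card B) \<le> real (card A) * \<tau> * ?d / 4 \<and> \<tau> * ?d * real (card A) \<le> real (card {e\<in>?S A B. X e})"
  have "Prob (random_graph k p) {H. \<not> sparse_sets \<tau> \<theta> k p H} \<le>
    Prob ?M {X. \<exists>b\<in>{b\<in>{1..k}. real b \<le> \<theta> * real k}. \<exists>B\<in>{B. B \<subseteq> ?V \<and> card B = b}. \<exists>A\<in>Pow B - {{}}. ?bad A B X}"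
   unfolding prob_random_graph
  proof (rule prob_mono)
   fix X assume "\<not> sparse_sets \<tau> \<theta> k p (?V, {e \<in> pairs ?V. X e})"
   then obtain A B where AB: "A \<subseteq> B" "B \<subseteq> ?V" "A \<noteq> {}" "real (card B) \<le> \<theta> * real k" "real (card B) \<le> real (card A) * \<tau> * ?d / 4"
    "\<tau> * ?d * real (card A) \<le> real (card {e \<in> edges (?V, {e \<in> pairs ?V. X e}). e \<subseteq> B \<and> e \<inter> A \<noteq> {}})"
    unfolding sparse_sets_def by (auto simp: not_less)
   have "{e \<in> edges (?V, {e \<in> pairs ?V. X e}). e \<subseteq> B \<and> e \<inter> A \<noteq> {}} = {e\<in>?S A B. X e}"
    using AB(2) by (auto simp: pairs_def)
   hence bad: "?bad A B X" using AB(5,6) by (simp only:)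
   moreover have "finite B" using AB(2) finite_subset by blast
   hence "0 < card B" using AB by (auto simp: card_gt_0_iff)
   moreover have "card B \<le> k" using card_mono[OF _ AB(2)] by simp
   ultimately have "card B \<in> {b\<in>{1..k}. real b \<le> \<theta> * real k}" "B \<in> {B'. B' \<subseteq> ?V \<and> card B' = card B}" "A \<in> Pow B - {{}}"
    using AB by simp_all
   thus "\<exists>b\<in>{b\<in>{1..k}. real b \<le> \<theta> * real k}. \<exists>B\<in>{B. B \<subseteq> ?V \<and> card B = b}. \<exists>A\<in>Pow B - {{}}. ?bad A B X"
    using bad by blast
  qed
  also have "\<dots> \<le> (\<Sum>b\<in>{b\<in>{1..k}. real b \<le> \<theta> * real k}. 16 / (real k * real k) * (1 / 2) ^ b)"
  proof (rule prob_union_bound)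
   fix b assume "b \<in> {b\<in>{1..k}. real b \<le> \<theta> * real k}"
   hence b: "0 < b" "real b \<le> \<theta> * real k" by auto
   let ?y = "exp 1 * real b / (\<tau> * real k)"
   have xle: "real b / real k \<le> \<theta>" using b k by (simp add: field_simps)
   have "Prob ?M {X. \<exists>B\<in>{B. B \<subseteq> ?V \<and> card B = b}. \<exists>A\<in>Pow B - {{}}. ?bad A B X} \<le>
     (exp 1 * real k / real b) ^ b * (2 ^ b * ?y ^ (4 * b))"
   proof (rule prob_union_bound_card)
    show "finite {B. B \<subseteq> ?V \<and> card B = b}" by (rule finite_subset[of _ "Pow ?V"]) auto
    show "real (card {B. B \<subseteq> ?V \<and> card B = b}) \<le> (exp 1 * real k / real b) ^ b"
     using n_subsets[of ?V b] choose_le_exp[OF b(1), of k] by simp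
    fix B assume B: "B \<in> {B. B \<subseteq> ?V \<and> card B = b}"
    hence fB: "finite B" using finite_subset by blast
    show "Prob ?M {X. \<exists>A\<in>Pow B - {{}}. ?bad A B X} \<le> 2 ^ b * ?y ^ (4 * b)"
    proof (rule prob_union_bound_card)
     show "finite (Pow B - {{}})" using fB by simp
     have "card (Pow B - {{}}) \<le> card (Pow B)" using fB by (intro card_mono) auto
     thus "real (card (Pow B - {{}})) \<le> 2 ^ b" using B fB by (simp add: card_Pow)
     fix A assume A: "A \<in> Pow B - {{}}"
     hence fA: "finite A" using fB finite_subset by blast
     have a: "0 < card A" using A fA by (auto simp: card_gt_0_iff)
     show "Prob ?M {X. ?bad A B X} \<le> ?y ^ (4 * b)"
     proof (cases "real (card B) \<le> real (card A) * \<tau> * ?d / 4")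
      case False
      thus ?thesis using assms by simp
     next
      case True
      define m where "m = nat \<lceil>\<tau> * ?d * real (card A)\<rceil>"
      have ta: "0 < \<tau> * ?d * real (card A)" using assms d a by simp
      hence m: "0 < m" "\<tau> * ?d * real (card A) \<le> real m" unfolding m_def by linarith+
      have S: "card (?S A B) \<le> card A * b"
      proof -
       have "?S A B \<subseteq> (\<lambda>(u, v). {u, v}) ` (A \<times> B)"
       proof
        fix e assume e: "e \<in> ?S A B"
        then obtain u where u: "u \<in> e" "u \<in> A" by blast
        from e obtain x y where "e = {x, y}" "x \<in> B" "y \<in> B" by (auto simp: pairs_def card_2_iff)
        hence "e = {u, x} \<or> e = {u, y}" using u by auto
        thus "e \<in> (\<lambda>(u, v). {u, v}) ` (A \<times> B)" using u \<open>x \<in> B\<close> \<open>y \<in> B\<close> by auto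
       qed
       hence "card (?S A B) \<le> card ((\<lambda>(u, v). {u, v}) ` (A \<times> B))" using fA fB by (intro card_mono) auto
       also have "\<dots> \<le> card (A \<times> B)" using fA fB by (intro card_image_le) auto
       finally show ?thesis using B by (simp add: card_cartesian_product)
      qed
      have "Prob ?M {X. ?bad A B X} \<le> Prob ?M {X. m \<le> card {e\<in>?S A B. X e}}"
       unfolding m_def by (intro prob_mono) (simp add: nat_le_iff ceiling_le_iff)
      also have "\<dots> \<le> real (card (?S A B) choose m) * p ^ m"
       using B p01 pairs_mono[of B ?V] by (intro prob_many) auto
      also have "\<dots> \<le> ?y powr real (4 * b)"
      proof (rule choose_le_exp'[OF m(1) S p01(1)])
       have "exp 1 * real (card A * b) * p / m \<le> exp 1 * real (card A * b) * p / (\<tau> * ?d * real (card A))"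
        using m ta p01 by (intro divide_left_mono) auto
       also have "\<dots> = ?y" using a d p01 assms k by (simp add: field_simps)
       finally show "exp 1 * real (card A * b) * p / m \<le> ?y" .
       have "?y = exp 1 / \<tau> * (real b / real k)" by simp
       also have "\<dots> \<le> exp 1 / \<tau> * (\<tau> ^ 4 / (2 * exp 5))" using xle assms by (intro mult_left_mono) auto
       also have "\<dots> = \<tau> ^ 3 / (2 * exp 4)" using assms(1)
        by (simp add: field_simps eval_nat_numeral exp_add[symmetric])
       also have "\<dots> \<le> 1 / 1"
       proof (rule frac_le)
        show "\<tau> ^ 3 \<le> 1" using assms by (intro power_le_one) auto
        show "1 \<le> 2 * exp (4::real)" using one_le_exp_iff[of 4] by linarith
       qed auto
       finally show "?y \<le> 1" by simp
       show "0 \<le> ?y" using assms by simp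
       show "real (4 * b) \<le> m" using True B m(2) by (simp add: mult.assoc mult.commute mult.left_commute)
      qed
      also have "\<dots> = ?y ^ (4 * b)" using b k assms by (simp add: powr_realpow del: of_nat_mult)
      finally show ?thesis .
     qed
    qed (use assms in simp)
   qed (use assms in simp)
   also have "\<dots> = (2 * exp 5 * (real b / real k) ^ 3 / \<tau> ^ 4) ^ b"
   proof -
    have "exp 5 = exp 1 * exp (1::real) ^ 4" by (simp add: exp_of_nat_mult[symmetric] exp_add[symmetric])
    moreover have "e * k / b * (2 * (e * b / (t * k)) ^ 4) = 2 * (e * e ^ 4) * (b / k) ^ 3 / t ^ 4"
     if "b > 0" "k > 0" "t > 0" for e b k t :: real
     using that by (simp add: field_simps eval_nat_numeral)
    from this[of "real b" "real k" \<tau> "exp 1"]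
    have "exp 1 * real k / real b * (2 * ?y ^ 4) = 2 * (exp 1 * exp 1 ^ 4) * (real b / real k) ^ 3 / \<tau> ^ 4"
     using b(1) k assms(1) by simp
    ultimately have *: "exp 1 * real k / real b * (2 * ?y ^ 4) = 2 * exp 5 * (real b / real k) ^ 3 / \<tau> ^ 4"
     by (simp only:)
    show ?thesis unfolding *[symmetric] by (simp only: power_mult power_mult_distrib)
   qed
   also have "\<dots> \<le> ((real b / real k)\<^sup>2) ^ b"
   proof (rule power_mono)
    have "2 * exp 5 * (real b / real k) ^ 3 / \<tau> ^ 4 = (2 * exp 5 / \<tau> ^ 4) * (real b / real k) * (real b / real k)\<^sup>2"
     by (simp add: eval_nat_numeral mult_ac)
    also have "\<dots> \<le> 1 * (real b / real k)\<^sup>2"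
    proof (rule mult_right_mono)
     have "(2 * exp 5 / \<tau> ^ 4) * (real b / real k) \<le> (2 * exp 5 / \<tau> ^ 4) * (\<tau> ^ 4 / (2 * exp 5))"
      using xle assms by (intro mult_left_mono) auto
     thus "(2 * exp 5 / \<tau> ^ 4) * (real b / real k) \<le> 1" using assms(1) by simp
    qed simp
    finally show "2 * exp 5 * (real b / real k) ^ 3 / \<tau> ^ 4 \<le> (real b / real k)\<^sup>2" by simp
   qed (use assms in simp)
   \<comment> \<open>One factor (b / k)^2 is kept for the decay in k. The other b - 1 factors are at
     most 1/16 each, which pays for b^2 and makes the sum over b converge.\<close>
   also have "\<dots> \<le> 16 / (real k * real k) * (1 / 2) ^ b"
   proof -
    obtain c where c: "b = Suc c" using b(1) by (cases b) auto
    have "real b / real k \<le> 1 / 4" using xle assms(3) by linarith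
    hence "(real b / real k)\<^sup>2 \<le> (1 / 4)\<^sup>2" by (intro power_mono) auto
    hence "((real b / real k)\<^sup>2) ^ c \<le> ((1 / 4)\<^sup>2) ^ c" by (intro power_mono) auto
    hence "((real b / real k)\<^sup>2) ^ b \<le> (real b / real k)\<^sup>2 * ((1 / 4)\<^sup>2) ^ c" unfolding c power_Suc by (intro mult_left_mono) auto
    also have "((1 / 4 :: real)\<^sup>2) ^ c = 16 * (1 / 16) ^ b" unfolding c by (simp add: power_divide)
    also have "(real b / real k)\<^sup>2 * (16 * (1 / 16) ^ b) = 16 / (real k * real k) * (real b ^ 2 * (1 / 16) ^ b)"
     by (simp add: power2_eq_square)
    also have "\<dots> \<le> 16 / (real k * real k) * (1 / 2) ^ b"
    proof (rule mult_left_mono)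
     have "real b < 2 ^ b" using of_nat_less_two_power[of b] by simp
     hence "real b ^ 2 \<le> (2 ^ b) ^ 2" by (intro power_mono) auto
     also have "(2 ^ b) ^ 2 = (4::real) ^ b" by (simp add: power2_eq_square power_mult_distrib[symmetric])
     finally have "real b ^ 2 * (1 / 16) ^ b \<le> 4 ^ b * (1 / 16) ^ b" by (intro mult_right_mono) auto
     also have "\<dots> = (1 / 4) ^ b" by (simp add: power_mult_distrib[symmetric])
     also have "\<dots> \<le> (1 / 2) ^ b" by (intro power_mono) auto
     finally show "real b ^ 2 * (1 / 16) ^ b \<le> (1 / 2) ^ b" .
    qed simp
    finally show ?thesis .
   qed
   finally show "Prob ?M {X. \<exists>B\<in>{B. B \<subseteq> ?V \<and> card B = b}. \<exists>A\<in>Pow B - {{}}. ?bad A B X} \<le>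
    16 / (real k * real k) * (1 / 2) ^ b" .
  qed simp
  also have "\<dots> \<le> (\<Sum>b\<in>{..k}. 16 / (real k * real k) * (1 / 2) ^ b)" by (intro sum_mono2) auto
  also have "\<dots> = 16 / (real k * real k) * (\<Sum>b\<in>{..k}. (1 / 2) ^ b)" by (rule sum_distrib_left[symmetric])
  also have "\<dots> \<le> 16 / (real k * real k) * 2"
  proof (rule mult_left_mono)
   have "(\<Sum>b\<in>{..k}. (1 / 2 :: real) ^ b) \<le> (\<Sum>b. (1 / 2) ^ b)" by (intro sum_le_suminf summable_geometric) auto
   thus "(\<Sum>b\<in>{..k}. (1 / 2 :: real) ^ b) \<le> 2" by (simp add: suminf_geometric)
  qed simp
  finally show "Prob (random_graph k p) {H. \<not> sparse_sets \<tau> \<theta> k p H} \<le> ?f k" by simp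
 qed
qed

section \<open>Routing in random graphs\<close>

definition nbrs :: "nat graph \<Rightarrow> nat \<Rightarrow> nat set" where "nbrs H v = {w. {v, w} \<in> edges H}"

lemma dense_pairsD:
 assumes "dense_pairs \<eta> k p H" "Y \<subseteq> {1..k}" "W \<subseteq> {1..k}" "Y \<inter> W = {}"
  "\<eta> * real k \<le> real (card Y)" "\<eta> * real k \<le> real (card W)"
 shows "real (card Y) * real (card W) * p / 2 < real (card (edges_between H Y W))"
 using assms(1)[unfolded dense_pairs_def, rule_format, OF assms(2-)] .

lemma sparse_setsD:
 assumes "sparse_sets \<tau> \<theta> k p H" "A \<subseteq> B" "B \<subseteq> {1..k}" "A \<noteq> {}" "real (card B) \<le> \<theta> * real k"
  "real (card B) \<le> real (card A) * \<tau> * (real k * p) / 4"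
 shows "real (card {e\<in>edges H. e \<subseteq> B \<and> e \<inter> A \<noteq> {}}) < \<tau> * (real k * p) * real (card A)"
 using assms(1)[unfolded sparse_sets_def, rule_format, OF assms(2-)] .

lemma nbrs_subset: "simple_graph H \<Longrightarrow> nbrs H v \<subseteq> verts H - {v}"
 by (fastforce simp: nbrs_def simple_graph_def pairs_def card_insert_if split: if_splits)

lemma finite_edges: "simple_graph H \<Longrightarrow> finite (edges H)"
 unfolding simple_graph_def by (meson finite_pairs finite_subset)

lemma ex_max:
 fixes f :: "'a \<Rightarrow> nat"
 assumes "P x" "\<And>y. P y \<Longrightarrow> f y \<le> m"
 shows "\<exists>z. P z \<and> (\<forall>y. P y \<longrightarrow> f y \<le> f z)"
 by (rule ex_has_greatest_nat[of P x f "Suc m"]) (auto intro!: assms simp: less_Suc_eq_le)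

text \<open>
 Vertices with few neighbours among the remaining ones are removed as long as possible: the
 edges between the removed and the remaining vertices stay few, so not many can be removed.
\<close>

lemma prune:
 fixes k :: nat and \<eta> p :: real
 assumes H: "simple_graph H" "verts H = {1..k}" and dense: "dense_pairs \<eta> k p H"
  and \<eta>: "0 < \<eta>" "\<eta> \<le> 1 / 100" "1 \<le> \<eta> * k" and p: "0 < p"
  and Z: "Z \<subseteq> {1..k}" "card Z \<le> \<eta> * k"
 shows "\<exists>G\<subseteq>{1..k} - Z. (1 - 3 * \<eta>) * k \<le> card G \<and> (\<forall>v\<in>G. k * p / 4 \<le> card (nbrs H v \<inter> G))"
proof -
 let ?V = "{1..k}" let ?d = "real k * p"
 define m where "m = nat \<lceil>\<eta> * k\<rceil>"
 have m: "\<eta> * k \<le> m" "m \<le> \<eta> * k + 1" unfolding m_def using \<eta> by linarith+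
 \<comment> \<open>The removal process is replaced by a largest set with its invariant. The cap
   \<open>m\<close> is a size to which \<open>dense_pairs\<close> applies; reaching it would
   contradict the invariant, since at least half of the vertices remain.\<close>
 let ?F = "\<lambda>Y. Y \<subseteq> ?V - Z \<and> card Y \<le> m \<and> card (edges_between H Y (?V - Z - Y)) \<le> card Y * ?d / 4"
 have "?F {}" by (simp add: edges_between_def)
 moreover have "\<And>Y. ?F Y \<Longrightarrow> card Y \<le> m" by simp
 ultimately have "\<exists>Y. ?F Y \<and> (\<forall>Y'. ?F Y' \<longrightarrow> card Y' \<le> card Y)" by (rule ex_max)
 then obtain Y where Y: "?F Y" and max: "\<And>Y'. ?F Y' \<Longrightarrow> card Y' \<le> card Y" by (elim exE conjE) simp
 define G where "G = ?V - Z - Y"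
 have fin: "finite Z" "finite Y" "finite G"
 proof -
  have "Y \<subseteq> ?V - Z" using Y by (rule conjunct1)
  thus "finite Z" "finite Y" "finite G"
   unfolding G_def using finite_subset[OF Z(1)] finite_subset[of Y "?V - Z"] by simp_all
 qed
 have "card ?V \<le> card (Z \<union> Y \<union> G)" using fin by (intro card_mono) (auto simp: G_def)
 also have "\<dots> \<le> card Z + card Y + card G" by (meson card_Un_le le_trans add_le_mono1)
 finally have "real k \<le> real (card Z) + real (card Y) + real (card G)" by simp
 moreover have "real (card Y) \<le> 2 * (\<eta> * k)" using Y m \<eta> by linarith
 ultimately have G: "(1 - 3 * \<eta>) * k \<le> card G" using Z(2) by (simp add: algebra_simps)
 have Ym: "card Y < m"
 proof (rule ccontr)
  assume "\<not> card Y < m"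
  hence Ym: "card Y = m" using Y by simp
  have "\<eta> * k \<le> (1 - 3 * \<eta>) * k" using \<eta> by (intro mult_right_mono) auto
  hence "real (card Y) * real (card G) * p / 2 < card (edges_between H Y G)"
  proof -
   have "Y \<subseteq> ?V" "G \<subseteq> ?V" "Y \<inter> G = {}" using Y by (auto simp: G_def)
   moreover have "\<eta> * k \<le> card Y" "\<eta> * k \<le> card G" using Ym m(1) \<open>\<eta> * k \<le> (1 - 3 * \<eta>) * k\<close> G by linarith+
   ultimately show ?thesis by (rule dense_pairsD[OF dense])
  qed
  also have "\<dots> \<le> card Y * ?d / 4" using Y by (simp add: G_def)
  finally have "real (card Y) * (real (card G) * p / 2) < real (card Y) * (?d / 4)" by simp
  hence "real (card G) * p / 2 < ?d / 4" by (rule mult_left_less_imp_less) simp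
  moreover have "(1 / 2) * real k * p \<le> real (card G) * p"
  proof (rule mult_right_mono)
   have "(1 / 2) * real k \<le> (1 - 3 * \<eta>) * k" using \<eta> by (intro mult_right_mono) auto
   thus "(1 / 2) * real k \<le> card G" using G by linarith
  qed (use p in simp)
  ultimately show False by linarith
 qed
 have "?d / 4 \<le> card (nbrs H v \<inter> G)" if v: "v \<in> G" for v
 proof (rule ccontr)
  assume *: "\<not> ?d / 4 \<le> card (nbrs H v \<inter> G)"
  let ?Y = "insert v Y"
  have vY: "v \<notin> Y" using v by (simp add: G_def)
  have "edges_between H ?Y (?V - Z - ?Y) \<subseteq> edges_between H Y G \<union> (\<lambda>w. {v, w}) ` (nbrs H v \<inter> G)"
   unfolding edges_between_def nbrs_def G_def by auto
  moreover have "finite (edges_between H Y G)" using finite_edges[OF H(1)] by (simp add: edges_between_def)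
  ultimately have "card (edges_between H ?Y (?V - Z - ?Y)) \<le> card (edges_between H Y G \<union> (\<lambda>w. {v, w}) ` (nbrs H v \<inter> G))"
   using fin by (intro card_mono) auto
  also have "\<dots> \<le> card (edges_between H Y G) + card ((\<lambda>w. {v, w}) ` (nbrs H v \<inter> G))" by (rule card_Un_le)
  also have "\<dots> \<le> card (edges_between H Y G) + card (nbrs H v \<inter> G)" using fin by (intro add_left_mono card_image_le) auto
  finally have "real (card (edges_between H ?Y (?V - Z - ?Y))) \<le> card (edges_between H Y G) + card (nbrs H v \<inter> G)" by linarith
  also have "\<dots> \<le> card Y * ?d / 4 + ?d / 4" using Y * by (simp add: G_def)
  also have "\<dots> = card ?Y * ?d / 4" using vY fin by (simp add: algebra_simps add_divide_distrib)
  finally have "?F ?Y" using Y Ym v vY fin by (auto simp: G_def)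
  from max[OF this] show False using vY fin by simp
 qed
 thus ?thesis using G Y by (intro exI[of _ G] conjI ballI) (auto simp: G_def)
qed

section \<open>Balls and short paths\<close>

primrec ball_in :: "nat graph \<Rightarrow> nat set \<Rightarrow> nat \<Rightarrow> nat \<Rightarrow> nat set" where
 "ball_in H G u 0 = {u}"
| "ball_in H G u (Suc i) = ball_in H G u i \<union> (\<Union>v\<in>ball_in H G u i. nbrs H v \<inter> G)"

lemma ball_in_subset: "u \<in> G \<Longrightarrow> ball_in H G u i \<subseteq> G"
 by (induction i) auto

lemma ball_in_path:
 assumes "w \<in> ball_in H G u i" "u \<in> G"
 shows "\<exists>P\<subseteq>G. finite P \<and> card P \<le> Suc i \<and> w \<in> P \<and> (\<forall>v\<in>P. (u, v) \<in> linked H P)"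
 using assms(1)
proof (induction i arbitrary: w)
 case 0
 thus ?case using assms(2) by (intro exI[of _ "{u}"]) auto
next
 case (Suc i)
 show ?case
 proof (cases "w \<in> ball_in H G u i")
  case True
  from Suc.IH[OF this] show ?thesis using le_SucI by blast
 next
  case False
  then obtain x where x: "x \<in> ball_in H G u i" "w \<in> nbrs H x" "w \<in> G" using Suc.prems by auto
  from Suc.IH[OF x(1)] obtain P where P: "P \<subseteq> G" "finite P" "card P \<le> Suc i" "x \<in> P"
   "\<forall>v\<in>P. (u, v) \<in> linked H P" by blast
  let ?P = "insert w P"
  have mono: "linked H P \<subseteq> linked H ?P" by (intro rtrancl_mono) auto
  have "(u, x) \<in> linked H ?P" using P(4,5) mono by blast
  moreover have "(x, w) \<in> adjacent H \<inter> ?P \<times> ?P" using x P(4) by (auto simp: adjacent_def nbrs_def)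
  ultimately have "(u, w) \<in> linked H ?P" by (rule rtrancl_into_rtrancl)
  moreover have "card ?P \<le> Suc (Suc i)" using P(2,3) by (simp add: card_insert_if)
  ultimately show ?thesis using P mono x(3) by (intro exI[of _ ?P]) auto
 qed
qed

text \<open>The order of the two ends distinguishes the two directions in which an edge is
  counted.\<close>

lemma degree_sum_le:
 assumes H: "simple_graph H" and A: "finite A" "\<And>v. v \<in> A \<Longrightarrow> nbrs H v \<inter> G \<subseteq> B" "A \<subseteq> B"
 shows "(\<Sum>v\<in>A. card (nbrs H v \<inter> G)) \<le> 2 * card {e\<in>edges H. e \<subseteq> B \<and> e \<inter> A \<noteq> {}}"
proof -
 let ?E = "{e\<in>edges H. e \<subseteq> B \<and> e \<inter> A \<noteq> {}}"
 have fin: "finite (nbrs H v \<inter> G)" for v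
  using nbrs_subset[OF H, of v] H by (meson finite_Diff finite_Int finite_subset simple_graph_def)
 have "(\<Sum>v\<in>A. card (nbrs H v \<inter> G)) = card (SIGMA v:A. nbrs H v \<inter> G)" using A(1) fin by (simp add: card_SigmaI)
 also have "\<dots> \<le> card (?E \<times> (UNIV :: bool set))"
 proof (rule card_inj_on_le)
  show "inj_on (\<lambda>(v, w). ({v, w}, v < w)) (SIGMA v:A. nbrs H v \<inter> G)"
   by (auto simp: inj_on_def doubleton_eq_iff)
  show "(\<lambda>(v, w). ({v, w}, v < w)) ` (SIGMA v:A. nbrs H v \<inter> G) \<subseteq> ?E \<times> UNIV"
   using A(2,3) by (auto simp: nbrs_def)
  show "finite (?E \<times> (UNIV :: bool set))" using finite_edges[OF H] by simp
 qed
 also have "\<dots> = 2 * card ?E" by (simp add: card_cartesian_product)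
 finally show ?thesis .
qed

text \<open>All neighbours in G of a ball A are in the next ball B, so with d = k p at least card A
  * d / 8 edges within B meet A. As long as B is small, \<open>sparse_sets\<close> with \<tau> = 1/8
  then forces card B > card A * d / 32, and d / 32 is at least sqrt d because d is at least 1024 =
  32^2.\<close>

lemma ball_in_growth:
 fixes k :: nat and \<theta> p :: real
 assumes H: "simple_graph H" "verts H = {1..k}" and sparse: "sparse_sets (1 / 8) \<theta> k p H" and d: "1024 \<le> k * p"
  and G: "G \<subseteq> {1..k}" "\<And>v. v \<in> G \<Longrightarrow> k * p / 4 \<le> card (nbrs H v \<inter> G)" and u: "u \<in> G"
 shows "sqrt (k * p) ^ i \<le> card (ball_in H G u i) \<or> \<theta> * k < card (ball_in H G u i)"
proof (induction i)
 case (Suc i)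
 let ?A = "ball_in H G u i" and ?B = "ball_in H G u (Suc i)" let ?d = "real k * p"
 have sub: "?A \<subseteq> G" "?B \<subseteq> G" "?A \<subseteq> ?B" using ball_in_subset[OF u] by auto
 have fin: "finite ?A" "finite ?B" using sub G(1) by (meson finite_subset finite_atLeastAtMost)+
 have u: "u \<in> ?A" by (induction i) auto
 show ?case
 proof (cases "\<theta> * k < card ?B")
  case False
  hence "card ?A \<le> \<theta> * k" using card_mono[OF fin(2) sub(3)] by linarith
  hence IH: "sqrt ?d ^ i \<le> card ?A" using Suc by linarith
  let ?E = "{e\<in>edges H. e \<subseteq> ?B \<and> e \<inter> ?A \<noteq> {}}"
  have "card ?A * (?d / 4) = (\<Sum>v\<in>?A. ?d / 4)" by simp
  also have "\<dots> \<le> (\<Sum>v\<in>?A. real (card (nbrs H v \<inter> G)))" by (intro sum_mono G(2)) (use sub in auto)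
  also have "\<dots> = real (\<Sum>v\<in>?A. card (nbrs H v \<inter> G))" by simp
  also have "\<dots> \<le> real (2 * card ?E)"
   by (subst of_nat_le_iff) (intro degree_sum_le H fin sub, auto)
  finally have "(1 / 8) * ?d * card ?A \<le> card ?E" by (simp del: ball_in.simps add: mult.commute)
  have "\<not> card ?B \<le> card ?A * (1 / 8) * ?d / 4"
  proof
   assume "card ?B \<le> card ?A * (1 / 8) * ?d / 4"
   hence "card ?E < (1 / 8) * ?d * card ?A"
    by (intro sparse_setsD[OF sparse sub(3)]) (use False sub(2) G(1) u in auto)
   thus False using \<open>(1 / 8) * ?d * card ?A \<le> card ?E\<close> by linarith
  qed
  hence "card ?A * (?d / 32) \<le> card ?B" by simp
  moreover have "sqrt ?d \<le> ?d / 32"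
  proof -
   have "sqrt 1024 \<le> sqrt ?d" using d by (rule real_sqrt_le_mono)
   moreover have "sqrt 1024 = (32 :: real)" by (rule real_sqrt_unique) auto
   ultimately have "32 \<le> sqrt ?d" by (simp only:)
   hence "32 * sqrt ?d \<le> sqrt ?d * sqrt ?d" by (intro mult_right_mono) (use d in \<open>simp_all\<close>)
   moreover have "sqrt ?d * sqrt ?d = ?d" using d by (simp del: of_nat_mult)
   ultimately show ?thesis by linarith
  qed
  hence "card ?A * sqrt ?d \<le> card ?A * (?d / 32)" by (intro mult_left_mono) auto
  moreover have "sqrt ?d ^ i * sqrt ?d \<le> card ?A * sqrt ?d" using IH d by (intro mult_right_mono) auto
  ultimately have "sqrt ?d ^ Suc i \<le> card ?B" by (simp add: mult.commute)
  thus ?thesis by blast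
 qed simp
qed simp

text \<open>After \<open>i\<close> steps the ball has at least \<theta> k vertices. By
  \<open>dense_pairs\<close>, one more step reaches all but fewer than \<eta> k vertices of the
  pruned set G. Outside of G there are at most 3 \<eta> k vertices, so at most 4 \<eta> k are lost
  in total, less than a tenth.\<close>

lemma robust_reach:
 fixes k i :: nat and \<eta> \<theta> p :: real
 assumes H: "simple_graph H" "verts H = {1..k}" and dense: "dense_pairs \<eta> k p H" and sparse: "sparse_sets (1 / 8) \<theta> k p H"
  and \<eta>: "0 < \<eta>" "\<eta> \<le> 1 / 100" "1 \<le> \<eta> * k" "\<eta> \<le> \<theta>" "\<theta> \<le> 1" and d: "1024 \<le> k * p" "0 < p"
  and i: "real k \<le> sqrt (k * p) ^ i" and Z: "Z \<subseteq> {1..k}" "card Z \<le> \<eta> * k"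
 shows "\<exists>u. \<exists>W\<subseteq>{1..k}. 10 * card ({1..k} - W) \<le> k \<and> (\<forall>w\<in>W. \<exists>P\<subseteq>{1..k} - Z. card P \<le> i + 2 \<and> w \<in> P \<and>
   (\<forall>v\<in>P. (u, v) \<in> linked H P))"
proof -
 let ?V = "{1..k}"
 obtain G where G: "G \<subseteq> ?V - Z" "(1 - 3 * \<eta>) * k \<le> card G" "\<And>v. v \<in> G \<Longrightarrow> k * p / 4 \<le> card (nbrs H v \<inter> G)"
  using prune[OF H dense \<eta>(1-3) d(2) Z] by (elim exE conjE) simp
 have k: "0 < real k" using \<eta>(1,3) by (cases "k = 0") auto
 have "0 < (1 - 3 * \<eta>) * k" using \<eta> k by simp
 hence "0 < card G" using G(2) by linarith
 then obtain u where u: "u \<in> G" by (metis card_gt_0_iff ex_in_conv)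
 have finG: "finite G" using G(1) finite_subset by blast
 let ?B = "ball_in H G u i" and ?C = "ball_in H G u (Suc i)"
 have sub: "?B \<subseteq> G" "?C \<subseteq> G" using ball_in_subset[OF u] by auto
 have "\<theta> * k \<le> card ?B"
 proof -
  have "G \<subseteq> ?V" using G(1) by blast
  from ball_in_growth[OF H sparse d(1) this G(3) u, of i] mult_right_mono[OF \<eta>(5), of "real k"] i
  show ?thesis by linarith
 qed
 moreover have "\<eta> * k \<le> \<theta> * k" using \<eta> by (intro mult_right_mono) auto
 ultimately have B: "\<eta> * k \<le> card ?B" by linarith
 have W: "card (G - ?C) < \<eta> * k"
 proof (rule ccontr)
  assume "\<not> card (G - ?C) < \<eta> * k"
  moreover have "?B \<inter> (G - ?C) = {}" by auto
  ultimately have "real (card ?B) * real (card (G - ?C)) * p / 2 < card (edges_between H ?B (G - ?C))"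
   using dense_pairsD[OF dense _ _ _ B] sub(1) G(1) by (simp add: not_less subset_iff)
  moreover have "edges_between H ?B (G - ?C) = {}" unfolding edges_between_def by (auto simp: nbrs_def)
  ultimately show False using d by (simp add: mult_less_0_iff)
 qed
 have card_rest: "card (A - ?C) + card ?C = card A" if "finite A" "?C \<subseteq> A" for A
  using card_Diff_subset[OF finite_subset[OF that(2,1)] that(2)] card_mono[OF that] by linarith
 have "?C \<subseteq> ?V" using sub(2) G(1) by blast
 from card_rest[OF _ this] have "card (?V - ?C) + card ?C = k" by simp
 moreover have "card (G - ?C) + card ?C = card G" using finG sub(2) by (rule card_rest)
 ultimately have "real (card (?V - ?C)) \<le> k - (1 - 3 * \<eta>) * k + \<eta> * k" using W G(2) by linarith
 also have "\<dots> = 4 * \<eta> * k" by (simp add: algebra_simps)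
 also have "\<dots> \<le> (1 / 10) * k" using \<eta> by (intro mult_right_mono) auto
 finally have "10 * card (?V - ?C) \<le> k" by linarith
 moreover have "\<exists>P\<subseteq>?V - Z. card P \<le> i + 2 \<and> w \<in> P \<and> (\<forall>v\<in>P. (u, v) \<in> linked H P)" if "w \<in> ?C" for w
  using ball_in_path[OF that u] G(1) by (elim exE conjE, intro exI conjI) auto
 ultimately show ?thesis using sub(2) G(1) by (intro exI[of _ u] exI[of _ ?C]) auto
qed

text \<open>
 The paths are chosen one group after the other, avoiding the vertices that already lie on \<open>M\<close>
 paths. As all paths are short, there are few of these at any time.
\<close>

lemma greedy_routing:
 assumes V: "verts H = {1..k}" and M: "k * k * l \<le> M * z" "0 < M"
  and reach: "\<And>Z. Z \<subseteq> {1..k} \<Longrightarrow> card Z \<le> z \<Longrightarrow> \<exists>u. \<exists>W\<subseteq>{1..k}. 10 * card ({1..k} - W) \<le> k \<and>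
   (\<forall>w\<in>W. \<exists>P\<subseteq>{1..k} - Z. card P \<le> l \<and> w \<in> P \<and> (\<forall>v\<in>P. (u, v) \<in> linked H P))"
 shows "q \<le> k \<Longrightarrow> \<exists>T home. T \<subseteq> {..<q} \<times> {1..k} \<times> {1..k} \<and>
   (\<forall>g<q. 10 * card {w\<in>{1..k}. \<forall>v. (g, w, v) \<notin> T} \<le> k) \<and>
   (\<forall>g w v. (g, w, v) \<in> T \<longrightarrow> (g, w, w) \<in> T \<and> (home g, v) \<in> linked H {v. (g, w, v) \<in> T}) \<and>
   (\<forall>v. card {(g, w). (g, w, v) \<in> T} \<le> M + k) \<and> card T \<le> q * k * l"
proof (induction q)
 case 0
 thus ?case by (intro exI[of _ "{}"]) auto
next
 case (Suc q)
 let ?V = "{1..k}"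
 from Suc obtain T home where T: "T \<subseteq> {..<q} \<times> ?V \<times> ?V" and
  T1: "\<And>g. g < q \<Longrightarrow> 10 * card {w\<in>?V. \<forall>v. (g, w, v) \<notin> T} \<le> k" and
  T2: "\<And>g w v. (g, w, v) \<in> T \<Longrightarrow> (g, w, w) \<in> T \<and> (home g, v) \<in> linked H {v. (g, w, v) \<in> T}" and
  T3: "\<And>v. card {(g, w). (g, w, v) \<in> T} \<le> M + k" and T4: "card T \<le> q * k * l"
  by (auto simp: Suc_le_eq)
 have finT: "finite T" using T finite_subset by blast
 let ?load = "\<lambda>v. card {(g, w). (g, w, v) \<in> T}"
 have fin_load: "finite {(g, w). (g, w, v) \<in> T}" for v
  by (rule finite_subset[of _ "{..<q} \<times> ?V"]) (use T in auto)
 \<comment> \<open>Vertices of load \<open>M\<close> are avoided, and a group adds at most one path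
   per target, so no load exceeds \<open>M + k\<close>. All paths together have at most k * k * l
   entries, whence at most \<open>z\<close> vertices are full.\<close>
 define Z where "Z = {v\<in>?V. M \<le> ?load v}"
 have Z: "Z \<subseteq> ?V" by (auto simp: Z_def)
 have "card Z \<le> z"
 proof -
  have "card Z * M = (\<Sum>v\<in>Z. M)" by simp
  also have "\<dots> \<le> (\<Sum>v\<in>Z. ?load v)" by (intro sum_mono) (simp add: Z_def)
  also have "\<dots> = card (SIGMA v:Z. {(g, w). (g, w, v) \<in> T})"
   using fin_load finite_subset[OF Z] by (simp add: card_SigmaI)
  also have "\<dots> \<le> card T"
  proof (rule card_inj_on_le[OF _ _ finT])
   show "inj_on (\<lambda>(v, g, w). (g, w, v)) (SIGMA v:Z. {(g, w). (g, w, v) \<in> T})" by (auto simp: inj_on_def)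
  qed auto
  also have "\<dots> \<le> k * k * l" using T4 Suc.prems by (meson le_trans mult_le_mono1 Suc_leD)
  also have "\<dots> \<le> M * z" by (rule M)
  finally show ?thesis using M(2) by (simp add: mult.commute)
 qed
 from reach[OF Z this] obtain u W where W: "W \<subseteq> ?V" "10 * card (?V - W) \<le> k" and
  P: "\<forall>w\<in>W. \<exists>P\<subseteq>?V - Z. card P \<le> l \<and> w \<in> P \<and> (\<forall>v\<in>P. (u, v) \<in> linked H P)" by blast
 from bchoice[OF P] obtain P where P: "\<And>w. w \<in> W \<Longrightarrow> P w \<subseteq> ?V - Z \<and> card (P w) \<le> l \<and> w \<in> P w \<and>
   (\<forall>v\<in>P w. (u, v) \<in> linked H (P w))" by (elim exE) (rule that, erule bspec)
 define N where "N = {(q, w, v) | w v. w \<in> W \<and> v \<in> P w}"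
 let ?T = "T \<union> N" and ?home = "home(q := u)"
 have finW: "finite W" using W(1) finite_subset by blast
 have old: "(g, w, v) \<in> ?T \<longleftrightarrow> (g, w, v) \<in> T" if "g \<noteq> q" for g w v using that by (auto simp: N_def)
 have new: "(q, w, v) \<in> ?T \<longleftrightarrow> w \<in> W \<and> v \<in> P w" for w v using T by (auto simp: N_def)
 have "?T \<subseteq> {..<Suc q} \<times> ?V \<times> ?V" using T W(1) P unfolding N_def by fastforce
 moreover have "10 * card {w\<in>?V. \<forall>v. (g, w, v) \<notin> ?T} \<le> k" if "g < Suc q" for g
 proof (cases "g = q")
  case True
  have "{w\<in>?V. \<forall>v. (q, w, v) \<notin> ?T} = ?V - W" unfolding new using P by blast
  thus ?thesis using W(2) True by (simp del: Un_iff)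
 next
  case False
  thus ?thesis using T1[of g] that old by (simp del: Un_iff)
 qed
 moreover have "(g, w, w) \<in> ?T \<and> (?home g, v) \<in> linked H {v. (g, w, v) \<in> ?T}"
  if "(g, w, v) \<in> ?T" for g w v
 proof (cases "g = q")
  case True
  hence wv: "w \<in> W" "v \<in> P w" using that new by blast+
  moreover have "{v. (q, w, v) \<in> ?T} = P w" using new wv(1) by blast
  ultimately show ?thesis using P[OF wv(1)] True new by (simp del: Un_iff)
 next
  case False
  thus ?thesis using T2[of g w v] that old by (simp del: Un_iff)
 qed
 moreover have "card {(g, w). (g, w, v) \<in> ?T} \<le> M + k" for v
 proof (cases "v \<in> Z \<or> v \<notin> ?V")
  case True
  hence "{(g, w). (g, w, v) \<in> ?T} = {(g, w). (g, w, v) \<in> T}" using P unfolding N_def by blast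
  thus ?thesis using T3 by simp
 next
  case False
  have "{(g, w). (g, w, v) \<in> ?T} \<subseteq> {(g, w). (g, w, v) \<in> T} \<union> {q} \<times> W" unfolding N_def by auto
  hence "card {(g, w). (g, w, v) \<in> ?T} \<le> card ({(g, w). (g, w, v) \<in> T} \<union> {q} \<times> W)"
   using fin_load finW by (intro card_mono) auto
  also have "\<dots> \<le> ?load v + card ({q} \<times> W)" by (rule card_Un_le)
  also have "\<dots> \<le> M + k" using False card_mono[OF _ W(1)] by (auto simp: Z_def card_cartesian_product)
  finally show ?thesis .
 qed
 moreover have "card ?T \<le> Suc q * k * l"
 proof -
  have "N = (\<lambda>(w, v). (q, w, v)) ` (SIGMA w:W. P w)" unfolding N_def by auto
  hence "card N \<le> card (SIGMA w:W. P w)"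
   by (auto intro!: card_image_le finite_SigmaI finW intro: finite_subset[OF conjunct1[OF P]])
  also have "\<dots> = (\<Sum>w\<in>W. card (P w))" using P finW
   by (intro card_SigmaI ballI) (blast intro: finite_subset[OF conjunct1[OF P]])+
  also have "\<dots> \<le> (\<Sum>w\<in>W. l)" by (intro sum_mono) (use P in blast)
  also have "\<dots> \<le> k * l" using card_mono[OF _ W(1)] by simp
  finally have "card N \<le> k * l" .
  thus ?thesis using T4 card_Un_le[of T N] by (simp add: algebra_simps)
 qed
 ultimately show ?case by (intro exI[of _ ?T] exI[of _ ?home] conjI allI impI) auto
qed

text \<open>There are k groups. With \<open>i\<close> about 2 \<rho>, the power sqrt (k p)^i reaches
  k. The load \<open>M\<close> is chosen such that paths for k * k pairs with i + 2 vertices each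
  fill at most \<eta> k / 2 vertices, which gives M = O(k \<rho> / \<eta>).\<close>

theorem routing_exists:
 fixes k :: nat and \<eta> \<theta> p :: real
 assumes H: "simple_graph H" "verts H = {1..k}" and dense: "dense_pairs \<eta> k p H" and sparse: "sparse_sets (1 / 8) \<theta> k p H"
  and \<eta>: "0 < \<eta>" "\<eta> \<le> 1 / 100" "1 \<le> \<eta> * k" "\<eta> \<le> \<theta>" "\<theta> \<le> 1" and d: "1024 \<le> k * p" "0 < p" "p \<le> 1"
 obtains T load where "routing H k load T" "load \<le> (11 / \<eta>) * (k * rho k p)"
proof -
 let ?d = "real k * p"
 have k: "0 < k" using \<eta>(1,3) by (cases "k = 0") auto
 have dk: "?d \<le> k" using d(3) by (simp add: mult_left_le)
 have lnd: "0 < ln ?d" using d by simp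
 have rho: "1 \<le> rho k p" using dk d lnd k unfolding rho_def by (simp add: divide_simps)
 define i where "i = nat \<lceil>2 * rho k p\<rceil>"
 have i: "2 * rho k p \<le> i" "i \<le> 2 * rho k p + 1" unfolding i_def using rho by linarith+
 have "real k = exp (rho k p * ln ?d)" using lnd k by (simp add: rho_def)
 also have "\<dots> \<le> exp (i * (ln ?d / 2))" using mult_right_mono[OF i(1), of "ln ?d / 2"] lnd by simp
 also have "\<dots> = sqrt ?d ^ i" using d by (simp add: exp_of_nat_mult ln_sqrt[symmetric])
 finally have ki: "real k \<le> sqrt ?d ^ i" .
 define z where "z = nat \<lfloor>\<eta> * k\<rfloor>"
 define m where "m = 2 * real k * (real i + 2) / \<eta>"
 define M where "M = nat \<lceil>m\<rceil>"
 have z: "z \<le> \<eta> * k" "\<eta> * k < real z + 1" unfolding z_def using \<eta> by linarith+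
 have "0 < z" using z(2) \<eta>(3) by (cases z) simp_all
 hence z': "\<eta> * k / 2 \<le> z" using z(2) by linarith
 have m0: "0 < m" unfolding m_def using \<eta> k by (intro divide_pos_pos mult_pos_pos) auto
 have M: "m \<le> M" "M \<le> m + 1" unfolding M_def using m0 by linarith+
 have "real (k * k * (i + 2)) = m * (\<eta> * k / 2)" using \<eta>(1) by (simp add: m_def field_simps)
 also have "\<dots> \<le> real M * real z" using M z' \<eta> by (intro mult_mono) auto
 finally have "real (k * k * (i + 2)) \<le> real (M * z)" by simp
 hence Mz: "k * k * (i + 2) \<le> M * z" by (simp only: of_nat_le_iff)
 have M0: "0 < M" using M(1) m0 by linarith
 have reach: "\<exists>u. \<exists>W\<subseteq>{1..k}. 10 * card ({1..k} - W) \<le> k \<and>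
   (\<forall>w\<in>W. \<exists>P\<subseteq>{1..k} - Z. card P \<le> i + 2 \<and> w \<in> P \<and> (\<forall>v\<in>P. (u, v) \<in> linked H P))"
  if "Z \<subseteq> {1..k}" "card Z \<le> z" for Z
  by (rule robust_reach[OF H dense sparse \<eta> d(1,2) ki that(1)]) (use that(2) z in linarith)
 from greedy_routing[OF H(2) Mz M0 reach order_refl] obtain T home where T: "T \<subseteq> {..<k} \<times> {1..k} \<times> {1..k}"
   "\<forall>g<k. 10 * card {w\<in>{1..k}. \<forall>v. (g, w, v) \<notin> T} \<le> k"
   "\<forall>g w v. (g, w, v) \<in> T \<longrightarrow> (g, w, w) \<in> T \<and> (home g, v) \<in> linked H {v. (g, w, v) \<in> T}"
   "\<forall>v. card {(g, w). (g, w, v) \<in> T} \<le> M + k" by blast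
 have "routing H k (M + k) T" unfolding routing_def H(2) card_atLeastAtMost diff_Suc_1 using T k by blast
 moreover have "M + k \<le> (11 / \<eta>) * (k * rho k p)"
 proof -
  have kr: "real k * 1 \<le> k * rho k p" using rho by (intro mult_left_mono) auto
  have "m * \<eta> = 2 * (k * real i) + 4 * k" using \<eta>(1) by (simp add: m_def field_simps)
  moreover have "real k * i \<le> real k * (2 * rho k p + 1)" using i by (intro mult_left_mono) auto
  moreover have "real k * \<eta> \<le> real k * (1 / 100)" "1 * \<eta> \<le> real k * \<eta>" using \<eta> k by (intro mult_left_mono mult_right_mono; simp)+
  ultimately have "(m + 1 + k) * \<eta> \<le> 11 * (k * rho k p)" using kr by (simp add: algebra_simps)
  hence "m + 1 + k \<le> (11 / \<eta>) * (k * rho k p)" using \<eta> by (simp add: pos_le_divide_eq)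
  thus ?thesis using M(2) by simp
 qed
 ultimately show thesis by (rule that)
qed

section \<open>Retractions\<close>

definition homomorphism :: "nat graph \<Rightarrow> (nat \<Rightarrow> nat) \<Rightarrow> bool" where
 "homomorphism H f \<longleftrightarrow> f ` verts H \<subseteq> verts H \<and> (\<forall>u v. {u, v} \<in> edges H \<longrightarrow> {f u, f v} \<in> edges H)"

text \<open>Images are fixed points, so \<open>r\<close> is idempotent on the vertices. The set
  \<open>U\<close> of moved vertices is named because the union bound runs over it.\<close>

definition retraction_moving :: "nat graph \<Rightarrow> nat set \<Rightarrow> (nat \<Rightarrow> nat) \<Rightarrow> bool" where
 "retraction_moving H U r \<longleftrightarrow> homomorphism H r \<and> U = {v\<in>verts H. r v \<noteq> v} \<and> (\<forall>v\<in>verts H. r v \<notin> U)"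

lemma homomorphism_funpow: "homomorphism H f \<Longrightarrow> homomorphism H (f ^^ n)"
 by (induction n) (simp_all add: homomorphism_def image_subset_iff)

text \<open>A suitable power of a homomorphism that is not injective is idempotent.\<close>

lemma retraction_exists:
 assumes H: "simple_graph H" and "\<not> core H"
 shows "\<exists>U r. U \<noteq> {} \<and> retraction_moving H U r"
proof -
 let ?V = "verts H"
 from assms(2) obtain f where f: "homomorphism H f" "\<not> inj_on f ?V"
  unfolding core_def homomorphism_def by blast
 have pow: "(f ^^ n) ` ?V \<subseteq> ?V" for n using homomorphism_funpow[OF f(1)] by (simp add: homomorphism_def)
 have "range (\<lambda>n. restrict (f ^^ n) ?V) \<subseteq> ?V \<rightarrow>\<^sub>E ?V" using pow by (auto simp: image_subset_iff)
 moreover have "finite (?V \<rightarrow>\<^sub>E ?V)" using H by (intro finite_PiE) (auto simp: simple_graph_def)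
 ultimately have "finite (range (\<lambda>n. restrict (f ^^ n) ?V))" by (rule finite_subset)
 hence "\<not> inj (\<lambda>n. restrict (f ^^ n) ?V)" using finite_imageD infinite_UNIV_nat by blast
 then obtain i j where ij: "restrict (f ^^ i) ?V = restrict (f ^^ j) ?V" "i \<noteq> j" unfolding inj_def by blast
 have "\<exists>i p. 0 < p \<and> restrict (f ^^ (i + p)) ?V = restrict (f ^^ i) ?V"
 proof (cases "i < j")
  case True
  thus ?thesis using ij by (intro exI[of _ i] exI[of _ "j - i"]) simp
 next
  case False
  thus ?thesis using ij by (intro exI[of _ j] exI[of _ "i - j"]) simp
 qed
 then obtain i p where p: "0 < p" and res: "restrict (f ^^ (i + p)) ?V = restrict (f ^^ i) ?V" by blast
 have period: "(f ^^ (i + p)) v = (f ^^ i) v" if "v \<in> ?V" for v using fun_cong[OF res, of v] that by simp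
 have step: "(f ^^ (m + p)) v = (f ^^ m) v" if "i \<le> m" "v \<in> ?V" for m v
 proof -
  obtain e where "m = e + i" using \<open>i \<le> m\<close> by (metis add.commute le_Suc_ex)
  thus ?thesis using period[OF that(2)] by (simp add: funpow_add add.assoc)
 qed
 have steps: "(f ^^ (m + a * p)) v = (f ^^ m) v" if "i \<le> m" "v \<in> ?V" for m a v
 proof (induction a)
  case (Suc a)
  have "(f ^^ (m + Suc a * p)) v = (f ^^ ((m + a * p) + p)) v" by (simp add: algebra_simps)
  also have "\<dots> = (f ^^ m) v" using step[of "m + a * p" v] that Suc by simp
  finally show ?case .
 qed simp
 \<comment> \<open>A multiple of the period \<open>p\<close> that is at least the preperiod
   \<open>i\<close>, so that applying this power twice is the same as applying it once.\<close>
 define n where "n = Suc i * p"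
 let ?r = "f ^^ n"
 have n: "i \<le> n" "0 < n" using p by (simp_all add: n_def trans_le_add2)
 have idem: "?r (?r v) = ?r v" if "v \<in> ?V" for v
  using steps[OF n(1) that, of "Suc i"] unfolding n_def[symmetric] funpow_add by simp
 let ?U = "{v\<in>?V. ?r v \<noteq> v}"
 have "retraction_moving H ?U ?r" using homomorphism_funpow[OF f(1)] idem by (simp add: retraction_moving_def)
 moreover have "?U \<noteq> {}"
 proof
  assume "?U = {}"
  moreover from f(2) obtain u v where uv: "u \<in> ?V" "v \<in> ?V" "f u = f v" "u \<noteq> v" unfolding inj_on_def by blast
  moreover have "?r u = ?r v" using uv(3) n(2) by (cases n) (simp_all add: funpow_swap1)
  ultimately show False by auto
 qed
 ultimately show ?thesis by (intro exI[of _ ?U] exI[of _ ?r] conjI)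
qed

text \<open>
 All neighbours of a moved vertex \<open>u\<close> that are not neighbours of \<open>r u\<close> are moved as well.
\<close>

lemma moved_set_large:
 fixes k :: nat and \<tau> \<theta> p :: real
 assumes H: "simple_graph H" "verts H = {1..k}" and r: "retraction_moving H U r" "U \<noteq> {}"
  and diff: "\<And>u x. u \<in> {1..k} \<Longrightarrow> x \<in> {1..k} \<Longrightarrow> u \<noteq> x \<Longrightarrow> 2 * \<tau> * (k * p) \<le> card (nbrs H u - nbrs H x)"
  and sparse: "sparse_sets \<tau> \<theta> k p H" and d: "4 \<le> \<tau> * (k * p)"
 shows "\<theta> * k < card U"
proof (rule ccontr)
 assume small: "\<not> \<theta> * k < card U"
 have U: "U \<subseteq> {1..k}" using r(1) H(2) by (auto simp: retraction_moving_def)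
 have finU: "finite U" using U finite_subset by blast
 have deg: "2 * \<tau> * (k * p) \<le> card (nbrs H u \<inter> U)" if u: "u \<in> U" for u
 proof -
  have "r u \<in> verts H" "r u \<noteq> u" "u \<in> verts H"
   using r(1) u by (auto simp: retraction_moving_def homomorphism_def)
  note ru = this[unfolded H(2)]
  have "nbrs H u - nbrs H (r u) \<subseteq> nbrs H u \<inter> U"
  proof
   fix w assume w: "w \<in> nbrs H u - nbrs H (r u)"
   hence "w \<in> verts H" using nbrs_subset[OF H(1)] by blast
   moreover have "{r u, r w} \<in> edges H" using r(1) w by (simp add: retraction_moving_def homomorphism_def nbrs_def)
   hence "r w \<noteq> w" using w by (auto simp: nbrs_def)
   ultimately show "w \<in> nbrs H u \<inter> U" using r(1) w by (simp add: retraction_moving_def)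
  qed
  hence "card (nbrs H u - nbrs H (r u)) \<le> card (nbrs H u \<inter> U)" using finU by (intro card_mono) auto
  thus ?thesis using diff[OF ru(3,1)] ru(2) by linarith
 qed
 let ?E = "{e\<in>edges H. e \<subseteq> U \<and> e \<inter> U \<noteq> {}}"
 have "card U * (2 * \<tau> * (k * p)) = (\<Sum>u\<in>U. 2 * \<tau> * (k * p))" by simp
 also have "\<dots> \<le> (\<Sum>u\<in>U. real (card (nbrs H u \<inter> U)))" by (intro sum_mono deg)
 also have "\<dots> = real (\<Sum>u\<in>U. card (nbrs H u \<inter> U))" by simp
 also have "\<dots> \<le> real (2 * card ?E)"
  by (subst of_nat_le_iff) (intro degree_sum_le H finU order_refl Int_lower2)
 finally have "\<tau> * (k * p) * card U \<le> card ?E" by (simp add: algebra_simps)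
 moreover have "card ?E < \<tau> * (k * p) * card U"
 proof (rule sparse_setsD[OF sparse order_refl U r(2)])
  show "card U \<le> \<theta> * k" using small by simp
  have "real (card U) * 4 \<le> real (card U) * (\<tau> * (k * p))" using d by (intro mult_left_mono) auto
  thus "card U \<le> card U * \<tau> * (k * p) / 4" by simp
 qed
 ultimately show False by linarith
qed

text \<open>
 The neighbourhood \<open>A\<close> of a vertex of maximum degree contains no clique of size \<open>t\<close>,
 and every vertex outside of \<open>A\<close> has at least \<open>card (W - A)\<close> non-neighbours.
\<close>

lemma turan:
 fixes adj :: "'a \<Rightarrow> 'a \<Rightarrow> bool"
 assumes sym: "\<And>u v. adj u v \<Longrightarrow> adj v u" and irrefl: "\<And>u. \<not> adj u u"
 shows "finite W \<Longrightarrow> (\<And>K. K \<subseteq> W \<Longrightarrow> card K = Suc t \<Longrightarrow> \<exists>u\<in>K. \<exists>v\<in>K. u \<noteq> v \<and> \<not> adj u v) \<Longrightarrow>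
  (real (card W))\<^sup>2 \<le> real t * real (card {(u, v)\<in>W \<times> W. \<not> adj u v})"
proof (induction t arbitrary: W)
 case 0
 have "W = {}"
 proof (rule ccontr)
  assume "W \<noteq> {}"
  then obtain w where "w \<in> W" by blast
  from 0(2)[of "{w}"] this show False by simp
 qed
 thus ?case by simp
next
 case (Suc t)
 show ?case
 proof (cases "W = {}")
  case False
  let ?deg = "\<lambda>u. card {w\<in>W. adj u w}"
  obtain v where v: "v \<in> W" and max: "\<And>u. u \<in> W \<Longrightarrow> ?deg u \<le> ?deg v"
  proof -
   have "Max (?deg ` W) \<in> ?deg ` W" using Suc.prems(1) False by (intro Max_in) auto
   then obtain v where v: "v \<in> W" "Max (?deg ` W) = ?deg v" by blast
   have "?deg u \<le> ?deg v" if "u \<in> W" for u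
    unfolding v(2)[symmetric] using Suc.prems(1) that by (intro Max_ge) auto
   thus thesis by (rule that[OF v(1)])
  qed
  define A where "A = {w\<in>W. adj v w}"
  let ?n = "\<lambda>X. card {(u, v)\<in>X \<times> X. \<not> adj u v}"
  have fin: "finite A" "finite (W - A)" using Suc.prems(1) by (simp_all add: A_def)
  have IH: "(real (card A))\<^sup>2 \<le> real t * real (?n A)"
  proof (rule Suc.IH[OF fin(1)])
   fix K assume K: "K \<subseteq> A" "card K = Suc t"
   have vK: "v \<notin> K" using K(1) irrefl by (auto simp: A_def)
   have "finite K" using K(1) fin(1) finite_subset by blast
   hence "card (insert v K) = Suc (Suc t)" using vK K(2) by simp
   moreover have "insert v K \<subseteq> W" using K(1) v by (auto simp: A_def)
   ultimately obtain x y where "x \<in> insert v K" "y \<in> insert v K" "x \<noteq> y" "\<not> adj x y"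
    using Suc.prems(2) by blast
   moreover have "adj v w" "adj w v" if "w \<in> K" for w using that K(1) sym by (auto simp: A_def)
   ultimately show "\<exists>x\<in>K. \<exists>y\<in>K. x \<noteq> y \<and> \<not> adj x y" by blast
  qed
  have split: "card A + card (W - A) = card W"
   using card_Diff_subset[of A W] card_mono[of W A] Suc.prems(1) fin(1) by (auto simp: A_def)
  have nonadj: "card (W - A) \<le> card {w\<in>W. \<not> adj u w}" if "u \<in> W" for u
  proof -
   have "card {w\<in>W. adj u w} + card {w\<in>W. \<not> adj u w} = card W"
    using Suc.prems(1) by (subst card_Un_disjoint[symmetric]) (auto intro!: arg_cong[of _ _ card])
   moreover have "card {w\<in>W. adj u w} \<le> card A" using max[OF that] by (simp add: A_def)
   ultimately show ?thesis using split by linarith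
  qed
  have "?n A + card (W - A) * card (W - A) \<le> ?n A + (\<Sum>u\<in>W - A. card {w\<in>W. \<not> adj u w})"
   using sum_mono[of "W - A" "\<lambda>_. card (W - A)", OF nonadj] by simp
  also have "\<dots> = ?n A + card (SIGMA u:W - A. {w\<in>W. \<not> adj u w})" using Suc.prems(1) fin by (simp add: card_SigmaI)
  also have "\<dots> = card ({(u, v)\<in>A \<times> A. \<not> adj u v} \<union> (SIGMA u:W - A. {w\<in>W. \<not> adj u w}))"
  proof (rule card_Un_disjoint[symmetric])
   show "finite {(u, v)\<in>A \<times> A. \<not> adj u v}" by (rule finite_subset[of _ "A \<times> A"]) (use fin in auto)
   show "finite (SIGMA u:W - A. {w\<in>W. \<not> adj u w})" using Suc.prems(1) fin by auto
  qed auto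
  also have "\<dots> \<le> ?n W"
  proof (rule card_mono)
   show "finite {(u, v)\<in>W \<times> W. \<not> adj u v}" by (rule finite_subset[of _ "W \<times> W"]) (use Suc.prems(1) in auto)
  qed (auto simp: A_def)
  finally have n: "real (?n A) + (real (card (W - A)))\<^sup>2 \<le> real (?n W)"
   by (simp only: power2_eq_square of_nat_mult[symmetric] of_nat_add[symmetric] of_nat_le_iff)
  define a b where "a = real (card A)" and "b = real (card (W - A))"
  \<comment> \<open>By the induction hypothesis a^2 is at most t times the number of non-adjacent
    pairs in A, so for positive t this follows from 2 a b \<le> a^2 / t + t b^2.\<close>
  have "2 * a * b \<le> real (?n A) + t * b\<^sup>2"
  proof (cases "t = 0")
   case True
   hence "a = 0" using IH by (simp add: a_def)
   thus ?thesis by simp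
  next
   case False
   have "0 \<le> (a - t * b)\<^sup>2" by simp
   also have "\<dots> = a\<^sup>2 + t * (t * b\<^sup>2) - t * (2 * a * b)" by (simp add: power2_eq_square algebra_simps)
   also have "\<dots> \<le> real t * (real (?n A) + t * b\<^sup>2 - 2 * a * b)" using IH by (simp add: a_def algebra_simps)
   finally have "0 \<le> real (?n A) + t * b\<^sup>2 - 2 * a * b" using False by (simp add: zero_le_mult_iff)
   thus ?thesis by simp
  qed
  moreover have "(real (card W))\<^sup>2 = a\<^sup>2 + 2 * a * b + b\<^sup>2"
   unfolding a_def b_def split[symmetric] of_nat_add by (simp add: power2_eq_square algebra_simps)
  ultimately have "(real (card W))\<^sup>2 \<le> real t * real (?n A) + real (?n A) + (t * b\<^sup>2 + b\<^sup>2)" using IH by (simp add: a_def)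
  also have "\<dots> = real (Suc t) * (real (?n A) + b\<^sup>2)" by (simp add: algebra_simps)
  also have "\<dots> \<le> real (Suc t) * real (?n W)" using n by (intro mult_left_mono) (auto simp: b_def)
  finally show ?thesis .
 qed simp
qed

definition clique_free :: "nat \<Rightarrow> nat graph \<Rightarrow> bool" where
 "clique_free t H \<longleftrightarrow> (\<forall>K\<subseteq>verts H. card K = t \<longrightarrow> (\<exists>u\<in>K. \<exists>v\<in>K. u \<noteq> v \<and> {u, v} \<notin> edges H))"

text \<open>Turan's bound for the adjacency pulled back along \<open>r\<close>, whose cliques are
  mapped injectively to cliques of H. It counts ordered pairs, so the diagonal contributes card W
  and every other pair counts twice. If \<open>r\<close> is a homomorphism, all pairs found here are
  non-edges of H, and this makes a given retraction unlikely.\<close>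

lemma many_nonadjacent_pairs:
 assumes H: "simple_graph H" "clique_free (Suc t) H" and W: "finite W" "r ` W \<subseteq> verts H"
 shows "(real (card W))\<^sup>2 \<le> t * (real (card W) + real (card {e\<in>pairs W. r ` e \<notin> edges H}) * 2)"
proof -
 let ?adj = "\<lambda>u v. {r u, r v} \<in> edges H"
 let ?N = "{e\<in>pairs W. r ` e \<notin> edges H}"
 have irrefl: "\<not> ?adj u u" for u using H(1) by (auto simp: simple_graph_def pairs_def)
 have 1: "(real (card W))\<^sup>2 \<le> real t * real (card {(u, v)\<in>W \<times> W. \<not> ?adj u v})"
 proof (rule turan[OF _ irrefl W(1)])
  fix K assume K: "K \<subseteq> W" "card K = Suc t"
  show "\<exists>u\<in>K. \<exists>v\<in>K. u \<noteq> v \<and> \<not> ?adj u v"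
  proof (cases "inj_on r K")
   case True
   hence "card (r ` K) = Suc t" "r ` K \<subseteq> verts H" using K W(2) by (auto simp: card_image)
   hence "\<exists>x\<in>r ` K. \<exists>y\<in>r ` K. x \<noteq> y \<and> {x, y} \<notin> edges H" using H(2) unfolding clique_free_def by blast
   then obtain u v where "u \<in> K" "v \<in> K" "r u \<noteq> r v" "{r u, r v} \<notin> edges H" by (elim bexE imageE) simp
   thus ?thesis by (intro bexI[of _ u] bexI[of _ v]) auto
  next
   case False
   then obtain u v where "u \<in> K" "v \<in> K" "r u = r v" "u \<noteq> v" unfolding inj_on_def by blast
   thus ?thesis using irrefl[of v] by (intro bexI[of _ u] bexI[of _ v]) auto
  qed
 qed (simp add: insert_commute)
 have 2: "real t * real (card {(u, v)\<in>W \<times> W. \<not> ?adj u v}) \<le> real t * real (card W + card ?N * 2)"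
 proof (intro mult_left_mono of_nat_mono)
  show "card {(u, v)\<in>W \<times> W. \<not> ?adj u v} \<le> card W + card ?N * 2"
  proof -
  let ?D = "\<lambda>e. {(u, v). e = {u, v}}"
  have D: "finite (?D e) \<and> card (?D e) \<le> 2" if e: "e \<in> ?N" for e
  proof -
   from e obtain x y where e: "e = {x, y}" by (auto simp: pairs_def card_2_iff)
   have sub: "?D e \<subseteq> {(x, y), (y, x)}" unfolding e by (simp add: doubleton_eq_iff subset_iff)
   have fin: "finite {(x, y), (y, x)}" by simp
   have "card {(x, y), (y, x)} \<le> 2" by (cases "x = y") simp_all
   thus ?thesis by (intro conjI finite_subset[OF sub fin] order.trans[OF card_mono[OF fin sub]])
  qed
  have finN: "finite ?N" using W(1) by simp
  have "card {(u, v)\<in>W \<times> W. \<not> ?adj u v} \<le> card ((\<lambda>u. (u, u)) ` W \<union> (\<Union>e\<in>?N. ?D e))"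
  proof (rule card_mono)
   show "finite ((\<lambda>u. (u, u)) ` W \<union> (\<Union>e\<in>?N. ?D e))"
    by (intro finite_UnI finite_imageI finite_UN_I W(1) finN conjunct1[OF D])
   show "{(u, v)\<in>W \<times> W. \<not> ?adj u v} \<subseteq> (\<lambda>u. (u, u)) ` W \<union> (\<Union>e\<in>?N. ?D e)"
    by (auto simp: doubleton_pairs)
  qed
  also have "\<dots> \<le> card ((\<lambda>u. (u, u)) ` W) + card (\<Union>e\<in>?N. ?D e)" by (rule card_Un_le)
  also have "\<dots> \<le> card W + (\<Sum>e\<in>?N. card (?D e))" by (intro add_mono card_image_le card_UN_le W(1) finN)
  also have "\<dots> \<le> card W + (\<Sum>e\<in>?N. 2)" by (intro add_left_mono sum_mono conjunct2[OF D])
  finally show ?thesis unfolding sum_constant of_nat_id .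
  qed
 qed (rule of_nat_0_le_iff)
 have "real (card W + card ?N * 2) = real (card W) + real (card ?N) * 2" unfolding of_nat_add of_nat_mult of_nat_numeral by (rule refl)
 from order.trans[OF 1 2[unfolded this]] show ?thesis .
qed

section \<open>Local statistics of random graphs\<close>

definition above_log :: "real \<Rightarrow> nat \<Rightarrow> real \<Rightarrow> bool" where
 "above_log \<epsilon> k p \<longleftrightarrow> (1 + \<epsilon>) * ln (real k) \<le> real k * p \<and> 0 < p \<and> p \<le> 1 / 2"

text \<open>Below this threshold k^5 p^6 and k^4 p^6 tend to 0, so no two vertices have three common
  neighbours and there is no clique of four vertices. Above it k p is at least k^(1/10).\<close>

definition sparse_range :: "nat \<Rightarrow> real \<Rightarrow> bool" where
 "sparse_range k p \<longleftrightarrow> p \<le> real k powr (- 9 / 10)"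

abbreviation star :: "nat \<Rightarrow> nat set \<Rightarrow> nat set set" where
 "star v W \<equiv> (\<lambda>w. {v, w}) ` W"

lemma card_star: "card (star v W) = card W"
 by (intro card_image) (auto simp: inj_on_def doubleton_eq_iff)

lemma card_star_filter: "card {e\<in>star v W. P e} = card {w\<in>W. P {v, w}}"
proof -
 have "{e\<in>star v W. P e} = star v {w\<in>W. P {v, w}}" by auto
 thus ?thesis by (simp add: card_star)
qed

lemma star_subset_pairs: "v \<in> V \<Longrightarrow> W \<subseteq> V \<Longrightarrow> v \<notin> W \<Longrightarrow> star v W \<subseteq> pairs V"
 by (auto simp: doubleton_pairs)

abbreviation graph_on :: "nat set \<Rightarrow> (nat set \<Rightarrow> bool) \<Rightarrow> nat graph" where
 "graph_on V X \<equiv> (V, {e\<in>pairs V. X e})"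

abbreviation graph_of :: "nat \<Rightarrow> (nat set \<Rightarrow> bool) \<Rightarrow> nat graph" where
 "graph_of k X \<equiv> (graph_on {1..k} X)"

lemma nbrs_graph_of: "v \<in> {1..k} \<Longrightarrow> nbrs (graph_of k X) v = {w\<in>{1..k} - {v}. X {v, w}}"
 by (auto simp: nbrs_def doubleton_pairs)

lemma above_log_imp_log_range: "0 \<le> \<epsilon> \<Longrightarrow> 1 \<le> k \<Longrightarrow> above_log \<epsilon> k p \<Longrightarrow> log_range k p"
proof -
 assume *: "0 \<le> \<epsilon>" "1 \<le> k" "above_log \<epsilon> k p"
 hence "1 * ln (real k) \<le> (1 + \<epsilon>) * ln (real k)" by (intro mult_right_mono) auto
 thus ?thesis using * by (simp add: above_log_def log_range_def)
qed

text \<open>The margin 1 + \<epsilon> over the threshold log k / k enters here: the failure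
  probability falls below 1 / k, so a union bound over the vertices works. A fraction \<epsilon> /
  12 of the mean is lost three times: through l = ln (12 / \<epsilon>), through k - 1 in place of k,
  and through the degree that is tolerated. Finally (1 - \<epsilon> / 4) (1 + \<epsilon>) \<ge> 1 +
  \<epsilon> / 2 for \<epsilon> \<le> 1.\<close>

lemma prob_low_degree:
 fixes k :: nat and p \<tau> \<epsilon> :: real
 assumes \<epsilon>: "0 < \<epsilon>" "\<epsilon> \<le> 1" and k: "12 / \<epsilon> \<le> real k" and p: "above_log \<epsilon> k p" and v: "v \<in> {1..k}"
  and \<tau>: "0 \<le> \<tau>" "\<tau> * (36 * ln (12 / \<epsilon>)) \<le> \<epsilon>"
 shows "Prob (bern (pairs {1..k}) p) {X. \<not> 3 * \<tau> * (k * p) < card (nbrs (graph_of k X) v)}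
  \<le> exp (- (1 + \<epsilon> / 2) * ln k)"
proof -
 let ?d = "real k * p" and ?l = "ln (12 / \<epsilon>)" and ?S = "star v ({1..k} - {v})"
 have p01: "0 < p" "p \<le> 1 / 2" using p by (simp_all add: above_log_def)
 have l: "0 \<le> ?l" "exp (- ?l) = \<epsilon> / 12" using \<epsilon> by (simp_all add: exp_minus)
 have k0: "0 < real k" using k \<epsilon> divide_pos_pos[of 12 \<epsilon>] by linarith
 have d0: "0 < ?d" using k0 p01 by simp
 have "Prob (bern (pairs {1..k}) p) {X. \<not> 3 * \<tau> * ?d < card (nbrs (graph_of k X) v)}
  \<le> Prob (bern (pairs {1..k}) p) {X. real (card {e\<in>?S. X e = True}) \<le> 3 * \<tau> * ?d}"
  by (rule prob_mono) (simp only: card_star_filter nbrs_graph_of[OF v] not_less simp_thms)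
 also have "\<dots> \<le> exp (?l * (3 * \<tau> * ?d) - real (card ?S) * (if True then p else 1 - p) * (1 - exp (- ?l)))"
 proof (rule prob_few)
  show "?S \<subseteq> pairs {1..k}" using v by (intro star_subset_pairs) auto
 qed (use p01 l in simp_all)
 also have "\<dots> \<le> exp (- (1 + \<epsilon> / 2) * ln k)"
 proof (subst exp_le_cancel_iff)
  have "card ?S = k - 1" using v by (simp add: card_star)
  hence "real (card ?S) = k - 1" using v by auto
  moreover have "1 \<le> \<epsilon> / 12 * k" using k \<epsilon> by (simp add: field_simps)
  ultimately have "(1 - \<epsilon> / 12) * k \<le> real (card ?S)" by (simp add: algebra_simps)
  hence "(1 - \<epsilon> / 12) * k * p * (1 - \<epsilon> / 12) \<le> real (card ?S) * p * (1 - \<epsilon> / 12)"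
   using p01 \<epsilon> by (intro mult_right_mono) auto
  moreover have "(1 - \<epsilon> / 12) * k * p * (1 - \<epsilon> / 12) = (1 - \<epsilon> / 6) * ?d + \<epsilon> * \<epsilon> / 144 * ?d" by (simp add: field_simps)
  moreover have "0 \<le> \<epsilon> * \<epsilon> / 144 * ?d" using d0 by simp
  moreover have "?l * (3 * \<tau> * ?d) \<le> \<epsilon> / 12 * ?d"
   using mult_right_mono[OF \<tau>(2), of "?d / 12"] d0 by (simp add: mult.commute mult.left_commute)
  moreover have "(1 - \<epsilon> / 4) * ?d = (1 - \<epsilon> / 6) * ?d - \<epsilon> / 12 * ?d" by (simp add: field_simps)
  ultimately have "?l * (3 * \<tau> * ?d) - real (card ?S) * p * (1 - \<epsilon> / 12) \<le> - ((1 - \<epsilon> / 4) * ?d)" by linarith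
  also have "\<dots> \<le> - ((1 - \<epsilon> / 4) * ((1 + \<epsilon>) * ln k))"
   using p \<epsilon> by (simp add: above_log_def mult_left_mono)
  also have "\<dots> \<le> - (1 + \<epsilon> / 2) * ln k"
  proof -
   have "\<epsilon> * \<epsilon> \<le> \<epsilon> * 1" using \<epsilon> by (intro mult_left_mono) auto
   hence "1 + \<epsilon> / 2 \<le> (1 - \<epsilon> / 4) * (1 + \<epsilon>)" by (simp add: field_simps)
   moreover have "0 \<le> ln (real k)" using k0 by simp
   ultimately have "(1 + \<epsilon> / 2) * ln k \<le> ((1 - \<epsilon> / 4) * (1 + \<epsilon>)) * ln k" by (rule mult_right_mono)
   thus ?thesis by (simp only: mult.assoc mult_minus_left neg_le_iff_le)
  qed
  finally show "?l * (3 * \<tau> * ?d) - real (card ?S) * (if True then p else 1 - p) * (1 - exp (- ?l)) \<le> - (1 + \<epsilon> / 2) * ln k"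
   unfolding l(2) if_True .
 qed
 finally show ?thesis .
qed

lemma min_degree_whp:
 fixes \<tau> \<epsilon> :: real
 assumes \<epsilon>: "0 < \<epsilon>" "\<epsilon> \<le> 1" and \<tau>: "0 \<le> \<tau>" "\<tau> * (36 * ln (12 / \<epsilon>)) \<le> \<epsilon>"
 shows "whp (above_log \<epsilon>) (\<lambda>k p H. \<forall>v\<in>{1..k}. 3 * \<tau> * (k * p) < card (nbrs H v))"
proof (rule whpI_eventually)
 let ?f = "\<lambda>k::nat. exp (- (\<epsilon> / 2) * ln (real k))"
 show "?f \<longlonglongrightarrow> 0" using \<epsilon>(1) by real_asymp
 show "\<forall>\<^sub>F k::nat in sequentially. 12 / \<epsilon> \<le> real k" by real_asymp
 fix k :: nat and p :: real assume elim: "12 / \<epsilon> \<le> real k" and p: "above_log \<epsilon> k p"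
 have k0: "0 < real k" using elim \<epsilon> divide_pos_pos[of 12 \<epsilon>] by linarith
 have "Prob (random_graph k p) {H. \<not> (\<forall>v\<in>{1..k}. 3 * \<tau> * (k * p) < card (nbrs H v))} =
  Prob (bern (pairs {1..k}) p) {X. \<exists>v\<in>{1..k}. \<not> 3 * \<tau> * (k * p) < card (nbrs (graph_of k X) v)}"
  unfolding prob_random_graph by (simp only: Ball_def Bex_def not_all not_imp)
 also have "\<dots> \<le> real k * exp (- (1 + \<epsilon> / 2) * ln k)"
  by (rule prob_union_bound_card[OF _ prob_low_degree[OF \<epsilon> elim p _ \<tau>]]) simp_all
 also have "\<dots> = exp (ln k) * exp (- (1 + \<epsilon> / 2) * ln k)" using k0 by simp
 also have "\<dots> = ?f k" by (subst exp_add[symmetric]) (simp add: algebra_simps)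
 finally show "Prob (random_graph k p) {H. \<not> (\<forall>v\<in>{1..k}. 3 * \<tau> * (k * p) < card (nbrs H v))} \<le> ?f k" .
qed

lemma codegree_whp: "whp (\<lambda>k p. 0 < p \<and> p \<le> 1 \<and> sparse_range k p)
 (\<lambda>k p H. \<forall>u\<in>{1..k}. \<forall>x\<in>{1..k}. u \<noteq> x \<longrightarrow> card (nbrs H u \<inter> nbrs H x) \<le> 2)"
proof (rule whpI_eventually)
 let ?f = "\<lambda>k::nat. real k powr (- 2 / 5)"
 show "?f \<longlonglongrightarrow> 0" by real_asymp
 show "\<forall>\<^sub>F k::nat in sequentially. 3 \<le> k" by (rule eventually_ge_at_top)
 fix k :: nat and p :: real assume elim: "3 \<le> k" and p: "0 < p \<and> p \<le> 1 \<and> sparse_range k p"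
 define V where "V = {1..k}"
 have V: "finite V" "card V = k" by (simp_all add: V_def)
 let ?T = "{W. W \<subseteq> V \<and> card W = 3}"
 let ?I = "{(u, x, W) | u x W. u \<in> V \<and> x \<in> V \<and> W \<in> ?T \<and> u \<noteq> x \<and> u \<notin> W \<and> x \<notin> W}"
 have sub: "?I \<subseteq> V \<times> V \<times> ?T" by auto
 have finT: "finite ?T" by (rule finite_subset[of _ "Pow V"]) (use V in auto)
 have "card ?I \<le> card (V \<times> V \<times> ?T)" using sub V finT by (intro card_mono) auto
 also have "\<dots> = k * (k * (k choose 3))" using V by (simp add: card_cartesian_product n_subsets)
 also have "\<dots> \<le> k * (k * k ^ 3)" using elim by (intro mult_left_mono binomial_le_pow) auto
 also have "\<dots> = k ^ 5" by (simp add: eval_nat_numeral)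
 finally have "real (card ?I) \<le> real (k ^ 5)" by (rule of_nat_mono)
 hence cardI: "real (card ?I) \<le> real k ^ 5" by simp
 have "Prob (random_graph k p) {H. \<not> (\<forall>u\<in>{1..k}. \<forall>x\<in>{1..k}. u \<noteq> x \<longrightarrow> card (nbrs H u \<inter> nbrs H x) \<le> 2)}
  \<le> Prob (bern (pairs V) p) {X. \<exists>(u, x, W)\<in>?I. \<forall>e\<in>star u W \<union> star x W. X e}"
  unfolding prob_random_graph V_def[symmetric]
 proof (rule prob_mono)
  fix X assume "\<not> (\<forall>u\<in>V. \<forall>x\<in>V. u \<noteq> x \<longrightarrow> card (nbrs (graph_on V X) u \<inter> nbrs (graph_on V X) x) \<le> 2)"
  then obtain u x where ux: "u \<in> V" "x \<in> V" "u \<noteq> x"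
   and "3 \<le> card (nbrs (graph_on V X) u \<inter> nbrs (graph_on V X) x)" by force
  then obtain W where W: "W \<subseteq> nbrs (graph_on V X) u \<inter> nbrs (graph_on V X) x" "card W = 3"
   by (meson obtain_subset_with_card_n)
  have "W \<subseteq> V" "u \<notin> W" "x \<notin> W" "\<forall>e\<in>star u W \<union> star x W. X e"
   using W(1) by (auto simp: nbrs_def doubleton_pairs)
  thus "\<exists>(u, x, W)\<in>?I. \<forall>e\<in>star u W \<union> star x W. X e" using ux W(2)
   by (intro bexI[of _ "(u, x, W)"]) auto
 qed
 also have "\<dots> \<le> real k ^ 5 * p ^ 6"
 proof (rule prob_union_bound_card)
  show "finite ?I" using sub V finT by (intro finite_subset[OF sub]) auto
  fix i assume "i \<in> ?I"
  then obtain u x W where i: "i = (u, x, W)" "u \<in> V" "x \<in> V" "W \<subseteq> V" "card W = 3" "u \<noteq> x" "u \<notin> W" "x \<notin> W" by blast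
  have "finite W" using i(5) card.infinite by fastforce
  moreover have "star u W \<inter> star x W = {}" using i by (auto simp: doubleton_eq_iff)
  ultimately have "card (star u W \<union> star x W) = 6" by (subst card_Un_disjoint) (simp_all add: card_star i(5))
  moreover have "star u W \<union> star x W \<subseteq> pairs V" using i by (auto simp: doubleton_pairs)
  ultimately show "Prob (bern (pairs V) p) {X. case i of (u, x, W) \<Rightarrow> \<forall>e\<in>star u W \<union> star x W. X e} \<le> p ^ 6"
   using prob_bern_all(1)[of "pairs V" "star u W \<union> star x W" p] p V by (simp add: i(1) Ball_def)
 qed (use cardI p in simp_all)
 also have "\<dots> \<le> real k powr 5 * (real k powr (- 9 / 10)) ^ 6"
  using p elim by (intro mult_mono power_mono) (auto simp: sparse_range_def powr_numeral)
 also have "\<dots> = ?f k" using elim by (simp add: powr_power flip: powr_add del: powr_numeral)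
 finally show "Prob (random_graph k p) {H. \<not> (\<forall>u\<in>{1..k}. \<forall>x\<in>{1..k}. u \<noteq> x \<longrightarrow> card (nbrs H u \<inter> nbrs H x) \<le> 2)} \<le> ?f k" .
qed

lemma prob_clique:
 fixes p :: real
 assumes p: "0 \<le> p" "p \<le> 1"
 shows "Prob (random_graph k p) {H. \<not> clique_free s H} \<le> real k ^ s * p ^ (s choose 2)"
proof (cases "s \<le> k")
 case True
 define V where "V = {1..k}"
 have V: "finite V" "card V = k" by (simp_all add: V_def)
 let ?I = "{K. K \<subseteq> V \<and> card K = s}"
 have "Prob (random_graph k p) {H. \<not> clique_free s H}
  \<le> Prob (bern (pairs V) p) {X. \<exists>K\<in>?I. \<forall>e\<in>pairs K. X e}"
  unfolding prob_random_graph V_def[symmetric]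
 proof (rule prob_mono)
  fix X assume "\<not> clique_free s (graph_on V X)"
  then obtain K where K: "K \<subseteq> V" "card K = s" and adj: "\<And>u v. u \<in> K \<Longrightarrow> v \<in> K \<Longrightarrow> u \<noteq> v \<Longrightarrow> X {u, v}"
   unfolding clique_free_def by auto
  have "X e" if "e \<in> pairs K" for e
   using that adj by (auto simp: pairs_def card_2_iff)
  thus "\<exists>K\<in>?I. \<forall>e\<in>pairs K. X e" using K by blast
 qed
 also have "\<dots> \<le> real k ^ s * p ^ (s choose 2)"
 proof (rule prob_union_bound_card)
  show "finite ?I" by (rule finite_subset[of _ "Pow V"]) (use V in auto)
  have "card ?I \<le> k ^ s" using V True by (simp add: n_subsets binomial_le_pow)
  hence "real (card ?I) \<le> real (k ^ s)" by (rule of_nat_mono)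
  thus "real (card ?I) \<le> real k ^ s" by simp
  fix K assume K: "K \<in> ?I"
  hence "finite K" using V finite_subset by blast
  hence "card (pairs K) = s choose 2" using K by (simp add: pairs_def n_subsets)
  moreover have "pairs K \<subseteq> pairs V" using K by (intro pairs_mono) blast
  ultimately show "Prob (bern (pairs V) p) {X. \<forall>e\<in>pairs K. X e} \<le> p ^ (s choose 2)"
   using prob_bern_all(1)[OF finite_pairs[OF V(1)], of "pairs K" p] p by simp
 qed (use p in simp)
 finally show ?thesis .
next
 case False
 have "clique_free s H" if "H \<in> set_pmf (random_graph k p)" for H
  unfolding clique_free_def
 proof (intro allI impI)
  fix K assume "K \<subseteq> verts H" "card K = s"
  hence "s \<le> k" using random_graph_support[OF that] card_mono[of "{1..k}" K] by simp
  thus "\<exists>u\<in>K. \<exists>v\<in>K. u \<noteq> v \<and> {u, v} \<notin> edges H" using False by simp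
 qed
 hence "Prob (random_graph k p) {H. \<not> clique_free s H} = 0"
  unfolding measure_pmf_zero_iff by auto
 thus ?thesis using p by simp
qed

lemma clique_free_sparse_whp: "whp (\<lambda>k p. 0 < p \<and> p \<le> 1 \<and> sparse_range k p) (\<lambda>k p H. clique_free 4 H)"
proof (rule whpI_eventually)
 let ?f = "\<lambda>k::nat. real k powr (- 7 / 5)"
 show "?f \<longlonglongrightarrow> 0" by real_asymp
 show "\<forall>\<^sub>F k::nat in sequentially. 1 \<le> k" by (rule eventually_ge_at_top)
 fix k :: nat and p :: real assume elim: "1 \<le> k" and p: "0 < p \<and> p \<le> 1 \<and> sparse_range k p"
 have "Prob (random_graph k p) {H. \<not> clique_free 4 H} \<le> real k ^ 4 * p ^ (4 choose 2)"
  using p by (intro prob_clique) auto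
 also have "4 choose 2 = (6 :: nat)" by (simp add: choose_two)
 also have "real k ^ 4 * p ^ 6 \<le> real k powr 4 * (real k powr (- 9 / 10)) ^ 6"
  using p elim by (intro mult_mono power_mono) (auto simp: sparse_range_def powr_numeral)
 also have "\<dots> = ?f k" using elim by (simp add: powr_power flip: powr_add del: powr_numeral)
 finally show "Prob (random_graph k p) {H. \<not> clique_free 4 H} \<le> ?f k" .
qed

text \<open>As p \<le> 1/2, the expected number of cliques with t + 1 vertices is at most exp ((t +
  1) (ln k - t ln 2 / 2)). With ln 2 \<ge> 2/3 and t \<ge> 4 ln k the inner factor is at most - ln k
  / 3.\<close>

lemma clique_free_whp: "whp log_range (\<lambda>k p H. clique_free (Suc (nat \<lceil>4 * ln (real k)\<rceil>)) H)"
proof (rule whpI_eventually)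
 let ?f = "\<lambda>k::nat. exp (- (3 / 10) * ln (real k))"
 show "?f \<longlonglongrightarrow> 0" by real_asymp
 show "\<forall>\<^sub>F k::nat in sequentially. 3 \<le> k" by (rule eventually_ge_at_top)
 fix k :: nat and p :: real assume elim: "3 \<le> k" and p: "log_range k p"
 define t where "t = nat \<lceil>4 * ln (real k)\<rceil>"
 have lnk: "0 < ln (real k)" using elim by simp
 have t: "4 * ln k \<le> t" unfolding t_def by linarith
 have p': "0 \<le> p" "p \<le> 1" "p \<le> 1 / 2" using p by (auto simp: log_range_def)
 have "Prob (random_graph k p) {H. \<not> clique_free (Suc t) H} \<le> real k ^ Suc t * p ^ (Suc t choose 2)"
  by (rule prob_clique[OF p'(1,2)])
 also have "\<dots> \<le> real k ^ Suc t * (1 / 2) ^ (Suc t choose 2)" using p' by (intro mult_left_mono power_mono) auto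
 also have "(1 / 2 :: real) ^ (Suc t choose 2) = exp (real (Suc t choose 2) * (- ln 2))"
  by (simp only: exp_of_nat_mult) (simp add: exp_minus)
 also have "real k ^ Suc t = exp (real (Suc t) * ln k)" using elim by (simp only: exp_of_nat_mult) simp
 also have "exp (real (Suc t) * ln k) * exp (real (Suc t choose 2) * (- ln 2)) = exp (real (Suc t) * ln k - ln 2 * real (Suc t choose 2))"
  by (subst exp_add[symmetric]) (simp only: mult_minus_right add_uminus_conv_diff mult.commute[of "ln 2"])
 also have "\<dots> \<le> ?f k"
 proof (subst exp_le_cancel_iff)
  have "real (Suc t choose 2) = real (Suc t) * (t / 2)"
  proof -
   have "2 * (Suc t choose 2) = Suc t * t" by (simp add: choose_two)
   hence "2 * real (Suc t choose 2) = real (Suc t) * real t" by (metis of_nat_mult of_nat_numeral)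
   thus ?thesis by simp
  qed
  hence "real (Suc t) * ln k - ln 2 * real (Suc t choose 2) = real (Suc t) * (ln k - ln 2 * (t / 2))"
   by (simp only: right_diff_distrib mult.left_commute[of "ln 2"])
  also have "\<dots> \<le> real (Suc t) * (- (3 / 10) * ln k)"
  proof (rule mult_left_mono)
   have "2 / 3 * (2 * ln k) \<le> ln 2 * (t / 2)" using ln2_ge_two_thirds t lnk by (intro mult_mono) auto
   thus "ln k - ln 2 * (t / 2) \<le> - (3 / 10) * ln k" using lnk by simp
  qed simp
  also have "\<dots> \<le> 1 * (- (3 / 10) * ln k)" using lnk by (intro mult_right_mono_neg) auto
  finally show "real (Suc t) * ln k - ln 2 * real (Suc t choose 2) \<le> - (3 / 10) * ln k" by simp
 qed
 finally show "Prob (random_graph k p) {H. \<not> clique_free (Suc (nat \<lceil>4 * ln (real k)\<rceil>)) H} \<le> ?f k"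
  unfolding t_def .
qed

text \<open>The factor 8 satisfies e / 8 \<le> 1 / e, so a degree of at least 8 k p has probability
  at most exp (- 8 k p), which is at most k^(-8).\<close>

lemma max_degree_whp: "whp log_range (\<lambda>k p H. \<forall>v\<in>{1..k}. card (nbrs H v) \<le> nat \<lceil>8 * (k * p)\<rceil>)"
proof (rule whpI_eventually)
 let ?f = "\<lambda>k::nat. real k * exp (- (8 * ln (real k)))"
 show "?f \<longlonglongrightarrow> 0" by real_asymp
 show "\<forall>\<^sub>F k::nat in sequentially. 3 \<le> k" by (rule eventually_ge_at_top)
 fix k :: nat and p :: real assume elim: "3 \<le> k" and p: "log_range k p"
 let ?d = "real k * p"
 define m where "m = nat \<lceil>8 * ?d\<rceil>"
 have p': "0 < p" "p \<le> 1" "ln k \<le> ?d" using p by (auto simp: log_range_def)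
 have d: "0 < ?d" using p' elim by simp
 have m: "8 * ?d \<le> m" "0 < m" unfolding m_def using d by linarith+
 have "Prob (random_graph k p) {H. \<not> (\<forall>v\<in>{1..k}. card (nbrs H v) \<le> m)} \<le>
  Prob (bern (pairs {1..k}) p) {X. \<exists>v\<in>{1..k}. m \<le> card {e\<in>star v ({1..k} - {v}). X e}}"
  unfolding prob_random_graph
 proof (rule prob_mono)
  fix X assume "\<not> (\<forall>v\<in>{1..k}. card (nbrs (graph_of k X) v) \<le> m)"
  then obtain v where v: "v \<in> {1..k}" "\<not> card (nbrs (graph_of k X) v) \<le> m" by blast
  hence "m \<le> card {e\<in>star v ({1..k} - {v}). X e}" unfolding card_star_filter nbrs_graph_of[OF v(1)] by simp
  thus "\<exists>v\<in>{1..k}. m \<le> card {e\<in>star v ({1..k} - {v}). X e}" using v(1) by blast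
 qed
 also have "\<dots> \<le> real k * exp (- (8 * ln k))"
 proof (rule prob_union_bound_card)
  fix v assume v: "v \<in> {1..k}"
  have "star v ({1..k} - {v}) \<subseteq> pairs {1..k}" using v by (intro star_subset_pairs) auto
  hence "Prob (bern (pairs {1..k}) p) {X. m \<le> card {e\<in>star v ({1..k} - {v}). X e}} \<le> real (card (star v ({1..k} - {v})) choose m) * p ^ m"
   using p' by (intro prob_many) auto
  also have "\<dots> \<le> (exp (- 1)) powr (8 * ?d)"
  proof (rule choose_le_exp')
   show "card (star v ({1..k} - {v})) \<le> k" using v by (simp add: card_star)
   have "exp 1 * k * p / m \<le> exp 1 * ?d / (8 * ?d)" unfolding mult.assoc
    using d by (intro divide_left_mono[OF m(1)] mult_pos_pos[of "real m"]) (simp_all add: m(2) del: mult_eq_0_iff zero_less_mult_iff)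
   also have "\<dots> = exp 1 / 8" using p'(1) elim by simp
   also have "\<dots> \<le> exp (- 1 :: real)"
   proof -
    have "exp 1 * exp 1 \<le> (272 / 100 :: real) * (272 / 100)" using e_less_272 by (intro mult_mono) auto
    thus ?thesis by (simp add: exp_minus field_simps)
   qed
   finally show "exp 1 * k * p / m \<le> exp (- 1 :: real)" .
  qed (use m p' in simp_all)
  also have "\<dots> = exp (- (8 * ?d))" by (simp add: powr_def)
  also have "\<dots> \<le> exp (- (8 * ln k))" using p' by simp
  finally show "Prob (bern (pairs {1..k}) p) {X. m \<le> card {e\<in>star v ({1..k} - {v}). X e}} \<le> exp (- (8 * ln k))" .
 qed simp_all
 finally show "Prob (random_graph k p) {H. \<not> (\<forall>v\<in>{1..k}. card (nbrs H v) \<le> nat \<lceil>8 * (k * p)\<rceil>)} \<le> ?f k"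
  unfolding m_def .
qed

definition detached :: "nat graph \<Rightarrow> nat set \<Rightarrow> nat set" where
 "detached H R = {v\<in>verts H - R. nbrs H v \<inter> R = {}}"

text \<open>For N hubs of this number, N^2 p is at least 4 k, so with high probability no N further
  vertices all miss the hubs. On the other hand, guessing the images of 2 N vertices costs k^(2 N) =
  exp (O(k sqrt (k p))), which is negligible against exp (const * k * k p) for large k p.\<close>

definition hub_number :: "nat \<Rightarrow> real \<Rightarrow> nat" where
 "hub_number k p = nat \<lceil>2 * k / sqrt (k * p)\<rceil>"

lemma few_detached_whp: "whp log_range (\<lambda>k p H. card (detached H {1..hub_number k p}) \<le> hub_number k p)"
proof (rule whpI_eventually)
 let ?f = "\<lambda>k::nat. exp (- (3 * real k))"
 show "?f \<longlonglongrightarrow> 0" by real_asymp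
 show "\<forall>\<^sub>F k::nat in sequentially. 3 \<le> k" by (rule eventually_ge_at_top)
 fix k :: nat and p :: real assume elim: "3 \<le> k" and p: "log_range k p"
 let ?d = "real k * p"
 define N where "N = hub_number k p"
 define V where "V = {1..k}"
 have V: "finite V" "card V = k" by (simp_all add: V_def)
 define R where "R = {1..N}"
 have R: "finite R" "card R = N" by (simp_all add: R_def)
 have p': "0 < p" "p \<le> 1" using p by (auto simp: log_range_def)
 have d: "0 < ?d" using p' elim by simp
 have N: "2 * k / sqrt ?d \<le> N" unfolding N_def hub_number_def by linarith
 let ?I = "{Y. Y \<subseteq> V - R \<and> card Y = N}"
 let ?E = "\<lambda>Y. {{y, w} | y w. y \<in> Y \<and> w \<in> R \<inter> V}"
 have "Prob (random_graph k p) {H. \<not> card (detached H R) \<le> N} \<le>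
  Prob (bern (pairs V) p) {X. \<exists>Y\<in>?I. \<forall>e\<in>?E Y. \<not> X e}"
  unfolding prob_random_graph V_def[symmetric]
 proof (rule prob_mono)
  fix X assume "\<not> card (detached (graph_on V X) R) \<le> N"
  then obtain Y where Y: "Y \<subseteq> detached (graph_on V X) R" "card Y = N"
   by (meson nat_le_linear obtain_subset_with_card_n)
  have "Y \<subseteq> V - R" using Y(1) by (auto simp: detached_def)
  moreover have "\<not> X e" if "e \<in> ?E Y" for e
  proof -
   from that obtain y w where e: "e = {y, w}" "y \<in> Y" "w \<in> R" "w \<in> V" by blast
   hence "y \<in> V" "y \<notin> R" "w \<notin> nbrs (graph_on V X) y" using Y(1) unfolding detached_def by auto
   thus ?thesis using e by (auto simp: nbrs_def doubleton_pairs)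
  qed
  ultimately show "\<exists>Y\<in>?I. \<forall>e\<in>?E Y. \<not> X e" using Y(2) by (intro bexI[of _ Y] ballI) simp_all
 qed
 also have "\<dots> \<le> 2 ^ k * exp (- (4 * real k))"
 proof (rule prob_union_bound_card)
  show "finite ?I" by (rule finite_subset[of _ "Pow V"]) (use V in auto)
  have "card ?I \<le> card (Pow V)" using V by (intro card_mono) auto
  hence "real (card ?I) \<le> real (2 ^ k)" using V by (intro of_nat_mono) (simp add: card_Pow)
  thus "real (card ?I) \<le> 2 ^ k" by simp
  fix Y assume Y: "Y \<in> ?I"
  have finY: "finite Y" using Y V finite_subset by blast
  have "N \<le> k"
  proof (rule ccontr)
   assume "\<not> N \<le> k"
   hence "V \<subseteq> R" by (auto simp: V_def R_def)
   moreover have "Y \<subseteq> V - R" "card Y = N" using Y by simp_all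
   ultimately have "Y = {}" by blast
   thus False using \<open>card Y = N\<close> \<open>\<not> N \<le> k\<close> by simp
  qed
  hence RV: "R \<inter> V = R" by (auto simp: V_def R_def)
  have "Prob (bern (pairs V) p) {X. \<forall>e\<in>?E Y. \<not> X e} = (1 - p) ^ card (?E Y)"
   unfolding RV
  proof (rule prob_bern_all(2))
   show "{{y, w} | y w. y \<in> Y \<and> w \<in> R} \<subseteq> pairs V"
    by (rule doubletons_subset) (use Y RV in blast)+
  qed (use V p' in auto)
  also have "card (?E Y) = N * N"
   unfolding RV using Y R by (subst card_doubletons[OF finY]) auto
  also have "(1 - p) ^ (N * N) \<le> exp (- p) ^ (N * N)"
   using p' exp_ge_add_one_self[of "- p"] by (intro power_mono) auto
  also have "\<dots> = exp (- (real N * real N * p))" by (simp add: exp_of_nat_mult[symmetric])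
  also have "\<dots> \<le> exp (- (4 * real k))"
  proof -
   have "2 * k / sqrt ?d * (2 * k / sqrt ?d) * p \<le> real N * real N * p"
    using N p' d by (intro mult_right_mono mult_mono) auto
   moreover have "2 * k / sqrt ?d * (2 * k / sqrt ?d) * p = 4 * real k"
   proof -
    have "2 * k / sqrt ?d * (2 * k / sqrt ?d) * p = 4 * k * k * p / (sqrt ?d * sqrt ?d)" by simp
    also have "\<dots> = 4 * k" using p'(1) elim by simp
    finally show ?thesis by simp
   qed
   ultimately show ?thesis by simp
  qed
  finally show "Prob (bern (pairs V) p) {X. \<forall>e\<in>?E Y. \<not> X e} \<le> exp (- (4 * real k))" .
 qed simp
 also have "\<dots> \<le> exp 1 ^ k * exp (- (4 * real k))"
  using exp_ge_add_one_self[of 1] by (intro mult_right_mono power_mono) auto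
 also have "\<dots> = exp (- (3 * real k))" by (simp add: exp_of_nat_mult[symmetric] exp_add[symmetric])
 finally show "Prob (random_graph k p) {H. \<not> card (detached H {1..hub_number k p}) \<le> hub_number k p} \<le> ?f k"
  unfolding R_def N_def .
qed

abbreviation apart :: "real \<Rightarrow> nat \<Rightarrow> real \<Rightarrow> nat graph \<Rightarrow> bool" where
 "apart \<tau> k p H \<equiv> \<forall>u\<in>{1..k}. \<forall>x\<in>{1..k}. u \<noteq> x \<longrightarrow> 2 * \<tau> * (real k * p) \<le> real (card (nbrs H u - nbrs H x))"

text \<open>For a pair u, x the edges at x are revealed first. As p \<le> 1/2, usually more than k /
  5 vertices are not adjacent to x. The edges from u to these are still independent, and more than k
  p / 5 of them are expected. In this range k p is at least a power of k, so a union bound over all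
  pairs is harmless.\<close>

lemma neighbourhood_difference_whp:
 fixes \<tau> :: real
 assumes \<tau>: "0 \<le> \<tau>" "\<tau> \<le> 1 / 100"
 shows "whp (\<lambda>k p. p \<le> 1 / 2 \<and> \<not> sparse_range k p)
  (apart \<tau>)"
proof (rule whpI_eventually)
 let ?g = "\<lambda>k::nat. exp (real k / 5 - (real k - 2) * (3 / 10)) + exp (- ((1 / 10) * real k powr (1 / 10)))"
 let ?f = "\<lambda>k::nat. real k * (real k * ?g k)"
 show "?f \<longlonglongrightarrow> 0" by real_asymp
 show "\<forall>\<^sub>F k::nat in sequentially. 3 \<le> k" by (rule eventually_ge_at_top)
 fix k :: nat and p :: real assume elim: "3 \<le> k" and "p \<le> 1 / 2 \<and> \<not> sparse_range k p"
 hence p: "p \<le> 1 / 2" "real k powr (- 9 / 10) < p" by (auto simp: sparse_range_def)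
 have "0 < real k powr (- 9 / 10)" using elim by simp
 hence p0: "0 < p" using p by linarith
 define V where "V = {1..k}"
 have V: "finite V" "card V = k" by (simp_all add: V_def)
 let ?d = "real k * p"
 have "real k powr (1 / 10) = real k powr 1 * real k powr (- 9 / 10)" by (subst powr_add[symmetric]) simp
 also have "\<dots> \<le> ?d" using p elim by simp
 finally have d: "real k powr (1 / 10) \<le> ?d" .
 have bound: "Prob (bern (pairs V) p) {X. \<not> 2 * \<tau> * ?d \<le> card {w\<in>V - {u, x}. X {u, w} \<and> \<not> X {x, w}}} \<le> ?g k"
  if ux: "u \<in> V" "x \<in> V" "u \<noteq> x" for u x
 proof -
  let ?W = "V - {u, x}"
  let ?few = "\<lambda>X. real (card {w\<in>?W. \<not> X {x, w}}) \<le> real k / 5"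
  let ?bad = "\<lambda>X. \<not> 2 * \<tau> * ?d \<le> card {w\<in>?W. X {u, w} \<and> \<not> X {x, w}}"
  have cardW: "real (card ?W) = real k - 2" using ux V elim by (simp add: card_Diff_subset)
  have "Prob (bern (pairs V) p) {X. ?few X} = Prob (bern (pairs V) p) {X. real (card {e\<in>star x ?W. X e = False}) \<le> real k / 5}"
   by (simp add: card_star_filter)
  also have "\<dots> \<le> exp (1 * (real k / 5) - real (card (star x ?W)) * (if False then p else 1 - p) * (1 - exp (- 1)))"
   using V p0 p ux by (intro prob_few star_subset_pairs) auto
  also have "\<dots> \<le> exp (real k / 5 - (real k - 2) * (3 / 10))"
  proof -
   have "(real k - 2) * ((1 / 2) * (3 / 5)) \<le> (real k - 2) * ((1 - p) * (1 - exp (- 1)))"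
    using elim p exp_minus_one_le by (intro mult_left_mono mult_mono) auto
   thus ?thesis using cardW by (simp add: card_star)
  qed
  finally have 1: "Prob (bern (pairs V) p) {X. ?few X} \<le> exp (real k / 5 - (real k - 2) * (3 / 10))" .
  let ?A = "star x (V - {x})" let ?B = "pairs V - ?A"
  have A: "?A \<subseteq> pairs V" using ux by (intro star_subset_pairs) auto
  have "Prob (Pi_pmf (?A \<union> ?B) False (\<lambda>_. bernoulli_pmf p)) {X. \<not> ?few X \<and> ?bad X} \<le> exp (- ((1 / 10) * real k powr (1 / 10)))"
  proof (rule prob_Pi_union_le)
   fix f assume "f \<in> set_pmf (Pi_pmf ?A False (\<lambda>_. bernoulli_pmf p))"
   let ?h = "\<lambda>g e. if e \<in> ?A then f e else g e"
   let ?N = "{w\<in>?W. \<not> f {x, w}}"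
   have hx: "?h g {x, w} = f {x, w}" if "w \<in> ?W" for g :: "nat set \<Rightarrow> bool" and w using that by auto
   have hu: "?h g {u, w} = g {u, w}" if "w \<in> ?W" for g :: "nat set \<Rightarrow> bool" and w
    using that ux by (auto simp: doubleton_eq_iff)
   have few: "?few (?h g) \<longleftrightarrow> real (card ?N) \<le> real k / 5" for g
   proof -
    have "{w\<in>?W. \<not> ?h g {x, w}} = ?N" using hx[of _ g] by blast
    thus ?thesis by simp
   qed
   have bad: "?bad (?h g) \<longleftrightarrow> \<not> 2 * \<tau> * ?d \<le> card {e\<in>star u ?N. g e}" for g
   proof -
    have "{w\<in>?W. ?h g {u, w} \<and> \<not> ?h g {x, w}} = {w\<in>?N. g {u, w}}" using hx[of _ g] hu[of _ g] by blast
    thus ?thesis unfolding card_star_filter by (simp only:)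
   qed
   show "Prob (Pi_pmf ?B False (\<lambda>_. bernoulli_pmf p)) {g. \<not> ?few (?h g) \<and> ?bad (?h g)} \<le> exp (- ((1 / 10) * real k powr (1 / 10)))"
   proof (cases "real (card ?N) \<le> real k / 5")
    case False
    have "Prob (bern ?B p) {g. \<not> ?few (?h g) \<and> ?bad (?h g)} \<le>
     Prob (bern ?B p) {g. real (card {e\<in>star u ?N. g e = True}) \<le> 2 * \<tau> * ?d}"
     unfolding few bad by (rule prob_mono) simp
    also have "\<dots> \<le> exp (1 * (2 * \<tau> * ?d) - real (card (star u ?N)) * (if True then p else 1 - p) * (1 - exp (- 1)))"
    proof (rule prob_few)
     show "star u ?N \<subseteq> ?B" using ux by (auto simp: doubleton_pairs doubleton_eq_iff)
    qed (use V p0 p in auto)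
    also have "\<dots> \<le> exp (- ((1 / 10) * real k powr (1 / 10)))"
    proof -
     have "real k / 5 * p * (3 / 5) \<le> real (card ?N) * p * (1 - exp (- 1))"
      using False p0 exp_minus_one_le by (intro mult_mono) auto
     moreover have "2 * \<tau> * ?d \<le> 2 * (1 / 100) * ?d" using \<tau> p0 by (intro mult_right_mono) auto
     ultimately show ?thesis using d by (simp add: card_star)
    qed
    finally show ?thesis .
   next
    case True
    thus ?thesis unfolding few by simp
   qed
  qed (use V A finite_subset[OF A] in auto)
  moreover have "?A \<union> ?B = pairs V" using A by blast
  ultimately have 2: "Prob (bern (pairs V) p) {X. \<not> ?few X \<and> ?bad X} \<le> exp (- ((1 / 10) * real k powr (1 / 10)))"
   by (simp only:)
  have "Prob (bern (pairs V) p) {X. ?bad X} \<le> Prob (bern (pairs V) p) {X. ?few X \<or> (\<not> ?few X \<and> ?bad X)}"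
   by (rule prob_mono) blast
  also note prob_disj
  finally show ?thesis using 1 2 by linarith
 qed
 have "Prob (random_graph k p) {H. \<not> apart \<tau> k p H} \<le>
  Prob (bern (pairs V) p) {X. \<exists>u\<in>V. \<exists>x\<in>V - {u}. \<not> 2 * \<tau> * ?d \<le> card {w\<in>V - {u, x}. X {u, w} \<and> \<not> X {x, w}}}"
  unfolding prob_random_graph V_def[symmetric]
 proof (rule prob_mono)
  fix X assume "\<not> (\<forall>u\<in>V. \<forall>x\<in>V. u \<noteq> x \<longrightarrow> 2 * \<tau> * ?d \<le> card (nbrs (graph_on V X) u - nbrs (graph_on V X) x))"
  then obtain u x where ux: "u \<in> V" "x \<in> V" "u \<noteq> x" and
   *: "\<not> 2 * \<tau> * ?d \<le> card (nbrs (graph_on V X) u - nbrs (graph_on V X) x)" by blast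
  have "{w\<in>V - {u, x}. X {u, w} \<and> \<not> X {x, w}} \<subseteq> nbrs (graph_on V X) u - nbrs (graph_on V X) x"
   using ux by (auto simp: nbrs_def doubleton_pairs)
  moreover have "finite (nbrs (graph_on V X) u - nbrs (graph_on V X) x)"
   by (rule finite_subset[OF _ V(1)]) (auto simp: nbrs_def doubleton_pairs)
  ultimately have "card {w\<in>V - {u, x}. X {u, w} \<and> \<not> X {x, w}} \<le> card (nbrs (graph_on V X) u - nbrs (graph_on V X) x)"
   by (intro card_mono)
  thus "\<exists>u\<in>V. \<exists>x\<in>V - {u}. \<not> 2 * \<tau> * ?d \<le> card {w\<in>V - {u, x}. X {u, w} \<and> \<not> X {x, w}}"
   using ux * by (intro bexI[of _ u] bexI[of _ x]) auto
 qed
 also have "\<dots> \<le> real k * (real k * ?g k)"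
 proof (rule prob_union_bound_card)
  fix u assume u: "u \<in> V"
  show "Prob (bern (pairs V) p) {X. \<exists>x\<in>V - {u}. \<not> 2 * \<tau> * ?d \<le> card {w\<in>V - {u, x}. X {u, w} \<and> \<not> X {x, w}}} \<le> real k * ?g k"
   by (rule prob_union_bound_card) (use V u bound in auto)
 qed (use V in auto)
 finally show "Prob (random_graph k p) {H. \<not> apart \<tau> k p H} \<le> ?f k" .
qed

section \<open>Random graphs are cores\<close>

text \<open>The properties that bound the number of candidates for a retraction, as a predicate that
  can be made a conjunct of the event whose probability is estimated.\<close>

definition tame :: "nat \<Rightarrow> nat set \<Rightarrow> nat \<Rightarrow> nat \<Rightarrow> nat graph \<Rightarrow> bool" where
 "tame t R x \<Delta> H \<longleftrightarrow> clique_free (Suc t) H \<and> card (detached H R) \<le> x \<and> (\<forall>v\<in>verts H. card (nbrs H v) \<le> \<Delta>)"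

lemma power_one_minus_le_exp: "0 \<le> p \<Longrightarrow> p \<le> 1 \<Longrightarrow> M \<le> real n \<Longrightarrow> (1 - p) ^ n \<le> exp (- (p * M))" for p M :: real
proof -
 assume p: "0 \<le> p" "p \<le> 1" "M \<le> real n"
 have "(1 - p) ^ n \<le> exp (- p) ^ n" using p exp_ge_add_one_self[of "- p"] by (intro power_mono) auto
 also have "\<dots> = exp (- (p * real n))" by (simp add: exp_of_nat_mult[symmetric] mult.commute)
 also have "\<dots> \<le> exp (- (p * M))" using p by (simp add: mult_left_mono)
 finally show ?thesis .
qed

text \<open>As w \<ge> 2 t, the diagonal term t w of Turan's bound is at most w^2 / 2 and can be
  absorbed.\<close>

lemma nonadjacent_count:
 fixes w \<mu> n :: real
 assumes "w\<^sup>2 \<le> real t * (w + n * 2)" "\<mu> \<le> w" "2 * real t \<le> \<mu>" "1 \<le> t"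
 shows "\<mu>\<^sup>2 / (4 * real t) \<le> n"
proof -
 have t: "0 < real t" using assms(4) by simp
 have w: "2 * real t \<le> w" using assms by linarith
 have "2 * real t * w \<le> w * w" using w t by (intro mult_right_mono) auto
 hence "w\<^sup>2 \<le> 4 * real t * n" using assms(1) by (simp add: power2_eq_square algebra_simps)
 moreover have "\<mu>\<^sup>2 \<le> w\<^sup>2" using assms t by (intro power_mono) auto
 ultimately show ?thesis using t by (simp add: field_simps)
qed

text \<open>
 The pairs inside of \<open>V - U\<close> and the pairs meeting \<open>R\<close> are revealed first. They determine a
 small set of candidates for the retraction: the image of a vertex \<open>v\<close> with a neighbour \<open>w\<close> in \<open>R\<close> is
 among the few neighbours of the image of \<open>w\<close>.
\<close>

lemma prob_retraction_moving:
 fixes p \<mu> :: real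
 assumes p: "0 \<le> p" "p \<le> 1" and U: "U \<subseteq> {1..k}" and R: "R \<subseteq> {1..k}" and \<Delta>: "1 \<le> \<Delta>" "1 \<le> k"
  and \<mu>: "\<mu> \<le> card (U - R)" "2 * real t \<le> \<mu>" "1 \<le> t"
 shows "Prob (random_graph k p) {H. tame t R x \<Delta> H \<and> (\<exists>r. retraction_moving H U r)}
  \<le> real k ^ (card R + x) * real \<Delta> ^ k * exp (- (p * (\<mu>\<^sup>2 / (4 * real t))))"
proof -
 define V where "V = {1..k}"
 have V: "finite V" "card V = k" by (simp_all add: V_def)
 note U = U[folded V_def] and R = R[folded V_def]
 define S W where "S = V - U" and "W = U - R"
 have finW: "finite W" using finite_subset[OF U V(1)] by (simp add: W_def)
 \<comment> \<open>A retraction maps into \<open>S\<close>. So this part contains every pair of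
   images and every pair at a hub, while the pairs inside \<open>W\<close> stay unrevealed.\<close>
 define A where "A = {e\<in>pairs V. e \<subseteq> S \<or> e \<inter> R \<noteq> {}}"
 define B where "B = pairs V - A"
 have AV: "A \<subseteq> pairs V" by (auto simp: A_def)
 let ?G = "\<lambda>h. (V, {e\<in>pairs V. h e})"
 let ?Q = "\<lambda>H. tame t R x \<Delta> H \<and> (\<exists>r. retraction_moving H U r)"
 let ?c = "real k ^ (card R + x) * real \<Delta> ^ k * exp (- (p * (\<mu>\<^sup>2 / (4 * real t))))"
 have "Prob (Pi_pmf (A \<union> B) False (\<lambda>_. bernoulli_pmf p)) {h. ?Q (?G h)} \<le> ?c"
 proof (rule prob_Pi_union_le)
  show "finite A" "finite B" "A \<inter> B = {}" using V by (auto simp: A_def B_def)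
  fix f assume "f \<in> set_pmf (Pi_pmf A False (\<lambda>_. bernoulli_pmf p))"
  define F where "F = {e\<in>A. f e}"
  let ?h = "\<lambda>g e. if e \<in> A then f e else g e"
  define G where "G = (\<lambda>g. ?G (?h g))"
  define N where "N = (\<lambda>s. {w\<in>S. {s, w} \<in> F})"
  define D where "D = {v\<in>V - R. \<forall>w\<in>R. {v, w} \<notin> F}"
  have edge_F: "e \<in> edges (G g) \<longleftrightarrow> e \<in> F" if "e \<in> A" for g e using that AV by (auto simp: F_def G_def)
  have F_edge: "e \<in> edges (G g)" if "e \<in> F" for g e using that AV by (auto simp: F_def G_def)
  have verts_G: "verts (G g) = V" for g by (simp add: G_def)
  have simple: "simple_graph (G g)" for g using V by (simp add: simple_graph_def G_def)
  have det: "detached (G g) R = D" for g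
  proof -
   have "w \<in> nbrs (G g) v \<longleftrightarrow> {v, w} \<in> F" if "v \<in> V - R" "w \<in> R" for v w
   proof -
    have "{v, w} \<in> A" using that R by (auto simp: A_def doubleton_pairs)
    from edge_F[OF this] show ?thesis by (simp only: nbrs_def mem_Collect_eq)
   qed
   thus ?thesis unfolding detached_def D_def verts_G by blast
  qed
  have N_nbrs: "N s \<subseteq> nbrs (G g) s" for s g unfolding N_def nbrs_def using F_edge by blast
  have fin_nbrs: "finite (nbrs (G g) s)" for g s
   by (rule finite_subset[OF nbrs_subset[OF simple]]) (use V in \<open>simp add: verts_G\<close>)
  let ?P = "Prob (bern B p) {g. ?Q (G g)}"
  have "?P \<le> ?c"
  \<comment> \<open>If the revealed part already violates tameness, the event is empty. Otherwise
    the candidate set \<open>C\<close> is determined before \<open>B\<close> is revealed.\<close>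
  proof (cases "card D \<le> x \<and> (\<forall>s\<in>V. card (N s) \<le> \<Delta>)")
   case False
   have no: "\<not> ?Q (G g)" for g
   proof
    assume "?Q (G g)"
    hence tame: "tame t R x \<Delta> (G g)" by blast
    have "card D \<le> x" using tame det[of g] by (simp only: tame_def)
    moreover have "card (N s) \<le> \<Delta>" if "s \<in> V" for s
     using tame that card_mono[OF fin_nbrs N_nbrs, of s g] unfolding tame_def verts_G by (meson le_trans)
    ultimately show False using False by blast
   qed
   hence "{g. ?Q (G g)} = {}" by blast
   hence "?P = 0" by (simp only: measure_empty)
   thus ?thesis by simp
  next
   case True
   define K where "K = R \<union> D"
   have K: "K \<subseteq> V" "finite K" using R V by (auto simp: K_def D_def intro: finite_subset)
   have "\<forall>v\<in>V - K. \<exists>w. w \<in> R \<and> {v, w} \<in> F" by (auto simp: K_def D_def)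
   from bchoice[OF this] obtain \<pi> where \<pi>: "\<And>v. v \<in> V - K \<Longrightarrow> \<pi> v \<in> R \<and> {v, \<pi> v} \<in> F" by auto
   \<comment> \<open>Hubs and detached vertices have arbitrary images, at most k^(card R + x)
     choices. Every other vertex \<open>v\<close> goes to a neighbour in \<open>S\<close> of the
     image of its hub \<open>\<pi> v\<close>, at most \<Delta> choices.\<close>
   define C where "C = (\<Union>r\<in>K \<rightarrow>\<^sub>E V. PiE V (\<lambda>v. if v \<in> K then {r v} else N (r (\<pi> v))))"
   have finN: "finite (N s)" for s unfolding N_def S_def using V by simp
   have finC: "finite C" unfolding C_def
    using V K finN by (intro finite_UN_I finite_PiE) auto
   have cardC: "card C \<le> k ^ (card R + x) * \<Delta> ^ k"
   proof -
    have "card C \<le> (\<Sum>r\<in>K \<rightarrow>\<^sub>E V. card (PiE V (\<lambda>v. if v \<in> K then {r v} else N (r (\<pi> v)))))"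
     unfolding C_def using V K by (intro card_UN_le finite_PiE) auto
    also have "\<dots> \<le> (\<Sum>r\<in>K \<rightarrow>\<^sub>E V. \<Delta> ^ k)"
    proof (rule sum_mono)
     fix r assume r: "r \<in> K \<rightarrow>\<^sub>E V"
     have "card (PiE V (\<lambda>v. if v \<in> K then {r v} else N (r (\<pi> v)))) = (\<Prod>v\<in>V. card (if v \<in> K then {r v} else N (r (\<pi> v))))"
      using V by (simp add: card_PiE)
     also have "\<dots> \<le> (\<Prod>v\<in>V. \<Delta>)"
     proof (rule prod_mono)
      fix v assume v: "v \<in> V"
      show "0 \<le> card (if v \<in> K then {r v} else N (r (\<pi> v))) \<and> card (if v \<in> K then {r v} else N (r (\<pi> v))) \<le> \<Delta>"
      proof (cases "v \<in> K")
       case False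
       hence "\<pi> v \<in> K" using \<pi>[of v] v by (simp add: K_def)
       hence "r (\<pi> v) \<in> V" using r by (rule PiE_mem[rotated])
       thus ?thesis using True False by simp
      qed (use \<Delta> in simp)
     qed
     finally show "card (PiE V (\<lambda>v. if v \<in> K then {r v} else N (r (\<pi> v)))) \<le> \<Delta> ^ k" using V by simp
    qed
    also have "\<dots> = k ^ card K * \<Delta> ^ k" using V K by (simp add: card_PiE)
    also have "\<dots> \<le> k ^ (card R + x) * \<Delta> ^ k"
    proof (intro mult_right_mono power_increasing)
     show "card K \<le> card R + x" using True card_Un_le[of R D] by (simp add: K_def)
    qed (use \<Delta> in auto)
    finally show ?thesis .
   qed
   let ?D = "\<lambda>r. {e\<in>pairs W. r ` e \<notin> F}"
   let ?I = "{r\<in>C. \<mu>\<^sup>2 / (4 * real t) \<le> card (?D r)}"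
   have D_B: "?D r \<subseteq> B" for r
   proof
    fix e assume e: "e \<in> ?D r"
    hence "e \<subseteq> W" "e \<noteq> {}" by (auto simp: pairs_def)
    hence "\<not> e \<subseteq> S" "e \<inter> R = {}" by (auto simp: W_def S_def)
    moreover have "e \<in> pairs V" using e U pairs_mono[of W V] by (auto simp: W_def)
    ultimately show "e \<in> B" unfolding A_def B_def by blast
   qed
   have "?P \<le> Prob (bern B p) {g. \<exists>r\<in>?I. \<forall>e\<in>?D r. \<not> g e}"
   proof (rule prob_mono)
    fix g assume Q: "?Q (G g)"
    let ?H = "G g"
    from Q obtain r where r: "retraction_moving ?H U r" by blast
    have tame: "clique_free (Suc t) ?H" using Q by (simp add: tame_def)
    have rS: "r v \<in> S" if "v \<in> V" for v
     using r that by (auto simp: retraction_moving_def homomorphism_def S_def verts_G)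
    have hom: "{r u, r v} \<in> edges ?H" if "{u, v} \<in> edges ?H" for u v
     using r that unfolding retraction_moving_def homomorphism_def by blast
    have hom': "r ` e \<in> edges ?H" if "e \<in> edges ?H" for e
    proof -
     have "e \<in> pairs V" using that by (simp add: G_def)
     then obtain u v where "e = {u, v}" by (auto simp: pairs_def card_2_iff)
     thus ?thesis using hom[of u v] that by simp
    qed
    have image_F: "r ` e \<in> edges ?H \<longleftrightarrow> r ` e \<in> F" if "e \<subseteq> V" for e
    proof
     assume *: "r ` e \<in> edges ?H"
     hence "r ` e \<in> pairs V" by (simp add: G_def)
     moreover have "r ` e \<subseteq> S" using that rS by blast
     ultimately have "r ` e \<in> A" unfolding A_def by blast
     thus "r ` e \<in> F" using * edge_F by blast
    qed (rule F_edge)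
    let ?r = "restrict r V"
    have "?r \<in> C" unfolding C_def
    proof (rule UN_I)
     show "restrict r K \<in> K \<rightarrow>\<^sub>E V" using rS K(1) by (auto simp: S_def)
     show "?r \<in> PiE V (\<lambda>v. if v \<in> K then {restrict r K v} else N (restrict r K (\<pi> v)))"
     proof (rule PiE_I)
      fix v assume v: "v \<in> V"
      show "?r v \<in> (if v \<in> K then {restrict r K v} else N (restrict r K (\<pi> v)))"
      proof (cases "v \<in> K")
       case False
       hence \<pi>v: "\<pi> v \<in> R" "{v, \<pi> v} \<in> F" using \<pi>[of v] v by auto
       have "r ` {v, \<pi> v} \<in> edges ?H" by (rule hom'[OF F_edge[OF \<pi>v(2)]])
       hence "r ` {v, \<pi> v} \<in> F" using image_F[of "{v, \<pi> v}"] v \<pi>v(1) R by blast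
       hence "{r (\<pi> v), r v} \<in> F" by (simp add: insert_commute)
       hence "r v \<in> N (r (\<pi> v))" using rS[OF v] by (simp add: N_def)
       thus ?thesis using False v \<pi>v(1) by (simp add: K_def)
      qed (use v in simp)
     qed simp
    qed
    have WV: "W \<subseteq> V" using U by (auto simp: W_def)
    have Deq: "?D ?r = {e\<in>pairs W. r ` e \<notin> edges ?H}"
    proof -
     have "?r ` e \<in> F \<longleftrightarrow> r ` e \<in> edges ?H" if "e \<in> pairs W" for e
     proof -
      have "e \<subseteq> V" using that WV by (auto simp: pairs_def)
      moreover from this have "?r ` e = r ` e" by (intro image_cong) auto
      ultimately show ?thesis using image_F[of e] by (simp only:)
     qed
     thus ?thesis by blast
    qed
    have "r ` W \<subseteq> verts ?H" using rS WV by (auto simp: S_def verts_G)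
    from many_nonadjacent_pairs[OF simple tame finW this]
    have "(real (card W))\<^sup>2 \<le> real t * (real (card W) + real (card (?D ?r)) * 2)" unfolding Deq .
    from nonadjacent_count[OF this \<mu>(1)[folded W_def] \<mu>(2,3)] have "?r \<in> ?I" using \<open>?r \<in> C\<close> by simp
    \<comment> \<open>A homomorphism sends edges to edges, so a pair whose image is a non-edge is
      itself a non-edge.\<close>
    moreover have "\<not> g e" if e: "e \<in> ?D ?r" for e
    proof
     assume "g e"
     moreover have "e \<in> B" using D_B e by blast
     ultimately have "e \<in> edges ?H" by (auto simp: B_def G_def)
     from hom'[OF this] show False using e unfolding Deq by blast
    qed
    ultimately show "\<exists>r\<in>?I. \<forall>e\<in>?D r. \<not> g e" by blast
   qed
   also have "\<dots> \<le> (real k ^ (card R + x) * real \<Delta> ^ k) * exp (- (p * (\<mu>\<^sup>2 / (4 * real t))))"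
   proof (rule prob_union_bound_card)
    show "finite ?I" using finC by simp
    have "card ?I \<le> card C" using finC by (intro card_mono) auto
    hence "card ?I \<le> k ^ (card R + x) * \<Delta> ^ k" using cardC by linarith
    hence "real (card ?I) \<le> real (k ^ (card R + x) * \<Delta> ^ k)" by (rule of_nat_mono)
    thus "real (card ?I) \<le> real k ^ (card R + x) * real \<Delta> ^ k" by simp
    fix r assume r: "r \<in> ?I"
    have "Prob (bern B p) {g. \<forall>e\<in>?D r. \<not> g e} = (1 - p) ^ card (?D r)"
     by (rule prob_bern_all(2)[OF _ D_B p]) (use V in \<open>simp add: B_def\<close>)
    also have "\<dots> \<le> exp (- (p * (\<mu>\<^sup>2 / (4 * real t))))" using r p by (intro power_one_minus_le_exp) auto
    finally show "Prob (bern B p) {g. \<forall>e\<in>?D r. \<not> g e} \<le> exp (- (p * (\<mu>\<^sup>2 / (4 * real t))))" .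
   qed simp
   finally show ?thesis .
  qed
  thus "Prob (bern B p) {g. ?Q (?G (?h g))} \<le> ?c" unfolding G_def .
 qed
 moreover have "A \<union> B = pairs V" using AV by (auto simp: B_def)
 ultimately show ?thesis unfolding prob_random_graph V_def[symmetric] by (simp only:)
qed

lemma prob_large_retraction:
 fixes p \<mu> \<theta> :: real
 assumes p: "0 \<le> p" "p \<le> 1" and R: "R \<subseteq> {1..k}" and \<Delta>: "1 \<le> \<Delta>" "1 \<le> k"
  and \<mu>: "\<mu> + card R \<le> \<theta> * k" "2 * real t \<le> \<mu>" "1 \<le> t"
 shows "Prob (random_graph k p) {H. tame t R x \<Delta> H \<and> (\<exists>U r. U \<subseteq> {1..k} \<and> \<theta> * k < card U \<and> retraction_moving H U r)}
  \<le> 2 ^ k * (real k ^ (card R + x) * real \<Delta> ^ k * exp (- (p * (\<mu>\<^sup>2 / (4 * real t)))))"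
proof -
 let ?I = "{U. U \<subseteq> {1..k} \<and> \<theta> * k < card U}"
 have "Prob (random_graph k p) {H. tame t R x \<Delta> H \<and> (\<exists>U r. U \<subseteq> {1..k} \<and> \<theta> * k < card U \<and> retraction_moving H U r)}
  \<le> Prob (random_graph k p) {H. \<exists>U\<in>?I. tame t R x \<Delta> H \<and> (\<exists>r. retraction_moving H U r)}"
  by (rule prob_mono) blast
 also have "\<dots> \<le> 2 ^ k * (real k ^ (card R + x) * real \<Delta> ^ k * exp (- (p * (\<mu>\<^sup>2 / (4 * real t)))))"
 proof (rule prob_union_bound_card)
  show "finite ?I" by (rule finite_subset[of _ "Pow {1..k}"]) auto
  have "card ?I \<le> card (Pow {1..k})" by (intro card_mono) auto
  hence "real (card ?I) \<le> real (2 ^ k)" by (intro of_nat_mono) (simp add: card_Pow)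
  thus "real (card ?I) \<le> 2 ^ k" by simp
  fix U assume U: "U \<in> ?I"
  have fin: "finite R" using R finite_subset by blast
  have "card U - card R \<le> card (U - R)" by (rule diff_card_le_card_Diff[OF fin])
  hence "\<mu> \<le> card (U - R)" using U \<mu>(1) by auto
  thus "Prob (random_graph k p) {H. tame t R x \<Delta> H \<and> (\<exists>r. retraction_moving H U r)}
   \<le> real k ^ (card R + x) * real \<Delta> ^ k * exp (- (p * (\<mu>\<^sup>2 / (4 * real t))))"
   using U by (intro prob_retraction_moving p R \<Delta> \<mu>) auto
 qed simp
 finally show ?thesis .
qed

section \<open>Comparison of exponents in the two ranges of p\<close>

lemma power_eq_exp: "0 < x \<Longrightarrow> x ^ n = exp (real n * ln x)" for x :: real
 by (simp add: exp_of_nat_mult)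

text \<open>With d = k p and after division by k, the logarithm of the count is at most 2 + 4 sqrt d
  + ln (9 d), for the sets U, the images of 2 N vertices and the maximum degree. The gain is
  \<theta>^2 d / 48, from \<mu> = \<theta> k / 2 and t = 3. It wins because d \<ge> ln k tends to
  infinity.\<close>

lemma sparse_exponent:
 fixes \<theta> :: real
 assumes \<theta>: "0 < \<theta>"
 shows "\<forall>\<^sub>F k in sequentially. \<forall>p::real. log_range k p \<longrightarrow> 12 \<le> \<theta> * real k \<and> real (hub_number k p) \<le> \<theta> * real k / 2 \<and> 1 \<le> 8 * (k * p) \<and>
  2 ^ k * (real k ^ (hub_number k p + hub_number k p) * real (nat \<lceil>8 * (k * p)\<rceil>) ^ k * exp (- (p * ((\<theta> * k / 2)\<^sup>2 / (4 * real 3))))) \<le> exp (- real k)"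
  (is "\<forall>\<^sub>F k in _. \<forall>p. _ \<longrightarrow> ?A k p")
proof -
 have "\<forall>\<^sub>F y::real in at_top. 2 / sqrt y \<le> \<theta> / 4" using \<theta> by real_asymp
 moreover have "\<forall>\<^sub>F y::real in at_top. 3 + 4 * sqrt y + ln (9 * y) \<le> \<theta>\<^sup>2 / 48 * y" using \<theta> by real_asymp
 moreover have "\<forall>\<^sub>F y::real in at_top. 1 \<le> y" by (rule eventually_ge_at_top)
 ultimately have "\<forall>\<^sub>F y::real in at_top. 2 / sqrt y \<le> \<theta> / 4 \<and> 3 + 4 * sqrt y + ln (9 * y) \<le> \<theta>\<^sup>2 / 48 * y \<and> 1 \<le> y"
  by (intro eventually_conj)
 then obtain y0 where y0: "\<And>y. y0 \<le> y \<Longrightarrow> 2 / sqrt y \<le> \<theta> / 4 \<and> 3 + 4 * sqrt y + ln (9 * y) \<le> \<theta>\<^sup>2 / 48 * y \<and> 1 \<le> y"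
  unfolding eventually_at_top_linorder by blast
 have "\<forall>\<^sub>F k::nat in sequentially. y0 \<le> ln (real k)" by real_asymp
 moreover have "\<forall>\<^sub>F k::nat in sequentially. 12 \<le> \<theta> * real k" using \<theta> by real_asymp
 moreover have "\<forall>\<^sub>F k::nat in sequentially. 1 \<le> k" by (rule eventually_ge_at_top)
 ultimately show ?thesis
 proof eventually_elim
  case (elim k)
  show ?case
  proof (intro allI impI)
   fix p :: real assume p: "log_range k p"
   define d where "d = real k * p"
   define N where "N = real (hub_number k p)"
   define \<Delta> where "\<Delta> = real (nat \<lceil>8 * d\<rceil>)"
   have k: "0 < real k" and lnk: "0 \<le> ln (real k)" using elim(3) by simp_all
   have d: "ln k \<le> d" "d \<le> k / 2" using p k by (auto simp: log_range_def d_def)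
   hence y: "2 / sqrt d \<le> \<theta> / 4" "3 + 4 * sqrt d + ln (9 * d) \<le> \<theta>\<^sup>2 / 48 * d" "1 \<le> d"
    using y0[of d] elim(1) by auto
   have "0 \<le> 2 * real k / sqrt d" using y k by simp
   hence N: "N \<le> 2 * real k / sqrt d + 1" unfolding N_def hub_number_def d_def by linarith
   have "2 * real k / sqrt d \<le> \<theta> * k / 4" using mult_right_mono[OF y(1), of "real k"] by simp
   hence Nk: "N \<le> \<theta> * k / 2" using N elim(2) by linarith
   have \<Delta>: "1 \<le> \<Delta>" "\<Delta> \<le> 9 * d" unfolding \<Delta>_def using y(3) by linarith+
   have "N * ln k \<le> (2 * real k / sqrt d + 1) * d" using N d lnk y by (intro mult_mono) auto
   also have "\<dots> = 2 * real k * (d / sqrt d) + d" by (simp add: algebra_simps)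
   also have "d / sqrt d = sqrt d" using y(3) by (simp add: real_div_sqrt)
   finally have Nl: "2 * (N * ln k) \<le> k * (4 * sqrt d + 1)" using d(2) by (simp add: algebra_simps)
   have "ln \<Delta> \<le> ln (9 * d)" using \<Delta> by simp
   hence \<Delta>l: "k * ln \<Delta> \<le> k * ln (9 * d)" using k by (intro mult_left_mono) auto
   have pk: "p * ((\<theta> * k / 2)\<^sup>2 / (4 * real 3)) = k * (\<theta>\<^sup>2 / 48 * d)" by (simp add: d_def power2_eq_square field_simps)
   have "k * ln 2 \<le> real k * 1" using ln_le_minus_one[of 2] k by (intro mult_left_mono) auto
   hence "k * ln 2 + 2 * (N * ln k) + k * ln \<Delta> - p * ((\<theta> * k / 2)\<^sup>2 / (4 * real 3)) \<le> k * (2 + 4 * sqrt d + ln (9 * d) - \<theta>\<^sup>2 / 48 * d)"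
    unfolding pk using Nl \<Delta>l by (simp add: algebra_simps)
   also have "\<dots> \<le> real k * (- 1)" using y(2) k by (intro mult_left_mono) auto
   finally have "exp (k * ln 2 + 2 * (N * ln k) + k * ln \<Delta> - p * ((\<theta> * k / 2)\<^sup>2 / (4 * real 3))) \<le> exp (- real k)" by simp
   moreover have "exp (k * ln 2 + 2 * (N * ln k) + k * ln \<Delta> - p * ((\<theta> * k / 2)\<^sup>2 / (4 * real 3)))
    = 2 ^ k * (real k ^ (hub_number k p + hub_number k p) * \<Delta> ^ k * exp (- (p * ((\<theta> * k / 2)\<^sup>2 / (4 * real 3)))))"
   proof -
    have "2 ^ k = exp (k * ln (2 :: real))" by (rule power_eq_exp) simp
    moreover have "real k ^ (hub_number k p + hub_number k p) = exp (2 * (N * ln k))"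
     using k by (subst power_eq_exp) (simp_all add: N_def)
    moreover have "\<Delta> ^ k = exp (k * ln \<Delta>)" using \<Delta>(1) by (intro power_eq_exp) simp
    ultimately show ?thesis by (simp only: exp_add exp_diff exp_minus divide_inverse mult.assoc)
   qed
   ultimately show "?A k p"
    using elim(2) Nk y(3) unfolding d_def[symmetric] \<Delta>_def[symmetric] N_def by (intro conjI) (simp_all only:)
  qed
 qed
qed

text \<open>Here p k^2 is at least k^(11/10), so even after division by t = O(log k) the gain
  exceeds the 2 k ln k of the crude count.\<close>

lemma dense_exponent:
 fixes \<theta> :: real
 assumes \<theta>: "0 < \<theta>"
 shows "\<forall>\<^sub>F k in sequentially. \<forall>p::real. \<not> sparse_range k p \<longrightarrow> 1 \<le> nat \<lceil>4 * ln (real k)\<rceil> \<and> 2 * real (nat \<lceil>4 * ln (real k)\<rceil>) \<le> \<theta> * real k \<and>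
  2 ^ k * (real k ^ k * real k ^ k * exp (- (p * ((\<theta> * k)\<^sup>2 / (4 * real (nat \<lceil>4 * ln (real k)\<rceil>)))))) \<le> exp (- real k)"
  (is "\<forall>\<^sub>F k in _. \<forall>p. _ \<longrightarrow> ?A k p")
proof -
 have "\<forall>\<^sub>F k::nat in sequentially. 1 \<le> ln (real k)" by real_asymp
 moreover have "\<forall>\<^sub>F k::nat in sequentially. 10 * ln (real k) \<le> \<theta> * real k" using \<theta> by real_asymp
 moreover have "\<forall>\<^sub>F k::nat in sequentially. 2 + 2 * ln (real k) \<le> \<theta>\<^sup>2 * real k powr (1 / 10) / (20 * ln (real k))" using \<theta> by real_asymp
 moreover have "\<forall>\<^sub>F k::nat in sequentially. 1 \<le> k" by (rule eventually_ge_at_top)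
 ultimately show ?thesis
 proof eventually_elim
  case (elim k)
  show ?case
  proof (intro allI impI)
   fix p :: real assume "\<not> sparse_range k p"
   hence p: "real k powr (- 9 / 10) < p" by (simp add: sparse_range_def)
   define t where "t = real (nat \<lceil>4 * ln (real k)\<rceil>)"
   have k: "0 < real k" using elim(4) by simp
   have t: "4 * ln k \<le> t" "t \<le> 5 * ln k" unfolding t_def using elim(1) by linarith+
   hence t1: "1 \<le> t" "0 < t" using elim(1) by linarith+
   have "real k * (real k * (real k powr (- 9 / 10))) \<le> real k * (real k * p)" using p k by (intro mult_left_mono) auto
   moreover have "real k * (real k powr (- 9 / 10)) = real k powr (1 / 10)"
    using k by (simp add: powr_mult_base)
   ultimately have kp: "real k * real k powr (1 / 10) \<le> real k * (real k * p)" by simp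
   have "k * (\<theta>\<^sup>2 * real k powr (1 / 10) / (20 * ln (real k))) = \<theta>\<^sup>2 * (real k * real k powr (1 / 10)) / (20 * ln (real k))"
    by simp
   also have "\<dots> \<le> \<theta>\<^sup>2 * (real k * (real k * p)) / (4 * t)"
   proof (rule frac_le)
    show "\<theta>\<^sup>2 * (real k * real k powr (1 / 10)) \<le> \<theta>\<^sup>2 * (real k * (real k * p))" by (rule mult_left_mono[OF kp]) simp
    have "0 \<le> p" using p by (intro order.trans[OF powr_ge_zero less_imp_le])
    thus "0 \<le> \<theta>\<^sup>2 * (real k * (real k * p))" by simp
   qed (use t(2) t1 in simp_all)
   also have "\<dots> = p * ((\<theta> * k)\<^sup>2 / (4 * t))" by (simp add: power2_eq_square)
   finally have "k * (2 + 2 * ln (real k)) \<le> p * ((\<theta> * k)\<^sup>2 / (4 * t))"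
    using mult_left_mono[OF elim(3), of "real k"] by linarith
   moreover have "k * ln 2 \<le> real k * 1" using ln_le_minus_one[of 2] k by (intro mult_left_mono) auto
   ultimately have "k * ln 2 + (k * ln k + k * ln k) - p * ((\<theta> * k)\<^sup>2 / (4 * t)) \<le> - real k" by (simp add: algebra_simps)
   hence "exp (k * ln 2 + (k * ln k + k * ln k) - p * ((\<theta> * k)\<^sup>2 / (4 * t))) \<le> exp (- real k)" by simp
   moreover have "exp (k * ln 2 + (k * ln k + k * ln k) - p * ((\<theta> * k)\<^sup>2 / (4 * t)))
    = 2 ^ k * (real k ^ k * real k ^ k * exp (- (p * ((\<theta> * k)\<^sup>2 / (4 * t)))))"
   proof -
    have "2 ^ k = exp (k * ln (2 :: real))" by (rule power_eq_exp) simp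
    moreover have "real k ^ k = exp (k * ln k)" using k by (rule power_eq_exp)
    ultimately show ?thesis by (simp only: exp_add exp_diff exp_minus divide_inverse mult.assoc)
   qed
   moreover have "1 \<le> nat \<lceil>4 * ln (real k)\<rceil>" using t1(1) unfolding t_def by linarith
   moreover have "2 * t \<le> \<theta> * real k" using t(2) elim(2) by linarith
   ultimately show "?A k p"
    unfolding t_def by (intro conjI) (simp_all only:)
  qed
 qed
qed

definition large_retraction :: "real \<Rightarrow> nat \<Rightarrow> nat graph \<Rightarrow> bool" where
 "large_retraction \<theta> k H \<longleftrightarrow> (\<exists>U r. U \<subseteq> {1..k} \<and> \<theta> * k < card U \<and> retraction_moving H U r)"

text \<open>Retractions that move at most \<theta> k vertices are excluded by the deterministic
  properties of the graph, the others by their small probability. The assumptions collect what is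
  proved differently in the two ranges of p.\<close>

lemma core_whp_if:
 fixes \<tau> \<theta> :: real
 assumes \<tau>: "0 < \<tau>"
  and diff: "whp Rg (apart \<tau>)"
  and sparse: "whp Rg (sparse_sets \<tau> \<theta>)"
  and tame: "whp Rg (\<lambda>k p H. tame (t k p) (R k p) (x k p) (\<Delta> k p) H)"
  and large: "\<forall>\<^sub>F k in sequentially. \<forall>p::real. Rg k p \<longrightarrow>
   Prob (random_graph k p) {H. tame (t k p) (R k p) (x k p) (\<Delta> k p) H \<and> large_retraction \<theta> k H} \<le> exp (- real k)"
  and d: "\<forall>\<^sub>F k in sequentially. \<forall>p::real. Rg k p \<longrightarrow> 4 \<le> \<tau> * (real k * p)"
 shows "whp Rg (\<lambda>k p H. core H)"
proof -
 have "whp Rg (\<lambda>k p H. \<not> (tame (t k p) (R k p) (x k p) (\<Delta> k p) H \<and> large_retraction \<theta> k H))"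
 proof (rule whpI)
  show "(\<lambda>k. exp (- real k)) \<longlonglongrightarrow> 0" by real_asymp
 qed (use large in \<open>simp only: not_not\<close>)
 from whp_conj[OF whp_conj[OF diff sparse] whp_conj[OF tame this]]
 show ?thesis
 proof (rule whp_mono)
  from d show "\<forall>\<^sub>F k in sequentially. \<forall>(p::real) H. Rg k p \<longrightarrow> simple_graph H \<longrightarrow> verts H = {1..k} \<longrightarrow>
   (apart \<tau> k p H \<and> sparse_sets \<tau> \<theta> k p H) \<and>
   tame (t k p) (R k p) (x k p) (\<Delta> k p) H \<and> \<not> (tame (t k p) (R k p) (x k p) (\<Delta> k p) H \<and> large_retraction \<theta> k H) \<longrightarrow> core H"
  proof eventually_elim
   case (elim k)
   show ?case
   proof (intro allI impI, elim conjE)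
    fix p :: real and H assume *: "Rg k p" "simple_graph H" "verts H = {1..k}"
     "apart \<tau> k p H" "sparse_sets \<tau> \<theta> k p H"
     "tame (t k p) (R k p) (x k p) (\<Delta> k p) H" "\<not> (tame (t k p) (R k p) (x k p) (\<Delta> k p) H \<and> large_retraction \<theta> k H)"
    show "core H"
    proof (rule ccontr)
     assume "\<not> core H"
     from retraction_exists[OF *(2) this] obtain U r where U: "U \<noteq> {}" "retraction_moving H U r" by blast
     have "\<theta> * k < card U" by (rule moved_set_large[OF *(2,3) U(2,1) _ *(5)]) (use *(1,4) elim in blast)+
     moreover have "U \<subseteq> {1..k}" using U(2) *(3) unfolding retraction_moving_def by blast
     ultimately have "large_retraction \<theta> k H" using U(2) unfolding large_retraction_def by blast
     thus False using *(6,7) by blast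
    qed
   qed
  qed
 qed
qed

lemma large_expected_degree:
 assumes "0 < \<tau>" "\<And>k p. Rg k p \<Longrightarrow> log_range k p"
 shows "\<forall>\<^sub>F k in sequentially. \<forall>p::real. Rg k p \<longrightarrow> 4 \<le> \<tau> * (real k * p)"
proof -
 have "\<forall>\<^sub>F k::nat in sequentially. 4 / \<tau> \<le> ln (real k)" using assms(1) by real_asymp
 thus ?thesis
 proof eventually_elim
  case (elim k)
  show ?case
  proof (intro allI impI)
   fix p assume "Rg k p"
   have "4 \<le> \<tau> * ln (real k)" using elim assms(1) by (simp add: field_simps)
   also have "\<dots> \<le> \<tau> * (real k * p)"
    using assms(2)[OF \<open>Rg k p\<close>] assms(1) by (intro mult_left_mono) (auto simp: log_range_def)
   finally show "4 \<le> \<tau> * (real k * p)" .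
  qed
 qed
qed

text \<open>In this range two neighbourhoods share at most two vertices, so the difference of two of
  them has almost all of the more than 3 \<tau> k p neighbours; this yields
  \<open>apart\<close>.\<close>

lemma core_sparse_whp:
 fixes \<tau> \<theta> \<epsilon> :: real
 assumes \<epsilon>: "0 < \<epsilon>" "\<epsilon> \<le> 1" and \<tau>: "0 < \<tau>" "\<tau> * (36 * ln (12 / \<epsilon>)) \<le> \<epsilon>" and \<theta>: "0 < \<theta>" "\<theta> \<le> 1"
  and sparse: "whp log_range (sparse_sets \<tau> \<theta>)"
 shows "whp (\<lambda>k p. (above_log \<epsilon> k p \<and> log_range k p) \<and> sparse_range k p) (\<lambda>k p H. core H)"
proof -
 let ?Rg = "\<lambda>k p. (above_log \<epsilon> k p \<and> log_range k p) \<and> sparse_range k p"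
 have d: "\<forall>\<^sub>F k in sequentially. \<forall>p::real. ?Rg k p \<longrightarrow> 4 \<le> \<tau> * (real k * p)"
  using \<tau>(1) by (rule large_expected_degree) simp
 have "whp ?Rg (\<lambda>k p H. \<forall>v\<in>{1..k}. 3 * \<tau> * (k * p) < card (nbrs H v))"
  by (rule whp_range[OF min_degree_whp[OF \<epsilon> less_imp_le[OF \<tau>(1)] \<tau>(2)]]) simp
 moreover have "whp ?Rg (\<lambda>k p H. \<forall>u\<in>{1..k}. \<forall>x\<in>{1..k}. u \<noteq> x \<longrightarrow> card (nbrs H u \<inter> nbrs H x) \<le> 2)"
  by (rule whp_range[OF codegree_whp]) (auto simp: log_range_def)
 ultimately have diff: "whp ?Rg (apart \<tau>)"
 proof (rule whp_mono[OF whp_conj])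
  from d show "\<forall>\<^sub>F k in sequentially. \<forall>(p::real) H. ?Rg k p \<longrightarrow> simple_graph H \<longrightarrow> verts H = {1..k} \<longrightarrow>
   (\<forall>v\<in>{1..k}. 3 * \<tau> * (k * p) < card (nbrs H v)) \<and> (\<forall>u\<in>{1..k}. \<forall>x\<in>{1..k}. u \<noteq> x \<longrightarrow> card (nbrs H u \<inter> nbrs H x) \<le> 2) \<longrightarrow>
   apart \<tau> k p H"
  proof eventually_elim
   case (elim k)
   show ?case
   proof (intro allI impI ballI, elim conjE)
    fix p :: real and H :: "nat graph" and u x
    assume *: "simple_graph H" "verts H = {1..k}" "\<forall>v\<in>{1..k}. 3 * \<tau> * (k * p) < card (nbrs H v)"
     "\<forall>u\<in>{1..k}. \<forall>x\<in>{1..k}. u \<noteq> x \<longrightarrow> card (nbrs H u \<inter> nbrs H x) \<le> 2" "u \<in> {1..k}" "x \<in> {1..k}" "u \<noteq> x"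
     "above_log \<epsilon> k p" "log_range k p" "sparse_range k p"
    have fin: "finite (nbrs H u)" by (rule finite_subset[OF nbrs_subset[OF *(1)]]) (simp add: *(2))
    have "card (nbrs H u) = card ((nbrs H u - nbrs H x) \<union> (nbrs H u \<inter> nbrs H x))" by (intro arg_cong[of _ _ card]) blast
    also have "\<dots> \<le> card (nbrs H u - nbrs H x) + card (nbrs H u \<inter> nbrs H x)" by (rule card_Un_le)
    also have "\<dots> \<le> card (nbrs H u - nbrs H x) + 2" using *(4-7) by simp
    finally have "real (card (nbrs H u)) \<le> real (card (nbrs H u - nbrs H x)) + 2" by simp
    moreover have "3 * \<tau> * (k * p) < card (nbrs H u)" using *(3,5) by blast
    moreover have "4 \<le> \<tau> * (real k * p)" using elim *(8-10) by blast
    ultimately show "2 * \<tau> * (k * p) \<le> card (nbrs H u - nbrs H x)" by simp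
   qed
  qed
 qed
 let ?tame = "\<lambda>k p. tame 3 {1..hub_number k p} (hub_number k p) (nat \<lceil>8 * (real k * p)\<rceil>)"
 have "whp ?Rg (\<lambda>k p H. clique_free 4 H)" by (rule whp_range[OF clique_free_sparse_whp]) (auto simp: log_range_def)
 moreover have "whp ?Rg (\<lambda>k p H. card (detached H {1..hub_number k p}) \<le> hub_number k p)" by (rule whp_range[OF few_detached_whp]) simp
 moreover have "whp ?Rg (\<lambda>k p H. \<forall>v\<in>{1..k}. card (nbrs H v) \<le> nat \<lceil>8 * (k * p)\<rceil>)" by (rule whp_range[OF max_degree_whp]) simp
 ultimately have "whp ?Rg (\<lambda>k p H. clique_free 4 H \<and> card (detached H {1..hub_number k p}) \<le> hub_number k p \<and> (\<forall>v\<in>{1..k}. card (nbrs H v) \<le> nat \<lceil>8 * (k * p)\<rceil>))"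
  by (intro whp_conj)
 hence tame: "whp ?Rg ?tame"
  by (rule whp_mono) (simp add: tame_def)
 have sparse': "whp ?Rg (sparse_sets \<tau> \<theta>)" by (rule whp_range[OF sparse]) simp
 show ?thesis
 proof (rule core_whp_if[OF \<tau>(1) diff sparse' tame _ d])
  from sparse_exponent[OF \<theta>(1)] eventually_ge_at_top[of 1]
  show "\<forall>\<^sub>F k in sequentially. \<forall>p::real. ?Rg k p \<longrightarrow>
   Prob (random_graph k p) {H. ?tame k p H \<and> large_retraction \<theta> k H} \<le> exp (- real k)"
  proof eventually_elim
   case (elim k)
   show ?case
   proof (intro allI impI)
    fix p :: real assume p: "?Rg k p"
    let ?N = "hub_number k p"
    from p have "log_range k p" by blast
    with elim(1) have *: "12 \<le> \<theta> * real k" "real ?N \<le> \<theta> * real k / 2" "1 \<le> 8 * (k * p)"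
     "2 ^ k * (real k ^ (?N + ?N) * real (nat \<lceil>8 * (k * p)\<rceil>) ^ k * exp (- (p * ((\<theta> * k / 2)\<^sup>2 / (4 * real 3))))) \<le> exp (- real k)" by blast+
    have "\<theta> * real k \<le> 1 * real k" using \<theta> by (intro mult_right_mono) auto
    hence Nk: "?N \<le> k" using *(2) by linarith
    have "Prob (random_graph k p) {H. ?tame k p H \<and> large_retraction \<theta> k H} \<le>
     2 ^ k * (real k ^ (card {1..?N} + ?N) * real (nat \<lceil>8 * (k * p)\<rceil>) ^ k * exp (- (p * ((\<theta> * k / 2)\<^sup>2 / (4 * real 3)))))"
     unfolding large_retraction_def
    proof (rule prob_large_retraction)
     show "0 \<le> p" "p \<le> 1" using p by (auto simp: log_range_def)
     show "{1..?N} \<subseteq> {1..k}" using Nk by auto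
     show "1 \<le> nat \<lceil>8 * (k * p)\<rceil>" using *(3) by linarith
     show "\<theta> * k / 2 + card {1..?N} \<le> \<theta> * k" using *(2) by simp
     show "2 * real 3 \<le> \<theta> * k / 2" using *(1) by simp
    qed (use elim(2) in auto)
    also have "\<dots> \<le> exp (- real k)" using *(4) by simp
    finally show "Prob (random_graph k p) {H. ?tame k p H \<and> large_retraction \<theta> k H} \<le> exp (- real k)" .
   qed
  qed
 qed
qed

text \<open>With an empty set of hubs all vertices are detached, and every map of the vertices is a
  candidate.\<close>

lemma core_dense_whp:
 fixes \<tau> \<theta> \<epsilon> :: real
 assumes \<tau>: "0 < \<tau>" "\<tau> \<le> 1 / 100" and \<theta>: "0 < \<theta>" and sparse: "whp log_range (sparse_sets \<tau> \<theta>)"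
 shows "whp (\<lambda>k p. (above_log \<epsilon> k p \<and> log_range k p) \<and> \<not> sparse_range k p) (\<lambda>k p H. core H)"
proof -
 let ?Rg = "\<lambda>k p. (above_log \<epsilon> k p \<and> log_range k p) \<and> \<not> sparse_range k p"
 have d: "\<forall>\<^sub>F k in sequentially. \<forall>p::real. ?Rg k p \<longrightarrow> 4 \<le> \<tau> * (real k * p)"
  using \<tau>(1) by (rule large_expected_degree) simp
 have diff: "whp ?Rg (apart \<tau>)"
  by (rule whp_range[OF neighbourhood_difference_whp[OF less_imp_le[OF \<tau>(1)] \<tau>(2)]]) (auto simp: log_range_def)
 let ?t = "\<lambda>k::nat. nat \<lceil>4 * ln (real k)\<rceil>"
 have "whp ?Rg (\<lambda>k p H. clique_free (Suc (?t k)) H)" by (rule whp_range[OF clique_free_whp]) simp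
 hence tame: "whp ?Rg (\<lambda>k p. tame (?t k) {} k k)"
 proof (rule whp_mono, intro always_eventually allI impI)
  fix k p and H :: "nat graph" assume H: "simple_graph H" "verts H = {1..k}" "clique_free (Suc (?t k)) H"
  have "card (nbrs H v) \<le> k" for v
  proof -
   have "nbrs H v \<subseteq> {1..k}" using nbrs_subset[OF H(1), of v] unfolding H(2) by blast
   from card_mono[OF _ this] show ?thesis by simp
  qed
  moreover have "detached H {} = {1..k}" unfolding detached_def H(2) by blast
  hence "card (detached H {}) = k" by simp
  ultimately show "tame (?t k) {} k k H" using H(3) unfolding tame_def by simp
 qed
 have sparse': "whp ?Rg (sparse_sets \<tau> \<theta>)" by (rule whp_range[OF sparse]) simp
 show ?thesis
 proof (rule core_whp_if[OF \<tau>(1) diff sparse' tame _ d])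
  from dense_exponent[OF \<theta>(1)] eventually_ge_at_top[of 1]
  show "\<forall>\<^sub>F k in sequentially. \<forall>p::real. ?Rg k p \<longrightarrow>
   Prob (random_graph k p) {H. tame (?t k) {} k k H \<and> large_retraction \<theta> k H} \<le> exp (- real k)"
  proof eventually_elim
   case (elim k)
   show ?case
   proof (intro allI impI)
    fix p :: real assume p: "?Rg k p"
    from p elim(1) have *: "1 \<le> ?t k" "2 * real (?t k) \<le> \<theta> * real k"
     "2 ^ k * (real k ^ k * real k ^ k * exp (- (p * ((\<theta> * k)\<^sup>2 / (4 * real (?t k)))))) \<le> exp (- real k)" by blast+
    have "Prob (random_graph k p) {H. tame (?t k) {} k k H \<and> large_retraction \<theta> k H} \<le>
     2 ^ k * (real k ^ (card ({} :: nat set) + k) * real k ^ k * exp (- (p * ((\<theta> * k)\<^sup>2 / (4 * real (?t k))))))"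
     unfolding large_retraction_def
     by (rule prob_large_retraction) (use p * elim(2) in \<open>auto simp: log_range_def\<close>)
    also have "\<dots> \<le> exp (- real k)" using *(3) by simp
    finally show "Prob (random_graph k p) {H. tame (?t k) {} k k H \<and> large_retraction \<theta> k H} \<le> exp (- real k)" .
   qed
  qed
 qed
qed

theorem core_whp:
 fixes \<epsilon> :: real
 assumes "0 < \<epsilon>"
 shows "whp (\<lambda>k p. above_log \<epsilon> k p \<and> log_range k p) (\<lambda>k p H. core H)"
proof -
 \<comment> \<open>Low degrees were excluded for \<epsilon> \<le> 1. The two terms of \<tau> serve
   the dense and the sparse range, those of \<theta> the hypotheses of
   \<open>sparse_sets_whp\<close>.\<close>
 define \<epsilon>' where "\<epsilon>' = min \<epsilon> 1"
 define \<tau> where "\<tau> = min (1 / 100) (\<epsilon>' / (36 * ln (12 / \<epsilon>')))"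
 define \<theta> where "\<theta> = min (1 / 4) (\<tau> ^ 4 / (2 * exp 5))"
 have \<epsilon>': "0 < \<epsilon>'" "\<epsilon>' \<le> 1" using assms by (simp_all add: \<epsilon>'_def)
 have l: "0 < ln (12 / \<epsilon>')" using \<epsilon>' by simp
 have \<tau>: "0 < \<tau>" "\<tau> \<le> 1 / 100" using \<epsilon>' l by (simp_all add: \<tau>_def)
 have "\<tau> \<le> \<epsilon>' / (36 * ln (12 / \<epsilon>'))" by (simp add: \<tau>_def)
 hence \<tau>': "\<tau> * (36 * ln (12 / \<epsilon>')) \<le> \<epsilon>'" using l by (simp add: pos_le_divide_eq)
 have \<theta>: "0 < \<theta>" "\<theta> \<le> 1 / 4" "\<theta> \<le> \<tau> ^ 4 / (2 * exp 5)" using \<tau> by (simp_all add: \<theta>_def)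
 have sparse: "whp log_range (sparse_sets \<tau> \<theta>)" using \<tau> \<theta> by (intro sparse_sets_whp) auto
 have "whp (\<lambda>k p. above_log \<epsilon>' k p \<and> log_range k p) (\<lambda>k p H. core H)"
  using \<theta> by (intro whp_cases[OF core_sparse_whp[OF \<epsilon>' \<tau>(1) \<tau>' \<theta>(1) _ sparse] core_dense_whp[OF \<tau> \<theta>(1) sparse]]) simp
 thus ?thesis
 proof (rule whp_range)
  fix k :: nat and p :: real assume *: "above_log \<epsilon> k p \<and> log_range k p"
  have "0 \<le> ln (real k)" by (cases k) auto
  hence "(1 + \<epsilon>') * ln (real k) \<le> (1 + \<epsilon>) * ln (real k)" by (intro mult_right_mono) (simp_all add: \<epsilon>'_def)
  thus "above_log \<epsilon>' k p \<and> log_range k p" using * unfolding above_log_def by linarith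
 qed
qed

section \<open>Solving 3-SAT with a solver for the subgraph problem\<close>

definition literal_code :: "literal \<Rightarrow> nat" where
 "literal_code = (\<lambda>(x, b). 2 * x + of_bool b)"

lemma foldl_parse_step_clause:
 "ls \<noteq> [] \<Longrightarrow> foldl parse_step (length ls, cur, acc) ls = (0, [], (rev ls @ cur) # acc)"
proof (induction ls arbitrary: cur)
 case (Cons l ls)
 thus ?case by (cases ls) (auto simp: parse_step_def)
qed simp

text \<open>Clauses and literals are accumulated and therefore come out in reverse order, which does
  not affect satisfiability.\<close>

lemma parse_encode: "parse (concat (map encode_clause F)) = rev (map (\<lambda>C. rev (map literal_code C)) F)"
proof -
 have clause: "foldl parse_step (0, [], acc) (encode_clause C) = (0, [], rev (map literal_code C) # acc)" for C acc
 proof (cases "C = []")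
  case True
  thus ?thesis by (simp add: encode_clause_def parse_step_def)
 next
  case False
  have "foldl parse_step (0, [], acc) (encode_clause C) = foldl parse_step (length (map literal_code C), [], acc) (map literal_code C)"
   using False by (simp add: encode_clause_def parse_step_def literal_code_def)
  thus ?thesis using False foldl_parse_step_clause[of "map literal_code C" "[]" acc] by simp
 qed
 have "foldl parse_step (0, [], acc) (concat (map encode_clause F)) = (0, [], rev (map (\<lambda>C. rev (map literal_code C)) F) @ acc)" for acc
  by (induction F arbitrary: acc) (simp_all add: clause)
 thus ?thesis by (simp add: parse_def)
qed

lemma dedup: "set (dedup xs) = set xs" "distinct (dedup xs)" "length (dedup xs) \<le> length xs"
proof -
 have "set (foldl (\<lambda>a x. if x \<in> set a then a else x # a) a xs) = set a \<union> set xs \<and>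
   (distinct a \<longrightarrow> distinct (foldl (\<lambda>a x. if x \<in> set a then a else x # a) a xs)) \<and>
   length (foldl (\<lambda>a x. if x \<in> set a then a else x # a) a xs) \<le> length a + length xs" for a
 proof (induction xs arbitrary: a)
  case (Cons x xs)
  show ?case using Cons.IH[of a] Cons.IH[of "x # a"] by (cases "x \<in> set a") auto
 qed simp
 from this[of "[]"] show "set (dedup xs) = set xs" "distinct (dedup xs)" "length (dedup xs) \<le> length xs"
  unfolding dedup_def by simp_all
qed

definition instance_code :: "nat \<Rightarrow> cnf \<Rightarrow> nat list" where
 "instance_code N F = N # length F # concat (map encode_clause F)"

lemma head_instance_code: "head (instance_code N F) = N" by (simp add: head_def instance_code_def)

lemma initial_cnf_instance_code:
 "initial_cnf (instance_code N F) = add_clauses (map dedup (rev (map (\<lambda>C. rev (map literal_code C)) F))) []"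
 by (simp add: initial_cnf_def tail_def instance_code_def parse_encode)

lemma reduced_initial_cnf:
 assumes "(N, F) \<in> instances three_sat"
 shows "reduced N (initial_cnf (instance_code N F))"
 unfolding initial_cnf_instance_code
proof (rule reduced_add_clauses)
 show "reduced N []" by (simp add: reduced_def)
 fix C assume "C \<in> set (map dedup (rev (map (\<lambda>C. rev (map literal_code C)) F)))"
 then obtain C' where C': "C' \<in> set F" "C = dedup (rev (map literal_code C'))" by auto
 hence "length C' \<le> 3" "\<forall>(x, b)\<in>set C'. x < N" using assms by (auto simp: three_sat_def)
 moreover from this(2) have "literal_code l < 2 * N" if "l \<in> set C'" for l
  using that by (cases l) (fastforce simp: literal_code_def)
 ultimately show "good_clause N C"
  using dedup[of "rev (map literal_code C')"] C'(2) by (auto simp: good_clause_def)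
qed

lemma sat_initial_cnf: "(\<exists>\<alpha>. sat \<alpha> (initial_cnf (instance_code N F))) \<longleftrightarrow> satisfiable F"
proof -
 have lit: "lit_true \<alpha> (literal_code (x, b)) \<longleftrightarrow> \<alpha> x = b" for \<alpha> x b
  by (cases b) (simp_all add: lit_true_def literal_code_def)
 have "sat \<alpha> (initial_cnf (instance_code N F)) \<longleftrightarrow> (\<forall>C\<in>set F. \<exists>l\<in>set C. lit_true \<alpha> (literal_code l))" for \<alpha>
  unfolding initial_cnf_instance_code sat_add_clauses by (simp add: sat_def dedup)
 moreover have "(\<exists>l\<in>set C. lit_true \<alpha> (literal_code l)) \<longleftrightarrow> (\<exists>(x, b)\<in>set C. \<alpha> x = b)" for \<alpha> C
  by (intro bex_cong refl) (simp add: lit split: prod.splits)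
 ultimately show ?thesis by (simp add: satisfiable_def)
qed

section \<open>Polynomial size of instances and formulas\<close>

definition clause_number :: "nat \<Rightarrow> nat" where "clause_number N = 4 * (2 * N + 1) ^ 3"
definition cnf_size :: "nat \<Rightarrow> nat" where "cnf_size N = Suc (clause_number N * (6 * N + 5))"
definition code_size :: "nat \<Rightarrow> nat" where
 "code_size N = Suc ((2 + 4 * clause_number N) * Suc (2 * N + 4 + clause_number N))"

text \<open>Applied to the input, where \<open>three_sat\<close> excludes repeated clauses, and to
  reduced formulas.\<close>

lemma short_lists:
 assumes "distinct Cs" "\<And>C. C \<in> set Cs \<Longrightarrow> length C \<le> 3 \<and> set C \<subseteq> A" "finite A" "card A \<le> 2 * N"
 shows "length Cs \<le> clause_number N"
proof -
 have "length Cs \<le> card {C. set C \<subseteq> A \<and> length C \<le> 3}"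
  using assms(1-3) by (intro card_le_set[where f = id]) (auto intro: finite_lists_length_le)
 also have "\<dots> = (\<Sum>i\<le>3. card A ^ i)" by (rule card_lists_length_le[OF assms(3)])
 also have "\<dots> \<le> (\<Sum>i\<le>(3::nat). (2 * N + 1) ^ 3)"
 proof (rule sum_mono)
  fix i :: nat assume i: "i \<in> {..3}"
  have "card A ^ i \<le> (2 * N + 1) ^ i" using assms(4) by (intro power_mono) auto
  also have "\<dots> \<le> (2 * N + 1) ^ 3" using i by (intro power_increasing) auto
  finally show "card A ^ i \<le> (2 * N + 1) ^ 3" .
 qed
 finally show ?thesis by (simp add: clause_number_def)
qed

lemma sz_reduced: assumes "reduced N \<Phi>" shows "sz \<Phi> \<le> cnf_size N"
proof -
 have good: "length C \<le> 3 \<and> set C \<subseteq> {..<2 * N}" if "C \<in> set \<Phi>" for C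
  using assms that by (auto simp: reduced_def good_clause_def)
 have sz: "sz C \<le> 6 * N + 4" if C: "C \<in> set \<Phi>" for C
 proof -
  have "sz C \<le> Suc (length C * Suc (2 * N))" using good[OF C] by (intro sz_le_length) auto
  also have "\<dots> \<le> Suc (3 * Suc (2 * N))" using good[OF C] by (intro Suc_le_mono[THEN iffD2] mult_right_mono) auto
  finally show ?thesis by simp
 qed
 have "length \<Phi> \<le> clause_number N"
  using good by (rule short_lists[OF reduced_distinct[OF assms]]) auto
 hence "length \<Phi> * (6 * N + 5) \<le> clause_number N * (6 * N + 5)" by (rule mult_right_mono) simp
 hence "Suc (length \<Phi> * Suc (6 * N + 4)) \<le> cnf_size N" by (simp add: cnf_size_def algebra_simps)
 with sz_le_length[of \<Phi>, OF sz] show ?thesis by linarith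
qed

lemma sz_instance_code:
 assumes "(N, F) \<in> instances three_sat"
 shows "length (instance_code N F) \<le> code_size N" "sz (instance_code N F) \<le> code_size N"
proof -
 have F: "distinct F" "\<And>C. C \<in> set F \<Longrightarrow> length C \<le> 3" "\<And>C x b. C \<in> set F \<Longrightarrow> (x, b) \<in> set C \<Longrightarrow> x < N"
  using assms by (auto simp: three_sat_def)
 have lenF: "length F \<le> clause_number N"
  by (rule short_lists[where A = "{..<N} \<times> UNIV"]) (use F in \<open>auto simp: card_cartesian_product\<close>)
 have "length (concat (map encode_clause F)) = (\<Sum>C\<leftarrow>F. length (encode_clause C))" by (simp add: length_concat o_def)
 also have "\<dots> \<le> (\<Sum>C\<leftarrow>F. 4)" using F(2) by (intro sum_list_mono) (fastforce simp: encode_clause_def)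
 finally have len: "length (instance_code N F) \<le> 2 + 4 * clause_number N"
  using lenF by (simp add: instance_code_def sum_list_triv)
 have "sz y \<le> 2 * N + 4 + clause_number N" if "y \<in> set (instance_code N F)" for y
 proof -
  have "y \<le> 2 * N + 3 + clause_number N"
   using that lenF F(2,3) by (fastforce simp: instance_code_def encode_clause_def)
  thus ?thesis by simp
 qed
 hence "sz (instance_code N F) \<le> Suc (length (instance_code N F) * Suc (2 * N + 4 + clause_number N))" by (rule sz_le_length)
 also have "\<dots> \<le> code_size N" unfolding code_size_def using len by (intro Suc_le_mono[THEN iffD2] mult_right_mono) auto
 finally show 1: "sz (instance_code N F) \<le> code_size N" .
 with length_less_sz[of "instance_code N F"] show "length (instance_code N F) \<le> code_size N" by linarith
qed

lemma polynomials_bigo: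
 assumes "0 < (a :: real)"
 shows "(\<lambda>N. real (cnf_size N)) \<in> O(\<lambda>N. 2 powr (a * real N))" "(\<lambda>N. real (code_size N)) \<in> O(\<lambda>N. 2 powr (a * real N))"
  "(\<lambda>N. real N) \<in> O(\<lambda>N. 2 powr (a * real N))"
proof -
 show "(\<lambda>N. real (cnf_size N)) \<in> O(\<lambda>N. 2 powr (a * real N))"
  unfolding cnf_size_def clause_number_def of_nat_Suc of_nat_mult of_nat_add of_nat_power of_nat_numeral of_nat_1
  using assms by real_asymp
 show "(\<lambda>N. real (code_size N)) \<in> O(\<lambda>N. 2 powr (a * real N))"
  unfolding code_size_def clause_number_def of_nat_Suc of_nat_mult of_nat_add of_nat_power of_nat_numeral of_nat_1
  using assms by real_asymp
 show "(\<lambda>N. real N) \<in> O(\<lambda>N. 2 powr (a * real N))" using assms by real_asymp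
qed

lemma sum_list_bound: "(\<And>x. x \<in> set xs \<Longrightarrow> f x \<le> B) \<Longrightarrow> (\<Sum>x\<leftarrow>xs. f x) \<le> length xs * B" for B :: nat
 using sum_list_mono[of xs f "\<lambda>_. B"] by (simp add: sum_list_triv)

text \<open>The solver is called on hosts of all sizes, also below the threshold of the O-bound;
  \<open>real n + 1\<close> keeps the bound meaningful for the empty host.\<close>

lemma bigo_powr_bound:
 fixes T :: "nat \<Rightarrow> nat"
 assumes "(\<lambda>n. real (T n)) \<in> O(\<lambda>n. real n powr \<gamma>)" "0 \<le> \<gamma>"
 obtains B where "0 \<le> B" "\<And>n. real (T n) \<le> B * (real n + 1) powr \<gamma>"
proof -
 from assms(1) obtain C where C: "0 < C" "\<forall>\<^sub>F n in sequentially. norm (real (T n)) \<le> C * norm (real n powr \<gamma>)"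
  by (elim landau_o.bigE)
 then obtain n0 where n0: "\<And>n. n0 \<le> n \<Longrightarrow> real (T n) \<le> C * real n powr \<gamma>"
  unfolding eventually_at_top_linorder by auto
 define B where "B = C + (\<Sum>n<n0. real (T n))"
 have B: "C \<le> B" "0 \<le> B" using C(1) by (simp_all add: B_def sum_nonneg add_nonneg_nonneg)
 have "real (T n) \<le> B * (real n + 1) powr \<gamma>" for n
 proof (cases "n0 \<le> n")
  case True
  have "real (T n) \<le> C * real n powr \<gamma>" by (rule n0[OF True])
  also have "\<dots> \<le> B * (real n + 1) powr \<gamma>" using B assms(2) by (intro mult_mono powr_mono2) auto
  finally show ?thesis .
 next
  case False
  hence "real (T n) \<le> (\<Sum>n<n0. real (T n))" by (intro member_le_sum) auto
  also have "\<dots> \<le> B * 1" using C(1) by (simp add: B_def)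
  also have "\<dots> \<le> B * (real n + 1) powr \<gamma>" using B assms(2) by (intro mult_left_mono ge_one_powr_ge_zero) auto
  finally show ?thesis .
 qed
 thus thesis using that B(2) by blast
qed

lemma capacity_eq: "0 < q2 \<Longrightarrow> capacity (de, r, m, q2) N = m * (N div q2 + 1)"
 by (simp add: capacity_def times_eq divmod_eq)

text \<open>In spite of the rounding, k targets together hold ten times the occurrences of a group,
  as \<open>place_exists\<close> demands.\<close>

lemma capacity_sufficient:
 fixes k N D :: nat
 assumes "0 < k"
 shows "10 * (D * (N div k + 1)) \<le> k * (10 * D * (N div (k * k) + 1))"
proof -
 have "N div k < k * (N div k div k) + k" using mult_div_mod_eq[of k "N div k"] mod_less_divisor[OF assms, of "N div k"] by linarith
 hence "N div k + 1 \<le> k * (N div (k * k) + 1)" by (simp add: div_mult2_eq)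
 hence "(10 * D) * (N div k + 1) \<le> (10 * D) * (k * (N div (k * k) + 1))" by (rule mult_left_mono) simp
 thus ?thesis by (simp only: mult.assoc mult.left_commute)
qed

lemma decides_withinD:
 assumes "decides_within c Q T" "x \<in> instances Q"
 shows "\<exists>t s. exec c (initial (encode Q x)) t s \<and> t \<le> T (param Q x) \<and> (accepting s \<longleftrightarrow> yes Q x)"
 using assms unfolding decides_within_def by blast

lemma graph_instance:
 assumes "simple_graph G" "verts G = {..<n}"
 shows "G \<in> instances (Sub H)" "encode (Sub H) G = encode_graph G" "param (Sub H) G = n"
 using assms by (auto simp: Sub_def)

lemma run_with_parameters:
 fixes P :: "'a::data" and p :: "'b::data"
 shows "\<exists>c K. \<forall>xs :: 'c::data. run c (enc xs) (enc (P, p, xs)) K"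
proof -
 obtain c t where c: "\<And>x. run c x (enc P) t" using run_constant by blast
 obtain d u where d: "\<And>x. run d x (enc p) u" using run_constant by blast
 have "run (fork c (fork d Skip)) (enc xs) (enc (P, p, xs)) (t + (u + 1 + 25) + 25)" for xs :: 'c
  unfolding enc_prod_def fst_conv snd_conv by (intro run_fork c d run_skip)
 thus ?thesis by blast
qed

section \<open>Exponential growth rates\<close>

abbreviation growth :: "real \<Rightarrow> (nat \<Rightarrow> real) \<Rightarrow> bool" where
 "growth a f \<equiv> f \<in> O(\<lambda>N. 2 powr (a * real N))"

lemma growth_mono: "growth a f \<Longrightarrow> a \<le> b \<Longrightarrow> growth b f"
proof (erule landau_o.big_trans)
 assume "a \<le> b"
 thus "growth b (\<lambda>N. 2 powr (a * real N))"
  by (intro bigoI[of _ 1] always_eventually allI) (simp add: mult_right_mono)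
qed

lemma growth_const: "0 \<le> a \<Longrightarrow> growth a (\<lambda>_. c)"
 by (intro bigoI[of _ "\<bar>c\<bar>"] always_eventually allI) (simp add: mult_left_le ge_one_powr_ge_zero mult_le_cancel_left1)

lemma growth_mult: "growth a f \<Longrightarrow> growth b g \<Longrightarrow> growth (a + b) (\<lambda>N. f N * g N)"
 using landau_o.big_mult[of f sequentially "\<lambda>N. 2 powr (a * real N)" g "\<lambda>N. 2 powr (b * real N)"]
 by (simp add: powr_add algebra_simps)

lemma growth_power: "growth a f \<Longrightarrow> growth (real n * a) (\<lambda>N. f N ^ n)"
proof (induction n)
 case (Suc n)
 from growth_mult[OF Suc.prems Suc.IH[OF Suc.prems]] show ?case by (simp only: power_Suc of_nat_Suc ring_distribs mult_1_left)
qed (use growth_const[of 0 1] in simp)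

lemma growth_le: "growth a g \<Longrightarrow> (\<And>N. 0 \<le> f N \<and> f N \<le> g N) \<Longrightarrow> growth a f"
 by (rule landau_o.big_trans[OF bigoI[of _ 1]]) (auto intro!: always_eventually abs_le_D1 simp: order.trans[OF _ abs_ge_self])

lemma real_sum_list: "real (\<Sum>x\<leftarrow>xs. f x) = (\<Sum>x\<leftarrow>xs. real (f x))"
 by (induction xs) auto

definition host_bound :: "nat \<Rightarrow> nat \<Rightarrow> nat \<Rightarrow> nat" where
 "host_bound k load c = k * 2 ^ (load * (3 * c))"

section \<open>The algorithm for 3-SAT with a fixed pattern\<close>

context
 fixes H :: "nat graph" and k load d e :: nat and T and P :: pattern and r :: real
 assumes H: "simple_graph H" "verts H = {1..k}" "1 \<le> k" "core H" and T: "routing H k load T" and P: "pattern_of H k T P"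
  and de: "0 < d" "0 < e" and r: "0 \<le> r"
   "2 powr (- r * (2 * d)) + 2 powr (- r * (2 * d * d)) \<le> 1"
   "2 powr (- r) + 2 powr (- r * (2 * d * d)) \<le> 1"
   "2 powr (- r * (2 * d)) + 2 powr (- r * e) \<le> 1"
begin

abbreviation "dmax \<equiv> 2 * (d + e + 1)"
abbreviation "pars \<equiv> ((d, e), 12 * d, 10 * dmax, k * k)"
abbreviation "cap N \<equiv> capacity pars N"
abbreviation "growth_rate N \<equiv> 2 powr (r * real (12 * d * N))"
abbreviation "host_size N \<equiv> host_bound k load (cap N)"

lemma leaf:
 assumes "(N, F) \<in> instances three_sat" "\<Phi> \<in> set (input_leaves pars (instance_code N F))"
 shows "C \<in> set \<Phi> \<Longrightarrow> good_clause N C" "occurrences \<Phi> x \<le> dmax"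
proof -
 note inv = leaves_invariant[OF reduced_initial_cnf[OF assms(1)] de r]
 have \<Phi>: "\<Phi> \<in> set (leaves d e (rounds (12 * d) N) [initial_cnf (instance_code N F)])"
  using assms(2) by (simp add: input_leaves_def head_instance_code)
 have red: "reduced N \<Phi>" by (rule inv(1)[OF \<Phi>])
 have "is_leaf d e \<Phi>" by (rule inv(3)[OF _ \<Phi>]) (simp add: rounds_def times_eq)
 thus "occurrences \<Phi> x \<le> dmax" unfolding occurrences_def by (rule leaf_occurrences[OF red _ de])
 show "C \<in> set \<Phi> \<Longrightarrow> good_clause N C" using red by (simp add: reduced_def)
qed

lemma cap: "10 * (dmax * (N div k + 1)) \<le> card (verts H) * cap N" "0 < cap N"
proof -
 have "cap N = 10 * dmax * (N div (k * k) + 1)" using H(3) by (intro capacity_eq) simp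
 thus "10 * (dmax * (N div k + 1)) \<le> card (verts H) * cap N" "0 < cap N"
  using capacity_sufficient[of k dmax N] H(3) by (simp_all add: H(2))
qed

lemma number_of_leaves:
 assumes "(N, F) \<in> instances three_sat"
 shows "real (length (leaves d e rs [initial_cnf (instance_code N F)])) \<le> growth_rate N"
 by (rule leaves_invariant(2)[OF reduced_initial_cnf[OF assms] de r])

lemma sz_leaves:
 assumes "(N, F) \<in> instances three_sat"
 shows "real (sz (leaves d e rs [initial_cnf (instance_code N F)])) \<le> 1 + growth_rate N * (1 + real (cnf_size N))"
proof -
 let ?L = "leaves d e rs [initial_cnf (instance_code N F)]"
 have "sz ?L \<le> Suc (length ?L * Suc (cnf_size N))"
  by (rule sz_le_length) (rule sz_reduced, rule leaves_invariant(1)[OF reduced_initial_cnf[OF assms] de r])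
 hence "real (sz ?L) \<le> 1 + real (length ?L) * (1 + real (cnf_size N))"
  by (simp only: of_nat_le_iff[symmetric, where ?'a = real] of_nat_Suc of_nat_mult)
 also have "\<dots> \<le> 1 + growth_rate N * (1 + real (cnf_size N))"
  using number_of_leaves[OF assms] by (intro add_left_mono mult_right_mono) auto
 finally show ?thesis .
qed

lemma host_facts:
 assumes "(N, F) \<in> instances three_sat" "\<Phi> \<in> set (input_leaves pars (instance_code N F))"
 shows "cost P N (assign P (cap N) \<Phi>) \<le> host_size N" "simple_graph (host_graph P N (cap N) \<Phi>)"
  "host P N (cap N) \<Phi> = encode_graph (host_graph P N (cap N) \<Phi>)"
  "yes (Sub H) (host_graph P N (cap N) \<Phi>) \<longleftrightarrow> (\<exists>\<alpha>. sat \<alpha> \<Phi>)"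
  "length (positions P N (assign P (cap N) \<Phi>)) \<le> host_size N"
proof -
 have V: "verts H \<noteq> {}" "card (verts H) = k" using H(2,3) by simp_all
 have good: "\<And>C. C \<in> set \<Phi> \<Longrightarrow> good_clause N C" and occ: "\<And>x. occurrences \<Phi> x \<le> dmax"
  using leaf[OF assms] by blast+
 note fact = H(1) V(1) T P good occ cap[of N]
 have "cost P N (assign P (cap N) \<Phi>) \<le> card (verts H) * 2 ^ (load * (3 * cap N))" by (rule cost_le[OF fact])
 thus le: "cost P N (assign P (cap N) \<Phi>) \<le> host_size N" by (simp only: V(2) host_bound_def)
 have "length (positions P N (assign P (cap N) \<Phi>)) \<le> cost P N (assign P (cap N) \<Phi>)" by (rule length_positions_le[OF fact])
 thus "length (positions P N (assign P (cap N) \<Phi>)) \<le> host_size N" using le by (rule order.trans)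
 show "simple_graph (host_graph P N (cap N) \<Phi>)" by (rule host_simple[OF fact])
 show "host P N (cap N) \<Phi> = encode_graph (host_graph P N (cap N) \<Phi>)" by (rule host_eq[OF fact])
 show "yes (Sub H) (host_graph P N (cap N) \<Phi>) \<longleftrightarrow> (\<exists>\<alpha>. sat \<alpha> \<Phi>)"
 proof
  assume yes: "yes (Sub H) (host_graph P N (cap N) \<Phi>)"
  show "\<exists>\<alpha>. sat \<alpha> \<Phi>" by (rule host_sound[OF fact], assumption) (rule H(4), rule yes)
 next
  assume "\<exists>\<alpha>. sat \<alpha> \<Phi>"
  then obtain \<alpha> where \<alpha>: "sat \<alpha> \<Phi>" by blast
  show "yes (Sub H) (host_graph P N (cap N) \<Phi>)" by (rule host_complete[OF fact], assumption) (rule \<alpha>)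
 qed
qed

abbreviation "measure_bound N \<equiv> real (sz P + sz pars + 2 + code_size N) +
 real (12 * d * N + 2) * (1 + growth_rate N * (1 + real (cnf_size N))) + growth_rate N * real (host_size N)"

lemma input_measure_le:
 assumes inst: "(N, F) \<in> instances three_sat"
 shows "real (input_measure (P, pars, instance_code N F)) \<le> measure_bound N"
proof -
 let ?xs = "instance_code N F"
 let ?l = "\<lambda>j. leaves d e (take j (rounds (12 * d) N)) [initial_cnf ?xs]"
 have eq: "input_measure (P, pars, ?xs) = sz (P, pars, ?xs) + (\<Sum>j\<le>12 * d * N + 1. sz (?l j)) +
   (\<Sum>\<Phi>\<leftarrow>input_leaves pars ?xs. cost P N (assign P (cap N) \<Phi>))"
  by (simp add: input_measure_def head_instance_code rounds_def times_eq)
 have "real (\<Sum>j\<le>12 * d * N + 1. sz (?l j)) = (\<Sum>j\<le>12 * d * N + 1. real (sz (?l j)))" by (rule of_nat_sum)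
 also have "\<dots> \<le> (\<Sum>j\<le>12 * d * N + 1. 1 + growth_rate N * (1 + real (cnf_size N)))"
  by (intro sum_mono sz_leaves inst)
 also have "\<dots> = real (12 * d * N + 2) * (1 + growth_rate N * (1 + real (cnf_size N)))" by simp
 finally have 1: "real (\<Sum>j\<le>12 * d * N + 1. sz (?l j)) \<le> real (12 * d * N + 2) * (1 + growth_rate N * (1 + real (cnf_size N)))" .
 have "(\<Sum>\<Phi>\<leftarrow>input_leaves pars ?xs. cost P N (assign P (cap N) \<Phi>)) \<le> length (input_leaves pars ?xs) * host_size N"
  by (rule sum_list_bound) (rule host_facts(1)[OF inst])
 hence "real (\<Sum>\<Phi>\<leftarrow>input_leaves pars ?xs. cost P N (assign P (cap N) \<Phi>)) \<le> real (length (input_leaves pars ?xs)) * real (host_size N)"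
  by (simp only: of_nat_le_iff[symmetric, where ?'a = real] of_nat_mult[symmetric])
 also have "\<dots> \<le> growth_rate N * real (host_size N)"
  using number_of_leaves[OF inst] by (intro mult_right_mono) (simp_all add: input_leaves_def)
 finally have 2: "real (\<Sum>\<Phi>\<leftarrow>input_leaves pars ?xs. cost P N (assign P (cap N) \<Phi>)) \<le> growth_rate N * real (host_size N)" .
 have "sz (P, pars, ?xs) \<le> sz P + sz pars + 2 + code_size N" using sz_instance_code(2)[OF inst] unfolding sz_simps by linarith
 hence 3: "real (sz (P, pars, ?xs)) \<le> real (sz P + sz pars + 2 + code_size N)" by (rule of_nat_mono)
 show ?thesis unfolding eq of_nat_add[of "sz _ + _"] of_nat_add[of "sz (P, pars, ?xs)"] using 1 2 3 by linarith
qed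

lemma host_instance:
 assumes inst: "(N, F) \<in> instances three_sat" and \<Phi>: "\<Phi> \<in> set (input_leaves pars (instance_code N F))"
 shows "\<exists>G\<in>instances (Sub H). encode (Sub H) G = host P N (cap N) \<Phi> \<and> param (Sub H) G \<le> host_size N \<and>
  length (host P N (cap N) \<Phi>) \<le> 1 + host_size N * host_size N \<and> (yes (Sub H) G \<longleftrightarrow> (\<exists>\<alpha>. sat \<alpha> \<Phi>))"
proof -
 note facts = host_facts[OF inst \<Phi>]
 let ?G = "host_graph P N (cap N) \<Phi>" let ?n = "length (positions P N (assign P (cap N) \<Phi>))"
 have G: "simple_graph ?G" "verts ?G = {..<?n}"
  by (rule facts) (simp add: host_graph_def Let_def)
 note n = facts(5)
 have "length (host P N (cap N) \<Phi>) = 1 + ?n * ?n"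
  by (simp add: host_def matrix_def length_concat o_def sum_list_triv)
 also have "\<dots> \<le> 1 + host_size N * host_size N" using n by (intro add_left_mono mult_mono) auto
 finally have len: "length (host P N (cap N) \<Phi>) \<le> 1 + host_size N * host_size N" .
 note G = graph_instance[OF G, where H = H]
 show ?thesis by (intro bexI[of _ ?G] conjI len facts(4) G(1)) (unfold G(2,3), rule facts(3)[symmetric], rule n)
qed

text \<open>Time is spent on reading the input, on the reduction, with degree \<open>m\<close> in
  its measure, and on one call per leaf. A host has at most \<open>host_size N\<close> vertices,
  which bounds the time of a call and, squared, the time for copying the adjacency matrix.\<close>

lemma solver:
 assumes sub: "decides_within c (Sub H) S" and S: "\<And>n. real (S n) \<le> B * (real n + 1) powr \<gamma>" "0 \<le> B" "0 \<le> \<gamma>"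
  and R: "\<And>z. run R (enc z) (enc (reduction (fst z) (fst (snd z)) (snd (snd z)))) (t z)" "\<And>z. t z \<le> (input_measure z + 2) ^ m"
 shows "\<exists>com K. \<forall>N F. (N, F) \<in> instances three_sat \<longrightarrow> (\<exists>u s. exec com (initial (instance_code N F)) u s \<and>
  (accepting s \<longleftrightarrow> satisfiable F) \<and> real u \<le> 9 * real (code_size N) + K + (measure_bound N + 2) ^ m +
   growth_rate N * (9 * (1 + real (host_size N) * real (host_size N)) + 7 * (B * (real (host_size N) + 1) powr \<gamma>) + K))"
proof -
 obtain a K0 where a: "\<And>xs :: nat list. run a (enc xs) (enc (P, pars, xs)) K0" using run_with_parameters by blast
 let ?com = "calls_com (Seq a R) c"
 let ?K = "real (K0 + 14 + (reg_bound c + 21))"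
 show ?thesis
 proof (intro exI[of _ ?com] exI[of _ ?K] allI impI)
  fix N F assume inst: "(N, F) \<in> instances three_sat"
  let ?xs = "instance_code N F" let ?h = "host_size N"
  let ?z = "(P, pars, ?xs)" let ?gs = "reduction P pars ?xs"
  have "run (Seq a R) (enc ?xs) (enc ?gs) (K0 + t ?z)"
   using run_seq[OF a R(1)[of ?z]] by simp
  \<comment> \<open>The run of \<open>c\<close> is chosen as a function of the encoded host, since
    different leaves may have the same host. Determinism identifies it with the run that
    \<open>decides_within\<close> provides.\<close>
  moreover define ts where "ts = (\<lambda>g. SOME x. exec c (initial g) (fst x) (snd x))"
  have gs: "?gs = map (host P N (cap N)) (input_leaves pars ?xs)" by (simp add: reduction_def head_instance_code)
  have call: "exec c (initial (host P N (cap N) \<Phi>)) (fst (ts (host P N (cap N) \<Phi>))) (snd (ts (host P N (cap N) \<Phi>))) \<and>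
    real (fst (ts (host P N (cap N) \<Phi>))) \<le> B * (real ?h + 1) powr \<gamma> \<and>
    (accepting (snd (ts (host P N (cap N) \<Phi>))) \<longleftrightarrow> (\<exists>\<alpha>. sat \<alpha> \<Phi>))" if \<Phi>: "\<Phi> \<in> set (input_leaves pars ?xs)" for \<Phi>
  proof -
   let ?g = "host P N (cap N) \<Phi>"
   from host_instance[OF inst \<Phi>] obtain G where G: "G \<in> instances (Sub H)" "encode (Sub H) G = ?g"
    "param (Sub H) G \<le> ?h" "yes (Sub H) G \<longleftrightarrow> (\<exists>\<alpha>. sat \<alpha> \<Phi>)" by blast
   from decides_withinD[OF sub G(1)] obtain u s where u: "exec c (initial ?g) u s" "u \<le> S (param (Sub H) G)"
    "accepting s \<longleftrightarrow> (\<exists>\<alpha>. sat \<alpha> \<Phi>)" unfolding G(2,4) by blast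
   have "exec c (initial ?g) (fst (u, s)) (snd (u, s))" using u(1) by simp
   hence ex: "exec c (initial ?g) (fst (ts ?g)) (snd (ts ?g))" unfolding ts_def by (rule someI)
   from exec_deterministic[OF u(1) ex] have us: "fst (ts ?g) = u" "snd (ts ?g) = s" by auto
   have "real u \<le> real (S (param (Sub H) G))" using u(2) by simp
   also have "\<dots> \<le> B * (real (param (Sub H) G) + 1) powr \<gamma>" by (rule S(1))
   also have "\<dots> \<le> B * (real ?h + 1) powr \<gamma>"
    using G(3) S(2,3) by (intro mult_left_mono powr_mono2) auto
   finally show ?thesis using ex u(3) unfolding us by blast
  qed
  have "exec c (initial g) (fst (ts g)) (snd (ts g))" if "g \<in> set ?gs" for g
   using that call unfolding gs by auto
  ultimately obtain u s where u: "u \<le> 9 * length ?xs + (K0 + t ?z) + (\<Sum>g\<leftarrow>?gs. 9 * length g + 7 * fst (ts g) + reg_bound c + 21) + 14"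
   "exec ?com (initial ?xs) u s" "accepting s \<longleftrightarrow> (\<exists>g\<in>set ?gs. accepting (snd (ts g)))"
   using exec_calls_com[of "Seq a R" ?xs ?gs "K0 + t ?z" c "\<lambda>g. fst (ts g)" "\<lambda>g. snd (ts g)"] by blast
  have "(\<exists>g\<in>set ?gs. accepting (snd (ts g))) \<longleftrightarrow> (\<exists>\<Phi>\<in>set (input_leaves pars ?xs). \<exists>\<alpha>. sat \<alpha> \<Phi>)"
   unfolding gs using call by auto
  also have "\<dots> \<longleftrightarrow> satisfiable F"
   using sat_leaves[of d e "rounds (12 * d) N" "[initial_cnf ?xs]"] sat_initial_cnf[of N F]
   unfolding input_leaves_def head_instance_code by auto
  finally have acc: "accepting s \<longleftrightarrow> satisfiable F" using u(3) by simp
  let ?b = "9 * (1 + real ?h * real ?h) + 7 * (B * (real ?h + 1) powr \<gamma>) + real (reg_bound c + 21)"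
  have "real (\<Sum>g\<leftarrow>?gs. 9 * length g + 7 * fst (ts g) + reg_bound c + 21) =
   (\<Sum>\<Phi>\<leftarrow>input_leaves pars ?xs. real (9 * length (host P N (cap N) \<Phi>) + 7 * fst (ts (host P N (cap N) \<Phi>)) + reg_bound c + 21))"
   unfolding gs map_map o_def by (rule real_sum_list)
  also have "\<dots> \<le> (\<Sum>\<Phi>\<leftarrow>input_leaves pars ?xs. ?b)"
  proof (rule sum_list_mono)
   fix \<Phi> assume \<Phi>: "\<Phi> \<in> set (input_leaves pars ?xs)"
   have "length (host P N (cap N) \<Phi>) \<le> 1 + ?h * ?h" using host_instance[OF inst \<Phi>] by blast
   hence "real (length (host P N (cap N) \<Phi>)) \<le> real (1 + ?h * ?h)" by (rule of_nat_mono)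
   hence "real (length (host P N (cap N) \<Phi>)) \<le> 1 + real ?h * real ?h" by (simp only: of_nat_add of_nat_mult of_nat_1)
   note bounds = this conjunct1[OF conjunct2[OF call[OF \<Phi>]]]
   have "9 * x + 7 * y + z + 21 \<le> 9 * (1 + a) + 7 * b + (z + 21)" if "x \<le> 1 + a" "y \<le> b" for x y z a b :: real
    using that by argo
   from this[OF bounds, of "real (reg_bound c)"]
   show "real (9 * length (host P N (cap N) \<Phi>) + 7 * fst (ts (host P N (cap N) \<Phi>)) + reg_bound c + 21) \<le> ?b"
    by (simp only: of_nat_add of_nat_mult of_nat_numeral)
  qed
  also have "\<dots> = real (length (input_leaves pars ?xs)) * ?b" by (simp only: sum_list_triv)
  also have "\<dots> \<le> growth_rate N * ?b"
   using number_of_leaves[OF inst] S(2) by (intro mult_right_mono) (simp_all add: input_leaves_def)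
  also have "\<dots> \<le> growth_rate N * (9 * (1 + real ?h * real ?h) + 7 * (B * (real ?h + 1) powr \<gamma>) + ?K)"
   by (intro mult_left_mono add_left_mono) simp_all
  finally have 1: "real (\<Sum>g\<leftarrow>?gs. 9 * length g + 7 * fst (ts g) + reg_bound c + 21) \<le>
   growth_rate N * (9 * (1 + real ?h * real ?h) + 7 * (B * (real ?h + 1) powr \<gamma>) + ?K)" .
  have "real (t ?z) \<le> real ((input_measure ?z + 2) ^ m)" using R(2)[of ?z] by (rule of_nat_mono)
  also have "\<dots> = (real (input_measure ?z) + 2) ^ m" by (simp only: of_nat_power of_nat_add of_nat_numeral)
  also have "\<dots> \<le> (measure_bound N + 2) ^ m"
   by (intro power_mono add_right_mono input_measure_le[OF inst]) simp
  finally have 2: "real (t ?z) \<le> (measure_bound N + 2) ^ m" .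
  have "real u \<le> real (9 * length ?xs + (K0 + t ?z) + (\<Sum>g\<leftarrow>?gs. 9 * length g + 7 * fst (ts g) + reg_bound c + 21) + 14)"
   using u(1) by (rule of_nat_mono)
  also have "\<dots> = 9 * real (length ?xs) + (real K0 + real (t ?z)) + real (\<Sum>g\<leftarrow>?gs. 9 * length g + 7 * fst (ts g) + reg_bound c + 21) + 14"
   by (simp only: of_nat_add of_nat_mult of_nat_numeral)
  also have "\<dots> \<le> 9 * real (code_size N) + ?K + (measure_bound N + 2) ^ m +
   growth_rate N * (9 * (1 + real ?h * real ?h) + 7 * (B * (real ?h + 1) powr \<gamma>) + ?K)"
  proof -
   have "real (length ?xs) \<le> real (code_size N)" using sz_instance_code(1)[OF inst] by (rule of_nat_mono)
   moreover have "real K0 + 14 \<le> ?K" by simp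
   ultimately show ?thesis using 1 2 by linarith
  qed
  finally show "\<exists>u s. exec ?com (initial ?xs) u s \<and> (accepting s \<longleftrightarrow> satisfiable F) \<and> real u \<le> 9 * real (code_size N) + ?K + (measure_bound N + 2) ^ m +
   growth_rate N * (9 * (1 + real ?h * real ?h) + 7 * (B * (real ?h + 1) powr \<gamma>) + ?K)"
   using u(2) acc by blast
 qed
qed

end

text \<open>Separates a factor that depends only on k, \<open>load\<close> and \<open>D\<close>,
  which the O-bound absorbs, from the growth in N at rate 30 D load / k^2. The rounding of the
  capacity goes into the former.\<close>

lemma host_bound_le:
 fixes k load D N :: nat
 shows "real (host_bound k load (10 * D * (N div (k * k) + 1))) \<le> real k * 2 powr (30 * real D * real load) * 2 powr (30 * real D * real load / (real k * real k) * real N)"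
proof -
 let ?\<kappa> = "30 * real D * real load"
 have "real (load * (3 * (10 * D * (N div (k * k) + 1)))) = ?\<kappa> * (real (N div (k * k)) + 1)" by (simp add: algebra_simps)
 also have "\<dots> \<le> ?\<kappa> * (real N / real (k * k) + 1)"
  by (intro mult_left_mono add_right_mono of_nat_div_le_of_nat) simp
 also have "\<dots> = ?\<kappa> + ?\<kappa> / (real k * real k) * real N" by (simp add: algebra_simps)
 finally have "2 powr real (load * (3 * (10 * D * (N div (k * k) + 1)))) \<le> 2 powr (?\<kappa> + ?\<kappa> / (real k * real k) * real N)"
  by (intro powr_mono) simp_all
 hence "real k * 2 powr real (load * (3 * (10 * D * (N div (k * k) + 1)))) \<le> real k * (2 powr ?\<kappa> * 2 powr (?\<kappa> / (real k * real k) * real N))"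
  unfolding powr_add by (intro mult_left_mono) simp_all
 moreover have "real (host_bound k load c) = real k * 2 powr real (load * (3 * c))" for c
  by (simp only: host_bound_def of_nat_mult[of k] of_nat_power of_nat_numeral powr_realpow zero_less_numeral)
 ultimately show ?thesis by (simp only: mult.assoc)
qed

lemma growth_cmult: "growth a f \<Longrightarrow> growth a (\<lambda>N. c * f N)"
 using growth_mult[OF growth_const[of 0 c]] by fastforce

text \<open>The measure of the reduction grows at rate 2 \<epsilon>, hence the condition 2 m
  \<epsilon> \<le> \<delta>. A call has rate at most 3 \<delta> / 4, since the solver contributes l
  \<gamma> \<le> \<delta> / 4 and the copying 2 \<epsilon> \<le> \<delta> / 2. The number of leaves
  adds \<epsilon> \<le> \<delta> / 4.\<close>

lemma solver_growth:
 fixes h :: "nat \<Rightarrow> real"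
 assumes \<epsilon>: "0 < \<epsilon>" "2 * real m * \<epsilon> \<le> \<delta>" "4 * \<epsilon> \<le> \<delta>" and h: "\<And>N. 0 \<le> h N \<and> h N \<le> C * 2 powr (l * real N)" "0 \<le> C"
  and l: "0 \<le> l" "l \<le> \<epsilon>" "l * \<gamma> \<le> \<delta> / 4" "0 \<le> \<gamma>"
 shows "growth \<delta> (\<lambda>N. 9 * real (code_size N) + K + (a + real (code_size N) + (b * real N + 2) * (1 + 2 powr (\<epsilon> * real N) * (1 + real (cnf_size N))) + 2 powr (\<epsilon> * real N) * h N + 2) ^ m +
   2 powr (\<epsilon> * real N) * (9 * (1 + h N * h N) + 7 * (B * (h N + 1) powr \<gamma>) + K))"
proof -
 let ?E = "\<lambda>N. 2 powr (\<epsilon> * real N)"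
 have \<delta>: "0 \<le> \<delta>" "\<epsilon> \<le> \<delta>" using \<epsilon> by simp_all
 have const: "growth a (\<lambda>_. c)" if "0 \<le> a" for a c using that by (rule growth_const)
 have E: "growth \<epsilon> ?E" by (rule landau_o.big_refl)
 have hl: "growth l h"
  by (rule bigoI[of _ C], intro always_eventually allI) (use h(1) in simp)
 have h\<epsilon>: "growth \<epsilon> h" by (rule growth_mono[OF hl l(2)])
 have poly: "growth (\<epsilon> / 2) (\<lambda>N. b * real N + 2)"
 proof (rule sum_in_bigo)
  show "growth (\<epsilon> / 2) (\<lambda>N. b * real N)"
   using \<epsilon>(1) by (intro growth_cmult polynomials_bigo(3)) simp
 qed (use \<epsilon>(1) in \<open>intro const, simp\<close>)
 have cnf: "growth (\<epsilon> / 2) (\<lambda>N. 1 + real (cnf_size N))"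
  using \<epsilon>(1) by (intro sum_in_bigo const polynomials_bigo(1)) simp_all
 have "growth (2 * \<epsilon>) (\<lambda>N. (b * real N + 2) * (1 + ?E N * (1 + real (cnf_size N))))"
 proof (rule growth_mono[OF growth_mult[OF poly sum_in_bigo(1)]])
  show "growth (\<epsilon> + \<epsilon> / 2) (\<lambda>N. ?E N * (1 + real (cnf_size N)))" by (rule growth_mult[OF E cnf])
 qed (use \<epsilon>(1) in \<open>intro const, simp_all\<close>)
 moreover have "growth (2 * \<epsilon>) (\<lambda>N. ?E N * h N)" by (rule growth_mono[OF growth_mult[OF E h\<epsilon>]]) simp
 moreover have "growth (2 * \<epsilon>) (\<lambda>N. real (code_size N))" using \<epsilon>(1) by (intro polynomials_bigo(2)) simp
 ultimately have "growth (2 * \<epsilon>) (\<lambda>N. a + real (code_size N) + (b * real N + 2) * (1 + ?E N * (1 + real (cnf_size N))) + ?E N * h N + 2)"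
  using \<epsilon>(1) by (intro sum_in_bigo const) simp_all
 from growth_power[OF this, of m]
 have 1: "growth \<delta> (\<lambda>N. (a + real (code_size N) + (b * real N + 2) * (1 + ?E N * (1 + real (cnf_size N))) + ?E N * h N + 2) ^ m)"
  by (rule growth_mono) (use \<epsilon>(2) in simp)
 have "growth (l * \<gamma>) (\<lambda>N. (h N + 1) powr \<gamma>)"
 proof (rule bigoI[of _ "(C + 1) powr \<gamma>"], intro always_eventually allI)
  fix N
  have "1 \<le> 2 powr (l * real N)" using l(1) by (intro ge_one_powr_ge_zero) simp_all
  hence "h N + 1 \<le> (C + 1) * 2 powr (l * real N)" using h(1)[of N] by (simp add: algebra_simps)
  hence "(h N + 1) powr \<gamma> \<le> ((C + 1) * 2 powr (l * real N)) powr \<gamma>"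
   using l(4) h(1)[of N] by (intro powr_mono2) auto
  also have "\<dots> = (C + 1) powr \<gamma> * 2 powr (l * \<gamma> * real N)"
   using h(2) by (simp add: powr_mult powr_powr mult.commute mult.left_commute)
  finally show "norm ((h N + 1) powr \<gamma>) \<le> (C + 1) powr \<gamma> * norm (2 powr (l * \<gamma> * real N))" by simp
 qed
 hence "growth (3 / 4 * \<delta>) (\<lambda>N. (h N + 1) powr \<gamma>)" by (rule growth_mono) (use l(3) \<delta> in simp)
 hence 2: "growth (3 / 4 * \<delta>) (\<lambda>N. 7 * (B * (h N + 1) powr \<gamma>))" by (intro growth_cmult)
 have "growth (3 / 4 * \<delta>) (\<lambda>N. h N * h N)" by (rule growth_mono[OF growth_mult[OF h\<epsilon> h\<epsilon>]]) (use \<epsilon>(3) \<delta> in simp)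
 hence "growth (3 / 4 * \<delta>) (\<lambda>N. 1 + h N * h N)" using \<delta> by (intro sum_in_bigo const) simp_all
 hence "growth (3 / 4 * \<delta>) (\<lambda>N. 9 * (1 + h N * h N))" by (rule growth_cmult)
 with 2 have "growth (3 / 4 * \<delta>) (\<lambda>N. 9 * (1 + h N * h N) + 7 * (B * (h N + 1) powr \<gamma>) + K)"
  using \<delta> by (intro sum_in_bigo const) simp_all
 from growth_mult[OF E this]
 have "growth \<delta> (\<lambda>N. ?E N * (9 * (1 + h N * h N) + 7 * (B * (h N + 1) powr \<gamma>) + K))"
  by (rule growth_mono) (use \<epsilon>(3) in simp)
 moreover have "growth \<delta> (\<lambda>N. 9 * real (code_size N))"
  using \<epsilon>(1) \<delta> by (intro growth_cmult polynomials_bigo(2)) simp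
 ultimately show ?thesis using 1 \<delta> by (intro sum_in_bigo const)
qed

text \<open>A load of O(k \<rho>) makes the hosts grow at a rate of at most A \<rho> / k, where A =
  30 D * 11 / \<eta>. A solver with exponent c k / \<rho> turns this into the rate A c = \<delta> /
  4, in which k and \<rho> cancel. The condition \<rho> \<le> w k keeps the rate of the hosts
  themselves below \<epsilon>.\<close>

theorem solver_reduction:
 fixes \<delta> \<eta> :: real
 assumes "0 < \<delta>" "0 < \<eta>"
 shows "\<exists>c>0. \<exists>w>0. \<forall>H k load T \<rho>. simple_graph H \<longrightarrow> verts H = {1..k} \<longrightarrow> 1 \<le> k \<longrightarrow> core H \<longrightarrow> routing H k load T \<longrightarrow>
  real load \<le> (11 / \<eta>) * (real k * \<rho>) \<longrightarrow> 0 < \<rho> \<longrightarrow> \<rho> \<le> w * real k \<longrightarrow>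
  solvable_in_bigo (Sub H) (\<lambda>n. real n powr (c * (real k / \<rho>))) \<longrightarrow> solvable_in_bigo three_sat (\<lambda>N. 2 powr (\<delta> * real N))"
proof -
 from pc_reduction obtain R t m where R: "\<And>z. run R (enc z) (enc (reduction (fst z) (fst (snd z)) (snd (snd z)))) (t z)"
  "\<And>z. t z \<le> (input_measure z + 2) ^ m" unfolding pcomp_def poly_bd_def by blast
 \<comment> \<open>The exponent \<open>m\<close> of the reduction is known before \<epsilon>, and
   \<open>D\<close> is determined afterwards by \<epsilon>.\<close>
 define \<epsilon> where "\<epsilon> = \<delta> / (4 * (real m + 1))"
 have \<epsilon>: "0 < \<epsilon>" "2 * real m * \<epsilon> \<le> \<delta>" "4 * \<epsilon> \<le> \<delta>" using assms(1) by (simp_all add: \<epsilon>_def field_simps)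
 obtain d e :: nat and r :: real where de: "0 < d" "0 < e" and r: "0 \<le> r" "r * (12 * d) = \<epsilon>"
  "2 powr (- r * (2 * d)) + 2 powr (- r * (2 * d * d)) \<le> 1"
  "2 powr (- r) + 2 powr (- r * (2 * d * d)) \<le> 1"
  "2 powr (- r * (2 * d)) + 2 powr (- r * e) \<le> 1" by (rule sparsification_constants[OF \<epsilon>(1)])
 define D where "D = 2 * (d + e + 1)"
 define A where "A = 330 * real D / \<eta>"
 have A: "0 < A" using assms(2) by (simp add: A_def D_def)
 show ?thesis
 proof (rule exI[of _ "\<delta> / (4 * A)"], intro conjI exI[of _ "\<epsilon> / A"] allI impI)
  show "0 < \<delta> / (4 * A)" "0 < \<epsilon> / A" using A assms(1) \<epsilon>(1) by simp_all
  fix H k load T and \<rho> :: real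
  assume H: "simple_graph H" "verts H = {1..k}" "1 \<le> k" "core H" and T: "routing H k load T"
   and load: "real load \<le> (11 / \<eta>) * (real k * \<rho>)" and \<rho>: "0 < \<rho>" "\<rho> \<le> \<epsilon> / A * real k"
   and sub: "solvable_in_bigo (Sub H) (\<lambda>n. real n powr (\<delta> / (4 * A) * (real k / \<rho>)))"
  let ?\<gamma> = "\<delta> / (4 * A) * (real k / \<rho>)"
  have \<gamma>: "0 \<le> ?\<gamma>" using assms(1) A \<rho>(1) by simp
  from sub obtain c S where c: "decides_within c (Sub H) S" "(\<lambda>n. real (S n)) \<in> O(\<lambda>n. real n powr ?\<gamma>)"
   unfolding solvable_in_bigo_def by blast
  obtain B where B: "0 \<le> B" "\<And>n. real (S n) \<le> B * (real n + 1) powr ?\<gamma>"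
   using bigo_powr_bound[OF c(2) \<gamma>] by metis
  from pattern_exists[OF H(1) T] obtain P where P: "pattern_of H k T P" .
  let ?p = "((d, e), 12 * d, 10 * (2 * (d + e + 1)), k * k) :: params"
  let ?h = "\<lambda>N. real (host_bound k load (capacity ?p N))"
  from solver[OF H T P de r(1,3,4,5) c(1) B(2,1) \<gamma> R] obtain com K where com: "\<And>N F. (N, F) \<in> instances three_sat \<Longrightarrow>
   \<exists>u s. exec com (initial (instance_code N F)) u s \<and> (accepting s \<longleftrightarrow> satisfiable F) \<and> real u \<le> 9 * real (code_size N) + K +
    (real (sz P + sz ?p + 2 + code_size N) + real (12 * d * N + 2) * (1 + 2 powr (r * real (12 * d * N)) * (1 + real (cnf_size N))) +
     2 powr (r * real (12 * d * N)) * ?h N + 2) ^ m +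
    2 powr (r * real (12 * d * N)) * (9 * (1 + ?h N * ?h N) + 7 * (B * (?h N + 1) powr ?\<gamma>) + K)" by blast
  define bd where "bd = (\<lambda>N. 9 * real (code_size N) + K + (real (sz P + sz ?p + 2) + real (code_size N) +
   (real (12 * d) * real N + 2) * (1 + 2 powr (\<epsilon> * real N) * (1 + real (cnf_size N))) + 2 powr (\<epsilon> * real N) * ?h N + 2) ^ m +
   2 powr (\<epsilon> * real N) * (9 * (1 + ?h N * ?h N) + 7 * (B * (?h N + 1) powr ?\<gamma>) + K))"
  have rate: "r * (real (12 * d) * real N) = \<epsilon> * real N" for N by (simp only: r(2)[symmetric] mult.assoc)
  have com': "\<exists>u s. exec com (initial (instance_code N F)) u s \<and> (accepting s \<longleftrightarrow> satisfiable F) \<and> real u \<le> bd N"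
   if "(N, F) \<in> instances three_sat" for N F
   using com[OF that] unfolding bd_def rate of_nat_add[of "_ + _" "code_size N"] of_nat_add[of "12 * d * N"] of_nat_mult[of "12 * d"] of_nat_numeral .
  let ?l = "30 * real D * real load / (real k * real k)"
  have "growth \<delta> bd" unfolding bd_def
  proof (rule solver_growth[OF \<epsilon>, where l = ?l and C = "real k * 2 powr (30 * real D * real load)"])
   fix N
   have "capacity ?p N = 10 * D * (N div (k * k) + 1)" unfolding D_def using H(3) by (intro capacity_eq) simp
   with host_bound_le[of k load D N]
   show "0 \<le> ?h N \<and> ?h N \<le> real k * 2 powr (30 * real D * real load) * 2 powr (?l * real N)" by simp
  next
   have k: "0 < real k" using H(3) by simp
   have "30 * real D * real load \<le> 30 * real D * ((11 / \<eta>) * (real k * \<rho>))" using load by (intro mult_left_mono) simp_all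
   hence "?l \<le> 30 * real D * ((11 / \<eta>) * (real k * \<rho>)) / (real k * real k)" by (rule divide_right_mono) simp
   also have "\<dots> = A * (\<rho> / real k)" using k by (simp add: A_def)
   finally have l: "?l \<le> A * (\<rho> / real k)" .
   also have "\<dots> \<le> A * (\<epsilon> / A)" using A k \<rho>(2) by (intro mult_left_mono) (simp_all add: pos_divide_le_eq)
   finally show "?l \<le> \<epsilon>" using A by simp
   have "?l * ?\<gamma> \<le> A * (\<rho> / real k) * ?\<gamma>" using l \<gamma> by (rule mult_right_mono)
   also have "\<dots> = \<delta> / 4" using A k \<rho>(1) by simp
   finally show "?l * ?\<gamma> \<le> \<delta> / 4" .
  qed (use \<gamma> in simp_all)
  hence "growth \<delta> (\<lambda>N. \<bar>bd N\<bar> + 1)" using assms(1) by (intro sum_in_bigo growth_const) simp_all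
  hence "growth \<delta> (\<lambda>N. real (nat \<lceil>bd N\<rceil>))" by (rule growth_le) linarith
  moreover have "decides_within com three_sat (\<lambda>N. nat \<lceil>bd N\<rceil>)"
   unfolding decides_within_def
  proof
   fix x assume "x \<in> instances three_sat"
   moreover obtain N F where x: "x = (N, F)" by (cases x)
   ultimately obtain u s where u: "exec com (initial (instance_code N F)) u s" "accepting s \<longleftrightarrow> satisfiable F" "real u \<le> bd N"
    using com' by blast
   have "u \<le> nat \<lceil>bd N\<rceil>" using u(3) by linarith
   thus "\<exists>t s. exec com (initial (encode three_sat x)) t s \<and> t \<le> nat \<lceil>bd (param three_sat x)\<rceil> \<and> accepting s = yes three_sat x"
    using u(1,2) unfolding x by (intro exI[of _ u] exI[of _ s]) (simp add: three_sat_def instance_code_def)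
  qed
  ultimately show "solvable_in_bigo three_sat (\<lambda>N. 2 powr (\<delta> * real N))" unfolding solvable_in_bigo_def by blast
 qed
qed

theorem corollary2:
  assumes ETH
  shows "\<exists>c::real. c > 0 \<and> (\<forall>\<epsilon>::real. \<epsilon> > 0 \<longrightarrow> (\<forall>p :: nat \<Rightarrow> real.
    (\<forall>\<^sub>F k in sequentially. (1 + \<epsilon>) * ln (real k) / real k \<le> p k \<and> p k \<le> 1 / 2) \<longrightarrow>
    (\<lambda>k. measure_pmf.prob (random_graph k (p k))
       {H. \<not> solvable_in_bigo (Sub H) (\<lambda>n. real n powr (c * (real k / rho k (p k))))})
      \<longlonglongrightarrow> 1))"
proof -
 from assms obtain \<delta> where \<delta>: "0 < \<delta>" "\<not> solvable_in_bigo three_sat (\<lambda>N. 2 powr (\<delta> * real N))"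
  unfolding ETH_def by blast
 \<comment> \<open>The bound of \<open>sparse_sets_whp\<close> for \<tau> = 1/8, the value with
   which the growth of balls is proved.\<close>
 define \<theta> :: real where "\<theta> = (1 / 8) ^ 4 / (2 * exp 5)"
 define \<eta> where "\<eta> = min \<theta> (1 / 100)"
 have "1 \<le> exp (5 :: real)" by simp
 hence "1 \<le> exp 5 * (2048 :: real)" by linarith
 hence "\<theta> \<le> 1 / 4" by (simp add: \<theta>_def field_simps power_divide)
 hence \<theta>: "0 < \<theta>" "\<theta> \<le> 1 / 4" "0 < \<eta>" "\<eta> \<le> 1 / 100" "\<eta> \<le> \<theta>" by (simp_all add: \<eta>_def \<theta>_def)
 obtain c w where cw: "0 < c" "0 < w" and red: "\<And>H k load T \<rho>. simple_graph H \<Longrightarrow> verts H = {1..k} \<Longrightarrow> 1 \<le> k \<Longrightarrow> core H \<Longrightarrow>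
  routing H k load T \<Longrightarrow> real load \<le> (11 / \<eta>) * (real k * \<rho>) \<Longrightarrow> 0 < \<rho> \<Longrightarrow> \<rho> \<le> w * real k \<Longrightarrow>
  \<not> solvable_in_bigo (Sub H) (\<lambda>n. real n powr (c * (real k / \<rho>)))"
  using solver_reduction[OF \<delta>(1) \<theta>(3)] \<delta>(2) by metis
 show ?thesis
 proof (intro exI[of _ c] conjI allI impI, rule cw(1))
  fix \<epsilon> :: real and p :: "nat \<Rightarrow> real"
  assume \<epsilon>: "0 < \<epsilon>" and p: "\<forall>\<^sub>F k in sequentially. (1 + \<epsilon>) * ln (real k) / real k \<le> p k \<and> p k \<le> 1 / 2"
  let ?Rg = "\<lambda>k p. above_log \<epsilon> k p \<and> log_range k p"
  let ?hard = "\<lambda>k p H. \<not> solvable_in_bigo (Sub H) (\<lambda>n. real n powr (c * (real k / rho k p)))"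
  have "whp log_range (dense_pairs \<eta>)" "whp log_range (sparse_sets (1 / 8) \<theta>)"
   using \<theta> by (intro dense_pairs_whp sparse_sets_whp; simp add: \<theta>_def)+
  hence "whp ?Rg (dense_pairs \<eta>)" "whp ?Rg (sparse_sets (1 / 8) \<theta>)" by (blast intro: whp_range)+
  from whp_conj[OF core_whp[OF \<epsilon>] whp_conj[OF this]]
  have hard: "whp ?Rg ?hard"
  proof (rule whp_mono)
   have "\<forall>\<^sub>F k::nat in sequentially. 1024 \<le> ln (real k)" by real_asymp
   moreover have "\<forall>\<^sub>F k::nat in sequentially. 1 \<le> \<eta> * real k" using \<theta>(3) by real_asymp
   moreover have "\<forall>\<^sub>F k::nat in sequentially. ln (real k) \<le> w * real k" using cw(2) by real_asymp
   moreover have "\<forall>\<^sub>F k::nat in sequentially. 2 \<le> k" by (rule eventually_ge_at_top)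
   ultimately show "\<forall>\<^sub>F k in sequentially. \<forall>p H. ?Rg k p \<longrightarrow> simple_graph H \<longrightarrow> verts H = {1..k} \<longrightarrow>
    core H \<and> dense_pairs \<eta> k p H \<and> sparse_sets (1 / 8) \<theta> k p H \<longrightarrow> ?hard k p H"
   proof eventually_elim
    case (elim k)
    show ?case
    proof (intro allI impI, elim conjE)
     fix p H assume H: "simple_graph H" "verts H = {1..k}" and core: "core H" and dense: "dense_pairs \<eta> k p H"
      and sparse: "sparse_sets (1 / 8) \<theta> k p H" and rg: "above_log \<epsilon> k p" "log_range k p"
     \<comment> \<open>As k p \<ge> ln k, the degree condition of \<open>ball_in_growth\<close>
       holds for large k.\<close>
     have pk: "1024 \<le> real k * p" "0 < p" "p \<le> 1" using rg(2) elim(1) by (auto simp: log_range_def)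
     have "\<theta> \<le> 1" using \<theta>(2) by simp
     then obtain T load where T: "routing H k load T" "real load \<le> (11 / \<eta>) * (real k * rho k p)"
      by (rule routing_exists[OF H dense sparse \<theta>(3,4) elim(2) \<theta>(5) _ pk])
     have "ln (exp 1) \<le> ln (real k * p)"
      using pk(1) e_less_272 by (subst ln_le_cancel_iff) auto
     hence l: "1 \<le> ln (real k * p)" by simp
     \<comment> \<open>As ln (k p) \<ge> 1, the value of \<open>rho\<close> is at most ln k, which
       is eventually below w k.\<close>
     have rho: "0 < rho k p" "rho k p \<le> ln (real k)"
      using l elim(4) unfolding rho_def by (simp_all add: pos_divide_le_eq mult_le_cancel_left1)
     show "?hard k p H" by (rule red[OF H _ core T rho(1)]) (use elim(3,4) rho(2) in auto)
    qed
   qed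
  qed
  have range: "\<forall>\<^sub>F k in sequentially. ?Rg k (p k)"
   using p eventually_ge_at_top[of 2]
  proof eventually_elim
   case (elim k)
   have k: "0 < real k" "0 < ln (real k)" using elim(2) by simp_all
   have "(1 + \<epsilon>) * ln (real k) \<le> real k * p k" using elim(1) k by (simp add: pos_divide_le_eq mult.commute)
   moreover have "0 < (1 + \<epsilon>) * ln (real k)" using k \<epsilon> by simp
   ultimately have "0 < real k * p k" by linarith
   hence "0 < p k" using k by (simp add: zero_less_mult_iff)
   hence "above_log \<epsilon> k (p k)" using \<open>(1 + \<epsilon>) * ln (real k) \<le> real k * p k\<close> elim(1) by (simp add: above_log_def)
   thus ?case using above_log_imp_log_range[of \<epsilon> k "p k"] \<epsilon> elim(2) by simp
  qed
  let ?bad = "\<lambda>k. Prob (random_graph k (p k)) {H. \<not> ?hard k (p k) H}"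
  have "?bad \<longlonglongrightarrow> 0"
  proof (rule tendstoI)
   fix x :: real assume x: "0 < x"
   with hard have "\<forall>\<^sub>F k in sequentially. \<forall>p. ?Rg k p \<longrightarrow> Prob (random_graph k p) {H. \<not> ?hard k p H} \<le> x / 2"
    unfolding whp_def by (meson half_gt_zero)
   with range show "\<forall>\<^sub>F k in sequentially. dist (?bad k) 0 < x"
   proof eventually_elim
    case (elim k)
    hence "?bad k \<le> x / 2" by blast
    thus ?case using x by simp
   qed
  qed
  from tendsto_diff[OF tendsto_const[of 1] this] have "(\<lambda>k. 1 - ?bad k) \<longlonglongrightarrow> 1" by (simp only: diff_zero)
  moreover have "Prob (random_graph k (p k)) {H. ?hard k (p k) H} = 1 - ?bad k" for k
  proof -
   have "{H. ?hard k (p k) H} = space (measure_pmf (random_graph k (p k))) - {H. \<not> ?hard k (p k) H}" by auto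
   thus ?thesis using measure_pmf.prob_compl[of "{H. \<not> ?hard k (p k) H}" "random_graph k (p k)"] by (simp only: sets_measure_pmf UNIV_I)
  qed
  ultimately show "(\<lambda>k. Prob (random_graph k (p k)) {H. ?hard k (p k) H}) \<longlonglongrightarrow> 1" by (simp only:)
 qed
qed

end
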